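(* Let $\ell\ge2$ and $\mathfrak g=sl_\ell(\mathbb C)$. For every $m,n\in\mathbb N=\{1,2,\dots\}$ with $2m\le\ell$, set $k_{m,n}=n-m$. Then $(\Delta_m(-1))^n\mathbf 1$ is a singular vector in the generalized Verma module $N_{k_{m,n}}(\mathfrak g)$.
   Context: Realization of $\mathfrak g=sl_\ell(\mathbb C)$: let $W(A)$ be the Weyl algebra, i.e. the associative unital $\mathbb C$-algebra generated by $A=\mathrm{span}\{a_1,\dots,a_\ell,a_1^*,\dots,a_\ell^*\}$ with relations $[a_i,a_j]=[a_i^*,a_j^*]=0$, $[a_i,a_j^*]=\delta_{i,j}$. Put $:xy:\,=\frac12(xy+yx)$. The Lie algebra $\mathfrak g\cong sl_\ell(\mathbb C)$ is the Lie subalgebra of $W(A)$ (under the commutator) generated by $X_{\epsilon_i-\epsilon_j}=\,:a_ia_j^*:$, $i\ne j$, $1\le i,j\le\ell$. Its Cartan subalgebra is spanned by $h_i-h_j$, where $h_i=-:a_ia_i^*:$, and $\epsilon_i(h_j)=\delta_{i,j}$; $X_{\epsilon_i-\epsilon_j}$ is a root vector for the root $\epsilon_i-\epsilon_j$. Simple roots are $\epsilon_i-\epsilon_{i+1}$ ($1\le i<\ell$), the highest root is $\theta=\epsilon_1-\epsilon_\ell$, and $\mathfrak n_+$ is the sum of the positive root spaces. Affine Lie algebra: $\hat{\mathfrak g}=\mathfrak g\otimes\mathbb C[t,t^{-1}]\oplus\mathbb Cc\oplus\mathbb Cd$, with $c$ central, $[x\otimes t^n,y\otimes t^m]=[x,y]\otimes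 t^{n+m}+n(x,y)\delta_{n+m,0}c$, $[d,x\otimes t^n]=n\,x\otimes t^n$, where $(\cdot,\cdot)$ is the invariant symmetric bilinear form on $\mathfrak g$ normalized by $(\theta,\theta)=2$. Write $x(n)=x\otimes t^n$. $N_k(\mathfrak g)=U(\hat{\mathfrak g})\otimes_{U(P)}\mathbb Cv_k$, where $P=\mathfrak g\otimes\mathbb C[t]\oplus\mathbb Cc\oplus\mathbb Cd$, and $\mathbb Cv_k$ is the one-dimensional $P$-module on which $\mathfrak g\otimes\mathbb C[t]+\mathbb Cd$ acts trivially and $c$ acts as $k$; $\mathbf 1=1\otimes v_k$. A singular vector in $N_k(\mathfrak g)$ is a nonzero weight vector annihilated by $\mathfrak n_+\otimes1$ and by $\mathfrak g\otimes t\mathbb C[t]$. For $2m\le\ell$, $\Delta_m(-1)=\det(A_m(-1))\in U(\hat{\mathfrak g})$, where $A_m(-1)$ is the $m\times m$ matrix whose $(i,j)$ entry is $X_{\epsilon_i-\epsilon_{\ell-j+1}}(-1)$, $1\le i,j\le m$ (these entries commute with one another). *)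

theory Defs
  imports Complex_Main "HOL-Library.Poly_Mapping" "HOL-Algebra.QuotRing" "HOL-Algebra.Module"
    "HOL-Algebra.Free_Abelian_Groups" "HOL-Combinatorics.Permutations"
begin

section \<open>Associative algebras given by generators and relations\<close>

text \<open>
  Associative unital complex algebras are records of type \<open>(complex, 'a) module\<close>, with \<open>mult\<close> and
  \<open>one\<close> the ring structure and \<open>smult\<close> the scalar multiplication.
  Words form the free monoid, so that \<open>'x word \<Rightarrow>\<^sub>0 complex\<close> with the convolution product of
  \<open>Poly_Mapping\<close> is the free associative algebra on \<open>'x\<close>.
\<close>

datatype 'x word = Word (letters: "'x list")

instantiation word :: (type) monoid_add
begin
definition zero_word :: "'a word" where "0 = Word []"
definition plus_word :: "'a word \<Rightarrow> 'a word \<Rightarrow> 'a word" where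
  "u + v = Word (letters u @ letters v)"
instance by standard (auto simp: zero_word_def plus_word_def)
end

definition free_algebra :: "'x set \<Rightarrow> (complex, 'x word \<Rightarrow>\<^sub>0 complex) module" where
  "free_algebra S = \<lparr>carrier = {p. \<forall>w\<in>Poly_Mapping.keys p. set (letters w) \<subseteq> S},
     monoid.mult = (*), one = 1, ring.zero = 0, ring.add = (+),
     smult = (\<lambda>c p. Poly_Mapping.single 0 c * p)\<rparr>"

definition letter :: "'x \<Rightarrow> 'x word \<Rightarrow>\<^sub>0 complex" where
  "letter x = Poly_Mapping.single (Word [x]) 1"

definition quotient_algebra ::
    "(complex, 'a, 'r) module_scheme \<Rightarrow> 'a set \<Rightarrow> (complex, 'a set) module" where
  "quotient_algebra A I = \<lparr>carrier = carrier (A Quot I), monoid.mult = monoid.mult (A Quot I),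
     one = monoid.one (A Quot I), ring.zero = ring.zero (A Quot I), ring.add = ring.add (A Quot I),
     smult = (\<lambda>c X. \<Union>x\<in>X. I +>\<^bsub>A\<^esub> (c \<odot>\<^bsub>A\<^esub> x))\<rparr>"

definition presented_algebra ::
    "'x set \<Rightarrow> ('x word \<Rightarrow>\<^sub>0 complex) set \<Rightarrow> (complex, ('x word \<Rightarrow>\<^sub>0 complex) set) module" where
  "presented_algebra S R = quotient_algebra (free_algebra S) (Idl\<^bsub>free_algebra S\<^esub> R)"

definition presented_gen ::
    "'x set \<Rightarrow> ('x word \<Rightarrow>\<^sub>0 complex) set \<Rightarrow> 'x \<Rightarrow> ('x word \<Rightarrow>\<^sub>0 complex) set" where
  "presented_gen S R x = (Idl\<^bsub>free_algebra S\<^esub> R) +>\<^bsub>free_algebra S\<^esub> letter x"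

text \<open>The values of the algebra homomorphism from the free algebra to \<open>A\<close> extending \<open>f\<close>.\<close>

definition free_lift ::
    "(complex, 'a, 'r) module_scheme \<Rightarrow> ('x \<Rightarrow> 'a) \<Rightarrow> ('x word \<Rightarrow>\<^sub>0 complex) \<Rightarrow> 'a" where
  "free_lift A f p = (\<Oplus>\<^bsub>A\<^esub> w\<in>Poly_Mapping.keys p. Poly_Mapping.lookup p w \<odot>\<^bsub>A\<^esub>
     foldr (\<lambda>x y. f x \<otimes>\<^bsub>A\<^esub> y) (letters w) \<one>\<^bsub>A\<^esub>)"

definition complex_algebra :: "(complex, complex) module" where
  "complex_algebra = \<lparr>carrier = UNIV, monoid.mult = (*), one = 1, ring.zero = 0, ring.add = (+),
     smult = (*)\<rparr>"

text \<open>The Leibniz formula. Over a noncommutative algebra the factors are taken in the order of the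
  rows; in the case of interest the entries commute.\<close>

definition alg_det ::
    "(complex, 'a, 'r) module_scheme \<Rightarrow> nat \<Rightarrow> (nat \<Rightarrow> nat \<Rightarrow> 'a) \<Rightarrow> 'a" where
  "alg_det A m M = (\<Oplus>\<^bsub>A\<^esub> s\<in>{s. s permutes {1..m}}. of_int (sign s) \<odot>\<^bsub>A\<^esub>
     foldr (\<lambda>i y. M i (s i) \<otimes>\<^bsub>A\<^esub> y) [1..<Suc m] \<one>\<^bsub>A\<^esub>)"


section \<open>Lie algebras and universal enveloping algebras\<close>

text \<open>Only the vector space part of \<open>module\<close> and the bracket belong to the structure of a Lie
  algebra; the inherited fields \<open>mult\<close> and \<open>one\<close> play no role.\<close>

record 'a lie_algebra = "(complex, 'a) module" +
  bracket :: "'a \<Rightarrow> 'a \<Rightarrow> 'a"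

definition commutator_lie :: "(complex, 'a) module \<Rightarrow> 'a lie_algebra" where
  "commutator_lie A = module.extend A
     (lie_algebra.fields (\<lambda>x y. x \<otimes>\<^bsub>A\<^esub> y \<ominus>\<^bsub>A\<^esub> y \<otimes>\<^bsub>A\<^esub> x))"

definition linear_subspace :: "'a set \<Rightarrow> (complex, 'a, 'r) module_scheme \<Rightarrow> bool" where
  "linear_subspace H V \<longleftrightarrow> H \<subseteq> carrier V \<and> \<zero>\<^bsub>V\<^esub> \<in> H \<and>
     (\<forall>x\<in>H. \<forall>y\<in>H. x \<oplus>\<^bsub>V\<^esub> y \<in> H) \<and> (\<forall>c. \<forall>x\<in>H. c \<odot>\<^bsub>V\<^esub> x \<in> H)"

definition linear_span :: "(complex, 'a, 'r) module_scheme \<Rightarrow> 'a set \<Rightarrow> 'a set" where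
  "linear_span V S = \<Inter>{H. linear_subspace H V \<and> S \<subseteq> H}"

definition linear_functional_on ::
    "'a set \<Rightarrow> (complex, 'a, 'r) module_scheme \<Rightarrow> ('a \<Rightarrow> complex) \<Rightarrow> bool" where
  "linear_functional_on H V f \<longleftrightarrow> (\<forall>x\<in>H. \<forall>y\<in>H. f (x \<oplus>\<^bsub>V\<^esub> y) = f x + f y) \<and>
     (\<forall>c. \<forall>x\<in>H. f (c \<odot>\<^bsub>V\<^esub> x) = c * f x)"

definition lie_subalgebra :: "'a set \<Rightarrow> 'a lie_algebra \<Rightarrow> bool" where
  "lie_subalgebra H L \<longleftrightarrow> linear_subspace H L \<and> (\<forall>x\<in>H. \<forall>y\<in>H. bracket L x y \<in> H)"

definition lie_generated :: "'a lie_algebra \<Rightarrow> 'a set \<Rightarrow> 'a lie_algebra" where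
  "lie_generated L S = L\<lparr>carrier := \<Inter>{H. lie_subalgebra H L \<and> S \<subseteq> H}\<rparr>"

text \<open>
  The universal enveloping algebra is the tensor algebra of \<open>L\<close> modulo
  \<open>x \<otimes> y - y \<otimes> x - [x, y]\<close>; the tensor algebra in turn is the free algebra on the set \<open>L\<close> modulo
  the relations expressing the linearity of \<open>L \<rightarrow> T(L)\<close>.
\<close>

definition env_rels :: "'a lie_algebra \<Rightarrow> ('a word \<Rightarrow>\<^sub>0 complex) set" where
  "env_rels L =
     {letter (x \<oplus>\<^bsub>L\<^esub> y) - letter x - letter y | x y. x \<in> carrier L \<and> y \<in> carrier L} \<union>
     {letter (c \<odot>\<^bsub>L\<^esub> x) - Poly_Mapping.single 0 c * letter x | c x. x \<in> carrier L} \<union>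
     {letter x * letter y - letter y * letter x - letter (bracket L x y) | x y.
        x \<in> carrier L \<and> y \<in> carrier L}"

definition env :: "'a lie_algebra \<Rightarrow> (complex, ('a word \<Rightarrow>\<^sub>0 complex) set) module" where
  "env L = presented_algebra (carrier L) (env_rels L)"

definition env_gen :: "'a lie_algebra \<Rightarrow> 'a \<Rightarrow> ('a word \<Rightarrow>\<^sub>0 complex) set" where
  "env_gen L = presented_gen (carrier L) (env_rels L)"

text \<open>For a Lie algebra homomorphism \<open>f\<close> from \<open>L\<close> to an associative algebra \<open>A\<close>, the function
  \<open>env_lift A f\<close> is the induced algebra homomorphism \<open>U(L) \<rightarrow> A\<close>: it is evaluated on
  representatives, and the set of values \<open>free_lift A f ` X\<close> is a singleton for every coset \<open>X\<close>.\<close>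

definition env_lift :: "(complex, 'b, 'r) module_scheme \<Rightarrow> ('a \<Rightarrow> 'b) \<Rightarrow>
    ('a word \<Rightarrow>\<^sub>0 complex) set \<Rightarrow> 'b" where
  "env_lift A f X = the_elem (free_lift A f ` X)"


section \<open>Tensor products over a noncommutative ring\<close>

text \<open>
  \<open>M \<otimes>\<^sub>R N\<close> for a right \<open>R\<close>-module \<open>M\<close> (with action \<open>ra\<close>) and a left \<open>R\<close>-module \<open>N\<close> (with
  action \<open>la\<close>): the free abelian group on \<open>M \<times> N\<close> modulo the subgroup generated by the
  biadditivity and balancing relations.
\<close>

definition tensor_free ::
    "('m, 'p) ring_scheme \<Rightarrow> ('n, 'q) ring_scheme \<Rightarrow> ('m \<times> 'n \<Rightarrow>\<^sub>0 int) monoid" where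
  "tensor_free M N = free_Abelian_group (carrier M \<times> carrier N)"

definition tensor_rels :: "('r, 's) ring_scheme \<Rightarrow> ('m, 'p) ring_scheme \<Rightarrow> ('m \<Rightarrow> 'r \<Rightarrow> 'm) \<Rightarrow>
    ('n, 'q) ring_scheme \<Rightarrow> ('r \<Rightarrow> 'n \<Rightarrow> 'n) \<Rightarrow> ('m \<times> 'n \<Rightarrow>\<^sub>0 int) set" where
  "tensor_rels R M ra N la = generate (tensor_free M N)
     ({frag_of (x \<oplus>\<^bsub>M\<^esub> y, z) - frag_of (x, z) - frag_of (y, z) | x y z.
         x \<in> carrier M \<and> y \<in> carrier M \<and> z \<in> carrier N} \<union>
      {frag_of (x, z \<oplus>\<^bsub>N\<^esub> w) - frag_of (x, z) - frag_of (x, w) | x z w.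
         x \<in> carrier M \<and> z \<in> carrier N \<and> w \<in> carrier N} \<union>
      {frag_of (ra x r, z) - frag_of (x, la r z) | x r z.
         x \<in> carrier M \<and> r \<in> carrier R \<and> z \<in> carrier N})"

definition pure_tensor :: "('r, 's) ring_scheme \<Rightarrow> ('m, 'p) ring_scheme \<Rightarrow> ('m \<Rightarrow> 'r \<Rightarrow> 'm) \<Rightarrow>
    ('n, 'q) ring_scheme \<Rightarrow> ('r \<Rightarrow> 'n \<Rightarrow> 'n) \<Rightarrow> 'm \<Rightarrow> 'n \<Rightarrow> ('m \<times> 'n \<Rightarrow>\<^sub>0 int) set" where
  "pure_tensor R M ra N la x z =
     tensor_rels R M ra N la #>\<^bsub>tensor_free M N\<^esub> frag_of (x, z)"

text \<open>For a ring \<open>M\<close>, the left \<open>M\<close>-module \<open>M \<otimes>\<^sub>R N\<close> with \<open>u \<cdot> (x \<otimes> z) = (u x) \<otimes> z\<close>. The fields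
  \<open>mult\<close> and \<open>one\<close> of the record carry no information.\<close>

definition tensor_module :: "('r, 's) ring_scheme \<Rightarrow> ('m, 'p) ring_scheme \<Rightarrow>
    ('m \<Rightarrow> 'r \<Rightarrow> 'm) \<Rightarrow> ('n, 'q) ring_scheme \<Rightarrow> ('r \<Rightarrow> 'n \<Rightarrow> 'n) \<Rightarrow>
    ('m, ('m \<times> 'n \<Rightarrow>\<^sub>0 int) set) module" where
  "tensor_module R M ra N la =
     (let F = tensor_free M N; K = tensor_rels R M ra N la in
      \<lparr>carrier = carrier (F Mod K), monoid.mult = undefined, one = undefined,
       ring.zero = monoid.one (F Mod K), ring.add = monoid.mult (F Mod K),
       smult = (\<lambda>u X. \<Union>p\<in>X. K #>\<^bsub>F\<^esub> frag_extend (\<lambda>(x, z). frag_of (u \<otimes>\<^bsub>M\<^esub> x, z)) p)\<rparr>)"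


section \<open>The realization of $sl_\ell$ in the Weyl algebra\<close>

text \<open>\<open>Ann i\<close> and \<open>Cre i\<close> stand for $a_i$ and $a_i^*$.\<close>

datatype weyl_gen = Ann nat | Cre nat

type_synonym weyl_elt = "(weyl_gen word \<Rightarrow>\<^sub>0 complex) set"

definition weyl_gens :: "nat \<Rightarrow> weyl_gen set" where
  "weyl_gens l = Ann ` {1..l} \<union> Cre ` {1..l}"

definition weyl_rels :: "nat \<Rightarrow> (weyl_gen word \<Rightarrow>\<^sub>0 complex) set" where
  "weyl_rels l =
     {letter (Ann i) * letter (Ann j) - letter (Ann j) * letter (Ann i) | i j.
        i \<in> {1..l} \<and> j \<in> {1..l}} \<union>
     {letter (Cre i) * letter (Cre j) - letter (Cre j) * letter (Cre i) | i j.
        i \<in> {1..l} \<and> j \<in> {1..l}} \<union>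
     {letter (Ann i) * letter (Cre j) - letter (Cre j) * letter (Ann i) - (if i = j then 1 else 0)
        | i j. i \<in> {1..l} \<and> j \<in> {1..l}}"

definition weyl :: "nat \<Rightarrow> (complex, weyl_elt) module" where
  "weyl l = presented_algebra (weyl_gens l) (weyl_rels l)"

definition weyl_a :: "nat \<Rightarrow> nat \<Rightarrow> weyl_elt" where
  "weyl_a l i = presented_gen (weyl_gens l) (weyl_rels l) (Ann i)"

definition weyl_a_star :: "nat \<Rightarrow> nat \<Rightarrow> weyl_elt" where
  "weyl_a_star l i = presented_gen (weyl_gens l) (weyl_rels l) (Cre i)"

definition normal_order :: "nat \<Rightarrow> weyl_elt \<Rightarrow> weyl_elt \<Rightarrow> weyl_elt" where
  "normal_order l x y = (1/2) \<odot>\<^bsub>weyl l\<^esub> (x \<otimes>\<^bsub>weyl l\<^esub> y \<oplus>\<^bsub>weyl l\<^esub> y \<otimes>\<^bsub>weyl l\<^esub> x)"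

text \<open>\<open>root_vec l i j\<close> is $X_{\epsilon_i-\epsilon_j}$.\<close>

definition root_vec :: "nat \<Rightarrow> nat \<Rightarrow> nat \<Rightarrow> weyl_elt" where
  "root_vec l i j = normal_order l (weyl_a l i) (weyl_a_star l j)"

definition sl :: "nat \<Rightarrow> weyl_elt lie_algebra" where
  "sl l = lie_generated (commutator_lie (weyl l))
     {root_vec l i j | i j. i \<in> {1..l} \<and> j \<in> {1..l} \<and> i \<noteq> j}"

definition cartan_h :: "nat \<Rightarrow> nat \<Rightarrow> weyl_elt" where
  "cartan_h l i = \<ominus>\<^bsub>weyl l\<^esub> normal_order l (weyl_a l i) (weyl_a_star l i)"

definition cartan :: "nat \<Rightarrow> weyl_elt set" where
  "cartan l = linear_span (sl l)
     {cartan_h l i \<ominus>\<^bsub>weyl l\<^esub> cartan_h l j | i j. i \<in> {1..l} \<and> j \<in> {1..l}}"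

text \<open>The linear functional $\epsilon_i$ on the span of $h_1,\dots,h_\ell$ with
  $\epsilon_i(h_j)=\delta_{i,j}$, that is, the \<open>i\<close>-th coordinate function with respect to
  the linearly independent elements $h_1,\dots,h_\ell$ of the Weyl algebra.\<close>

definition eps :: "nat \<Rightarrow> nat \<Rightarrow> weyl_elt \<Rightarrow> complex" where
  "eps l i h = (THE z. \<exists>c :: nat \<Rightarrow> complex.
     h = (\<Oplus>\<^bsub>weyl l\<^esub> j\<in>{1..l}. c j \<odot>\<^bsub>weyl l\<^esub> cartan_h l j) \<and> z = c i)"

definition root_space :: "nat \<Rightarrow> (weyl_elt \<Rightarrow> complex) \<Rightarrow> weyl_elt set" where
  "root_space l \<alpha> = {x \<in> carrier (sl l). \<forall>h\<in>cartan l. bracket (sl l) h x = \<alpha> h \<odot>\<^bsub>sl l\<^esub> x}"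

text \<open>With simple roots $\epsilon_i-\epsilon_{i+1}$, the positive roots are
  $\epsilon_i-\epsilon_j$ for \<open>i < j\<close>.\<close>

definition n_plus :: "nat \<Rightarrow> weyl_elt set" where
  "n_plus l = linear_span (sl l)
     (\<Union>{root_space l (\<lambda>h. eps l i h - eps l j h) | i j. 1 \<le> i \<and> i < j \<and> j \<le> l})"

definition highest_root :: "nat \<Rightarrow> weyl_elt \<Rightarrow> complex" where
  "highest_root l h = eps l 1 h - eps l l h"

definition invariant_form :: "'a lie_algebra \<Rightarrow> ('a \<Rightarrow> 'a \<Rightarrow> complex) \<Rightarrow> bool" where
  "invariant_form L B \<longleftrightarrow>
     (\<forall>x\<in>carrier L. linear_functional_on (carrier L) L (B x)) \<and>
     (\<forall>x\<in>carrier L. \<forall>y\<in>carrier L. B x y = B y x) \<and>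
     (\<forall>x\<in>carrier L. \<forall>y\<in>carrier L. \<forall>z\<in>carrier L. B (bracket L x y) z = B x (bracket L y z))"

text \<open>
  The value $(\theta,\theta)$ refers to the form on the dual of the Cartan subalgebra transported from
  \<open>B\<close> along $\mathfrak h\to\mathfrak h^*$, $t\mapsto B(t,\cdot)$: it is $B(t,t)$ for the element
  $t\in\mathfrak h$ that corresponds to $\theta$.
\<close>

definition normalized_form :: "nat \<Rightarrow> (weyl_elt \<Rightarrow> weyl_elt \<Rightarrow> complex) \<Rightarrow> bool" where
  "normalized_form l B \<longleftrightarrow> invariant_form (sl l) B \<and>
     (\<exists>t\<in>cartan l. (\<forall>h\<in>cartan l. B t h = highest_root l h) \<and> B t t = 2)"


section \<open>The affine Lie algebra and the generalized Verma module\<close>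

text \<open>
  An element $\sum_n x_n\otimes t^n + a c + b d$ is represented by \<open>(f, a, b)\<close>, where
  \<open>f\<close> is the finitely supported function \<open>n \<mapsto> x\<^sub>n\<close>.
\<close>

type_synonym 'a affine_elt = "(int \<Rightarrow> 'a) \<times> complex \<times> complex"

definition loop_support :: "'a lie_algebra \<Rightarrow> (int \<Rightarrow> 'a) \<Rightarrow> int set" where
  "loop_support L f = {n. f n \<noteq> \<zero>\<^bsub>L\<^esub>}"

definition loops :: "'a lie_algebra \<Rightarrow> (int \<Rightarrow> 'a) set" where
  "loops L = {f. range f \<subseteq> carrier L \<and> finite (loop_support L f)}"

fun affine_bracket :: "'a lie_algebra \<Rightarrow> ('a \<Rightarrow> 'a \<Rightarrow> complex) \<Rightarrow>
    'a affine_elt \<Rightarrow> 'a affine_elt \<Rightarrow> 'a affine_elt" where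
  "affine_bracket L B (f, a, b) (g, a', b') =
     ((\<lambda>n. (\<Oplus>\<^bsub>L\<^esub> i\<in>loop_support L f. bracket L (f i) (g (n - i)))
           \<oplus>\<^bsub>L\<^esub> (b * of_int n) \<odot>\<^bsub>L\<^esub> g n \<oplus>\<^bsub>L\<^esub> (- b' * of_int n) \<odot>\<^bsub>L\<^esub> f n),
      (\<Sum>i\<in>loop_support L f. of_int i * B (f i) (g (- i))),
      0)"

definition affine :: "'a lie_algebra \<Rightarrow> ('a \<Rightarrow> 'a \<Rightarrow> complex) \<Rightarrow> 'a affine_elt lie_algebra" where
  "affine L B = \<lparr>carrier = loops L \<times> UNIV, monoid.mult = undefined, one = undefined,
     ring.zero = (\<lambda>n. \<zero>\<^bsub>L\<^esub>, 0, 0),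
     ring.add = (\<lambda>(f, a, b) (g, a', b'). (\<lambda>n. f n \<oplus>\<^bsub>L\<^esub> g n, a + a', b + b')),
     smult = (\<lambda>z (f, a, b). (\<lambda>n. z \<odot>\<^bsub>L\<^esub> f n, z * a, z * b)),
     bracket = affine_bracket L B\<rparr>"

text \<open>\<open>at_power L x n\<close> is $x(n)=x\otimes t^n$.\<close>

definition at_power :: "'a lie_algebra \<Rightarrow> 'a \<Rightarrow> int \<Rightarrow> 'a affine_elt" where
  "at_power L x n = (\<lambda>j. if j = n then x else \<zero>\<^bsub>L\<^esub>, 0, 0)"

text \<open>\<open>affine_P\<close> is $P=\mathfrak g\otimes\mathbb C[t]\oplus\mathbb Cc\oplus\mathbb Cd$, and
  \<open>positive_loops\<close> is $\mathfrak g\otimes t\mathbb C[t]$.\<close>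

definition affine_P :: "'a lie_algebra \<Rightarrow> ('a \<Rightarrow> 'a \<Rightarrow> complex) \<Rightarrow> 'a affine_elt lie_algebra" where
  "affine_P L B = (affine L B)\<lparr>carrier := {f \<in> loops L. \<forall>n<0. f n = \<zero>\<^bsub>L\<^esub>} \<times> UNIV\<rparr>"

definition positive_loops :: "'a lie_algebra \<Rightarrow> 'a affine_elt set" where
  "positive_loops L = {f \<in> loops L. \<forall>n\<le>0. f n = \<zero>\<^bsub>L\<^esub>} \<times> {(0, 0)}"

text \<open>The scalar by which an element of $P$ acts on $\mathbb Cv_k$.\<close>

fun level_char :: "complex \<Rightarrow> 'a affine_elt \<Rightarrow> complex" where
  "level_char k (f, a, b) = k * a"

type_synonym 'a affine_env = "('a affine_elt word \<Rightarrow>\<^sub>0 complex) set"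

type_synonym 'a verma_elt = "('a affine_env \<times> complex \<Rightarrow>\<^sub>0 int) set"

text \<open>
  The right action of $U(P)$ on $U(\hat{\mathfrak g})$ is right multiplication through the algebra
  homomorphism induced by $P\subseteq\hat{\mathfrak g}$, and the left action on
  $\mathbb Cv_k=\mathbb C$ is given by the algebra homomorphism $U(P)\to\mathbb C$ induced by
  \<open>level_char k\<close>.
\<close>

definition env_P_right_action :: "'a lie_algebra \<Rightarrow> ('a \<Rightarrow> 'a \<Rightarrow> complex) \<Rightarrow>
    'a affine_env \<Rightarrow> 'a affine_env \<Rightarrow> 'a affine_env" where
  "env_P_right_action L B u p =
     u \<otimes>\<^bsub>env (affine L B)\<^esub> env_lift (env (affine L B)) (env_gen (affine L B)) p"

definition env_P_left_action :: "complex \<Rightarrow> 'a affine_env \<Rightarrow> complex \<Rightarrow> complex" where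
  "env_P_left_action k p z = env_lift complex_algebra (level_char k) p * z"

definition verma :: "'a lie_algebra \<Rightarrow> ('a \<Rightarrow> 'a \<Rightarrow> complex) \<Rightarrow> complex \<Rightarrow>
    ('a affine_env, 'a verma_elt) module" where
  "verma L B k = tensor_module (env (affine_P L B))
     (env (affine L B)) (env_P_right_action L B) complex_algebra (env_P_left_action k)"

definition vacuum :: "'a lie_algebra \<Rightarrow> ('a \<Rightarrow> 'a \<Rightarrow> complex) \<Rightarrow> complex \<Rightarrow> 'a verma_elt" where
  "vacuum L B k = pure_tensor (env (affine_P L B))
     (env (affine L B)) (env_P_right_action L B) complex_algebra (env_P_left_action k)
     \<one>\<^bsub>env (affine L B)\<^esub> 1"


section \<open>Singular vectors\<close>

text \<open>$\hat{\mathfrak h}=\mathfrak h\oplus\mathbb Cc\oplus\mathbb Cd$\<close>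

definition affine_cartan :: "nat \<Rightarrow> weyl_elt affine_elt set" where
  "affine_cartan l = {(fst (at_power (sl l) h 0), a, b) | h a b. h \<in> cartan l}"

text \<open>A complex scalar acts on a $U(\hat{\mathfrak g})$-module as the corresponding multiple of the
  unit of $U(\hat{\mathfrak g})$.\<close>

definition weight_vector :: "nat \<Rightarrow> (weyl_elt \<Rightarrow> weyl_elt \<Rightarrow> complex) \<Rightarrow>
    (weyl_elt affine_env, 'v) module \<Rightarrow> 'v \<Rightarrow> bool" where
  "weight_vector l B N v \<longleftrightarrow>
     (\<exists>\<mu>. linear_functional_on (affine_cartan l) (affine (sl l) B) \<mu> \<and>
       (\<forall>h\<in>affine_cartan l. env_gen (affine (sl l) B) h \<odot>\<^bsub>N\<^esub> v =
          (\<mu> h \<odot>\<^bsub>env (affine (sl l) B)\<^esub> \<one>\<^bsub>env (affine (sl l) B)\<^esub>) \<odot>\<^bsub>N\<^esub> v))"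

definition singular_vector :: "nat \<Rightarrow> (weyl_elt \<Rightarrow> weyl_elt \<Rightarrow> complex) \<Rightarrow>
    (weyl_elt affine_env, 'v) module \<Rightarrow> 'v \<Rightarrow> bool" where
  "singular_vector l B N v \<longleftrightarrow> v \<in> carrier N \<and> v \<noteq> \<zero>\<^bsub>N\<^esub> \<and> weight_vector l B N v \<and>
     (\<forall>x\<in>n_plus l. env_gen (affine (sl l) B) (at_power (sl l) x 0) \<odot>\<^bsub>N\<^esub> v = \<zero>\<^bsub>N\<^esub>) \<and>
     (\<forall>x\<in>positive_loops (sl l). env_gen (affine (sl l) B) x \<odot>\<^bsub>N\<^esub> v = \<zero>\<^bsub>N\<^esub>)"

definition Delta :: "nat \<Rightarrow> (weyl_elt \<Rightarrow> weyl_elt \<Rightarrow> complex) \<Rightarrow> nat \<Rightarrow> weyl_elt affine_env" where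
  "Delta l B m = alg_det (env (affine (sl l) B)) m
     (\<lambda>i j. env_gen (affine (sl l) B) (at_power (sl l) (root_vec l i (l - j + 1)) (- 1)))"

end

theory Submission
  imports Defs
begin

text \<open>
  Write $D=\Delta_m(-1)$. The Lie algebra $\mathfrak n_+\otimes 1+\mathfrak g\otimes t\mathbb C[t]$ is generated
  by $\mathfrak n_+\otimes 1$ and $f=X_{\epsilon_\ell-\epsilon_1}(1)$. The elements of the former act on the matrix
  $A_m(-1)$ by row and column operations, hence kill $D$. For the latter, $[f,D]$ is a first order
  expression in the Cartan element and the row and column operations attached to the first row and column;
  moving these to the right gives $f D^n\mathbf 1=n(k+m-n)\,C D^{n-1}\mathbf 1$ with \<open>C\<close> the cofactor of the
  first entry, and the factor vanishes for $k=n-m$.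

  Without a Poincare-Birkhoff-Witt theorem, $D^n\mathbf 1\neq0$ needs a representation of level \<open>k\<close>. The affine
  algebra acts by vector fields on polynomial functions on the big cell of an infinite Grassmannian, twisted
  by the \<open>k\<close>-th power of the determinant line bundle. Evaluation at the base point is an eigenvector of
  $U(P)$ and so defines a functional on the induced module. The entries of $A_m(-1)$ act as minus the partial
  derivatives in \<open>m\<^sup>2\<close> of the coordinates, and $D^n$ maps the \<open>n\<close>-th power of the product of the
  diagonal ones to a nonzero constant.
\<close>

section \<open>Free and presented algebras\<close>

text \<open>All algebras and modules here are quotients whose elements are cosets, so the
  calculation is carried out on words, with two congruences: one modulo the two-sided ideal of
  relations, which may be applied to any factor of a product, and one modulo the left ideal
  annihilating the vacuum, which may be applied to the rightmost factor only. The vector is nonzero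
  when its word lies outside that left ideal, and this is detected by a functional vanishing on the
  ideal. Such functionals are dual to a left module, hence the test space has to be a right module;
  vector fields, which represent brackets with the opposite sign, supply exactly that. The level
  enters them linearly, as a factor of the multiplier, so one construction serves every level. The
  form is given only as invariant and normalized. It has to be recognized as the trace form, because
  both the central term in the bracket of \<open>f\<close> with the opposite entry of the matrix and
  the cocycle of the infinite matrices are computed by traces.\<close>

abbreviation fcar :: "'x set \<Rightarrow> ('x word \<Rightarrow>\<^sub>0 complex) set" where
  "fcar S \<equiv> carrier (free_algebra S)"

abbreviation scal :: "complex \<Rightarrow> 'x word \<Rightarrow>\<^sub>0 complex" where
  "scal c \<equiv> Poly_Mapping.single 0 c"

lemma letters_simps [simp]: "letters 0 = []" "letters (u + v) = letters u @ letters v"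
  by (simp_all add: zero_word_def plus_word_def)

lemma poly_mapping_sum_single:
  "p = (\<Sum>w\<in>Poly_Mapping.keys p. Poly_Mapping.single w (Poly_Mapping.lookup p w))"
proof (rule poly_mapping_eqI)
  fix k
  have "(\<Sum>w\<in>Poly_Mapping.keys p. Poly_Mapping.lookup (Poly_Mapping.single w (Poly_Mapping.lookup p w)) k)
      = (\<Sum>w\<in>Poly_Mapping.keys p. if w = k then Poly_Mapping.lookup p w else 0)"
    by (intro sum.cong) (auto simp: lookup_single when_def)
  then show "Poly_Mapping.lookup p k = Poly_Mapping.lookup
      (\<Sum>w\<in>Poly_Mapping.keys p. Poly_Mapping.single w (Poly_Mapping.lookup p w)) k"
    by (simp add: lookup_sum in_keys_iff)
qed


text \<open>The rule for single terms is restricted to the keys of \<open>p\<close>, so that a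
  hypothesis such as \<open>p \<in> fcar S\<close> remains usable for each term.\<close>

lemma pm_induct [case_names zero single add]:
  assumes zero: "P 0"
    and single: "\<And>w c. w \<in> Poly_Mapping.keys p \<Longrightarrow> P (Poly_Mapping.single w c)"
    and add: "\<And>q r. P q \<Longrightarrow> P r \<Longrightarrow> P (q + r)"
  shows "P (p :: 'a \<Rightarrow>\<^sub>0 'b::comm_monoid_add)"
proof -
  have "P (\<Sum>w\<in>A. Poly_Mapping.single w (Poly_Mapping.lookup p w))"
    if "finite A" "A \<subseteq> Poly_Mapping.keys p" for A
    using that by (induction rule: finite_induct) (auto intro: zero single add)
  from this[of "Poly_Mapping.keys p"] show ?thesis
    using poly_mapping_sum_single[of p] by simp
qed

lemma fcar_iff: "p \<in> fcar S \<longleftrightarrow> (\<forall>w\<in>Poly_Mapping.keys p. set (letters w) \<subseteq> S)"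
  by (simp add: free_algebra_def)

lemma fcar_closed [simp, intro]:
  "0 \<in> fcar S" "1 \<in> fcar S" "scal c \<in> fcar S" "x \<in> S \<Longrightarrow> letter x \<in> fcar S"
  "p \<in> fcar S \<Longrightarrow> q \<in> fcar S \<Longrightarrow> p + q \<in> fcar S"
  "p \<in> fcar S \<Longrightarrow> q \<in> fcar S \<Longrightarrow> p * q \<in> fcar S"
  "p \<in> fcar S \<Longrightarrow> - p \<in> fcar S"
  "p \<in> fcar S \<Longrightarrow> q \<in> fcar S \<Longrightarrow> p - q \<in> fcar S"
proof -
  show add: "p + q \<in> fcar S" if "p \<in> fcar S" "q \<in> fcar S" for p q
    using that Poly_Mapping.keys_add[of p q] by (auto simp: fcar_iff)
  show um: "- p \<in> fcar S" if "p \<in> fcar S" for p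
    using that by (auto simp: fcar_iff in_keys_iff)
  show "p - q \<in> fcar S" if "p \<in> fcar S" "q \<in> fcar S" for p q
    using add[OF that(1) um[OF that(2)]] by simp
  show "p * q \<in> fcar S" if "p \<in> fcar S" "q \<in> fcar S" for p q
    using that Poly_Mapping.keys_mult[of p q] by (fastforce simp: fcar_iff)
qed (auto simp: fcar_iff letter_def)

lemma fcar_sum [simp, intro]: "(\<And>i. i \<in> A \<Longrightarrow> p i \<in> fcar S) \<Longrightarrow> sum p A \<in> fcar S"
  by (induction A rule: infinite_finite_induct) auto

lemma fcar_power [simp, intro]: "p \<in> fcar S \<Longrightarrow> p ^ n \<in> fcar S"
  by (induction n) auto

lemma fcar_prod_list [simp, intro]: "(\<And>i. i \<in> set xs \<Longrightarrow> p i \<in> fcar S) \<Longrightarrow> prod_list (map p xs) \<in> fcar S"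
  by (induction xs) auto

lemma fcar_mono: "S \<subseteq> T \<Longrightarrow> p \<in> fcar S \<Longrightarrow> p \<in> fcar T"
  by (auto simp: fcar_iff)

lemma scal_mult: "scal c * scal d = scal (c * d)"
  by (simp add: mult_single)

lemma scal_of_int: "scal (of_int k) = of_int k" by (metis single_of_int)

lemma scal_of_nat: "scal (of_nat k) = of_nat k" by (metis single_of_nat)

lemma scal_commute: "scal c * p = p * scal c"
  by (induction p rule: pm_induct) (auto simp: mult_single algebra_simps)

lemma free_algebra_sel [simp]:
  "monoid.mult (free_algebra S) = (*)" "one (free_algebra S) = 1" "ring.zero (free_algebra S) = 0"
  "ring.add (free_algebra S) = (+)" "smult (free_algebra S) = (\<lambda>c p. scal c * p)"
  by (simp_all add: free_algebra_def)

lemma ring_free_algebra: "ring (free_algebra S)"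
proof (rule ringI)
  show "abelian_group (free_algebra S)"
  proof (rule abelian_groupI)
    show "\<exists>y\<in>fcar S. y \<oplus>\<^bsub>free_algebra S\<^esub> x = \<zero>\<^bsub>free_algebra S\<^esub>" if "x \<in> fcar S" for x
      by (rule bexI[of _ "- x"]) (use that in auto)
  qed (auto simp: add.assoc add.commute)
  show "Group.monoid (free_algebra S)"
    by (rule Group.monoidI) (auto simp: mult.assoc)
qed (auto simp: algebra_simps)

lemma free_algebra_a_inv: "p \<in> fcar S \<Longrightarrow> a_inv (free_algebra S) p = - p"
proof -
  assume p: "p \<in> fcar S"
  interpret ring "free_algebra S" by (rule ring_free_algebra)
  show ?thesis
    using p by (intro minus_equality) auto
qed

lemma single_prod_letters:
  "Poly_Mapping.single w c = (scal c * prod_list (map letter (letters w)) :: 'x word \<Rightarrow>\<^sub>0 complex)"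
proof -
  have "prod_list (map letter xs) = (Poly_Mapping.single (Word xs) 1 :: 'x word \<Rightarrow>\<^sub>0 complex)" for xs :: "'x list"
  proof (induction xs)
    case Nil
    then show ?case by (simp flip: zero_word_def)
  next
    case (Cons x xs)
    then show ?case by (simp add: letter_def mult_single plus_word_def)
  qed
  from this[of "letters w"] show ?thesis by (simp add: mult_single)
qed

section \<open>Presented algebras, computed on representatives\<close>

locale presentation =
  fixes S :: "'x set" and R :: "('x word \<Rightarrow>\<^sub>0 complex) set"
  assumes rels_sub: "R \<subseteq> fcar S"
begin

abbreviation "I \<equiv> Idl\<^bsub>free_algebra S\<^esub> R"
abbreviation "A \<equiv> presented_algebra S R"

definition Q :: "('x word \<Rightarrow>\<^sub>0 complex) \<Rightarrow> ('x word \<Rightarrow>\<^sub>0 complex) set" where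
  "Q p = I +>\<^bsub>free_algebra S\<^esub> p"

lemma ideal_I: "ideal I (free_algebra S)"
  using ring.genideal_ideal[OF ring_free_algebra rels_sub] .

lemma I_sub: "I \<subseteq> fcar S"
  using ideal_I by (simp add: additive_subgroup.a_subset ideal_def)

lemma rels_I: "r \<in> R \<Longrightarrow> r \<in> I"
  using ring.genideal_self[OF ring_free_algebra rels_sub] by auto

lemma I_closed:
  "0 \<in> I" "p \<in> I \<Longrightarrow> q \<in> I \<Longrightarrow> p + q \<in> I" "p \<in> I \<Longrightarrow> - p \<in> I"
  "p \<in> I \<Longrightarrow> q \<in> I \<Longrightarrow> p - q \<in> I"
  "p \<in> I \<Longrightarrow> u \<in> fcar S \<Longrightarrow> u * p \<in> I" "p \<in> I \<Longrightarrow> u \<in> fcar S \<Longrightarrow> p * u \<in> I"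
proof -
  interpret ideal I "free_algebra S" by (rule ideal_I)
  show "0 \<in> I" using additive_subgroup.zero_closed[OF additive_subgroup_axioms] by simp
  show a: "p + q \<in> I" if "p \<in> I" "q \<in> I" for p q using additive_subgroup.a_closed[OF additive_subgroup_axioms that] by simp
  show m: "- p \<in> I" if "p \<in> I" for p
    using additive_subgroup.a_inv_closed[OF additive_subgroup_axioms that] free_algebra_a_inv[of p S] I_sub that by auto
  show "p - q \<in> I" if "p \<in> I" "q \<in> I" for p q using a[OF that(1) m[OF that(2)]] by simp
  show "u * p \<in> I" if "p \<in> I" "u \<in> fcar S" for p u using I_l_closed[OF that] by simp
  show "p * u \<in> I" if "p \<in> I" "u \<in> fcar S" for p u using I_r_closed[OF that] by simp
qed

lemma I_least:
  assumes T: "T \<subseteq> fcar S" "0 \<in> T" "\<And>p q. p \<in> T \<Longrightarrow> q \<in> T \<Longrightarrow> p + q \<in> T"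
    "\<And>p. p \<in> T \<Longrightarrow> - p \<in> T" "\<And>u p. p \<in> T \<Longrightarrow> u \<in> fcar S \<Longrightarrow> u * p \<in> T"
    "\<And>u p. p \<in> T \<Longrightarrow> u \<in> fcar S \<Longrightarrow> p * u \<in> T"
    and R: "R \<subseteq> T"
  shows "I \<subseteq> T"
proof -
  interpret ring "free_algebra S" by (rule ring_free_algebra)
  have "ideal T (free_algebra S)"
  proof (rule idealI[OF ring_free_algebra])
    show "subgroup T (add_monoid (free_algebra S))"
    proof (rule group.subgroupI)
      show "Group.group (add_monoid (free_algebra S))"
        using a_comm_group comm_group.axioms(2) by blast
      show "inv\<^bsub>add_monoid (free_algebra S)\<^esub> a \<in> T" if "a \<in> T" for a
        using that free_algebra_a_inv[of a S] T by (auto simp: a_inv_def)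
    qed (use T in auto)
  qed (use T in auto)
  then show ?thesis using R by (rule genideal_minimal)
qed

text \<open>The \<open>p\<close> with \<open>\<psi> (u * p * v) = 0\<close> for all \<open>u\<close>
  and \<open>v\<close> form a two-sided ideal, which contains \<open>R\<close>. Characters and
  actions are shown to descend to presented algebras in this way.\<close>

lemma I_kill:
  fixes \<psi> :: "('x word \<Rightarrow>\<^sub>0 complex) \<Rightarrow> 'b::ab_group_add"
  assumes add: "\<And>p q. p \<in> fcar S \<Longrightarrow> q \<in> fcar S \<Longrightarrow> \<psi> (p + q) = \<psi> p + \<psi> q"
    and rel: "\<And>u r v. r \<in> R \<Longrightarrow> u \<in> fcar S \<Longrightarrow> v \<in> fcar S \<Longrightarrow> \<psi> (u * r * v) = 0"
    and p: "p \<in> I"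
  shows "\<psi> p = 0"
proof -
  define T where "T = {p \<in> fcar S. \<forall>u\<in>fcar S. \<forall>v\<in>fcar S. \<psi> (u * p * v) = 0}"
  have z: "\<psi> 0 = 0" using add[of 0 0] by simp
  have um: "\<psi> (- p) = - \<psi> p" if "p \<in> fcar S" for p
    using add[of p "- p"] that z by (simp add: eq_neg_iff_add_eq_0 add.commute)
  have "I \<subseteq> T"
  proof (rule I_least)
    show "R \<subseteq> T" using rels_sub rel by (auto simp: T_def)
    show "p * x \<in> T" if "p \<in> T" "x \<in> fcar S" for p x
    proof -
      have "\<psi> (u * (p * x) * v) = 0" if "u \<in> fcar S" "v \<in> fcar S" for u v
        using \<open>p \<in> T\<close> that \<open>x \<in> fcar S\<close> fcar_closed(6)[of x S v]
        by (auto simp: T_def mult.assoc)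
      then show ?thesis using that by (auto simp: T_def)
    qed
  qed (auto simp: T_def z um add distrib_left distrib_right mult.assoc[symmetric])
  then have "\<psi> (1 * p * 1) = 0" using p fcar_closed(2)[of S] unfolding T_def by blast
  then show ?thesis by simp
qed

lemma A_sel:
  "carrier A = carrier (free_algebra S Quot I)" "monoid.mult A = monoid.mult (free_algebra S Quot I)"
  "one A = one (free_algebra S Quot I)" "ring.zero A = ring.zero (free_algebra S Quot I)"
  "ring.add A = ring.add (free_algebra S Quot I)"
  "c \<odot>\<^bsub>A\<^esub> X = (\<Union>x\<in>X. Q (scal c * x))"
  by (simp_all add: presented_algebra_def quotient_algebra_def Q_def)

lemma ring_A: "ring A"
proof -
  interpret i: ideal I "free_algebra S" by (rule ideal_I)
  interpret q: ring "free_algebra S Quot I" by (rule i.quotient_is_ring)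
  show ?thesis
  proof (rule ringI)
    show "abelian_group A"
    proof (rule abelian_groupI)
      show "\<exists>y\<in>carrier A. y \<oplus>\<^bsub>A\<^esub> x = \<zero>\<^bsub>A\<^esub>" if "x \<in> carrier A" for x
        using that q.l_neg q.a_inv_closed unfolding A_sel by blast
      show "x \<oplus>\<^bsub>A\<^esub> y \<oplus>\<^bsub>A\<^esub> z = x \<oplus>\<^bsub>A\<^esub> (y \<oplus>\<^bsub>A\<^esub> z)"
        if "x \<in> carrier A" "y \<in> carrier A" "z \<in> carrier A" for x y z
        using that q.a_assoc unfolding A_sel by blast
      show "x \<oplus>\<^bsub>A\<^esub> y = y \<oplus>\<^bsub>A\<^esub> x" if "x \<in> carrier A" "y \<in> carrier A" for x y
        using that q.a_comm unfolding A_sel by blast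
    qed (simp_all only: A_sel q.a_closed q.zero_closed q.l_zero)
    show "Group.monoid A"
      by (rule Group.monoidI)
        (simp_all only: A_sel q.m_closed q.one_closed q.m_assoc q.l_one q.r_one)
  qed (simp_all only: A_sel q.l_distr q.r_distr)
qed

lemma Q_eq: "p \<in> fcar S \<Longrightarrow> q \<in> fcar S \<Longrightarrow> Q p = Q q \<longleftrightarrow> p - q \<in> I"
proof -
  assume pq: "p \<in> fcar S" "q \<in> fcar S"
  interpret i: ideal I "free_algebra S" by (rule ideal_I)
  show ?thesis
    unfolding Q_def using i.quotient_eq_iff_same_a_r_cos[OF ideal_I, of p q] pq
    by (simp add: a_minus_def free_algebra_a_inv)
qed

lemma Q_set: "Q p = {i + p | i. i \<in> I}"
  by (auto simp: Q_def a_r_coset_def r_coset_def)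

lemma Q_carrier [simp, intro]: "p \<in> fcar S \<Longrightarrow> Q p \<in> carrier A"
  unfolding A_sel Q_def using ideal.rcos_ring_hom[OF ideal_I]
  by (auto simp: ring_hom_def)

lemma carrier_A: "carrier A = Q ` fcar S"
  by (auto simp: A_sel Q_def FactRing_def A_RCOSETS_def RCOSETS_def a_r_coset_def)

lemma Q_ops:
  "p \<in> fcar S \<Longrightarrow> q \<in> fcar S \<Longrightarrow> Q p \<otimes>\<^bsub>A\<^esub> Q q = Q (p * q)"
  "p \<in> fcar S \<Longrightarrow> q \<in> fcar S \<Longrightarrow> Q p \<oplus>\<^bsub>A\<^esub> Q q = Q (p + q)"
  "\<one>\<^bsub>A\<^esub> = Q 1" "\<zero>\<^bsub>A\<^esub> = Q 0"
proof -
  have h: "(+>\<^bsub>free_algebra S\<^esub>) I \<in> ring_hom (free_algebra S) (free_algebra S Quot I)"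
    by (rule ideal.rcos_ring_hom[OF ideal_I])
  show "p \<in> fcar S \<Longrightarrow> q \<in> fcar S \<Longrightarrow> Q p \<otimes>\<^bsub>A\<^esub> Q q = Q (p * q)"
    "p \<in> fcar S \<Longrightarrow> q \<in> fcar S \<Longrightarrow> Q p \<oplus>\<^bsub>A\<^esub> Q q = Q (p + q)" "\<one>\<^bsub>A\<^esub> = Q 1"
    using ring_hom_mult[OF h, of p q] ring_hom_add[OF h, of p q] ring_hom_one[OF h]
    unfolding A_sel Q_def free_algebra_sel by (blast dest: sym)+
  have "Q 0 = I" by (simp add: Q_set)
  then show "\<zero>\<^bsub>A\<^esub> = Q 0" unfolding A_sel by (simp only: FactRing_def ring.simps)
qed

text \<open>Scalars are the elements \<open>scal c\<close> of the free algebra, so independence of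
  the representative is stability of the ideal under left multiplication.\<close>

lemma Q_smult [simp]: "p \<in> fcar S \<Longrightarrow> c \<odot>\<^bsub>A\<^esub> Q p = Q (scal c * p)"
proof -
  assume p: "p \<in> fcar S"
  have "Q (scal c * x) = Q (scal c * p)" if "x \<in> Q p" for x
  proof -
    obtain i where i: "i \<in> I" "x = i + p" using \<open>x \<in> Q p\<close> by (auto simp: Q_set)
    have "scal c * i \<in> I" using i by (auto intro: I_closed)
    then show ?thesis using i p I_sub by (subst Q_eq) (auto simp: algebra_simps)
  qed
  moreover have "p \<in> Q p" using I_closed(1) by (force simp: Q_set)
  ultimately have "(\<Union>x\<in>Q p. Q (scal c * x)) = Q (scal c * p)" by blast
  then show ?thesis by (simp only: A_sel)
qed

lemma Q_uminus: "p \<in> fcar S \<Longrightarrow> \<ominus>\<^bsub>A\<^esub> Q p = Q (- p)"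
proof -
  assume p: "p \<in> fcar S"
  interpret ring A by (rule ring_A)
  show ?thesis using p by (intro minus_equality) (auto simp: Q_ops)
qed

lemma Q_minus: "p \<in> fcar S \<Longrightarrow> q \<in> fcar S \<Longrightarrow> Q p \<ominus>\<^bsub>A\<^esub> Q q = Q (p - q)"
  by (simp add: a_minus_def Q_uminus Q_ops)

lemma Q_finsum: "(\<And>i. i \<in> B \<Longrightarrow> p i \<in> fcar S) \<Longrightarrow> finite B \<Longrightarrow> finsum A (\<lambda>i. Q (p i)) B = Q (sum p B)"
proof -
  interpret ring A by (rule ring_A)
  show "(\<And>i. i \<in> B \<Longrightarrow> p i \<in> fcar S) \<Longrightarrow> finite B \<Longrightarrow> finsum A (\<lambda>i. Q (p i)) B = Q (sum p B)"
    by (rotate_tac, induction B rule: finite_induct) (simp_all add: Q_ops Pi_def)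
qed

lemma Q_foldr: "(\<And>i. i \<in> set xs \<Longrightarrow> p i \<in> fcar S) \<Longrightarrow>
    foldr (\<lambda>i y. Q (p i) \<otimes>\<^bsub>A\<^esub> y) xs \<one>\<^bsub>A\<^esub> = Q (prod_list (map p xs))"
  by (induction xs) (simp_all add: Q_ops fcar_prod_list)

lemma Q_pow: "p \<in> fcar S \<Longrightarrow> Q p [^]\<^bsub>A\<^esub> (n::nat) = Q (p ^ n)"
proof -
  interpret ring A by (rule ring_A)
  show "p \<in> fcar S \<Longrightarrow> Q p [^]\<^bsub>A\<^esub> (n::nat) = Q (p ^ n)"
    by (induction n) (simp_all add: Q_ops power_commutes)
qed

lemma presented_gen_Q: "presented_gen S R x = Q (letter x)"
  by (simp add: presented_gen_def Q_def)

text \<open>The lift of the generators is the quotient map itself. Hence the homomorphism that an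
  inclusion of Lie algebras induces between enveloping algebras is the identity on
  representatives.\<close>

lemma free_lift_Q:
  assumes p: "p \<in> fcar S"
  shows "free_lift A (\<lambda>x. Q (letter x)) p = Q p"
proof -
  interpret ring A by (rule ring_A)
  have *: "Poly_Mapping.lookup p w \<odot>\<^bsub>A\<^esub> foldr (\<lambda>x y. Q (letter x) \<otimes>\<^bsub>A\<^esub> y) (letters w) \<one>\<^bsub>A\<^esub>
      = Q (Poly_Mapping.single w (Poly_Mapping.lookup p w))"
    and s: "Poly_Mapping.single w (Poly_Mapping.lookup p w) \<in> fcar S"
    if "w \<in> Poly_Mapping.keys p" for w
  proof -
    have w: "set (letters w) \<subseteq> S" using p that by (simp add: fcar_iff)
    show "Poly_Mapping.single w (Poly_Mapping.lookup p w) \<in> fcar S" using w by (simp add: fcar_iff)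
    show "Poly_Mapping.lookup p w \<odot>\<^bsub>A\<^esub> foldr (\<lambda>x y. Q (letter x) \<otimes>\<^bsub>A\<^esub> y) (letters w) \<one>\<^bsub>A\<^esub>
      = Q (Poly_Mapping.single w (Poly_Mapping.lookup p w))"
    proof -
      have "prod_list (map letter (letters w)) \<in> fcar S" using w by (auto intro!: fcar_prod_list)
      then show ?thesis
        using w by (subst Q_foldr) (auto simp: single_prod_letters[of w])
    qed
  qed
  have "free_lift A (\<lambda>x. Q (letter x)) p = (\<Oplus>\<^bsub>A\<^esub> w\<in>Poly_Mapping.keys p.
      Q (Poly_Mapping.single w (Poly_Mapping.lookup p w)))"
    unfolding free_lift_def by (rule finsum_cong') (use * s in auto)
  also have "\<dots> = Q p"
    by (subst Q_finsum) (auto intro: s simp flip: poly_mapping_sum_single)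
  finally show ?thesis .
qed

end

text \<open>The determinant calculus below lives in type class rings, hence in the free algebra on
  the whole type. This retraction onto the words over \<open>S\<close> pulls ideals of
  \<open>fcar S\<close> back to ideals there.\<close>

definition proj :: "'x set \<Rightarrow> ('x word \<Rightarrow>\<^sub>0 complex) \<Rightarrow> 'x word \<Rightarrow>\<^sub>0 complex" where
  "proj S = Poly_Mapping.mapp (\<lambda>w c. if set (letters w) \<subseteq> S then c else 0)"

lemma lookup_proj: "Poly_Mapping.lookup (proj S p) w =
    (if set (letters w) \<subseteq> S then Poly_Mapping.lookup p w else 0)"
  by (auto simp: proj_def lookup_mapp when_def in_keys_iff)

lemma proj_add: "proj S (p + q) = proj S p + proj S q"
  by (rule poly_mapping_eqI) (simp add: lookup_proj lookup_add)

lemma proj_zero [simp]: "proj S 0 = 0"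
  by (rule poly_mapping_eqI) (simp add: lookup_proj)

lemma proj_diff: "proj S (p - q) = proj S p - proj S q"
  by (rule poly_mapping_eqI) (simp add: lookup_proj lookup_minus)

lemma proj_single: "proj S (Poly_Mapping.single w c) =
    (if set (letters w) \<subseteq> S then Poly_Mapping.single w c else 0)"
  by (rule poly_mapping_eqI) (auto simp: lookup_proj lookup_single when_def)

text \<open>A concatenation has all its letters in \<open>S\<close> exactly when both words do, so
  dropping the other words is multiplicative.\<close>

lemma proj_mult: "proj S (p * q) = proj S p * proj S q"
proof (induction p rule: pm_induct)
  case (single w c)
  show ?case
    by (induction q rule: pm_induct) (auto simp: mult_single proj_single proj_add distrib_left)
qed (auto simp: proj_add distrib_right)

lemma proj_fcar [simp, intro]: "proj S p \<in> fcar S"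
  by (auto simp: fcar_iff in_keys_iff lookup_proj split: if_splits)

lemma proj_id [simp]: "p \<in> fcar S \<Longrightarrow> proj S p = p"
  by (rule poly_mapping_eqI) (auto simp: fcar_iff in_keys_iff lookup_proj)

section \<open>Linear extension from words\<close>

definition wsum :: "('w \<Rightarrow> complex) \<Rightarrow> ('w \<Rightarrow>\<^sub>0 complex) \<Rightarrow> complex" where
  "wsum h p = (\<Sum>w\<in>Poly_Mapping.keys p. Poly_Mapping.lookup p w * h w)"

lemma wsum_single [simp]: "wsum h (Poly_Mapping.single w c) = c * h w"
  by (simp add: wsum_def)

lemma wsum_zero [simp]: "wsum h 0 = 0"
  by (simp add: wsum_def)

lemma wsum_add: "wsum h (p + q) = wsum h p + wsum h q"
  unfolding wsum_def by (rule setsum_keys_plus_distrib) (auto simp: algebra_simps)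

lemma wsum_uminus: "wsum h (- p) = - wsum h p"
  by (simp add: wsum_def sum_negf)

lemma wsum_diff: "wsum h (p - q) = wsum h p - wsum h q"
  using wsum_add[of h p "- q"] by (simp add: wsum_uminus)

lemma wsum_one: "wsum h 1 = h 0"
  by (metis mult_1 single_one wsum_single)

lemma wsum_scal: "wsum h (scal c * p) = c * wsum h p"
  by (induction p rule: pm_induct) (auto simp: mult_single wsum_add algebra_simps)

lemma wsum_sum: "wsum h (sum p A) = (\<Sum>i\<in>A. wsum h (p i))"
  by (induction A rule: infinite_finite_induct) (auto simp: wsum_add)

definition act :: "('x \<Rightarrow> ('a \<Rightarrow> complex) \<Rightarrow> 'a \<Rightarrow> complex) \<Rightarrow> ('x word \<Rightarrow>\<^sub>0 complex) \<Rightarrow>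
    ('a \<Rightarrow> complex) \<Rightarrow> 'a \<Rightarrow> complex" where
  "act \<rho> p g = (\<lambda>a. wsum (\<lambda>w. fold \<rho> (letters w) g a) p)"

text \<open>The first letter of a word acts first, so that \<open>act\<close> makes \<open>M\<close> a right module.\<close>

locale word_action =
  fixes S :: "'x set" and \<rho> :: "'x \<Rightarrow> ('a \<Rightarrow> complex) \<Rightarrow> 'a \<Rightarrow> complex" and M :: "('a \<Rightarrow> complex) set"
  assumes M_zero: "(\<lambda>a. 0) \<in> M"
    and M_add: "f \<in> M \<Longrightarrow> g \<in> M \<Longrightarrow> (\<lambda>a. f a + g a) \<in> M"
    and M_scale: "f \<in> M \<Longrightarrow> (\<lambda>a. c * f a) \<in> M"
    and M_op: "x \<in> S \<Longrightarrow> f \<in> M \<Longrightarrow> \<rho> x f \<in> M"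
    and op_add: "x \<in> S \<Longrightarrow> f \<in> M \<Longrightarrow> g \<in> M \<Longrightarrow> \<rho> x (\<lambda>a. f a + g a) = (\<lambda>a. \<rho> x f a + \<rho> x g a)"
    and op_scale: "x \<in> S \<Longrightarrow> f \<in> M \<Longrightarrow> \<rho> x (\<lambda>a. c * f a) = (\<lambda>a. c * \<rho> x f a)"
begin

lemma fold_M: "set xs \<subseteq> S \<Longrightarrow> f \<in> M \<Longrightarrow> fold \<rho> xs f \<in> M"
  by (induction xs arbitrary: f) (auto intro: M_op)

lemma fold_add: "set xs \<subseteq> S \<Longrightarrow> f \<in> M \<Longrightarrow> g \<in> M \<Longrightarrow>
    fold \<rho> xs (\<lambda>a. f a + g a) = (\<lambda>a. fold \<rho> xs f a + fold \<rho> xs g a)"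
  by (induction xs arbitrary: f g) (auto simp: op_add intro: M_op)

lemma fold_scale: "set xs \<subseteq> S \<Longrightarrow> f \<in> M \<Longrightarrow> fold \<rho> xs (\<lambda>a. c * f a) = (\<lambda>a. c * fold \<rho> xs f a)"
  by (induction xs arbitrary: f) (auto simp: op_scale intro: M_op)

lemma act_single: "act \<rho> (Poly_Mapping.single w c) f = (\<lambda>a. c * fold \<rho> (letters w) f a)"
  by (simp add: act_def)

lemma act_add_left: "act \<rho> (p + q) f = (\<lambda>a. act \<rho> p f a + act \<rho> q f a)"
  by (simp add: act_def wsum_add)

lemma act_diff_left: "act \<rho> (p - q) f = (\<lambda>a. act \<rho> p f a - act \<rho> q f a)"
  by (simp add: act_def wsum_diff)

lemma act_scal: "act \<rho> (scal c * p) f = (\<lambda>a. c * act \<rho> p f a)"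
  by (simp add: act_def wsum_scal)

lemma act_zero_left [simp]: "act \<rho> 0 f = (\<lambda>a. 0)"
  by (simp add: act_def)

lemma act_one [simp]: "act \<rho> 1 f = f"
  by (simp add: act_def wsum_one)

lemma act_letter [simp]: "act \<rho> (letter x) f = \<rho> x f"
  by (simp add: act_def letter_def)

lemma act_M:
  assumes p: "p \<in> fcar S" and f: "f \<in> M"
  shows "act \<rho> p f \<in> M"
proof (induction p rule: pm_induct)
  case (single w c)
  then show ?case using p f by (auto simp: act_single fcar_iff intro!: M_scale fold_M)
qed (auto simp: act_add_left M_zero intro: M_add)

lemma act_add:
  assumes p: "p \<in> fcar S" and f: "f \<in> M" "g \<in> M"
  shows "act \<rho> p (\<lambda>a. f a + g a) = (\<lambda>a. act \<rho> p f a + act \<rho> p g a)"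
proof (induction p rule: pm_induct)
  case (single w c)
  then show ?case using p f by (auto simp: act_single fcar_iff fold_add algebra_simps)
qed (auto simp: act_add_left algebra_simps)

lemma act_scale:
  assumes p: "p \<in> fcar S" and f: "f \<in> M"
  shows "act \<rho> p (\<lambda>a. c * f a) = (\<lambda>a. c * act \<rho> p f a)"
proof (induction p rule: pm_induct)
  case (single w c)
  then show ?case using p f by (auto simp: act_single fcar_iff fold_scale algebra_simps)
qed (auto simp: act_add_left algebra_simps)

lemma act_zero: "p \<in> fcar S \<Longrightarrow> act \<rho> p (\<lambda>a. 0) = (\<lambda>a. 0)"
  using act_scale[of p "\<lambda>a. 0" 0] M_zero by simp

text \<open>The first letter acts first, hence the reversed order. Membership of
  \<open>act \<rho> p f\<close> in \<open>M\<close> is carried along in the induction because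
  \<open>act \<rho> q\<close> is known to be linear only on \<open>M\<close>.\<close>

lemma act_mult:
  assumes p: "p \<in> fcar S" and q: "q \<in> fcar S" and f: "f \<in> M"
  shows "act \<rho> (p * q) f = act \<rho> q (act \<rho> p f)"
proof -
  have "act \<rho> (p * q) f = act \<rho> q (act \<rho> p f) \<and> act \<rho> p f \<in> M"
  proof (induction p rule: pm_induct)
    case (single w c)
    then have w: "set (letters w) \<subseteq> S" using p by (auto simp: fcar_iff)
    have m: "fold \<rho> (letters w) f \<in> M" using w f by (rule fold_M)
    have "act \<rho> (Poly_Mapping.single w c * q) f = (\<lambda>a. c * act \<rho> q (fold \<rho> (letters w) f) a)"
      by (induction q rule: pm_induct)
        (auto simp: mult_single act_single distrib_left act_add_left algebra_simps)
    then show ?case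
      using act_scale[OF q m, of c] M_scale[OF m, of c] by (simp add: act_single)
  next
    case (add p1 p2)
    then show ?case
      using act_add[OF q, of "act \<rho> p1 f" "act \<rho> p2 f"]
      by (auto simp: distrib_right act_add_left intro: M_add)
  qed (auto simp: act_zero[OF q] M_zero)
  then show ?thesis by simp
qed

end

locale presentation_action = presentation S R + word_action S \<rho> M
  for S :: "'x set" and R and \<rho> :: "'x \<Rightarrow> ('a \<Rightarrow> complex) \<Rightarrow> 'a \<Rightarrow> complex" and M +
  assumes act_rel: "r \<in> R \<Longrightarrow> f \<in> M \<Longrightarrow> act \<rho> r f = (\<lambda>a. 0)"
begin

lemma act_I: "p \<in> I \<Longrightarrow> f \<in> M \<Longrightarrow> act \<rho> p f = (\<lambda>a. 0)"
proof
  fix a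
  assume p: "p \<in> I" and f: "f \<in> M"
  show "act \<rho> p f a = 0"
  proof (rule I_kill[where \<psi> = "\<lambda>p. act \<rho> p f a"])
    fix u r v assume "r \<in> R" "u \<in> fcar S" "v \<in> fcar S"
    then show "act \<rho> (u * r * v) f a = 0"
      using rels_sub f by (auto simp: act_mult act_M act_rel act_zero)
  qed (auto simp: act_add_left p)
qed

end

section \<open>Induced modules\<close>

lemma complex_algebra_sel [simp]:
  "carrier complex_algebra = UNIV" "monoid.mult complex_algebra = (*)" "one complex_algebra = 1"
  "ring.zero complex_algebra = 0" "ring.add complex_algebra = (+)" "smult complex_algebra = (*)"
  by (simp_all add: complex_algebra_def)

lemma finsum_complex_algebra: "finite B \<Longrightarrow> finsum complex_algebra f B = sum f B"
proof -
  interpret abelian_monoid complex_algebra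
    by (rule abelian_monoidI) (auto simp: add.assoc add.commute)
  show "finite B \<Longrightarrow> finsum complex_algebra f B = sum f B"
    by (induction rule: finite_induct) (auto simp: finsum_insert)
qed

section \<open>Characters of the free algebra\<close>

definition word_char :: "('x \<Rightarrow> complex) \<Rightarrow> ('x word \<Rightarrow>\<^sub>0 complex) \<Rightarrow> complex" where
  "word_char \<chi> = wsum (\<lambda>w. prod_list (map \<chi> (letters w)))"

lemma word_char_simps [simp]:
  "word_char \<chi> (p + q) = word_char \<chi> p + word_char \<chi> q"
  "word_char \<chi> (p - q) = word_char \<chi> p - word_char \<chi> q"
  "word_char \<chi> (letter x) = \<chi> x" "word_char \<chi> (scal c) = c"
  "word_char \<chi> 0 = 0" "word_char \<chi> 1 = 1"
  by (simp_all add: word_char_def wsum_add wsum_diff letter_def wsum_one)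

lemma word_char_mult [simp]: "word_char \<chi> (p * q) = word_char \<chi> p * word_char \<chi> q"
proof (induction p rule: pm_induct)
  case (single w c)
  show ?case
    by (induction q rule: pm_induct)
      (auto simp: mult_single word_char_def distrib_left wsum_add algebra_simps)
qed (auto simp: distrib_right)

lemma free_lift_complex: "free_lift complex_algebra \<chi> p = word_char \<chi> p"
proof -
  have "foldr (\<lambda>x y. \<chi> x * y) xs 1 = prod_list (map \<chi> xs)" for xs
    by (induction xs) auto
  then show ?thesis
    by (simp add: free_lift_def finsum_complex_algebra word_char_def wsum_def)
qed

lemma image_const: "x \<in> X \<Longrightarrow> (\<And>x. x \<in> X \<Longrightarrow> f x = c) \<Longrightarrow> f ` X = {c}"
  by auto

locale lie_closed =
  fixes G :: "'a lie_algebra"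
  assumes add_closed: "x \<in> carrier G \<Longrightarrow> y \<in> carrier G \<Longrightarrow> x \<oplus>\<^bsub>G\<^esub> y \<in> carrier G"
    and smult_closed: "x \<in> carrier G \<Longrightarrow> c \<odot>\<^bsub>G\<^esub> x \<in> carrier G"
    and bracket_closed: "x \<in> carrier G \<Longrightarrow> y \<in> carrier G \<Longrightarrow> bracket G x y \<in> carrier G"
begin

lemma presentation_env: "presentation (carrier G) (env_rels G)"
  unfolding presentation_def env_rels_def
  using add_closed smult_closed bracket_closed by auto

sublocale presentation "carrier G" "env_rels G" by (rule presentation_env)

lemma env_eq: "env G = A" by (simp add: env_def)

lemma env_gen_eq: "env_gen G = (\<lambda>x. Q (letter x))"
  by (rule ext) (simp add: env_gen_def presented_gen_Q)

end

locale induced = lie_closed G for G :: "'a lie_algebra" +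
  fixes CP :: "'a set" and \<chi> :: "'a \<Rightarrow> complex"
  assumes CP_sub: "CP \<subseteq> carrier G"
    and CP_add: "x \<in> CP \<Longrightarrow> y \<in> CP \<Longrightarrow> x \<oplus>\<^bsub>G\<^esub> y \<in> CP"
    and CP_smult: "x \<in> CP \<Longrightarrow> c \<odot>\<^bsub>G\<^esub> x \<in> CP"
    and CP_bracket: "x \<in> CP \<Longrightarrow> y \<in> CP \<Longrightarrow> bracket G x y \<in> CP"
    and \<chi>_add: "x \<in> CP \<Longrightarrow> y \<in> CP \<Longrightarrow> \<chi> (x \<oplus>\<^bsub>G\<^esub> y) = \<chi> x + \<chi> y"
    and \<chi>_smult: "x \<in> CP \<Longrightarrow> \<chi> (c \<odot>\<^bsub>G\<^esub> x) = c * \<chi> x"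
    and \<chi>_bracket: "x \<in> CP \<Longrightarrow> y \<in> CP \<Longrightarrow> \<chi> (bracket G x y) = 0"
begin

abbreviation "H \<equiv> G\<lparr>carrier := CP\<rparr>"

sublocale P: presentation CP "env_rels H"
proof -
  have "lie_closed H"
    by unfold_locales (simp_all add: CP_add CP_smult CP_bracket)
  from lie_closed.presentation_env[OF this] show "presentation CP (env_rels H)" by simp
qed

lemma env_H: "env H = P.A"
  by (simp add: env_def)

abbreviation "ra \<equiv> \<lambda>u p. u \<otimes>\<^bsub>env G\<^esub> env_lift (env G) (env_gen G) p"
abbreviation "la \<equiv> \<lambda>p z. env_lift complex_algebra \<chi> p * z"
abbreviation "N \<equiv> tensor_module (env H) (env G) ra complex_algebra la"
abbreviation "F \<equiv> tensor_free (env G) complex_algebra"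
abbreviation "K \<equiv> tensor_rels (env H) (env G) ra complex_algebra la"

lemma CP_fcar: "p \<in> fcar CP \<Longrightarrow> p \<in> fcar (carrier G)"
  using CP_sub fcar_mono by blast

text \<open>The relations of the subalgebra are among those of the whole algebra. This is what makes
  the right action of the enveloping algebra of \<open>H\<close> well defined.\<close>

lemma IP_sub: "P.I \<subseteq> I"
proof -
  have "P.I \<subseteq> I \<inter> fcar CP"
  proof (rule P.I_least)
    have "env_rels H \<subseteq> env_rels G"
      unfolding env_rels_def using CP_sub by (intro Un_mono) (simp, blast)+
    moreover have "env_rels G \<subseteq> I" using rels_I by blast
    moreover have "env_rels H \<subseteq> fcar CP" by (rule P.rels_sub)
    ultimately show "env_rels H \<subseteq> I \<inter> fcar CP" by blast
  qed (auto intro: I_closed dest: CP_fcar)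
  then show ?thesis by blast
qed

lemma env_lift_G: "p \<in> fcar CP \<Longrightarrow> env_lift (env G) (env_gen G) (P.Q p) = Q p"
proof -
  assume p: "p \<in> fcar CP"
  have "free_lift (env G) (env_gen G) x = Q p" if x: "x \<in> P.Q p" for x
  proof -
    obtain i where i: "i \<in> P.I" "x = i + p" using x unfolding P.Q_set by auto
    have "free_lift (env G) (env_gen G) x = Q x"
      using free_lift_Q[of x] i P.I_sub p CP_fcar by (auto simp: env_eq env_gen_eq)
    also have "\<dots> = Q p" using i IP_sub I_sub p CP_fcar by (subst Q_eq) auto
    finally show ?thesis .
  qed
  moreover have "p \<in> P.Q p" using P.I_closed(1) unfolding P.Q_set by force
  ultimately have "free_lift (env G) (env_gen G) ` P.Q p = {Q p}" by (intro image_const)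
  then show ?thesis by (simp add: env_lift_def)
qed

lemma ra_Q: "u \<in> fcar (carrier G) \<Longrightarrow> p \<in> fcar CP \<Longrightarrow> ra (Q u) (P.Q p) = Q (u * p)"
  using CP_fcar[of p] by (simp add: env_lift_G) (simp add: env_eq Q_ops)

lemma word_char_IP: "p \<in> P.I \<Longrightarrow> word_char \<chi> p = 0"
proof (rule P.I_kill[where \<psi> = "word_char \<chi>"])
  fix u r v assume "r \<in> env_rels H"
  then have "word_char \<chi> r = 0"
    by (auto simp: env_rels_def \<chi>_add \<chi>_smult \<chi>_bracket)
  then show "word_char \<chi> (u * r * v) = 0" by simp
qed auto

lemma env_lift_C: "p \<in> fcar CP \<Longrightarrow> env_lift complex_algebra \<chi> (P.Q p) = word_char \<chi> p"
proof -
  assume p: "p \<in> fcar CP"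
  have "free_lift complex_algebra \<chi> x = word_char \<chi> p" if x: "x \<in> P.Q p" for x
    using x word_char_IP unfolding P.Q_set by (auto simp: free_lift_complex)
  moreover have "p \<in> P.Q p" using P.I_closed(1) unfolding P.Q_set by force
  ultimately have "free_lift complex_algebra \<chi> ` P.Q p = {word_char \<chi> p}" by (intro image_const)
  then show ?thesis by (simp add: env_lift_def)
qed

text \<open>The generating relations of the tensor product, isolated so that \<open>K\<close> is the
  subgroup generated by them.\<close>

definition "T = {frag_of (x \<oplus>\<^bsub>env G\<^esub> y, z) - frag_of (x, z) - frag_of (y, z) | x y z.
         x \<in> carrier (env G) \<and> y \<in> carrier (env G) \<and> z \<in> carrier complex_algebra} \<union>
      {frag_of (x, z \<oplus>\<^bsub>complex_algebra\<^esub> w) - frag_of (x, z) - frag_of (x, w) | x z w.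
         x \<in> carrier (env G) \<and> z \<in> carrier complex_algebra \<and> w \<in> carrier complex_algebra} \<union>
      {frag_of (ra x r, z) - frag_of (x, la r z) | x r z.
         x \<in> carrier (env G) \<and> r \<in> carrier (env H) \<and> z \<in> carrier complex_algebra}"

lemma K_eq: "K = generate F T"
  by (simp add: tensor_rels_def T_def)

lemma F_sel [simp]: "carrier F = {c. Poly_Mapping.keys c \<subseteq> carrier (env G) \<times> UNIV}"
  "monoid.mult F = (+)" "one F = 0"
  by (simp_all add: tensor_free_def free_Abelian_group_def)

lemma F_group: "Group.group F"
  by (simp add: tensor_free_def)

lemma F_inv: "x \<in> carrier F \<Longrightarrow> inv\<^bsub>F\<^esub> x = - x"
  by (simp add: tensor_free_def)

lemma lift_carrier: "r \<in> carrier (env H) \<Longrightarrow> env_lift (env G) (env_gen G) r \<in> carrier (env G)"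
  using P.carrier_A env_lift_G CP_fcar by (auto simp: env_H env_eq)

lemma T_sub: "T \<subseteq> carrier F"
proof -
  interpret ring "env G" unfolding env_eq by (rule ring_A)
  have d: "a \<in> carrier F \<Longrightarrow> b \<in> carrier F \<Longrightarrow> a - b \<in> carrier F" for a b
    using keys_diff[of a b] by auto
  show ?thesis
    unfolding T_def by (auto intro!: d simp: keys_frag_of lift_carrier simp del: F_sel)
     (auto simp: keys_frag_of lift_carrier)
qed

lemma K_closed: "0 \<in> K" "a \<in> K \<Longrightarrow> b \<in> K \<Longrightarrow> a + b \<in> K" "a \<in> K \<Longrightarrow> - a \<in> K"
  "a \<in> K \<Longrightarrow> b \<in> K \<Longrightarrow> a - b \<in> K" "t \<in> T \<Longrightarrow> t \<in> K" "a \<in> K \<Longrightarrow> a \<in> carrier F"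
proof -
  have s: "subgroup K F" unfolding K_eq by (rule group.generate_is_subgroup[OF F_group T_sub])
  show "0 \<in> K" using subgroup.one_closed[OF s] by simp
  show c: "a \<in> K \<Longrightarrow> a \<in> carrier F" for a using subgroup.subset[OF s] by blast
  show a: "a + b \<in> K" if "a \<in> K" "b \<in> K" for a b using subgroup.m_closed[OF s that] by simp
  show m: "- a \<in> K" if "a \<in> K" for a
    using subgroup.m_inv_closed[OF s that] F_inv[OF c[OF that]] by simp
  show "a - b \<in> K" if "a \<in> K" "b \<in> K" for a b using a[OF that(1) m[OF that(2)]] by simp
  show "t \<in> T \<Longrightarrow> t \<in> K" unfolding K_eq by (rule generate.incl)
qed

text \<open>The target subgroup \<open>Z\<close> is a parameter because it is taken to be
  \<open>K\<close> itself for the stability under left multiplication, and \<open>{0}\<close> for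
  functionals.\<close>

lemma K_kill:
  fixes \<psi> :: "_ \<Rightarrow> 'c::ab_group_add"
  assumes add: "\<And>a b. \<psi> (a + b) = \<psi> a + \<psi> b" and t: "\<And>t. t \<in> T \<Longrightarrow> \<psi> t \<in> Z"
    and Z: "0 \<in> Z" "\<And>a b. a \<in> Z \<Longrightarrow> b \<in> Z \<Longrightarrow> a + b \<in> Z" "\<And>a. a \<in> Z \<Longrightarrow> - a \<in> Z"
    and a: "a \<in> K"
  shows "\<psi> a \<in> Z"
proof -
  have z: "\<psi> 0 = 0" using add[of 0 0] by simp
  have um: "\<psi> (- p) = - \<psi> p" for p
    using add[of p "- p"] z by (simp add: eq_neg_iff_add_eq_0 add.commute)
  from a show ?thesis unfolding K_eq
  proof (induction rule: generate.induct)
    case (inv h)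
    then show ?case using T_sub F_inv[of h] um t Z by auto
  qed (use z add t Z in auto)
qed

definition coset :: "(('a word \<Rightarrow>\<^sub>0 complex) set \<times> complex \<Rightarrow>\<^sub>0 int) \<Rightarrow> _" where
  "coset p = K #>\<^bsub>F\<^esub> p"

lemma coset_set: "coset p = {k + p | k. k \<in> K}"
  by (auto simp: coset_def r_coset_def)

lemma coset_eq: "coset p = coset q \<longleftrightarrow> p - q \<in> K"
proof
  assume e: "coset p = coset q"
  have "p \<in> coset p" using K_closed(1) by (force simp: coset_set)
  then show "p - q \<in> K" unfolding e by (auto simp: coset_set)
next
  assume d: "p - q \<in> K"
  show "coset p = coset q"
  proof (rule Set.set_eqI)
    fix x
    have "x \<in> coset p \<longleftrightarrow> x - p \<in> K" for p by (force simp: coset_set)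
    moreover have "x - p \<in> K \<longleftrightarrow> x - q \<in> K"
      using K_closed(2)[OF _ d, of "x - p"] K_closed(4)[OF _ d, of "x - q"] by (auto simp: algebra_simps)
    ultimately show "x \<in> coset p \<longleftrightarrow> x \<in> coset q" by blast
  qed
qed

lemma N_zero: "\<zero>\<^bsub>N\<^esub> = coset 0"
  by (simp add: tensor_module_def Let_def FactGroup_def coset_set)

lemma N_carrier: "p \<in> carrier F \<Longrightarrow> coset p \<in> carrier N"
  by (auto simp: tensor_module_def Let_def FactGroup_def RCOSETS_def coset_def)

definition ext :: "('a word \<Rightarrow>\<^sub>0 complex) set \<Rightarrow> (('a word \<Rightarrow>\<^sub>0 complex) set \<times> complex \<Rightarrow>\<^sub>0 int) \<Rightarrow> _" where
  "ext u = frag_extend (\<lambda>(x, z). frag_of (u \<otimes>\<^bsub>env G\<^esub> x, z))"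

text \<open>Left multiplication is additive and commutes with the right action, so each of the three
  kinds of relations is carried to a relation of the same kind.\<close>

lemma ext_K: "u \<in> carrier (env G) \<Longrightarrow> a \<in> K \<Longrightarrow> ext u a \<in> K"
proof (rule K_kill[where \<psi> = "ext u"])
  interpret ring "env G" unfolding env_eq by (rule ring_A)
  fix t assume u: "u \<in> carrier (env G)" and "t \<in> T"
  then have "ext u t \<in> T"
  proof -
    have e: "ext u (a - b) = ext u a - ext u b" for a b by (simp add: ext_def frag_extend_diff)
    have f: "ext u (frag_of (x, z)) = frag_of (u \<otimes>\<^bsub>env G\<^esub> x, z)" for x z by (simp add: ext_def)
    from \<open>t \<in> T\<close> consider
      (1) x y z where "t = frag_of (x \<oplus>\<^bsub>env G\<^esub> y, z) - frag_of (x, z) - frag_of (y, z)"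
          "x \<in> carrier (env G)" "y \<in> carrier (env G)"
      | (2) x z w where "t = frag_of (x, z + w) - frag_of (x, z) - frag_of (x, w)" "x \<in> carrier (env G)"
      | (3) x r z where "t = frag_of (ra x r, z) - frag_of (x, la r z)" "x \<in> carrier (env G)" "r \<in> carrier (env H)"
      unfolding T_def by auto
    then show ?thesis
    proof cases
      case 1
      then have "ext u t = frag_of (u \<otimes>\<^bsub>env G\<^esub> x \<oplus>\<^bsub>env G\<^esub> u \<otimes>\<^bsub>env G\<^esub> y, z)
          - frag_of (u \<otimes>\<^bsub>env G\<^esub> x, z) - frag_of (u \<otimes>\<^bsub>env G\<^esub> y, z)"
        using u by (simp add: e f r_distr)
      then show ?thesis unfolding T_def using 1 u m_closed by (intro UnI1) (auto)
    next
      case 2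
      then show ?thesis unfolding T_def using u m_closed[OF u 2(2)] by (auto simp: e f)
    next
      case 3
      then have "ext u t = frag_of (ra (u \<otimes>\<^bsub>env G\<^esub> x) r, z) - frag_of (u \<otimes>\<^bsub>env G\<^esub> x, la r z)"
        using u lift_carrier by (simp add: e f m_assoc)
      then show ?thesis unfolding T_def using 3 u m_closed[OF u 3(2)] by (intro UnI2) (auto)
    qed
  qed
  then show "ext u t \<in> K" by (rule K_closed)
qed (auto simp: ext_def frag_extend_add intro: K_closed)

lemma N_smult: "u \<in> carrier (env G) \<Longrightarrow> u \<odot>\<^bsub>N\<^esub> coset p = coset (ext u p)"
proof -
  assume u: "u \<in> carrier (env G)"
  have "coset (ext u x) = coset (ext u p)" if "x \<in> coset p" for x
  proof -
    obtain k where "k \<in> K" "x = k + p" using \<open>x \<in> coset p\<close> by (auto simp: coset_set)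
    then show ?thesis using ext_K[OF u] by (auto simp: coset_eq ext_def frag_extend_add)
  qed
  moreover have "p \<in> coset p" using K_closed(1) by (force simp: coset_set)
  ultimately have "(\<Union>x\<in>coset p. coset (ext u x)) = coset (ext u p)" by blast
  then show ?thesis
    by (simp add: tensor_module_def Let_def coset_def ext_def)
qed

definition vec :: "('a word \<Rightarrow>\<^sub>0 complex) \<Rightarrow> _" where
  "vec u = coset (frag_of (Q u, 1))"

lemma pure_tensor_one: "pure_tensor (env H) (env G) ra complex_algebra la \<one>\<^bsub>env G\<^esub> 1 = vec 1"
  by (simp add: pure_tensor_def vec_def coset_def env_eq Q_ops)

lemma vec_carrier: "u \<in> fcar (carrier G) \<Longrightarrow> vec u \<in> carrier N"
  unfolding vec_def using Q_carrier[of u] by (intro N_carrier) (simp add: keys_frag_of flip: env_eq)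

lemma smult_vec: "x \<in> fcar (carrier G) \<Longrightarrow> u \<in> fcar (carrier G) \<Longrightarrow> Q x \<odot>\<^bsub>N\<^esub> vec u = vec (x * u)"
  using N_smult[of "Q x"] by (simp add: vec_def ext_def env_eq Q_ops)

text \<open>The words that annihilate the generator of the induced module. From here on the module
  is studied through this left ideal of the free algebra and no longer through cosets of
  cosets.\<close>

definition "J = {u \<in> fcar (carrier G). frag_of (Q u, 1) \<in> K}"

lemma vec_zero_iff: "u \<in> fcar (carrier G) \<Longrightarrow> vec u = \<zero>\<^bsub>N\<^esub> \<longleftrightarrow> u \<in> J"
  by (simp add: vec_def N_zero coset_eq J_def)

lemma frag_add: "u \<in> fcar (carrier G) \<Longrightarrow> v \<in> fcar (carrier G) \<Longrightarrow>
   frag_of (Q (u + v), 1) - frag_of (Q u, 1) - frag_of (Q v, 1) \<in> K"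
proof (rule K_closed(5))
  assume uv: "u \<in> fcar (carrier G)" "v \<in> fcar (carrier G)"
  have "frag_of (Q u \<oplus>\<^bsub>env G\<^esub> Q v, 1) - frag_of (Q u, 1) - frag_of (Q v, 1) \<in> T"
    unfolding T_def using uv by (intro UnI1) (auto simp: env_eq)
  then show "frag_of (Q (u + v), 1) - frag_of (Q u, 1) - frag_of (Q v, 1) \<in> T"
    using uv by (simp add: env_eq Q_ops)
qed

lemma J_sub: "u \<in> J \<Longrightarrow> u \<in> fcar (carrier G)" by (simp add: J_def)

lemma J_zero: "0 \<in> J"
  using K_closed(3)[OF frag_add[of 0 0]] by (simp add: J_def)

lemma J_add: "u \<in> J \<Longrightarrow> v \<in> J \<Longrightarrow> u + v \<in> J"
  using K_closed(2)[OF K_closed(2)[OF frag_add[of u v], of "frag_of (Q u, 1)"], of "frag_of (Q v, 1)"]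
  by (auto simp: J_def)

lemma J_mult: "u \<in> J \<Longrightarrow> x \<in> fcar (carrier G) \<Longrightarrow> x * u \<in> J"
proof -
  assume u: "u \<in> J" and x: "x \<in> fcar (carrier G)"
  then have "ext (Q x) (frag_of (Q u, 1)) \<in> K" by (intro ext_K) (auto simp: J_def env_eq)
  then show ?thesis using u x by (simp add: J_def ext_def env_eq Q_ops)
qed

lemma I_J: "u \<in> I \<Longrightarrow> u \<in> J"
proof -
  assume u: "u \<in> I"
  then have "Q u = Q 0" using I_sub by (subst Q_eq) auto
  then show ?thesis using J_zero I_sub u by (auto simp: J_def)
qed

lemma frag_balance: "u \<in> fcar (carrier G) \<Longrightarrow> p \<in> fcar CP \<Longrightarrow>
   frag_of (Q (u * p), 1) - frag_of (Q u, word_char \<chi> p) \<in> K"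
proof (rule K_closed(5))
  assume up: "u \<in> fcar (carrier G)" "p \<in> fcar CP"
  then have "P.Q p \<in> carrier (env H)" "Q u \<in> carrier (env G)"
    using P.Q_carrier[of p] by (auto simp: env_H env_eq)
  then have "frag_of (ra (Q u) (P.Q p), 1) - frag_of (Q u, la (P.Q p) 1) \<in> T"
    unfolding T_def
    by (intro UnI2 CollectI exI[of _ "Q u"] exI[of _ "P.Q p"] exI[of _ 1] conjI refl) simp_all
  then show "frag_of (Q (u * p), 1) - frag_of (Q u, word_char \<chi> p) \<in> T"
    using up by (simp add: ra_Q env_lift_C)
qed

lemma J_diff_iff: "u \<in> fcar (carrier G) \<Longrightarrow> v \<in> fcar (carrier G) \<Longrightarrow>
  u - v \<in> J \<longleftrightarrow> frag_of (Q u, 1) - frag_of (Q v, 1) \<in> K"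
proof -
  assume uv: "u \<in> fcar (carrier G)" "v \<in> fcar (carrier G)"
  have k: "frag_of (Q u, 1) - frag_of (Q (u - v), 1) - frag_of (Q v, 1) \<in> K"
    using frag_add[of "u - v" v] uv by simp
  show ?thesis
    using K_closed(2)[OF k, of "frag_of (Q (u - v), 1)"] uv
      K_closed(4)[OF _ k, of "frag_of (Q u, 1) - frag_of (Q v, 1)"]
    by (auto simp: J_def algebra_simps)
qed

lemma vec_eq_iff: "u \<in> fcar (carrier G) \<Longrightarrow> v \<in> fcar (carrier G) \<Longrightarrow> vec u = vec v \<longleftrightarrow> u - v \<in> J"
  by (simp add: J_diff_iff vec_def coset_eq)

text \<open>Balancing moves \<open>p\<close> across the tensor sign, where it becomes the scalar
  \<open>word_char \<chi> p\<close>; the constant word with that value becomes the same scalar. The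
  difference of the two relations only involves the first tensor factor. The constants of the
  enveloping algebra of \<open>H\<close> thus also account for complex scalars in the second
  factor.\<close>

lemma J_char: "u \<in> fcar (carrier G) \<Longrightarrow> p \<in> fcar CP \<Longrightarrow> u * (p - scal (word_char \<chi> p)) \<in> J"
proof -
  assume up: "u \<in> fcar (carrier G)" "p \<in> fcar CP"
  have "frag_of (Q (u * p), 1) - frag_of (Q u, word_char \<chi> p)
     - (frag_of (Q (u * scal (word_char \<chi> p)), 1) - frag_of (Q u, word_char \<chi> p)) \<in> K"
    using frag_balance[OF up] frag_balance[OF up(1) fcar_closed(3), of "word_char \<chi> p"]
    by (intro K_closed(4)[of "_ - _" "_ - _"]) simp_all
  then have "u * p - u * scal (word_char \<chi> p) \<in> J"
    using up CP_fcar by (subst J_diff_iff) (auto)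
  then show ?thesis by (simp add: algebra_simps)
qed

text \<open>The universal property of the tensor product: a functional that respects the relations
  and is an eigenvector for right multiplication by the subalgebra descends to the induced module.
  This is the tool for showing that a vector is nonzero.\<close>

lemma J_functional:
  fixes \<phi> :: "('a word \<Rightarrow>\<^sub>0 complex) \<Rightarrow> complex"
  assumes add: "\<And>p q. p \<in> fcar (carrier G) \<Longrightarrow> q \<in> fcar (carrier G) \<Longrightarrow> \<phi> (p + q) = \<phi> p + \<phi> q"
    and I: "\<And>p. p \<in> I \<Longrightarrow> \<phi> p = 0"
    and char: "\<And>u p. u \<in> fcar (carrier G) \<Longrightarrow> p \<in> fcar CP \<Longrightarrow> \<phi> (u * p) = \<phi> u * word_char \<chi> p"
    and u: "u \<in> J"
  shows "\<phi> u = 0"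
proof -
  \<comment> \<open>A function of the coset, through an arbitrary representative; the hypothesis
    \<open>I\<close> makes the choice immaterial.\<close>
  define f where "f X = \<phi> (SOME p. p \<in> fcar (carrier G) \<and> Q p = X)" for X
  have f: "f (Q p) = \<phi> p" if p: "p \<in> fcar (carrier G)" for p
  proof -
    define q where "q = (SOME q. q \<in> fcar (carrier G) \<and> Q q = Q p)"
    have q: "q \<in> fcar (carrier G) \<and> Q q = Q p"
      unfolding q_def by (rule someI[of _ p]) (use p in simp)
    then have "q - p \<in> I" using p Q_eq[of q p] by blast
    then have "\<phi> (q - p) = 0" by (rule I)
    then have "\<phi> q = \<phi> p" using add[of "q - p" p] p q by simp
    then show ?thesis by (simp add: f_def q_def)
  qed
  \<comment> \<open>The additive extension of \<open>(X, z) \<mapsto> z * f X\<close> to the free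
    abelian group.\<close>
  define \<Phi> where "\<Phi> a = (\<Sum>y\<in>Poly_Mapping.keys a. of_int (Poly_Mapping.lookup a y) * (snd y * f (fst y)))" for a
  have \<Phi>_add: "\<Phi> (a + b) = \<Phi> a + \<Phi> b" for a b
    unfolding \<Phi>_def by (rule setsum_keys_plus_distrib) (auto simp: algebra_simps)
  have \<Phi>_of: "\<Phi> (frag_of (X, z)) = z * f X" for X z
    by (simp add: \<Phi>_def keys_frag_of)
  have \<Phi>_diff: "\<Phi> (a - b) = \<Phi> a - \<Phi> b" for a b
    using \<Phi>_add[of "a - b" b] by simp
  have "\<Phi> t = 0" if "t \<in> T" for t
  proof -
    from \<open>t \<in> T\<close> consider
      (1) x y z where "t = frag_of (Q x \<oplus>\<^bsub>env G\<^esub> Q y, z) - frag_of (Q x, z) - frag_of (Q y, z)"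
          "x \<in> fcar (carrier G)" "y \<in> fcar (carrier G)"
      | (2) x z w where "t = frag_of (x, z \<oplus>\<^bsub>complex_algebra\<^esub> w) - frag_of (x, z) - frag_of (x, w)"
      | (3) x r z where "t = frag_of (ra (Q x) (P.Q r), z) - frag_of (Q x, la (P.Q r) z)"
          "x \<in> fcar (carrier G)" "r \<in> fcar CP"
      unfolding T_def env_eq env_H carrier_A P.carrier_A by blast
    then show ?thesis
    proof cases
      case 1
      then show ?thesis unfolding 1(1) \<Phi>_diff \<Phi>_of
        by (simp add: env_eq Q_ops f add algebra_simps)
    next
      case 2
      then show ?thesis unfolding 2 \<Phi>_diff \<Phi>_of by (simp add: algebra_simps)
    next
      case 3
      then show ?thesis using CP_fcar[of r]
        unfolding 3(1) \<Phi>_diff \<Phi>_of by (simp add: ra_Q env_lift_C f char)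
    qed
  qed
  moreover have "frag_of (Q u, 1) \<in> K" using u by (simp add: J_def)
  ultimately have "\<Phi> (frag_of (Q u, 1)) \<in> {0}"
    by - (rule K_kill[where \<psi> = \<Phi>, OF \<Phi>_add], simp_all)
  then show ?thesis unfolding \<Phi>_of f[OF J_sub[OF u]] by simp
qed

end

section \<open>Determinants with entries commuting modulo an ideal\<close>

abbreviation br :: "'r::ring_1 \<Rightarrow> 'r \<Rightarrow> 'r" where "br x y \<equiv> x * y - y * x"

abbreviation upd :: "('i \<Rightarrow> 'r) \<Rightarrow> 'i \<Rightarrow> 'r \<Rightarrow> 'i \<Rightarrow> 'r" where
  "upd y i z \<equiv> (\<lambda>k. if k = i then z else y k)"

lemma prod_list_upd_notin: "i \<notin> set xs \<Longrightarrow> prod_list (map (upd y i (z)) xs) = prod_list (map y xs)"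
  by (induction xs) auto

text \<open>The Leibniz rule for the derivation \<open>br x\<close>. Distinctness of the list allows
  a position to be named by the element that stands there.\<close>

lemma br_prod_list: "distinct xs \<Longrightarrow> br x (prod_list (map y xs)) =
    (\<Sum>i\<in>set xs. prod_list (map (upd y i (br x (y i))) xs))"
proof (induction xs)
  case (Cons a xs)
  have "(\<Sum>i\<in>set xs. prod_list (map (upd y i (br x (y i))) (a # xs)))
      = (\<Sum>i\<in>set xs. y a * prod_list (map (upd y i (br x (y i))) xs))"
    using Cons.prems by (intro sum.cong) auto
  also have "\<dots> = y a * br x (prod_list (map y xs))"
    using Cons.IH Cons.prems by (simp add: sum_distrib_left)
  finally show ?case
    using Cons.prems by (simp add: prod_list_upd_notin algebra_simps)
qed simp

lemma br_prod_list_left: "distinct xs \<Longrightarrow> br (prod_list (map y xs)) x =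
    (\<Sum>i\<in>set xs. prod_list (map (upd y i (br (y i) x)) xs))"
proof (induction xs)
  case (Cons a xs)
  have "(\<Sum>i\<in>set xs. prod_list (map (upd y i (br (y i) x)) (a # xs)))
      = (\<Sum>i\<in>set xs. y a * prod_list (map (upd y i (br (y i) x)) xs))"
    using Cons.prems by (intro sum.cong) auto
  also have "\<dots> = y a * br (prod_list (map y xs)) x"
    using Cons.IH Cons.prems by (simp add: sum_distrib_left)
  finally show ?case
    using Cons.prems by (simp add: prod_list_upd_notin algebra_simps)
qed simp

lemma br_sum_right: "br x (sum f A) = (\<Sum>a\<in>A. br x (f a))"
  by (simp add: sum_distrib_left sum_distrib_right sum_subtractf)

lemma br_sum_left: "br (sum f A) x = (\<Sum>a\<in>A. br (f a) x)"
  by (simp add: sum_distrib_left sum_distrib_right sum_subtractf)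

lemma br_of_int_mult: "br x (of_int k * y) = of_int k * br x y" "br (of_int k * y) x = of_int k * br y x"
proof -
  have "x * (of_int k * y) = of_int k * (x * y)" by (metis mult.assoc mult_of_int_commute)
  then show "br x (of_int k * y) = of_int k * br x y" by (simp add: right_diff_distrib mult.assoc)
  have "y * (of_int k * x) = of_int k * (y * x)" by (metis mult.assoc mult_of_int_commute)
  then show "br (of_int k * y) x = of_int k * br y x"
    using \<open>x * (of_int k * y) = of_int k * (x * y)\<close> by (simp add: right_diff_distrib mult.assoc)
qed

lemma set_upt1: "set [1..<Suc m] = {1..m}" by auto

definition pdet :: "nat \<Rightarrow> (nat \<Rightarrow> nat \<Rightarrow> 'r::ring_1) \<Rightarrow> 'r" where
  "pdet m y = (\<Sum>\<sigma>\<in>{\<sigma>. \<sigma> permutes {1..m}}. of_int (sign \<sigma>) * prod_list (map (\<lambda>i. y i (\<sigma> i)) [1..<Suc m]))"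

text \<open>Congruence modulo a two-sided ideal of a type class ring takes the place of equality in
  the quotient.\<close>

locale ring_ideal =
  fixes I :: "'r::ring_1 set"
  assumes I_zero: "0 \<in> I" and I_add: "a \<in> I \<Longrightarrow> b \<in> I \<Longrightarrow> a + b \<in> I"
    and I_left: "b \<in> I \<Longrightarrow> a * b \<in> I" and I_right: "a \<in> I \<Longrightarrow> a * b \<in> I"
begin

definition cg :: "'r \<Rightarrow> 'r \<Rightarrow> bool" (infix "\<doteq>" 50) where "a \<doteq> b \<longleftrightarrow> a - b \<in> I"

lemma I_uminus: "a \<in> I \<Longrightarrow> - a \<in> I"
  using I_left[of a "-1"] by simp

lemma cg_refl [simp, intro]: "a \<doteq> a" by (simp add: cg_def I_zero)

lemma cg_sym: "a \<doteq> b \<Longrightarrow> b \<doteq> a"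
  using I_uminus[of "a - b"] by (simp add: cg_def)

lemma cg_trans [trans]: "a \<doteq> b \<Longrightarrow> b \<doteq> c \<Longrightarrow> a \<doteq> c"
  using I_add[of "a - b" "b - c"] by (simp add: cg_def)

lemma cg_eq_trans [trans]: "a \<doteq> b \<Longrightarrow> b = c \<Longrightarrow> a \<doteq> c" "a = b \<Longrightarrow> b \<doteq> c \<Longrightarrow> a \<doteq> c"
  by simp_all

lemma cg_add: "a \<doteq> b \<Longrightarrow> c \<doteq> d \<Longrightarrow> a + c \<doteq> b + d"
  using I_add[of "a - b" "c - d"] by (simp add: cg_def algebra_simps)

lemma cg_uminus: "a \<doteq> b \<Longrightarrow> - a \<doteq> - b"
  using I_uminus[of "a - b"] by (simp add: cg_def)

lemma cg_diff: "a \<doteq> b \<Longrightarrow> c \<doteq> d \<Longrightarrow> a - c \<doteq> b - d"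
  using cg_add[OF _ cg_uminus] by simp

lemma cg_mult: "a \<doteq> b \<Longrightarrow> c \<doteq> d \<Longrightarrow> a * c \<doteq> b * d"
  using I_add[OF I_right[of "a - b" c] I_left[of "c - d" b]] by (simp add: cg_def algebra_simps)

lemma cg_sum: "(\<And>i. i \<in> A \<Longrightarrow> f i \<doteq> g i) \<Longrightarrow> sum f A \<doteq> sum g A"
  by (induction A rule: infinite_finite_induct) (auto intro: cg_add)

lemma cg_prod_list: "(\<And>i. i \<in> set xs \<Longrightarrow> f i \<doteq> g i) \<Longrightarrow> prod_list (map f xs) \<doteq> prod_list (map g xs)"
  by (induction xs) (auto intro: cg_mult)

lemma cg_prod_list_commute: "(\<And>y. y \<in> set ys \<Longrightarrow> x * y \<doteq> y * x) \<Longrightarrow> x * prod_list ys \<doteq> prod_list ys * x"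
proof (induction ys)
  case (Cons y ys)
  have "x * (y * prod_list ys) = (x * y) * prod_list ys" by (simp add: mult.assoc)
  also have "\<dots> \<doteq> y * (x * prod_list ys)"
    using cg_mult[OF Cons.prems[of y] cg_refl[of "prod_list ys"]] by (simp add: mult.assoc)
  also have "\<dots> \<doteq> y * (prod_list ys * x)" using Cons by (intro cg_mult[OF cg_refl]) auto
  finally show ?case by (simp add: mult.assoc)
qed simp

lemma cg_prod_list_perm:
  "(\<And>x y. x \<in> set xs \<Longrightarrow> y \<in> set xs \<Longrightarrow> x * y \<doteq> y * x) \<Longrightarrow> mset xs = mset ys \<Longrightarrow>
    prod_list xs \<doteq> prod_list ys"
proof (induction xs arbitrary: ys)
  case (Cons x xs)
  have "x \<in> set ys" using Cons.prems(2) by (metis list.set_intros(1) set_mset_mset)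
  then obtain us vs where ys: "ys = us @ x # vs" by (meson split_list)
  have m: "mset xs = mset (us @ vs)" using Cons.prems(2) by (simp add: ys)
  then have s: "set xs = set (us @ vs)" by (metis set_mset_mset)
  have "x * prod_list xs \<doteq> x * prod_list (us @ vs)"
    using Cons.IH[OF _ m] Cons.prems(1) by (intro cg_mult) auto
  also have "\<dots> = (x * prod_list us) * prod_list vs" by (simp add: mult.assoc)
  also have "\<dots> \<doteq> (prod_list us * x) * prod_list vs"
    using s by (intro cg_mult cg_prod_list_commute Cons.prems(1)) auto
  finally show ?case by (simp add: ys mult.assoc)
qed simp

text \<open>The sign-reversing involution \<open>h\<close> matches even permutations with odd ones
  and the matched terms cancel. Splitting by parity avoids a division by 2, which a general ring
  does not allow.\<close>

lemma cg_sum_sign_zero: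
  assumes h: "\<And>\<sigma>. \<sigma> permutes {1..m::nat} \<Longrightarrow> h \<sigma> permutes {1..m} \<and> h (h \<sigma>) = \<sigma> \<and> sign (h \<sigma>) = - sign \<sigma>"
    and f: "\<And>\<sigma>. \<sigma> permutes {1..m} \<Longrightarrow> f (h \<sigma>) \<doteq> f \<sigma>"
  shows "(\<Sum>\<sigma>\<in>{\<sigma>. \<sigma> permutes {1..m}}. of_int (sign \<sigma>) * f \<sigma>) \<doteq> 0"
proof -
  define E where "E = {\<sigma>. \<sigma> permutes {1..m} \<and> sign \<sigma> = 1}"
  define O' where "O' = {\<sigma>. \<sigma> permutes {1..m} \<and> sign \<sigma> = -1}"
  have fin: "finite E" "finite O'"
    using finite_permutations[of "{1..m}"] by (auto simp: E_def O'_def)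
  have un: "{\<sigma>. \<sigma> permutes {1..m}} = E \<union> O'"
    by (auto simp: E_def O'_def sign_def)
  have disj: "E \<inter> O' = {}" by (auto simp: E_def O'_def)
  have O': "(\<Sum>\<sigma>\<in>O'. of_int (sign \<sigma>) * f \<sigma>) = (\<Sum>\<sigma>\<in>E. of_int (sign (h \<sigma>)) * f (h \<sigma>))"
    by (rule sum.reindex_bij_witness[where i = h and j = h]) (use h in \<open>auto simp: E_def O'_def\<close>)
  have "(\<Sum>\<sigma>\<in>{\<sigma>. \<sigma> permutes {1..m}}. of_int (sign \<sigma>) * f \<sigma>)
      = (\<Sum>\<sigma>\<in>E. of_int (sign \<sigma>) * f \<sigma> + of_int (sign (h \<sigma>)) * f (h \<sigma>))"
    unfolding un using fin disj by (simp add: sum.union_disjoint O' sum.distrib)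
  also have "\<dots> \<doteq> (\<Sum>\<sigma>\<in>E. 0)"
  proof (rule cg_sum)
    fix \<sigma> assume "\<sigma> \<in> E"
    then have s: "\<sigma> permutes {1..m}" "sign \<sigma> = 1" by (auto simp: E_def)
    show "of_int (sign \<sigma>) * f \<sigma> + of_int (sign (h \<sigma>)) * f (h \<sigma>) \<doteq> 0"
      using cg_diff[OF cg_refl[of "f \<sigma>"] f[OF s(1)]] h[OF s(1)] s by simp
  qed
  finally show ?thesis by simp
qed

text \<open>Composing with the transposition on the left changes column indices only and keeps the
  factors in the order of their rows, so that matched terms are literally equal.\<close>

lemma pdet_equal_cols:
  assumes pq: "p \<in> {1..m}" "q \<in> {1..m}" "p \<noteq> q" and c: "\<And>i. i \<in> {1..m} \<Longrightarrow> y i p = y i q"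
  shows "pdet m y \<doteq> 0"
  unfolding pdet_def
proof (rule cg_sum_sign_zero[where h = "\<lambda>\<sigma>. Transposition.transpose p q \<circ> \<sigma>"])
  fix \<sigma> assume s: "\<sigma> permutes {1..m}"
  have t: "Transposition.transpose p q permutes {1..m}" using pq by (intro permutes_swap_id) auto
  show "(Transposition.transpose p q \<circ> \<sigma>) permutes {1..m} \<and>
      Transposition.transpose p q \<circ> (Transposition.transpose p q \<circ> \<sigma>) = \<sigma> \<and>
      sign (Transposition.transpose p q \<circ> \<sigma>) = - sign \<sigma>"
    using pq permutes_compose[OF s t] sign_compose[OF permutation_swap_id permutes_imp_permutation[OF _ s], of p q]
    by (auto simp: sign_swap_id comp_assoc[symmetric])
  have "y i ((Transposition.transpose p q \<circ> \<sigma>) i) = y i (\<sigma> i)" if "i \<in> {1..m}" for i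
    using c[OF that] by (auto simp: Transposition.transpose_def)
  then have "map (\<lambda>i. y i ((Transposition.transpose p q \<circ> \<sigma>) i)) [1..<Suc m] = map (\<lambda>i. y i (\<sigma> i)) [1..<Suc m]"
    by (intro map_cong) auto
  then show "prod_list (map (\<lambda>i. y i ((Transposition.transpose p q \<circ> \<sigma>) i)) [1..<Suc m])
      \<doteq> prod_list (map (\<lambda>i. y i (\<sigma> i)) [1..<Suc m])" by (simp only: cg_refl)
qed

text \<open>Composing with the transposition on the right permutes the row-ordered factors, so
  matched terms agree only after reordering. This is where commutation modulo the ideal
  enters.\<close>

lemma pdet_equal_rows:
  assumes pq: "p \<in> {1..m}" "q \<in> {1..m}" "p \<noteq> q" and c: "\<And>j. j \<in> {1..m} \<Longrightarrow> y p j = y q j"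
    and comm: "\<And>i j i' j'. i \<in> {1..m} \<Longrightarrow> j \<in> {1..m} \<Longrightarrow> i' \<in> {1..m} \<Longrightarrow> j' \<in> {1..m} \<Longrightarrow>
       y i j * y i' j' \<doteq> y i' j' * y i j"
  shows "pdet m y \<doteq> 0"
  unfolding pdet_def
proof (rule cg_sum_sign_zero[where h = "\<lambda>\<sigma>. \<sigma> \<circ> Transposition.transpose p q"])
  fix \<sigma> assume s: "\<sigma> permutes {1..m}"
  let ?t = "Transposition.transpose p q"
  have t: "?t permutes {1..m}" using pq by (intro permutes_swap_id) auto
  show "(\<sigma> \<circ> ?t) permutes {1..m} \<and> \<sigma> \<circ> ?t \<circ> ?t = \<sigma> \<and> sign (\<sigma> \<circ> ?t) = - sign \<sigma>"
    using pq permutes_compose[OF t s] sign_compose[OF permutes_imp_permutation[OF _ s] permutation_swap_id, of p q]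
    by (auto simp: sign_swap_id comp_assoc)
  have eq: "y i ((\<sigma> \<circ> ?t) i) = y (?t i) (\<sigma> (?t i))" if "i \<in> {1..m}" for i
    using c permutes_in_image[OF s] pq that by (auto simp: Transposition.transpose_def)
  then have "map (\<lambda>i. y i ((\<sigma> \<circ> ?t) i)) [1..<Suc m] = map (\<lambda>i. y i (\<sigma> i)) (map ?t [1..<Suc m])"
    by (auto simp del: upt_Suc)
  moreover have "prod_list (map (\<lambda>i. y i (\<sigma> i)) (map ?t [1..<Suc m])) \<doteq> prod_list (map (\<lambda>i. y i (\<sigma> i)) [1..<Suc m])"
  proof (rule cg_prod_list_perm)
    have "mset (map ?t [1..<Suc m]) = mset [1..<Suc m]"
    proof -
      have "mset (map ?t [1..<Suc m]) = image_mset ?t (mset_set {1..m})"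
        by (metis atLeastLessThanSuc_atLeastAtMost mset_map mset_upt)
      also have "\<dots> = mset_set (?t ` {1..m})"
        using permutes_inj_on[OF t] by (rule image_mset_mset_set)
      also have "\<dots> = mset [1..<Suc m]"
        using permutes_image[OF t] by (metis atLeastLessThanSuc_atLeastAtMost mset_upt)
      finally show ?thesis .
    qed
    then show "mset (map (\<lambda>i. y i (\<sigma> i)) (map ?t [1..<Suc m])) = mset (map (\<lambda>i. y i (\<sigma> i)) [1..<Suc m])"
      by (metis mset_map)
  next
    fix a b
    assume ab: "a \<in> set (map (\<lambda>i. y i (\<sigma> i)) (map ?t [1..<Suc m]))" "b \<in> set (map (\<lambda>i. y i (\<sigma> i)) (map ?t [1..<Suc m]))"
    have "set (map ?t [1..<Suc m]) = {1..m}" using permutes_image[OF t]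
      by (simp add: atLeastLessThanSuc_atLeastAtMost del: upt_Suc)
    then obtain i i' where "i \<in> {1..m}" "i' \<in> {1..m}" "a = y i (\<sigma> i)" "b = y i' (\<sigma> i')"
      using ab unfolding list.set_map[of _ "map ?t [1..<Suc m]"] by blast
    then show "a * b \<doteq> b * a" using comm permutes_in_image[OF s] by blast
  qed
  ultimately show "prod_list (map (\<lambda>i. y i ((\<sigma> \<circ> ?t) i)) [1..<Suc m])
      \<doteq> prod_list (map (\<lambda>i. y i (\<sigma> i)) [1..<Suc m])" by (simp only:)
qed

lemma br_cg: "a \<doteq> b \<Longrightarrow> c \<doteq> d \<Longrightarrow> br a c \<doteq> br b d"
  by (intro cg_diff cg_mult)

lemma br_zero_iff: "br a b \<doteq> 0 \<longleftrightarrow> a * b \<doteq> b * a"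
  by (simp add: cg_def)

lemma br_zeroD: "br a b \<doteq> 0 \<Longrightarrow> a * b \<doteq> b * a" "br a b \<doteq> 0 \<Longrightarrow> b * a \<doteq> a * b"
    "br a b \<doteq> 0 \<Longrightarrow> br b a \<doteq> 0"
  using I_uminus[of "a * b - b * a"] by (simp_all add: cg_def)

lemma br_prod_list_cg:
  assumes "distinct xs" "\<And>i. i \<in> set xs \<Longrightarrow> br x (y i) \<doteq> z i"
  shows "br x (prod_list (map y xs)) \<doteq> (\<Sum>i\<in>set xs. prod_list (map (upd y i (z i)) xs))"
  unfolding br_prod_list[OF assms(1)]
  by (intro cg_sum cg_prod_list) (auto simp: assms)

lemma br_prod_list_zero:
  assumes "\<And>i. i \<in> set xs \<Longrightarrow> br x (y i) \<doteq> 0"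
  shows "br x (prod_list (map y xs)) \<doteq> 0"
  unfolding br_zero_iff by (rule cg_prod_list_commute) (use assms br_zero_iff in auto)

lemma prod_list_zero_entry: "i \<in> set xs \<Longrightarrow> y i = 0 \<Longrightarrow> prod_list (map y xs) = (0::'r)"
  by (induction xs) auto

text \<open>Each product in the Leibniz formula has exactly one factor from row \<open>q\<close>,
  and the derivation changes no other factor.\<close>

lemma br_pdet_row:
  assumes q: "q \<in> {1..m}"
    and x: "\<And>i j. i \<in> {1..m} \<Longrightarrow> j \<in> {1..m} \<Longrightarrow> br x (e i j) \<doteq> (if i = q then z j else 0)"
  shows "br x (pdet m e) \<doteq> pdet m (e(q := z))"
  unfolding pdet_def br_sum_right br_of_int_mult
proof (intro cg_sum cg_mult cg_refl)
  fix \<sigma> assume "\<sigma> \<in> {\<sigma>. \<sigma> permutes {1..m}}"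
  then have s: "\<sigma> permutes {1..m}" by simp
  have set: "set [1..<Suc m] = {1..m}" by auto
  have "br x (prod_list (map (\<lambda>i. e i (\<sigma> i)) [1..<Suc m]))
     \<doteq> (\<Sum>i\<in>set [1..<Suc m]. prod_list (map (upd (\<lambda>i. e i (\<sigma> i)) i (if i = q then z (\<sigma> i) else 0)) [1..<Suc m]))"
  proof (rule br_prod_list_cg)
    show "br x (e i (\<sigma> i)) \<doteq> (if i = q then z (\<sigma> i) else 0)" if "i \<in> set [1..<Suc m]" for i
      using that x permutes_in_image[OF s] unfolding set by blast
  qed simp
  also have "\<dots> = (\<Sum>i\<in>{1..m}. if i = q then prod_list (map (\<lambda>i. (e(q := z)) i (\<sigma> i)) [1..<Suc m]) else 0)"
    unfolding set
  proof (rule sum.cong[OF refl])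
    fix i assume "i \<in> {1..m}"
    then show "prod_list (map (upd (\<lambda>i. e i (\<sigma> i)) i (if i = q then z (\<sigma> i) else 0)) [1..<Suc m])
      = (if i = q then prod_list (map (\<lambda>i. (e(q := z)) i (\<sigma> i)) [1..<Suc m]) else 0)"
      by (auto simp: fun_upd_def simp del: upt_Suc intro!: prod_list_zero_entry[of i] arg_cong[of _ _ prod_list])
  qed
  also have "\<dots> = prod_list (map (\<lambda>i. (e(q := z)) i (\<sigma> i)) [1..<Suc m])" using q by simp
  finally show "br x (prod_list (map (\<lambda>i. e i (\<sigma> i)) [1..<Suc m])) \<doteq> \<dots>" .
qed

text \<open>Injectivity of \<open>\<sigma>\<close> leaves exactly one factor in column
  \<open>j0\<close>. The list of rows is arbitrary because the rule is applied to full products and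
  to products over the rows from 2 on.\<close>

lemma br_prod_col:
  assumes \<sigma>: "inj_on \<sigma> (set xs)" and xs: "distinct xs" and j0: "j0 \<in> \<sigma> ` set xs"
    and x: "\<And>i. i \<in> set xs \<Longrightarrow> br x (e i (\<sigma> i)) \<doteq> (if \<sigma> i = j0 then z i else 0)"
  shows "br x (prod_list (map (\<lambda>i. e i (\<sigma> i)) xs)) \<doteq> prod_list (map (\<lambda>i. if \<sigma> i = j0 then z i else e i (\<sigma> i)) xs)"
proof -
  obtain i0 where i0: "i0 \<in> set xs" "\<sigma> i0 = j0" using j0 by auto
  have u: "\<sigma> i = j0 \<longleftrightarrow> i = i0" if "i \<in> set xs" for i
    using \<sigma> i0 that by (auto dest: inj_onD)
  have "br x (prod_list (map (\<lambda>i. e i (\<sigma> i)) xs))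
     \<doteq> (\<Sum>i\<in>set xs. prod_list (map (upd (\<lambda>i. e i (\<sigma> i)) i (if \<sigma> i = j0 then z i else 0)) xs))"
    by (rule br_prod_list_cg) (use x xs in auto)
  also have "\<dots> = (\<Sum>i\<in>set xs. if i = i0 then prod_list (map (\<lambda>i. if \<sigma> i = j0 then z i else e i (\<sigma> i)) xs) else 0)"
  proof (rule sum.cong[OF refl])
    fix i assume i: "i \<in> set xs"
    show "prod_list (map (upd (\<lambda>i. e i (\<sigma> i)) i (if \<sigma> i = j0 then z i else 0)) xs)
      = (if i = i0 then prod_list (map (\<lambda>i. if \<sigma> i = j0 then z i else e i (\<sigma> i)) xs) else 0)"
      using u i by (auto intro!: prod_list_zero_entry[of i] arg_cong[of _ _ prod_list])
  qed
  also have "\<dots> = prod_list (map (\<lambda>i. if \<sigma> i = j0 then z i else e i (\<sigma> i)) xs)" using i0 by simp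
  finally show ?thesis .
qed

lemma br_pdet_col:
  assumes p: "p \<in> {1..m}"
    and x: "\<And>i j. i \<in> {1..m} \<Longrightarrow> j \<in> {1..m} \<Longrightarrow> br x (e i j) \<doteq> (if j = p then z i else 0)"
  shows "br x (pdet m e) \<doteq> pdet m (\<lambda>i j. if j = p then z i else e i j)"
  unfolding pdet_def br_sum_right br_of_int_mult
proof (intro cg_sum cg_mult cg_refl)
  fix \<sigma> assume "\<sigma> \<in> {\<sigma>. \<sigma> permutes {1..m}}"
  then have s: "\<sigma> permutes {1..m}" by simp
  have set: "set [1..<Suc m] = {1..m}" by auto
  show "br x (prod_list (map (\<lambda>i. e i (\<sigma> i)) [1..<Suc m]))
     \<doteq> prod_list (map (\<lambda>i. if \<sigma> i = p then z i else e i (\<sigma> i)) [1..<Suc m])"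
    using x permutes_in_image[OF s] permutes_image[OF s] p permutes_inj_on[OF s]
    by (intro br_prod_col distinct_upt) (simp_all only: set)
qed

text \<open>Every product takes one entry from each row and each column, so all products have the
  same weight, the sum of all \<open>a i\<close> and \<open>b j\<close>. Centrality of the weights
  lets them be collected in front.\<close>

lemma br_pdet_diag:
  assumes x: "\<And>i j. i \<in> {1..m} \<Longrightarrow> j \<in> {1..m} \<Longrightarrow> br x (e i j) \<doteq> (a i + b j) * e i j"
    and ab: "\<And>i u. u * a i = a i * u" "\<And>j u. u * b j = b j * u"
  shows "br x (pdet m e) \<doteq> ((\<Sum>i\<in>{1..m}. a i) + (\<Sum>j\<in>{1..m}. b j)) * pdet m e"
  unfolding pdet_def br_sum_right br_of_int_mult sum_distrib_left[of "_ + _"]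
proof (intro cg_sum)
  fix \<sigma> assume "\<sigma> \<in> {\<sigma>. \<sigma> permutes {1..m}}"
  then have s: "\<sigma> permutes {1..m}" by simp
  let ?P = "prod_list (map (\<lambda>i. e i (\<sigma> i)) [1..<Suc m])"
  let ?c = "\<lambda>i. a i + b (\<sigma> i)"
  have set: "set [1..<Suc m] = {1..m}" by auto
  have c: "prod_list (map (upd y i (?c i * y i)) xs) = ?c i * prod_list (map y xs)"
    if "distinct xs" "i \<in> set xs" for xs i and y :: "nat \<Rightarrow> 'r"
    using that
  proof (induction xs)
    case (Cons k xs)
    have comm: "u * ?c i = ?c i * u" for u by (simp only: distrib_left distrib_right ab)
    show ?case
    proof (cases "k = i")
      case True
      then have "map (upd y i (?c i * y i)) xs = map y xs" using Cons.prems by auto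
      then show ?thesis
        unfolding True by (simp only: list.map prod_list.Cons mult.assoc simp_thms if_True)
    next
      case False
      then have "prod_list (map (upd y i (?c i * y i)) (k # xs)) = y k * (?c i * prod_list (map y xs))"
        using Cons by simp
      also have "\<dots> = ?c i * (y k * prod_list (map y xs))"
        using comm[of "y k"] by (simp flip: mult.assoc)
      finally show ?thesis by simp
    qed
  qed simp
  have "br x ?P \<doteq> (\<Sum>i\<in>set [1..<Suc m]. prod_list (map (upd (\<lambda>i. e i (\<sigma> i)) i (?c i * e i (\<sigma> i))) [1..<Suc m]))"
  proof (rule br_prod_list_cg)
    show "br x (e i (\<sigma> i)) \<doteq> ?c i * e i (\<sigma> i)" if "i \<in> set [1..<Suc m]" for i
      using that x permutes_in_image[OF s] unfolding set by blast
  qed simp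
  also have "\<dots> = (\<Sum>i\<in>{1..m}. ?c i * ?P)"
    unfolding set by (intro sum.cong refl c[where y = "\<lambda>i. e i (\<sigma> i)"]) (auto simp del: upt_Suc)
  also have "\<dots> = ((\<Sum>i\<in>{1..m}. a i) + (\<Sum>j\<in>{1..m}. b j)) * ?P"
    using sum.permute[OF s, of b] by (simp add: sum.distrib comp_def flip: sum_distrib_right)
  finally have "of_int (sign \<sigma>) * br x ?P \<doteq> of_int (sign \<sigma>) * (((\<Sum>i\<in>{1..m}. a i) + (\<Sum>j\<in>{1..m}. b j)) * ?P)"
    by (intro cg_mult) auto
  also have "\<dots> = ((\<Sum>i\<in>{1..m}. a i) + (\<Sum>j\<in>{1..m}. b j)) * (of_int (sign \<sigma>) * ?P)"
    by (metis mult.assoc mult_of_int_commute)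
  finally show "of_int (sign \<sigma>) * br x ?P \<doteq> \<dots>" .
qed

end

text \<open>\<open>J\<close> models the annihilator of a cyclic vector. Congruence modulo
  \<open>J\<close> is preserved by multiplication from the left only, so an operator has to be moved
  to the right end of a product before its action on the vector can be used.\<close>

locale module_ideal = ring_ideal I for I :: "'r::ring_1 set" +
  fixes J :: "'r set"
  assumes J_add: "a \<in> J \<Longrightarrow> b \<in> J \<Longrightarrow> a + b \<in> J" and J_left: "b \<in> J \<Longrightarrow> a * b \<in> J"
    and I_J: "I \<subseteq> J"
begin

definition cj :: "'r \<Rightarrow> 'r \<Rightarrow> bool" (infix "\<leadsto>" 50) where "a \<leadsto> b \<longleftrightarrow> a - b \<in> J"

lemma J_zero: "0 \<in> J" using I_J I_zero by blast

lemma J_uminus: "a \<in> J \<Longrightarrow> - a \<in> J"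
  using J_left[of a "-1"] by simp

lemma cj_refl [simp, intro]: "a \<leadsto> a" by (simp add: cj_def J_zero)

lemma cj_trans [trans]: "a \<leadsto> b \<Longrightarrow> b \<leadsto> c \<Longrightarrow> a \<leadsto> c"
  using J_add[of "a - b" "b - c"] by (simp add: cj_def)

lemma cg_cj: "a \<doteq> b \<Longrightarrow> a \<leadsto> b"
  using I_J by (auto simp: cg_def cj_def)

lemma cg_cj_trans [trans]: "a \<doteq> b \<Longrightarrow> b \<leadsto> c \<Longrightarrow> a \<leadsto> c" "a \<leadsto> b \<Longrightarrow> b \<doteq> c \<Longrightarrow> a \<leadsto> c"
  using cg_cj cj_trans by blast+

lemma cj_eq_trans [trans]: "a \<leadsto> b \<Longrightarrow> b = c \<Longrightarrow> a \<leadsto> c" "a = b \<Longrightarrow> b \<leadsto> c \<Longrightarrow> a \<leadsto> c"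
  by simp_all

lemma cj_add: "a \<leadsto> b \<Longrightarrow> c \<leadsto> d \<Longrightarrow> a + c \<leadsto> b + d"
  using J_add[of "a - b" "c - d"] by (simp add: cj_def algebra_simps)

lemma cj_uminus: "a \<leadsto> b \<Longrightarrow> - a \<leadsto> - b"
  using J_uminus[of "a - b"] by (simp add: cj_def)

lemma cj_diff: "a \<leadsto> b \<Longrightarrow> c \<leadsto> d \<Longrightarrow> a - c \<leadsto> b - d"
  using cj_add[OF _ cj_uminus] by simp

lemma cj_left: "a \<leadsto> b \<Longrightarrow> c * a \<leadsto> c * b"
  using J_left[of "a - b" c] by (simp add: cj_def algebra_simps)

lemma cj_sum: "(\<And>i. i \<in> A \<Longrightarrow> f i \<leadsto> g i) \<Longrightarrow> sum f A \<leadsto> sum g A"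
  by (induction A rule: infinite_finite_induct) (auto intro: cj_add)

lemma cj_zero_iff: "a \<leadsto> 0 \<longleftrightarrow> a \<in> J" by (simp add: cj_def)

text \<open>\<open>s\<close> is the weight of \<open>D\<close> and \<open>t\<close> that of the
  cyclic vector; passing one factor \<open>D\<close> adds \<open>s\<close>. With
  \<open>s = t = 0\<close> it says that an operator commuting with \<open>D\<close> and killing the
  cyclic vector also kills \<open>D ^ n\<close>.\<close>

lemma cj_power_weight:
  assumes D: "br x D \<doteq> s * D" and s: "\<And>u. u * s = s * u" and t: "\<And>u. u * t = t * u" and x: "x \<leadsto> t"
  shows "x * D ^ n \<leadsto> (t + of_nat n * s) * D ^ n"
proof (induction n)
  case (Suc n)
  have "x * D ^ Suc n = br x D * D ^ n + D * (x * D ^ n)"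
    by (simp add: algebra_simps)
  also have "\<dots> \<leadsto> s * D * D ^ n + D * ((t + of_nat n * s) * D ^ n)"
    by (intro cj_add cj_left Suc.IH cg_cj cg_mult D cg_refl)
  also have "\<dots> = (t + of_nat (Suc n) * s) * D ^ Suc n"
    using t[of D] s[of D] by (simp add: distrib_right distrib_left mult.assoc)
      (metis (no_types, lifting) mult.assoc mult_of_nat_commute add.commute add.left_commute)
  finally show ?case .
qed (simp add: x)

lemma cj_prod_zero:
  assumes "\<And>i. i \<in> set xs \<Longrightarrow> br x (y i) \<doteq> 0" and x: "x \<in> J"
  shows "x * prod_list (map y xs) \<leadsto> 0"
proof -
  have "x * prod_list (map y xs) \<doteq> prod_list (map y xs) * x"
    using br_prod_list_zero[OF assms(1)] by (simp add: br_zero_iff)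
  also have "\<dots> \<leadsto> prod_list (map y xs) * 0" by (rule cj_left) (simp add: cj_zero_iff x)
  finally show ?thesis by simp
qed

end

text \<open>\<open>f\<close> plays the role of the lowest root vector times $t$, and \<open>H\<close>, \<open>Y j\<close>, \<open>X i\<close> are its brackets
  with the entries of the first row and column of the matrix \<open>e\<close>.\<close>

locale lowering = module_ideal I J for I J :: "'r::ring_1 set" +
  fixes m :: nat and e :: "nat \<Rightarrow> nat \<Rightarrow> 'r" and f H :: 'r and X Y :: "nat \<Rightarrow> 'r" and \<kappa> :: int
  assumes m: "1 \<le> m"
    and comm: "i \<in> {1..m} \<Longrightarrow> j \<in> {1..m} \<Longrightarrow> p \<in> {1..m} \<Longrightarrow> s \<in> {1..m} \<Longrightarrow> e i j * e p s \<doteq> e p s * e i j"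
    and f_e: "i \<in> {1..m} \<Longrightarrow> j \<in> {1..m} \<Longrightarrow> br f (e i j) \<doteq>
        (if i = 1 \<and> j = 1 then H else if i = 1 then - Y j else if j = 1 then X i else 0)"
    and H_e: "p \<in> {1..m} \<Longrightarrow> s \<in> {1..m} \<Longrightarrow> br H (e p s) \<doteq>
        ((if p = 1 then - 1 else 0) + (if s = 1 then - 1 else 0)) * e p s"
    and Y_e: "j \<in> {2..m} \<Longrightarrow> p \<in> {1..m} \<Longrightarrow> s \<in> {1..m} \<Longrightarrow> br (Y j) (e p s) \<doteq> (if s = 1 then e p j else 0)"
    and X_e: "i \<in> {2..m} \<Longrightarrow> p \<in> {1..m} \<Longrightarrow> s \<in> {1..m} \<Longrightarrow> br (X i) (e p s) \<doteq> (if p = 1 then - e i s else 0)"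
    and f_J: "f \<in> J" and X_J: "i \<in> {2..m} \<Longrightarrow> X i \<in> J" and Y_J: "j \<in> {2..m} \<Longrightarrow> Y j \<in> J"
    and H_J: "H \<leadsto> of_int \<kappa>"
begin

definition "G i j = (if i = 1 \<and> j = 1 then H else if i = 1 then - Y j else if j = 1 then X i else 0)"

definition "D = pdet m e"

definition "P \<sigma> = prod_list (map (\<lambda>i. e i (\<sigma> i)) [2..<Suc m])"

definition "C = (\<Sum>\<sigma>\<in>{\<sigma>. \<sigma> permutes {1..m} \<and> \<sigma> 1 = 1}. of_int (sign \<sigma>) * P \<sigma>)"

lemma upt_split: "[1..<Suc m] = 1 # [2..<Suc m]"
  using m by (metis Suc_1 less_Suc_eq_le upt_conv_Cons One_nat_def)

lemma set_upt2: "set [2..<Suc m] = {2..m}" by auto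

text \<open>\<open>H\<close> has weight -1 on the first row and on the first column, which gives -2
  on \<open>D\<close>. \<open>Y j\<close> overwrites the first column by column \<open>j\<close>,
  and \<open>X i\<close> the first row by minus row \<open>i\<close>, so both produce a determinant
  with two proportional lines.\<close>

lemma G_D: "i \<in> {1..m} \<Longrightarrow> j \<in> {1..m} \<Longrightarrow> br (G i j) D \<doteq> (if i = 1 \<and> j = 1 then - 2 * D else 0)"
proof -
  assume i: "i \<in> {1..m}" and j: "j \<in> {1..m}"
  consider "i = 1" "j = 1" | "i = 1" "j \<noteq> 1" | "i \<noteq> 1" "j = 1" | "i \<noteq> 1" "j \<noteq> 1" by blast
  then show ?thesis
  proof cases
    case 1
    have "br H D \<doteq> ((\<Sum>i\<in>{1..m}. if i = 1 then - 1 else 0) + (\<Sum>j\<in>{1..m}. if j = 1 then - 1 else 0)) * D"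
      unfolding D_def by (rule br_pdet_diag) (use H_e in auto)
    then show ?thesis using 1 m by (simp add: G_def)
  next
    case 2
    then have j2: "j \<in> {2..m}" using j by auto
    have "br (Y j) D \<doteq> pdet m (\<lambda>i j'. if j' = 1 then e i j else e i j')"
      unfolding D_def by (rule br_pdet_col) (use Y_e j2 m in auto)
    also have "\<dots> \<doteq> 0"
      by (rule pdet_equal_cols[of 1 _ j]) (use j2 m in auto)
    finally have "- br (Y j) D \<doteq> - 0" by (rule cg_uminus)
    then show ?thesis using 2 by (simp add: G_def algebra_simps)
  next
    case 3
    then have i2: "i \<in> {2..m}" using i by auto
    have "br (X i) D \<doteq> pdet m (e(1 := \<lambda>s. - e i s))"
      unfolding D_def by (rule br_pdet_row) (use X_e i2 m in auto)
    also have "pdet m (e(1 := \<lambda>s. - e i s)) = - pdet m (e(1 := e i))"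
    proof -
      have "map (\<lambda>k. (e(1 := z)) k (\<sigma> k)) [2..<Suc m] = map (\<lambda>k. e k (\<sigma> k)) [2..<Suc m]" for z \<sigma>
        by (rule map_cong[OF refl]) (unfold set_upt2, simp)
      then show ?thesis
        unfolding pdet_def upt_split list.map prod_list.Cons fun_upd_same
        by (simp only: mult_minus_left mult_minus_right sum_negf)
    qed
    also have "\<dots> \<doteq> - 0"
    proof (intro cg_uminus pdet_equal_rows[of 1 _ i])
      fix a b c d assume "a \<in> {1..m}" "b \<in> {1..m}" "c \<in> {1..m}" "d \<in> {1..m}"
      then show "(e(1 := e i)) a b * (e(1 := e i)) c d \<doteq> (e(1 := e i)) c d * (e(1 := e i)) a b"
        using i comm by auto
    qed (use i2 m in auto)
    finally show ?thesis using 3 by (simp add: G_def)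
  qed (simp add: G_def)
qed

lemma e_D: "i \<in> {1..m} \<Longrightarrow> j \<in> {1..m} \<Longrightarrow> br (e i j) D \<doteq> 0"
  unfolding D_def using br_pdet_diag[of m "e i j" e "\<lambda>_. 0" "\<lambda>_. 0"] comm by (simp add: cg_def)

lemma C_D: "br C D \<doteq> 0"
proof -
  have "br C D \<doteq> (\<Sum>\<sigma>\<in>{\<sigma>. \<sigma> permutes {1..m} \<and> \<sigma> 1 = 1}. of_int (sign \<sigma>) * 0)"
    unfolding C_def br_sum_left br_of_int_mult
  proof (intro cg_sum cg_mult cg_refl)
    fix \<sigma> assume "\<sigma> \<in> {\<sigma>. \<sigma> permutes {1..m} \<and> \<sigma> 1 = 1}"
    then have s: "\<sigma> permutes {1..m}" by simp
    have "br D (P \<sigma>) \<doteq> 0" unfolding P_def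
    proof (rule br_prod_list_zero)
      fix i assume "i \<in> set [2..<Suc m]"
      then have i: "i \<in> {1..m}" by auto
      then have "br (e i (\<sigma> i)) D \<doteq> 0" using permutes_in_image[OF s] by (intro e_D) auto
      then show "br D (e i (\<sigma> i)) \<doteq> 0" by (rule br_zeroD)
    qed
    then show "br (P \<sigma>) D \<doteq> 0" by (rule br_zeroD)
  qed
  then show ?thesis by simp
qed

text \<open>In \<open>br f D\<close> one factor of every product is replaced by an entry of
  \<open>G\<close>, while the other factors commute with \<open>D\<close>. Of the entries of
  \<open>G\<close> only \<open>G 1 1 = H\<close> fails to commute with \<open>D\<close>, so just the
  permutations fixing 1 survive; their sum is the cofactor \<open>C\<close>.\<close>

lemma f_D_D: "br (br f D) D \<doteq> - 2 * C * D"
proof -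
  let ?S = "{\<sigma>. \<sigma> permutes {1..m}}"
  let ?R = "\<lambda>\<sigma> i. prod_list (map (upd (\<lambda>i. e i (\<sigma> i)) i (G i (\<sigma> i))) [1..<Suc m])"
  have fin: "finite ?S" by (simp add: finite_permutations)
  have fD: "br f D \<doteq> (\<Sum>\<sigma>\<in>?S. of_int (sign \<sigma>) * (\<Sum>i\<in>set [1..<Suc m]. ?R \<sigma> i))"
    unfolding D_def pdet_def br_sum_right br_of_int_mult
  proof (intro cg_sum cg_mult cg_refl br_prod_list_cg)
    fix \<sigma> i assume s: "\<sigma> \<in> ?S" and i: "i \<in> set [1..<Suc m]"
    then show "br f (e i (\<sigma> i)) \<doteq> G i (\<sigma> i)"
      unfolding set_upt1 G_def using permutes_in_image[of \<sigma> "{1..m}" i] by (intro f_e) auto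
  qed simp
  have R: "br (?R \<sigma> i) D \<doteq> (if i = 1 \<and> \<sigma> 1 = 1 then - 2 * P \<sigma> * D else 0)"
    if s: "\<sigma> \<in> ?S" and i: "i \<in> set [1..<Suc m]" for \<sigma> i
  proof -
    have im: "i \<in> {1..m}" using i unfolding set_upt1 .
    have sm: "\<sigma> k \<in> {1..m}" if "k \<in> {1..m}" for k
      using s that permutes_in_image[of \<sigma> "{1..m}" k] by blast
    let ?y = "upd (\<lambda>i. e i (\<sigma> i)) i (G i (\<sigma> i))"
    have "br (?R \<sigma> i) D = (\<Sum>k\<in>set [1..<Suc m]. prod_list (map (upd ?y k (br (?y k) D)) [1..<Suc m]))"
      by (rule br_prod_list_left) simp
    also have "\<dots> \<doteq> (\<Sum>k\<in>set [1..<Suc m]. if k = i then prod_list (map (upd ?y i (if i = 1 \<and> \<sigma> i = 1 then - 2 * D else 0)) [1..<Suc m]) else 0)"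
    proof (rule cg_sum)
      fix k assume k: "k \<in> set [1..<Suc m]"
      then have km: "k \<in> {1..m}" unfolding set_upt1 .
      show "prod_list (map (upd ?y k (br (?y k) D)) [1..<Suc m]) \<doteq>
        (if k = i then prod_list (map (upd ?y i (if i = 1 \<and> \<sigma> i = 1 then - 2 * D else 0)) [1..<Suc m]) else 0)"
      proof (cases "k = i")
        case True
        show ?thesis unfolding True if_P[OF refl]
          by (intro cg_prod_list) (use G_D[OF im sm[OF im]] in auto)
      next
        case False
        have "prod_list (map (upd ?y k (br (?y k) D)) [1..<Suc m]) \<doteq> prod_list (map (upd ?y k 0) [1..<Suc m])"
          by (intro cg_prod_list) (use e_D[OF km sm[OF km]] False in auto)
        also have "\<dots> = 0" using k by (rule prod_list_zero_entry) simp
        finally show ?thesis using False by simp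
      qed
    qed
    also have "\<dots> = prod_list (map (upd ?y i (if i = 1 \<and> \<sigma> i = 1 then - 2 * D else 0)) [1..<Suc m])"
      using i by (simp del: upt_Suc set_upt)
    also have "\<dots> \<doteq> (if i = 1 \<and> \<sigma> 1 = 1 then - 2 * P \<sigma> * D else 0)"
    proof (cases "i = 1 \<and> \<sigma> i = 1")
      case True
      have t: "i = 1" "\<sigma> 1 = 1" using True by auto
      have "map (upd ?y i (- 2 * D)) [2..<Suc m] = map (\<lambda>i. e i (\<sigma> i)) [2..<Suc m]"
        using True by (intro map_cong) (auto simp: set_upt2)
      then have "prod_list (map (upd ?y i (if i = 1 \<and> \<sigma> i = 1 then - 2 * D else 0)) [1..<Suc m]) = - 2 * (D * P \<sigma>)"
        by (simp only: upt_split P_def list.map prod_list.Cons simp_thms if_True mult.assoc t)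
      moreover have "D * P \<sigma> \<doteq> P \<sigma> * D"
        unfolding P_def
      proof (rule cg_prod_list_commute)
        fix y assume "y \<in> set (map (\<lambda>i. e i (\<sigma> i)) [2..<Suc m])"
        then obtain k where k: "k \<in> {2..m}" "y = e k (\<sigma> k)" unfolding set_map set_upt2 by blast
        then have km: "k \<in> {1..m}" by auto
        show "D * y \<doteq> y * D" unfolding k(2) by (rule br_zeroD(2)[OF e_D[OF km sm[OF km]]])
      qed
      ultimately have "prod_list (map (upd ?y i (if i = 1 \<and> \<sigma> i = 1 then - 2 * D else 0)) [1..<Suc m]) \<doteq> - 2 * (P \<sigma> * D)"
        by (simp only: cg_mult cg_refl)
      then show ?thesis using t by (simp only: simp_thms if_True mult.assoc)
    next
      case False
      then have "prod_list (map (upd ?y i (if i = 1 \<and> \<sigma> i = 1 then - 2 * D else 0)) [1..<Suc m]) = 0"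
        using i by (intro prod_list_zero_entry[of i]) auto
      then show ?thesis using False by auto
    qed
    finally show ?thesis .
  qed
  have "br (br f D) D \<doteq> br (\<Sum>\<sigma>\<in>?S. of_int (sign \<sigma>) * (\<Sum>i\<in>set [1..<Suc m]. ?R \<sigma> i)) D"
    by (intro br_cg fD cg_refl)
  also have "\<dots> \<doteq> (\<Sum>\<sigma>\<in>?S. of_int (sign \<sigma>) * (\<Sum>i\<in>set [1..<Suc m]. if i = 1 \<and> \<sigma> 1 = 1 then - 2 * P \<sigma> * D else 0))"
    unfolding br_sum_left br_of_int_mult by (intro cg_sum cg_mult cg_refl R)
  also have "\<dots> = (\<Sum>\<sigma>\<in>?S. if \<sigma> 1 = 1 then - 2 * (of_int (sign \<sigma>) * P \<sigma>) * D else 0)"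
  proof (rule sum.cong[OF refl])
    fix \<sigma> assume "\<sigma> \<in> ?S"
    have "(\<Sum>i\<in>{1..m}. if i = 1 \<and> \<sigma> 1 = 1 then - 2 * P \<sigma> * D else 0) = (if \<sigma> 1 = 1 then - 2 * P \<sigma> * D else 0)"
      using m by auto
    moreover have "of_int (sign \<sigma>) * (- 2 * P \<sigma> * D) = - 2 * (of_int (sign \<sigma>) * P \<sigma>) * D"
      by (metis mult.assoc mult_of_int_commute)
    ultimately show "of_int (sign \<sigma>) * (\<Sum>i\<in>set [1..<Suc m]. if i = 1 \<and> \<sigma> 1 = 1 then - 2 * P \<sigma> * D else 0)
      = (if \<sigma> 1 = 1 then - 2 * (of_int (sign \<sigma>) * P \<sigma>) * D else 0)"
      unfolding set_upt1 by auto
  qed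
  also have "\<dots> = - 2 * C * D"
  proof -
    have "{\<sigma> \<in> ?S. \<sigma> 1 = 1} = {\<sigma>. \<sigma> permutes {1..m} \<and> \<sigma> 1 = 1}" by auto
    then show ?thesis unfolding C_def sum_distrib_left sum_distrib_right sum.inter_filter[OF fin, symmetric] by simp
  qed
  finally show ?thesis .
qed

lemma P_one: "\<sigma> permutes {1..m} \<Longrightarrow> prod_list (map (\<lambda>i. e i (\<sigma> i)) [1..<Suc m]) = e 1 (\<sigma> 1) * P \<sigma>"
  unfolding upt_split P_def by (simp del: upt_Suc)

text \<open>The bracket of \<open>f\<close> with an entry of row \<open>i \<ge> 2\<close> is zero or
  \<open>X i\<close>. The latter commutes with the remaining factors, none of which lies in row 1,
  and then kills the cyclic vector.\<close>

lemma f_tail: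
  assumes "set xs \<subseteq> {2..m}" "\<And>i. i \<in> set xs \<Longrightarrow> \<sigma> i \<in> {1..m}"
  shows "f * prod_list (map (\<lambda>i. e i (\<sigma> i)) xs) \<in> J"
  using assms
proof (induction xs)
  case (Cons i xs)
  let ?P = "prod_list (map (\<lambda>i. e i (\<sigma> i)) xs)"
  have i: "i \<in> {2..m}" "i \<in> {1..m}" "\<sigma> i \<in> {1..m}" "i \<noteq> 1" using Cons.prems by auto
  have "f * (e i (\<sigma> i) * ?P) = br f (e i (\<sigma> i)) * ?P + e i (\<sigma> i) * (f * ?P)"
    by (simp add: algebra_simps)
  also have "\<dots> \<leadsto> (if \<sigma> i = 1 then X i else 0) * ?P + e i (\<sigma> i) * 0"
  proof (rule cj_add)
    show "br f (e i (\<sigma> i)) * ?P \<leadsto> (if \<sigma> i = 1 then X i else 0) * ?P"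
      using f_e[OF i(2,3)] i by (intro cg_cj cg_mult cg_refl) simp
    have "f * ?P \<leadsto> 0" using Cons by (simp add: cj_zero_iff)
    then show "e i (\<sigma> i) * (f * ?P) \<leadsto> e i (\<sigma> i) * 0" by (rule cj_left)
  qed
  also have "\<dots> \<leadsto> 0 + 0"
  proof (rule cj_add)
    have "X i * ?P \<leadsto> 0"
    proof (rule cj_prod_zero)
      fix k assume "k \<in> set xs"
      then have k: "k \<in> {1..m}" "\<sigma> k \<in> {1..m}" "k \<noteq> 1" using Cons.prems by auto
      then show "br (X i) (e k (\<sigma> k)) \<doteq> 0" using X_e[OF i(1) k(1,2)] by simp
    qed (use X_J i in auto)
    then show "(if \<sigma> i = 1 then X i else 0) * ?P \<leadsto> 0" by auto
  qed simp
  finally show ?case by (simp add: cj_zero_iff)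
qed (simp add: f_J)

text \<open>By \<open>f_tail\<close> only the bracket of \<open>f\<close> with the first factor
  matters. For \<open>\<sigma> 1 = 1\<close> it is \<open>H\<close>, which acts by
  \<open>\<kappa>\<close>. Otherwise it is \<open>- Y (\<sigma> 1)\<close>, which moves the single
  factor in column 1 to column \<open>\<sigma> 1\<close>; the permutation is changed by a
  transposition into one that fixes 1.\<close>

lemma first_row:
  assumes s: "\<sigma> permutes {1..m}"
  shows "f * prod_list (map (\<lambda>i. e i (\<sigma> i)) [1..<Suc m]) \<leadsto>
    (if \<sigma> 1 = 1 then of_int \<kappa> * P \<sigma> else - P (Transposition.transpose 1 (\<sigma> 1) \<circ> \<sigma>))"
proof -
  have sm: "\<sigma> k \<in> {1..m}" if "k \<in> {1..m}" for k
    using s that permutes_in_image[of \<sigma> "{1..m}" k] by blast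
  have one: "1 \<in> {1..m}" using m by simp
  have s1: "\<sigma> k \<noteq> \<sigma> 1" if "k \<in> {2..m}" for k
    using inj_eq[OF permutes_inj[OF s], of k 1] that by auto
  have "f * (e 1 (\<sigma> 1) * P \<sigma>) = br f (e 1 (\<sigma> 1)) * P \<sigma> + e 1 (\<sigma> 1) * (f * P \<sigma>)"
    by (simp add: algebra_simps)
  also have "\<dots> \<leadsto> G 1 (\<sigma> 1) * P \<sigma> + e 1 (\<sigma> 1) * 0"
  proof (rule cj_add)
    have "br f (e 1 (\<sigma> 1)) \<doteq> G 1 (\<sigma> 1)" unfolding G_def by (rule f_e[OF one sm[OF one]])
    then show "br f (e 1 (\<sigma> 1)) * P \<sigma> \<leadsto> G 1 (\<sigma> 1) * P \<sigma>"
      by (intro cg_cj cg_mult cg_refl)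
    have "f * P \<sigma> \<in> J" unfolding P_def by (rule f_tail) (unfold set_upt2, use sm in auto)
    then have "f * P \<sigma> \<leadsto> 0" by (simp add: cj_zero_iff)
    then show "e 1 (\<sigma> 1) * (f * P \<sigma>) \<leadsto> e 1 (\<sigma> 1) * 0" by (rule cj_left)
  qed
  also have "\<dots> = G 1 (\<sigma> 1) * P \<sigma>" by simp
  also have "\<dots> \<leadsto> (if \<sigma> 1 = 1 then of_int \<kappa> * P \<sigma> else - P (Transposition.transpose 1 (\<sigma> 1) \<circ> \<sigma>))"
  proof (cases "\<sigma> 1 = 1")
    case True
    have "H * P \<sigma> = br H (P \<sigma>) + P \<sigma> * H" by simp
    also have "\<dots> \<leadsto> 0 + P \<sigma> * of_int \<kappa>"
    proof (intro cj_add cj_left H_J cg_cj)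
      \<comment> \<open>\<open>P \<sigma>\<close> has no factor from row 1 and, as
        \<open>\<sigma> 1 = 1\<close>, none from column 1; elsewhere \<open>H\<close> has weight
        0.\<close>
      show "br H (P \<sigma>) \<doteq> 0" unfolding P_def
      proof (rule br_prod_list_zero)
        fix i assume "i \<in> set [2..<Suc m]"
        then have i: "i \<in> {2..m}" "i \<in> {1..m}" unfolding set_upt2 by auto
        show "br H (e i (\<sigma> i)) \<doteq> 0" using H_e[OF i(2) sm[OF i(2)]] s1[OF i(1)] i True by simp
      qed
    qed
    also have "\<dots> = of_int \<kappa> * P \<sigma>" by (simp add: mult_of_int_commute)
    finally show ?thesis using True by (simp add: G_def)
  next
    case False
    have j: "\<sigma> 1 \<in> {2..m}" using False sm[OF one] by auto
    have "br (Y (\<sigma> 1)) (P \<sigma>) + P \<sigma> * Y (\<sigma> 1) \<leadsto> P (Transposition.transpose 1 (\<sigma> 1) \<circ> \<sigma>) + P \<sigma> * 0"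
    proof (rule cj_add)
      have "br (Y (\<sigma> 1)) (P \<sigma>) \<doteq> prod_list (map (\<lambda>i. if \<sigma> i = 1 then e i (\<sigma> 1) else e i (\<sigma> i)) [2..<Suc m])"
        unfolding P_def
      proof (rule br_prod_col)
        show "inj_on \<sigma> (set [2..<Suc m])" by (rule permutes_inj_on[OF s])
        have "1 \<in> \<sigma> ` {1..m}" using permutes_image[OF s] m by auto
        moreover have "{1..m} = insert 1 {2..m}" using m by auto
        ultimately show "1 \<in> \<sigma> ` set [2..<Suc m]" unfolding set_upt2 using False by auto
        fix i assume "i \<in> set [2..<Suc m]"
        then have i: "i \<in> {1..m}" unfolding set_upt2 by auto
        show "br (Y (\<sigma> 1)) (e i (\<sigma> i)) \<doteq> (if \<sigma> i = 1 then e i (\<sigma> 1) else 0)"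
          by (rule Y_e[OF j i sm[OF i]])
      qed simp
      also have "map (\<lambda>i. if \<sigma> i = 1 then e i (\<sigma> 1) else e i (\<sigma> i)) [2..<Suc m]
          = map (\<lambda>i. e i ((Transposition.transpose 1 (\<sigma> 1) \<circ> \<sigma>) i)) [2..<Suc m]"
      proof (rule map_cong[OF refl])
        fix i assume "i \<in> set [2..<Suc m]"
        then have "\<sigma> i \<noteq> \<sigma> 1" unfolding set_upt2 by (rule s1)
        then show "(if \<sigma> i = 1 then e i (\<sigma> 1) else e i (\<sigma> i)) = e i ((Transposition.transpose 1 (\<sigma> 1) \<circ> \<sigma>) i)"
          by (auto simp: Transposition.transpose_def)
      qed
      finally show "br (Y (\<sigma> 1)) (P \<sigma>) \<leadsto> P (Transposition.transpose 1 (\<sigma> 1) \<circ> \<sigma>)"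
        unfolding P_def by (rule cg_cj)
      have "Y (\<sigma> 1) \<leadsto> 0" using Y_J[OF j] by (simp add: cj_zero_iff)
      then show "P \<sigma> * Y (\<sigma> 1) \<leadsto> P \<sigma> * 0" by (rule cj_left)
    qed
    then have "Y (\<sigma> 1) * P \<sigma> \<leadsto> P (Transposition.transpose 1 (\<sigma> 1) \<circ> \<sigma>)"
      by (simp only: mult_zero_right add_0_right diff_add_cancel)
    then have "- (Y (\<sigma> 1) * P \<sigma>) \<leadsto> - P (Transposition.transpose 1 (\<sigma> 1) \<circ> \<sigma>)"
      by (rule cj_uminus)
    then show ?thesis using False by (simp add: G_def)
  qed
  finally show ?thesis unfolding P_one[OF s] .
qed

text \<open>The permutations fixing 1 give \<open>\<kappa>\<close> times the cofactor. Each of the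
  other \<open>m - 1\<close> values of \<open>\<sigma> 1\<close> gives the cofactor once more: the
  sign of the transposition cancels the minus sign in front of \<open>Y\<close>.\<close>

lemma f_D: "f * D \<leadsto> of_int (\<kappa> + int m - 1) * C"
proof -
  let ?S = "{\<sigma>. \<sigma> permutes {1..m}}"
  let ?S1 = "{\<sigma>. \<sigma> permutes {1..m} \<and> \<sigma> 1 = 1}"
  let ?t = "\<lambda>j. Transposition.transpose (1::nat) j"
  let ?T = "\<lambda>\<sigma>. if \<sigma> 1 = 1 then of_int \<kappa> * P \<sigma> else - P (?t (\<sigma> 1) \<circ> \<sigma>)"
  let ?Sj = "\<lambda>j. {\<sigma>. \<sigma> permutes {1..m} \<and> \<sigma> 1 = j}"
  have fin: "finite ?S" "finite (?Sj j)" for j using finite_permutations[of "{1..m}"] by auto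
  have "f * D = (\<Sum>\<sigma>\<in>?S. of_int (sign \<sigma>) * (f * prod_list (map (\<lambda>i. e i (\<sigma> i)) [1..<Suc m])))"
    unfolding D_def pdet_def sum_distrib_left
    by (intro sum.cong refl) (metis mult.assoc mult_of_int_commute)
  also have "\<dots> \<leadsto> (\<Sum>\<sigma>\<in>?S. of_int (sign \<sigma>) * ?T \<sigma>)"
  proof (rule cj_sum)
    fix \<sigma> assume "\<sigma> \<in> ?S"
    then have "\<sigma> permutes {1..m}" by simp
    then show "of_int (sign \<sigma>) * (f * prod_list (map (\<lambda>i. e i (\<sigma> i)) [1..<Suc m])) \<leadsto> of_int (sign \<sigma>) * ?T \<sigma>"
      by (rule cj_left[OF first_row])
  qed
  also have "\<dots> = (\<Sum>j\<in>{1..m}. \<Sum>\<sigma>\<in>?Sj j. of_int (sign \<sigma>) * ?T \<sigma>)"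
  proof -
    have "\<sigma> 1 \<in> {1..m}" if "\<sigma> permutes {1..m}" for \<sigma>
      using permutes_in_image[OF that, of 1] m by simp
    then have "?S = (\<Union>j\<in>{1..m}. ?Sj j)" by blast
    then show ?thesis using fin by (simp only:) (rule sum.UNION_disjoint, auto)
  qed
  also have "\<dots> = (\<Sum>j\<in>{1..m}. if j = 1 then of_int \<kappa> * C else C)"
  proof (rule sum.cong[OF refl])
    fix j assume j: "j \<in> {1..m}"
    show "(\<Sum>\<sigma>\<in>?Sj j. of_int (sign \<sigma>) * ?T \<sigma>) = (if j = 1 then of_int \<kappa> * C else C)"
    proof (cases "j = 1")
      case True
      then show ?thesis unfolding C_def
        by (auto simp: sum_distrib_left intro!: sum.cong) (metis mult.assoc mult_of_int_commute)
    next
      case False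
      have tp: "?t j permutes {1..m}" using j m by (intro permutes_swap_id) auto
      have "(\<Sum>\<sigma>\<in>?Sj j. of_int (sign \<sigma>) * ?T \<sigma>) = (\<Sum>\<sigma>\<in>?S1. of_int (sign \<sigma>) * P \<sigma>)"
      proof (rule sum.reindex_bij_witness[where i = "\<lambda>\<sigma>. ?t j \<circ> \<sigma>" and j = "\<lambda>\<sigma>. ?t j \<circ> \<sigma>"])
        fix \<sigma> assume "\<sigma> \<in> ?Sj j"
        then have s: "\<sigma> permutes {1..m}" "\<sigma> 1 = j" by auto
        have "sign (?t j \<circ> \<sigma>) = - sign \<sigma>"
          using False sign_compose[OF permutation_swap_id permutes_imp_permutation[OF _ s(1)], of 1 j]
          by (simp add: sign_swap_id)
        then show "of_int (sign (?t j \<circ> \<sigma>)) * P (?t j \<circ> \<sigma>) = of_int (sign \<sigma>) * ?T \<sigma>"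
          using s False by simp
      qed (use permutes_compose[OF _ tp] in \<open>auto simp: comp_assoc[symmetric]\<close>)
      then show ?thesis using False by (simp add: C_def)
    qed
  qed
  also have "\<dots> = of_int (\<kappa> + int m - 1) * C"
  proof -
    have "{1..m} = insert 1 {2..m}" using m by auto
    then show ?thesis using m by (simp add: algebra_simps)
  qed
  finally show ?thesis .
qed

lemma of_int_left_commute: "x * (of_int k * y) = of_int k * (x * (y::'r))"
  by (metis mult.assoc mult_of_int_commute)

lemma br_power: "br (br f D) (D ^ n) \<doteq> of_int (- 2 * int n) * (C * D ^ n)"
proof (induction n)
  case (Suc n)
  let ?G = "br f D"
  have "br ?G (D ^ Suc n) = br ?G D * D ^ n + D * br ?G (D ^ n)"
    by (simp only: power_Suc left_diff_distrib right_diff_distrib mult.assoc) simp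
  also have "\<dots> \<doteq> of_int (- 2) * C * D * D ^ n + D * (of_int (- 2 * int n) * (C * D ^ n))"
    using f_D_D by (intro cg_add cg_mult cg_refl Suc.IH) simp
  also have "D * (of_int (- 2 * int n) * (C * D ^ n)) = of_int (- 2 * int n) * ((D * C) * D ^ n)"
    by (simp only: of_int_left_commute mult.assoc)
  also have "of_int (- 2) * C * D * D ^ n + \<dots> \<doteq>
      of_int (- 2) * C * D * D ^ n + of_int (- 2 * int n) * ((C * D) * D ^ n)"
    by (intro cg_add cg_mult cg_refl br_zeroD(2)[OF C_D])
  also have "\<dots> = (of_int (- 2) + of_int (- 2 * int n)) * (C * D ^ Suc n)"
    by (simp only: distrib_right mult.assoc power_Suc)
  also have "\<dots> = of_int (- 2 * int (Suc n)) * (C * D ^ Suc n)"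
    unfolding of_int_add[symmetric] by (simp add: algebra_simps)
  finally show ?case .
qed simp

text \<open>With \<open>G = br f D\<close> the product \<open>f D^(N+1)\<close> is
  \<open>[G, D^N] + D^N G + D f D^N\<close>. The three terms contribute \<open>- 2 N\<close>,
  \<open>\<kappa> + m - 1\<close> and \<open>N (\<kappa> + m - N)\<close>, and the sum of these
  factors as \<open>(N + 1) (\<kappa> + m - (N + 1))\<close>.\<close>

lemma f_power: "f * D ^ Suc n \<leadsto> of_int (int (Suc n) * (\<kappa> + int m - int (Suc n))) * (C * D ^ n)"
proof (induction n)
  case 0
  show ?case using f_D by (simp add: algebra_simps)
next
  case (Suc n)
  let ?G = "br f D" and ?N = "Suc n"
  let ?a = "of_int (\<kappa> + int m - 1) :: 'r" and ?b = "of_int (int ?N * (\<kappa> + int m - int ?N)) :: 'r"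
  have CD: "D * C \<doteq> C * D" by (rule br_zeroD(2)[OF C_D])
  have CDn: "D ^ n * C \<doteq> C * D ^ n" for n
  proof (induction n)
    case (Suc n)
    have "D ^ Suc n * C = D * (D ^ n * C)" by (simp add: mult.assoc)
    also have "\<dots> \<doteq> D * (C * D ^ n)" by (intro cg_mult cg_refl Suc.IH)
    also have "\<dots> = (D * C) * D ^ n" by (simp add: mult.assoc)
    also have "\<dots> \<doteq> (C * D) * D ^ n" by (intro cg_mult cg_refl CD)
    finally show ?case by (simp add: mult.assoc)
  qed simp
  have G: "?G \<leadsto> ?a * C"
  proof -
    have "f * D - D * f \<leadsto> ?a * C - D * 0"
      using f_J by (intro cj_diff f_D cj_left) (simp add: cj_zero_iff)
    then show ?thesis by simp
  qed
  have "f * D ^ Suc ?N = br ?G (D ^ ?N) + D ^ ?N * ?G + D * (f * D ^ ?N)"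
    by (simp only: power_Suc left_diff_distrib right_diff_distrib mult.assoc) simp
  also have "\<dots> \<leadsto> of_int (- 2 * int ?N) * (C * D ^ ?N) + D ^ ?N * (?a * C) + D * (?b * (C * D ^ n))"
    by (intro cj_add cj_left G Suc.IH cg_cj[OF br_power])
  also have "D ^ ?N * (?a * C) = ?a * (D ^ ?N * C)" by (rule of_int_left_commute)
  also have "D * (?b * (C * D ^ n)) = ?b * ((D * C) * D ^ n)"
    by (simp only: of_int_left_commute mult.assoc)
  also have "of_int (- 2 * int ?N) * (C * D ^ ?N) + ?a * (D ^ ?N * C) + ?b * ((D * C) * D ^ n)
     \<doteq> of_int (- 2 * int ?N) * (C * D ^ ?N) + ?a * (C * D ^ ?N) + ?b * ((C * D) * D ^ n)"
    by (intro cg_add cg_mult CD CDn cg_refl)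
  also have "\<dots> = (of_int (- 2 * int ?N) + ?a + ?b) * (C * D ^ ?N)"
    by (simp only: distrib_right mult.assoc power_Suc)
  also have "of_int (- 2 * int ?N) + ?a + ?b = (of_int (int (Suc ?N) * (\<kappa> + int m - int (Suc ?N))) :: 'r)"
    unfolding of_int_add[symmetric] by (rule arg_cong[of _ _ of_int]) (simp add: algebra_simps)
  finally show ?case .
qed

theorem f_power_zero: "\<kappa> = int n - int m \<Longrightarrow> n \<ge> 1 \<Longrightarrow> f * D ^ n \<in> J"
  using f_power[of "n - 1"] by (cases n) (simp_all add: cj_zero_iff)

end

section \<open>Polynomial functions and vector fields\<close>

text \<open>\<open>sh x \<epsilon> u\<close> is the point \<open>x + \<epsilon> u\<close>.\<close>

locale poly_space =
  fixes coord :: "'v \<Rightarrow> 'p \<Rightarrow> complex" and sh :: "'p \<Rightarrow> complex \<Rightarrow> 'p \<Rightarrow> 'p"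
  assumes coord_sh: "coord v (sh x \<epsilon> u) = coord v x + \<epsilon> * coord v u"
    and sh_zero: "sh x 0 u = x"
begin

text \<open>Polynomials are taken as functions generated by the coordinates. Infinitely many
  variables are then harmless, and a derivation can be defined by differentiating along a line
  without choosing a polynomial expression.\<close>

inductive_set polyfun :: "('p \<Rightarrow> complex) set" where
  const: "(\<lambda>x. c) \<in> polyfun"
| coord: "coord v \<in> polyfun"
| add: "f \<in> polyfun \<Longrightarrow> g \<in> polyfun \<Longrightarrow> (\<lambda>x. f x + g x) \<in> polyfun"
| mult: "f \<in> polyfun \<Longrightarrow> g \<in> polyfun \<Longrightarrow> (\<lambda>x. f x * g x) \<in> polyfun"

definition Der :: "('p \<Rightarrow> 'p) \<Rightarrow> ('p \<Rightarrow> complex) \<Rightarrow> 'p \<Rightarrow> complex" where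
  "Der V f x = (THE d. ((\<lambda>\<epsilon>. f (sh x \<epsilon> (V x))) has_field_derivative d) (at 0))"

lemma Der_eqI: "((\<lambda>\<epsilon>. f (sh x \<epsilon> (V x))) has_field_derivative d) (at 0) \<Longrightarrow> Der V f x = d"
  unfolding Der_def by (rule the_equality) (auto intro: DERIV_unique)

lemma has_deriv:
  "f \<in> polyfun \<Longrightarrow> ((\<lambda>\<epsilon>. f (sh x \<epsilon> (V x))) has_field_derivative Der V f x) (at 0)"
proof -
  assume "f \<in> polyfun"
  then have "\<exists>d. ((\<lambda>\<epsilon>. f (sh x \<epsilon> (V x))) has_field_derivative d) (at 0)"
  proof induction
    case (coord v)
    show ?case unfolding coord_sh by (rule exI) (auto intro!: derivative_eq_intros)
  next
    case (add f g)
    then show ?case using DERIV_add by fast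
  next
    case (mult f g)
    then show ?case using DERIV_mult by fast
  qed (auto intro: DERIV_const)
  then show ?thesis using Der_eqI by blast
qed

lemma Der_const [simp]: "Der V (\<lambda>x. c) x = 0"
  by (rule Der_eqI) simp

lemma Der_coord [simp]: "Der V (coord v) x = coord v (V x)"
  by (rule Der_eqI) (auto simp: coord_sh intro!: derivative_eq_intros)

lemma Der_add: "f \<in> polyfun \<Longrightarrow> g \<in> polyfun \<Longrightarrow> Der V (\<lambda>x. f x + g x) x = Der V f x + Der V g x"
  by (rule Der_eqI) (intro DERIV_add has_deriv)

lemma Der_mult: "f \<in> polyfun \<Longrightarrow> g \<in> polyfun \<Longrightarrow>
    Der V (\<lambda>x. f x * g x) x = f x * Der V g x + Der V f x * g x"
  using DERIV_mult[OF has_deriv[of f x V] has_deriv[of g x V]]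
  by (intro Der_eqI) (simp add: sh_zero algebra_simps)

lemma Der_scale: "f \<in> polyfun \<Longrightarrow> Der V (\<lambda>x. c * f x) x = c * Der V f x"
  using Der_mult[OF const[of c], of f V x] by simp

lemma polyfun_scale: "f \<in> polyfun \<Longrightarrow> (\<lambda>x. c * f x) \<in> polyfun"
  by (rule mult[OF const])

lemma polyfun_diff: "f \<in> polyfun \<Longrightarrow> g \<in> polyfun \<Longrightarrow> (\<lambda>x. f x - g x) \<in> polyfun"
  using add[OF _ polyfun_scale[of g "-1"], of f] by simp

lemma polyfun_sum: "(\<And>i. i \<in> A \<Longrightarrow> f i \<in> polyfun) \<Longrightarrow> (\<lambda>x. \<Sum>i\<in>A. f i x) \<in> polyfun"
  by (induction A rule: infinite_finite_induct) (auto intro: polyfun.intros)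

lemma polyfun_prod: "(\<And>i. i \<in> A \<Longrightarrow> f i \<in> polyfun) \<Longrightarrow> (\<lambda>x. \<Prod>i\<in>A. f i x) \<in> polyfun"
  by (induction A rule: infinite_finite_induct) (auto intro: polyfun.intros)

lemma Der_sum: "(\<And>i. i \<in> A \<Longrightarrow> f i \<in> polyfun) \<Longrightarrow> Der V (\<lambda>x. \<Sum>i\<in>A. f i x) x = (\<Sum>i\<in>A. Der V (f i) x)"
proof (induction A rule: infinite_finite_induct)
  case (insert i A)
  then show ?case using Der_add[of "f i" "\<lambda>x. \<Sum>i\<in>A. f i x" V x] polyfun_sum[of A f] by simp
qed auto

definition poly_field :: "('p \<Rightarrow> 'p) \<Rightarrow> bool" where
  "poly_field V \<longleftrightarrow> (\<forall>v. (\<lambda>x. coord v (V x)) \<in> polyfun)"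

lemma Der_polyfun: "f \<in> polyfun \<Longrightarrow> poly_field V \<Longrightarrow> Der V f \<in> polyfun"
proof (induction rule: polyfun.induct)
  case (const c)
  have "Der V (\<lambda>x. c) = (\<lambda>x. 0)" by (rule ext) simp
  then show ?case by (simp add: polyfun.const)
next
  case (coord v)
  have "Der V (coord v) = (\<lambda>x. coord v (V x))" by (rule ext) simp
  then show ?case using coord by (simp add: poly_field_def)
next
  case (add f g)
  have "Der V (\<lambda>x. f x + g x) = (\<lambda>x. Der V f x + Der V g x)" using add by (intro ext) (simp add: Der_add)
  then show ?case using add by (auto intro: polyfun.add)
next
  case (mult f g)
  have "Der V (\<lambda>x. f x * g x) = (\<lambda>x. f x * Der V g x + Der V f x * g x)"
    using mult by (intro ext) (simp add: Der_mult)
  then show ?case using mult by (auto intro!: polyfun.add polyfun.mult)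
qed

lemma Der_linear:
  assumes "\<And>v x. coord v (U x) = a * coord v (V x) + b * coord v (W x)" and "f \<in> polyfun"
  shows "Der U f x = a * Der V f x + b * Der W f x"
  using assms(2) by induction (auto simp: Der_add Der_mult assms(1) algebra_simps)

text \<open>The commutator of two derivations is a derivation, so it is determined by its values on
  the coordinates.\<close>

lemma Der_bracket:
  assumes "poly_field V" "poly_field W"
    and "\<And>v x. Der V (\<lambda>x. coord v (W x)) x - Der W (\<lambda>x. coord v (V x)) x = coord v (U x)"
    and "f \<in> polyfun"
  shows "Der V (Der W f) x - Der W (Der V f) x = Der U f x"
  using assms(4)
proof (induction arbitrary: x)
  case (const c)
  have "Der W (\<lambda>x. c) = (\<lambda>x. 0)" "Der V (\<lambda>x. c) = (\<lambda>x. 0)" by (rule ext, simp)+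
  then show ?case by simp
next
  case (coord v)
  have "Der W (coord v) = (\<lambda>x. coord v (W x))" "Der V (coord v) = (\<lambda>x. coord v (V x))" by (rule ext, simp)+
  then show ?case using assms(3) by simp
next
  case (add f g)
  have "Der W (\<lambda>x. f x + g x) = (\<lambda>x. Der W f x + Der W g x)" "Der V (\<lambda>x. f x + g x) = (\<lambda>x. Der V f x + Der V g x)"
    using add by (auto intro!: ext simp: Der_add)
  then show ?case using add Der_polyfun assms(1,2) by (simp add: Der_add algebra_simps)
next
  case (mult f g)
  have "Der W (\<lambda>x. f x * g x) = (\<lambda>x. f x * Der W g x + Der W f x * g x)"
    "Der V (\<lambda>x. f x * g x) = (\<lambda>x. f x * Der V g x + Der V f x * g x)"
    using mult by (auto intro!: ext simp: Der_mult)
  moreover have p: "Der W f \<in> polyfun" "Der V f \<in> polyfun" "Der W g \<in> polyfun" "Der V g \<in> polyfun"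
    using mult assms(1,2) by (auto intro: Der_polyfun)
  ultimately have "Der V (Der W (\<lambda>x. f x * g x)) x - Der W (Der V (\<lambda>x. f x * g x)) x
     = f x * (Der V (Der W g) x - Der W (Der V g) x) + (Der V (Der W f) x - Der W (Der V f) x) * g x"
    using mult(1,2) by (simp add: Der_add Der_mult polyfun.mult algebra_simps)
  also have "\<dots> = Der U (\<lambda>x. f x * g x) x" using mult by (simp add: Der_mult)
  finally show ?case .
qed

end

section \<open>The ideal of relations in the full free algebra\<close>

context presentation
begin

text \<open>The ideal of relations pulled back along the retraction: a two-sided ideal of the ring
  of all words, to which the congruence calculus applies.\<close>

abbreviation "PI \<equiv> {u. proj S u \<in> I}"

lemma ring_ideal_PI: "ring_ideal PI"
  by unfold_locales (auto simp: proj_add proj_mult I_closed)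

sublocale ring_ideal PI by (rule ring_ideal_PI)

lemma Q_cg: "p \<in> fcar S \<Longrightarrow> q \<in> fcar S \<Longrightarrow> Q p = Q q \<longleftrightarrow> cg p q"
  by (simp add: Q_eq cg_def proj_diff)

lemma rel_cg: "p - q \<in> R \<Longrightarrow> cg p q"
  using rels_sub rels_I by (auto simp: cg_def)

end

lemma scal_assoc: "scal c * (scal d * p) = scal (c * d) * p"
  by (simp add: mult.assoc[symmetric] scal_mult)

lemma scal_left_commute: "p * (scal c * q) = scal c * (p * q)"
  by (metis mult.assoc scal_commute)

lemma scal_add: "scal c + scal d = scal (c + d)"
  by (simp add: single_add)

lemma scal_uminus: "scal (- c) = - scal c"
  by (simp add: single_uminus)

lemma scal_sum: "scal (sum f A) = (\<Sum>i\<in>A. scal (f i))"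
  by (induction A rule: infinite_finite_induct) (auto simp: single_add)

lemma br_scal: "br (scal c * p) q = scal c * br p q" "br p (scal c * q) = scal c * br p q"
  by (simp_all add: scal_left_commute right_diff_distrib mult.assoc)

section \<open>Matrices and the Weyl algebra\<close>

definition mbr :: "nat \<Rightarrow> (nat \<Rightarrow> nat \<Rightarrow> complex) \<Rightarrow> (nat \<Rightarrow> nat \<Rightarrow> complex) \<Rightarrow> nat \<Rightarrow> nat \<Rightarrow> complex" where
  "mbr l M M' i j = (\<Sum>k\<in>{1..l}. M i k * M' k j - M' i k * M k j)"

definition mtr :: "nat \<Rightarrow> (nat \<Rightarrow> nat \<Rightarrow> complex) \<Rightarrow> complex" where
  "mtr l M = (\<Sum>i\<in>{1..l}. M i i)"

definition munit :: "nat \<Rightarrow> nat \<Rightarrow> nat \<Rightarrow> nat \<Rightarrow> complex" where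
  "munit p q i j = (if i = p \<and> j = q then 1 else 0)"

lemma mtr_mbr: "mtr l (mbr l M M') = 0"
proof -
  have "(\<Sum>i\<in>{1..l}. \<Sum>k\<in>{1..l}. M i k * M' k i) = (\<Sum>i\<in>{1..l}. \<Sum>k\<in>{1..l}. M' i k * M k i)"
    by (subst sum.swap) (simp add: mult.commute)
  then show ?thesis by (simp add: mtr_def mbr_def sum_subtractf)
qed

locale weyl_alg =
  fixes l :: nat
begin

abbreviation "a i \<equiv> (letter (Ann i) :: weyl_gen word \<Rightarrow>\<^sub>0 complex)"
abbreviation "b i \<equiv> (letter (Cre i) :: weyl_gen word \<Rightarrow>\<^sub>0 complex)"

lemma gens: "i \<in> {1..l} \<Longrightarrow> Ann i \<in> weyl_gens l" "i \<in> {1..l} \<Longrightarrow> Cre i \<in> weyl_gens l"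
  by (auto simp: weyl_gens_def)

sublocale W: presentation "weyl_gens l" "weyl_rels l"
  by unfold_locales (auto simp: weyl_rels_def intro!: fcar_closed(4-8) gens)

lemma weyl_eq: "weyl l = W.A" by (simp add: weyl_def)

lemma ab_car: "i \<in> {1..l} \<Longrightarrow> a i \<in> fcar (weyl_gens l)" "i \<in> {1..l} \<Longrightarrow> b i \<in> fcar (weyl_gens l)"
  using gens by auto

abbreviation wcg (infix "\<doteq>" 50) where "wcg \<equiv> W.cg"

lemma ccr:
  assumes "i \<in> {1..l}" "j \<in> {1..l}"
  shows "br (a i) (a j) \<doteq> 0" "br (b i) (b j) \<doteq> 0" "br (a i) (b j) \<doteq> (if i = j then 1 else 0)"
proof -
  have "br (a i) (a j) \<in> weyl_rels l" "br (b i) (b j) \<in> weyl_rels l"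
    "br (a i) (b j) - (if i = j then 1 else 0) \<in> weyl_rels l"
    unfolding weyl_rels_def using assms by blast+
  then show "br (a i) (a j) \<doteq> 0" "br (b i) (b j) \<doteq> 0" "br (a i) (b j) \<doteq> (if i = j then 1 else 0)"
    by (auto intro!: W.rel_cg simp del: if_split)
qed

text \<open>The sign is chosen so that these elements satisfy the commutation relations of matrix
  units. The Cartan elements \<open>cartan_h\<close> are then represented by \<open>E i i\<close>,
  while the root vectors are represented by \<open>- E i j\<close>.\<close>

definition E :: "nat \<Rightarrow> nat \<Rightarrow> weyl_gen word \<Rightarrow>\<^sub>0 complex" where
  "E i j = scal (- (1 / 2)) * (a i * b j + b j * a i)"

lemma E_car: "i \<in> {1..l} \<Longrightarrow> j \<in> {1..l} \<Longrightarrow> E i j \<in> fcar (weyl_gens l)"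
  unfolding E_def using ab_car by auto

lemma E_cg: "i \<in> {1..l} \<Longrightarrow> j \<in> {1..l} \<Longrightarrow> E i j \<doteq> - (a i * b j) + scal (if i = j then 1 / 2 else 0)"
proof -
  assume ij: "i \<in> {1..l}" "j \<in> {1..l}"
  have "E i j = - (a i * b j) + scal (1 / 2) * br (a i) (b j)"
  proof -
    have "scal (1 / 2) * p + scal (1 / 2) * p = (p :: weyl_gen word \<Rightarrow>\<^sub>0 complex)" for p
      by (simp add: scal_add flip: distrib_right)
    then have "scal (- (1 / 2)) * (a i * b j) = - (a i * b j) + scal (1 / 2) * (a i * b j)"
      by (simp add: scal_uminus algebra_simps)
    then show ?thesis by (simp add: E_def distrib_left right_diff_distrib scal_uminus)
  qed
  also have "\<dots> \<doteq> - (a i * b j) + scal (1 / 2) * (if i = j then 1 else 0)"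
    by (intro W.cg_add W.cg_mult W.cg_refl ccr ij)
  finally show ?thesis by (cases "i = j") auto
qed

text \<open>Symmetrization changes \<open>- (a i * b j)\<close> only by a scalar, which drops out of
  commutators; the rest is the canonical commutation relation applied twice.\<close>

lemma br_E:
  assumes "i \<in> {1..l}" "j \<in> {1..l}" "p \<in> {1..l}" "q \<in> {1..l}"
  shows "br (E i j) (E p q) \<doteq> (if j = p then E i q else 0) - (if q = i then E p j else 0)"
proof -
  have "br (E i j) (E p q) \<doteq> br (- (a i * b j) + scal (if i = j then 1 / 2 else 0)) (- (a p * b q) + scal (if p = q then 1 / 2 else 0))"
    by (intro W.br_cg E_cg assms)
  also have "\<dots> = br (a i * b j) (a p * b q)"
  proof -
    have "br (- x + scal c) (- y + scal d) = br x y" for x y :: "weyl_gen word \<Rightarrow>\<^sub>0 complex" and c d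
      using scal_commute[of c y] scal_commute[of d x] scal_commute[of c "scal d"] by (simp add: algebra_simps)
    then show ?thesis .
  qed
  also have "\<dots> = - (a i * br (a p) (b j) * b q) + br (a i) (a p) * b j * b q + a p * a i * br (b j) (b q) + a p * br (a i) (b q) * b j"
    by (simp add: algebra_simps)
  also have "\<dots> \<doteq> - (a i * (if p = j then 1 else 0) * b q) + 0 * b j * b q + a p * a i * 0 + a p * (if i = q then 1 else 0) * b j"
    by (intro W.cg_add W.cg_uminus W.cg_mult W.cg_refl ccr assms)
  also have "\<dots> = (if j = p then - (a i * b q) + scal (if i = q then 1 / 2 else 0) else 0) - (if q = i then - (a p * b j) + scal (if p = j then 1 / 2 else 0) else 0)"
    by auto
  also have "\<dots> \<doteq> (if j = p then E i q else 0) - (if q = i then E p j else 0)"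
    using W.cg_sym[OF E_cg] assms by (intro W.cg_diff) auto
  finally show ?thesis .
qed

definition pre :: "(nat \<Rightarrow> nat \<Rightarrow> complex) \<Rightarrow> weyl_gen word \<Rightarrow>\<^sub>0 complex" where
  "pre M = (\<Sum>i\<in>{1..l}. \<Sum>j\<in>{1..l}. scal (M i j) * E i j)"

lemma pre_car [simp]: "pre M \<in> fcar (weyl_gens l)"
  unfolding pre_def by (intro fcar_sum fcar_closed E_car)

lemma pre_add: "pre (\<lambda>i j. M i j + M' i j) = pre M + pre M'"
  by (simp add: pre_def single_add distrib_right sum.distrib)

lemma pre_scale: "pre (\<lambda>i j. c * M i j) = scal c * pre M"
  by (simp add: pre_def sum_distrib_left scal_assoc)

lemma pre_diff: "pre (\<lambda>i j. M i j - M' i j) = pre M - pre M'"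
  using pre_add[of "\<lambda>i j. M i j - M' i j" M'] by simp

lemma pre_cong: "(\<And>i j. i \<in> {1..l} \<Longrightarrow> j \<in> {1..l} \<Longrightarrow> M i j = M' i j) \<Longrightarrow> pre M = pre M'"
  unfolding pre_def by (intro sum.cong refl) simp

lemma pre_unit: "p \<in> {1..l} \<Longrightarrow> q \<in> {1..l} \<Longrightarrow> pre (munit p q) = E p q"
proof -
  assume p: "p \<in> {1..l}" "q \<in> {1..l}"
  have "pre (munit p q) = (\<Sum>i\<in>{1..l}. \<Sum>j\<in>{1..l}. if j = q then if i = p then E p q else 0 else 0)"
    unfolding pre_def by (intro sum.cong refl) (auto simp: munit_def)
  also have "\<dots> = E p q" using p by simp
  finally show ?thesis .
qed

lemma br_pre: "br (pre M) (pre M') \<doteq> pre (mbr l M M')"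
proof -
  have "br (pre M) (pre M') = (\<Sum>i\<in>{1..l}. \<Sum>j\<in>{1..l}. \<Sum>p\<in>{1..l}. \<Sum>q\<in>{1..l}. scal (M i j * M' p q) * br (E i j) (E p q))"
  proof -
    have "br (scal c * E i j) (pre M') = (\<Sum>p\<in>{1..l}. \<Sum>q\<in>{1..l}. scal (c * M' p q) * br (E i j) (E p q))" for c i j
    proof -
      have "br (E i j) (pre M') = (\<Sum>p\<in>{1..l}. br (E i j) (\<Sum>q\<in>{1..l}. scal (M' p q) * E p q))"
        unfolding pre_def by (rule br_sum_right)
      also have "\<dots> = (\<Sum>p\<in>{1..l}. \<Sum>q\<in>{1..l}. scal (M' p q) * br (E i j) (E p q))"
        by (intro sum.cong refl trans[OF br_sum_right] br_scal(2))
      finally show ?thesis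
        unfolding br_scal(1) by (simp only: sum_distrib_left scal_assoc)
    qed
    moreover have "br (pre M) (pre M') = (\<Sum>i\<in>{1..l}. \<Sum>j\<in>{1..l}. br (scal (M i j) * E i j) (pre M'))"
      unfolding pre_def[of M] by (intro trans[OF br_sum_left] sum.cong refl br_sum_left)
    ultimately show ?thesis by (simp only:)
  qed
  also have "\<dots> \<doteq> (\<Sum>i\<in>{1..l}. \<Sum>j\<in>{1..l}. \<Sum>p\<in>{1..l}. \<Sum>q\<in>{1..l}. scal (M i j * M' p q) * ((if j = p then E i q else 0) - (if q = i then E p j else 0)))"
    by (intro W.cg_sum W.cg_mult W.cg_refl br_E)
  also have "\<dots> = (\<Sum>i\<in>{1..l}. \<Sum>j\<in>{1..l}. \<Sum>p\<in>{1..l}. \<Sum>q\<in>{1..l}. if p = j then scal (M i j * M' p q) * E i q else 0)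
      - (\<Sum>i\<in>{1..l}. \<Sum>j\<in>{1..l}. \<Sum>p\<in>{1..l}. \<Sum>q\<in>{1..l}. if q = i then scal (M i j * M' p q) * E p j else 0)"
    unfolding sum_subtractf[symmetric] by (intro sum.cong refl) (auto simp: algebra_simps)
  also have "(\<Sum>i\<in>{1..l}. \<Sum>j\<in>{1..l}. \<Sum>p\<in>{1..l}. \<Sum>q\<in>{1..l}. if p = j then scal (M i j * M' p q) * E i q else 0)
     = (\<Sum>i\<in>{1..l}. \<Sum>q\<in>{1..l}. scal (\<Sum>j\<in>{1..l}. M i j * M' j q) * E i q)"
  proof (rule sum.cong[OF refl])
    fix i
    have "(\<Sum>p\<in>{1..l}. \<Sum>q\<in>{1..l}. if p = j then scal (M i j * M' p q) * E i q else 0) = (\<Sum>q\<in>{1..l}. scal (M i j * M' j q) * E i q)"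
      if "j \<in> {1..l}" for j
      using that by (subst sum.swap) simp
    then have "(\<Sum>j\<in>{1..l}. \<Sum>p\<in>{1..l}. \<Sum>q\<in>{1..l}. if p = j then scal (M i j * M' p q) * E i q else 0)
      = (\<Sum>j\<in>{1..l}. \<Sum>q\<in>{1..l}. scal (M i j * M' j q) * E i q)" by (rule sum.cong[OF refl])
    also have "\<dots> = (\<Sum>q\<in>{1..l}. \<Sum>j\<in>{1..l}. scal (M i j * M' j q) * E i q)" by (rule sum.swap)
    also have "\<dots> = (\<Sum>q\<in>{1..l}. scal (\<Sum>j\<in>{1..l}. M i j * M' j q) * E i q)"
      by (simp add: scal_sum sum_distrib_right)
    finally show "(\<Sum>j\<in>{1..l}. \<Sum>p\<in>{1..l}. \<Sum>q\<in>{1..l}. if p = j then scal (M i j * M' p q) * E i q else 0) = \<dots>" .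
  qed
  also have "(\<Sum>i\<in>{1..l}. \<Sum>j\<in>{1..l}. \<Sum>p\<in>{1..l}. \<Sum>q\<in>{1..l}. if q = i then scal (M i j * M' p q) * E p j else 0)
     = (\<Sum>p\<in>{1..l}. \<Sum>j\<in>{1..l}. scal (\<Sum>i\<in>{1..l}. M' p i * M i j) * E p j)"
  proof -
    have "(\<Sum>i\<in>{1..l}. \<Sum>j\<in>{1..l}. \<Sum>p\<in>{1..l}. \<Sum>q\<in>{1..l}. if q = i then scal (M i j * M' p q) * E p j else 0)
      = (\<Sum>i\<in>{1..l}. \<Sum>j\<in>{1..l}. \<Sum>p\<in>{1..l}. scal (M' p i * M i j) * E p j)"
      by (intro sum.cong refl) (simp add: mult.commute)
    also have "\<dots> = (\<Sum>i\<in>{1..l}. \<Sum>p\<in>{1..l}. \<Sum>j\<in>{1..l}. scal (M' p i * M i j) * E p j)"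
      by (intro sum.cong refl sum.swap)
    also have "\<dots> = (\<Sum>p\<in>{1..l}. \<Sum>i\<in>{1..l}. \<Sum>j\<in>{1..l}. scal (M' p i * M i j) * E p j)" by (rule sum.swap)
    also have "\<dots> = (\<Sum>p\<in>{1..l}. \<Sum>j\<in>{1..l}. \<Sum>i\<in>{1..l}. scal (M' p i * M i j) * E p j)"
      by (intro sum.cong refl sum.swap)
    also have "\<dots> = (\<Sum>p\<in>{1..l}. \<Sum>j\<in>{1..l}. scal (\<Sum>i\<in>{1..l}. M' p i * M i j) * E p j)"
      by (simp add: scal_sum sum_distrib_right)
    finally show ?thesis .
  qed
  also have "(\<Sum>i\<in>{1..l}. \<Sum>q\<in>{1..l}. scal (\<Sum>j\<in>{1..l}. M i j * M' j q) * E i q)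
      - (\<Sum>p\<in>{1..l}. \<Sum>j\<in>{1..l}. scal (\<Sum>i\<in>{1..l}. M' p i * M i j) * E p j) = pre (mbr l M M')"
    by (simp add: pre_def mbr_def sum_subtractf single_diff left_diff_distrib)
  finally show ?thesis .
qed

section \<open>Differential operators separate matrices\<close>

sublocale poly_space "\<lambda>v x. (x :: nat \<Rightarrow> complex) v" "\<lambda>x \<epsilon> u v. x v + \<epsilon> * u v"
  by unfold_locales auto

definition uvec :: "nat \<Rightarrow> nat \<Rightarrow> complex" where "uvec j v = (if v = j then 1 else 0)"

abbreviation "dd j \<equiv> Der (\<lambda>_. uvec j)"

text \<open>Since \<open>act\<close> applies the first letter first, the word
  \<open>a i * b i\<close> multiplies and then differentiates. Hence \<open>Ann\<close> has to be
  the multiplication and \<open>Cre\<close> the derivative in order that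
  \<open>br (a i) (b i)\<close> acts as 1.\<close>

fun op :: "weyl_gen \<Rightarrow> ((nat \<Rightarrow> complex) \<Rightarrow> complex) \<Rightarrow> (nat \<Rightarrow> complex) \<Rightarrow> complex" where
  "op (Ann i) f = (\<lambda>x. x i * f x)"
| "op (Cre i) f = dd i f"

lemma pf_uvec: "poly_field (\<lambda>_. uvec j)"
  by (auto simp: poly_field_def intro: polyfun.const)

sublocale A: word_action "weyl_gens l" op polyfun
proof
  fix x f c assume f: "f \<in> polyfun"
  show "op x f \<in> polyfun"
    by (cases x) (auto intro!: polyfun.mult f polyfun.coord Der_polyfun pf_uvec)
  show "op x (\<lambda>a. c * f a) = (\<lambda>a. c * op x f a)"
    using f by (cases x) (auto simp: Der_scale)
  fix g assume "g \<in> polyfun"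
  then show "op x (\<lambda>a. f a + g a) = (\<lambda>a. op x f a + op x g a)"
    using f by (cases x) (auto simp: Der_add algebra_simps)
qed (auto intro: polyfun.intros polyfun_scale)

lemma dd_mult: "f \<in> polyfun \<Longrightarrow> dd j (\<lambda>x. x i * f x) = (\<lambda>x. x i * dd j f x + (if i = j then f x else 0))"
  using Der_mult[OF coord[of i], of f "\<lambda>_. uvec j"] Der_coord[of "\<lambda>_. uvec j" i] by (auto simp: uvec_def)

lemma dd_comm: "f \<in> polyfun \<Longrightarrow> dd i (dd j f) x = dd j (dd i f) x"
  using Der_bracket[OF pf_uvec pf_uvec, of i j "\<lambda>_ _. 0" f x] Der_linear[of "\<lambda>_ _. 0" 0 "\<lambda>_. uvec j" 0 "\<lambda>_. uvec j" f x]
  by simp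

lemma act_rel:
  assumes "r \<in> weyl_rels l" and f: "f \<in> polyfun"
  shows "act op r f = (\<lambda>x. 0)"
proof -
  have 2: "act op (letter x * letter y) f = op y (op x f)" if "x \<in> weyl_gens l" "y \<in> weyl_gens l" for x y
    using A.act_mult[of "letter x" "letter y" f] that f by simp
  have one: "act op (if i = j then 1 else 0) f = (\<lambda>x. if i = j then f x else 0)" for i j :: nat
    by auto
  from assms(1) show ?thesis
    unfolding weyl_rels_def
    by (auto simp: A.act_diff_left 2 gens one dd_mult f dd_comm intro!: ext)
qed

sublocale PA: presentation_action "weyl_gens l" "weyl_rels l" op polyfun
  by unfold_locales (rule act_rel)

text \<open>\<open>- E i j\<close> acts as \<open>x_i d/dx_j\<close> plus half the Kronecker delta.
  Applying it to the coordinate \<open>x_r\<close> and evaluating at the basis vector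
  \<open>s\<close> reads off the coefficient; the constant is measured on the function 1 and
  subtracted.\<close>

definition mat :: "(weyl_gen word \<Rightarrow>\<^sub>0 complex) \<Rightarrow> nat \<Rightarrow> nat \<Rightarrow> complex" where
  "mat p s r = - (act op p (\<lambda>x. x r) (uvec s) - (if s = r then act op p (\<lambda>x. 1) (\<lambda>_. 0) else 0))"

lemma mat_add: "mat (p + q) s r = mat p s r + mat q s r"
  by (simp add: mat_def A.act_add_left)

lemma mat_scal: "mat (scal c * p) s r = c * mat p s r"
  by (simp add: mat_def A.act_scal algebra_simps)

lemma mat_zero: "mat 0 s r = 0"
  by (simp add: mat_def)

lemma mat_diff: "mat (p - q) s r = mat p s r - mat q s r"
  using mat_add[of "p - q" q] by simp

lemma mat_sum: "mat (\<Sum>i\<in>A. p i) s r = (\<Sum>i\<in>A. mat (p i) s r)"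
  by (induction A rule: infinite_finite_induct) (auto simp: mat_zero mat_add)

lemma mat_I: "p \<in> W.I \<Longrightarrow> mat p s r = 0"
  by (simp add: mat_def PA.act_I polyfun.coord polyfun.const)

lemma mat_E: "i \<in> {1..l} \<Longrightarrow> j \<in> {1..l} \<Longrightarrow> mat (E i j) s r = munit i j s r"
proof -
  assume ij: "i \<in> {1..l}" "j \<in> {1..l}"
  have 2: "act op (letter x * letter y) f = op y (op x f)" if "x \<in> weyl_gens l" "y \<in> weyl_gens l" "f \<in> polyfun" for x y f
    using A.act_mult[of "letter x" "letter y" f] that by simp
  have c: "dd j (\<lambda>x. x r) = (\<lambda>x. if r = j then 1 else 0)" for r j
    using Der_coord[of "\<lambda>_. uvec j" r] by (auto simp: uvec_def)
  have k: "dd j (\<lambda>x. 1) = (\<lambda>x. 0)" for j by (rule ext) simp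
  have "act op (a i * b j + b j * a i) (\<lambda>x. x r) (uvec s) = 2 * (if r = j \<and> s = i then 1 else 0) + (if i = j \<and> s = r then 1 else 0)"
    using ij by (auto simp: A.act_add_left 2 gens polyfun.coord dd_mult c uvec_def)
  moreover have "act op (a i * b j + b j * a i) (\<lambda>x. 1) (\<lambda>_. 0) = (if i = j then 1 else 0)"
    using ij dd_mult[OF polyfun.const[of 1], of j i] by (auto simp: A.act_add_left 2 gens polyfun.const k)
  ultimately show ?thesis
    by (auto simp: mat_def E_def A.act_scal munit_def)
qed

lemma mat_pre: "s \<in> {1..l} \<Longrightarrow> r \<in> {1..l} \<Longrightarrow> mat (pre M) s r = M s r"
proof -
  assume sr: "s \<in> {1..l}" "r \<in> {1..l}"
  have "mat (pre M) s r = (\<Sum>i\<in>{1..l}. \<Sum>j\<in>{1..l}. M i j * munit i j s r)"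
    unfolding pre_def mat_sum mat_scal by (intro sum.cong refl) (simp add: mat_E)
  also have "\<dots> = (\<Sum>i\<in>{1..l}. \<Sum>j\<in>{1..l}. if j = r then if i = s then M s r else 0 else 0)"
    by (intro sum.cong refl) (auto simp: munit_def)
  also have "\<dots> = M s r" using sr by simp
  finally show ?thesis .
qed

end

section \<open>The structure of the realization\<close>

definition mdiag :: "(nat \<Rightarrow> complex) \<Rightarrow> nat \<Rightarrow> nat \<Rightarrow> complex" where
  "mdiag d i j = (if i = j then d i else 0)"

definition hdiff :: "nat \<Rightarrow> nat \<Rightarrow> nat \<Rightarrow> nat \<Rightarrow> complex" where
  "hdiff p q i j = munit p p i j - munit q q i j"

lemma mbr_munit: "j \<in> {1..l} \<Longrightarrow> i \<in> {1..l} \<Longrightarrow>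
    mbr l (munit i j) (munit p q) x y = (if j = p then munit i q x y else 0) - (if q = i then munit p j x y else 0)"
proof -
  assume ij: "j \<in> {1..l}" "i \<in> {1..l}"
  have "(\<Sum>k\<in>{1..l}. munit i j x k * munit p q k y) = (\<Sum>k\<in>{1..l}. if k = j then (if j = p then munit i q x y else 0) else 0)"
    by (intro sum.cong refl) (auto simp: munit_def)
  moreover have "(\<Sum>k\<in>{1..l}. munit p q x k * munit i j k y) = (\<Sum>k\<in>{1..l}. if k = i then (if q = i then munit p j x y else 0) else 0)"
    by (intro sum.cong refl) (auto simp: munit_def)
  ultimately show ?thesis using ij by (simp add: mbr_def sum_subtractf)
qed

lemma mbr_mdiag: "x \<in> {1..l} \<Longrightarrow> y \<in> {1..l} \<Longrightarrow> mbr l (mdiag d) M x y = (d x - d y) * M x y"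
proof -
  assume xy: "x \<in> {1..l}" "y \<in> {1..l}"
  have "(\<Sum>k\<in>{1..l}. mdiag d x k * M k y) = (\<Sum>k\<in>{1..l}. if k = x then d x * M x y else 0)"
    by (intro sum.cong refl) (auto simp: mdiag_def)
  moreover have "(\<Sum>k\<in>{1..l}. M x k * mdiag d k y) = (\<Sum>k\<in>{1..l}. if k = y then M x y * d y else 0)"
    by (intro sum.cong refl) (auto simp: mdiag_def)
  ultimately show ?thesis using xy by (simp add: mbr_def sum_subtractf algebra_simps)
qed

lemma mtr_simps:
  "mtr l (\<lambda>i j. M i j + M' i j) = mtr l M + mtr l M'" "mtr l (\<lambda>i j. M i j - M' i j) = mtr l M - mtr l M'"
  "mtr l (\<lambda>i j. c * M i j) = c * mtr l M" "mtr l (\<lambda>i j. - M i j) = - mtr l M" "mtr l (\<lambda>i j. 0) = 0"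
  "mtr l (mdiag d) = (\<Sum>i\<in>{1..l}. d i)"
  by (simp_all add: mtr_def sum.distrib sum_subtractf sum_distrib_left sum_negf mdiag_def)

lemma mtr_munit: "p \<in> {1..l} \<Longrightarrow> mtr l (munit p q) = (if p = q then 1 else 0)"
proof -
  assume "p \<in> {1..l}"
  moreover have "mtr l (munit p q) = (\<Sum>i\<in>{1..l}. if i = p then if p = q then 1 else 0 else 0)"
    unfolding mtr_def by (intro sum.cong refl) (auto simp: munit_def)
  ultimately show ?thesis by simp
qed

lemma mtr_hdiff: "p \<in> {1..l} \<Longrightarrow> q \<in> {1..l} \<Longrightarrow> mtr l (hdiff p q) = 0"
  unfolding hdiff_def[abs_def] by (simp add: mtr_simps mtr_munit)

text \<open>Traceless matrices are spanned by off-diagonal units and differences of diagonal units.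
  The rule \<open>cong\<close> is there because matrices are functions on all of \<open>nat\<close>,
  and only the entries with indices up to \<open>l\<close> count.\<close>

lemma traceless_induct [consumes 1, case_names cong zero add scale unit diag]:
  assumes tr: "mtr l M = 0"
    and cong: "\<And>M M'. P M \<Longrightarrow> (\<And>i j. i \<in> {1..l} \<Longrightarrow> j \<in> {1..l} \<Longrightarrow> M i j = M' i j) \<Longrightarrow> P M'"
    and zero: "P (\<lambda>i j. 0)"
    and add: "\<And>M M'. P M \<Longrightarrow> P M' \<Longrightarrow> mtr l M = 0 \<Longrightarrow> mtr l M' = 0 \<Longrightarrow> P (\<lambda>i j. M i j + M' i j)"
    and scale: "\<And>c M. P M \<Longrightarrow> mtr l M = 0 \<Longrightarrow> P (\<lambda>i j. c * M i j)"
    and unit: "\<And>p q. p \<in> {1..l} \<Longrightarrow> q \<in> {1..l} \<Longrightarrow> p \<noteq> q \<Longrightarrow> P (munit p q)"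
    and diag: "\<And>p q. p \<in> {1..l} \<Longrightarrow> q \<in> {1..l} \<Longrightarrow> p \<noteq> q \<Longrightarrow> P (hdiff p q)"
  shows "P M"
proof -
  \<comment> \<open>Each diagonal unit is replaced by its difference with the first one. In the
    expansion of \<open>M\<close> this subtracts the trace of \<open>M\<close> times the unit at
    \<open>(1, 1)\<close>, which is zero.\<close>
  define f where "f x i j = (case x of (p, q) \<Rightarrow> if p = q then hdiff p 1 i j else munit p q i j)" for x i j
  have fP: "P (f x) \<and> mtr l (f x) = 0" if "x \<in> {1..l} \<times> {1..l}" for x
  proof -
    obtain p q where x: "x = (p, q)" by force
    have pq: "p \<in> {1..l}" "q \<in> {1..l}" "1 \<in> {1..l}" using that x by auto
    consider "p \<noteq> q" | "p = q" "p \<noteq> 1" | "p = 1" "q = 1" by blast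
    then show ?thesis
    proof cases
      case 1
      then have "f x = munit p q" by (auto simp: f_def x intro!: ext)
      then show ?thesis using 1 pq unit by (simp add: mtr_munit)
    next
      case 2
      then have "f x = hdiff p 1" by (auto simp: f_def x intro!: ext)
      then show ?thesis using diag[of p 1] 2 pq mtr_hdiff by simp
    next
      case 3
      then have "f x = (\<lambda>i j. 0)" by (auto simp: f_def x hdiff_def intro!: ext)
      then show ?thesis using zero by (simp add: mtr_simps)
    qed
  qed
  have "P (\<lambda>i j. \<Sum>x\<in>A. c x * f x i j) \<and> mtr l (\<lambda>i j. \<Sum>x\<in>A. c x * f x i j) = 0"
    if "finite A" "A \<subseteq> {1..l} \<times> {1..l}" for A and c :: "nat \<times> nat \<Rightarrow> complex"
    using that
  proof (induction rule: finite_induct)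
    case empty
    then show ?case using zero by (simp add: mtr_simps)
  next
    case (insert x A)
    then have "P (\<lambda>i j. c x * f x i j) \<and> mtr l (\<lambda>i j. c x * f x i j) = 0"
      using fP[of x] scale by (simp add: mtr_simps)
    then show ?case using insert add[of "\<lambda>i j. c x * f x i j"] by (simp add: mtr_simps)
  qed
  from this[of "{1..l} \<times> {1..l}" "\<lambda>(p, q). M p q"]
  have P: "P (\<lambda>i j. \<Sum>x\<in>{1..l} \<times> {1..l}. (case x of (p, q) \<Rightarrow> M p q) * f x i j)" by simp
  show ?thesis
  proof (rule cong[OF P])
    fix i j assume ij: "i \<in> {1..l}" "j \<in> {1..l}"
    have "(\<Sum>x\<in>{1..l} \<times> {1..l}. (case x of (p, q) \<Rightarrow> M p q) * f x i j)
        = (\<Sum>p\<in>{1..l}. \<Sum>q\<in>{1..l}. M p q * f (p, q) i j)"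
      by (simp add: sum.cartesian_product split_def)
    also have "\<dots> = (\<Sum>p\<in>{1..l}. \<Sum>q\<in>{1..l}. (if q = j then if p = i then M i j else 0 else 0) - (if q = p then M p p * munit 1 1 i j else 0))"
      by (intro sum.cong refl) (auto simp: f_def munit_def hdiff_def algebra_simps)
    also have "\<dots> = M i j - (\<Sum>p\<in>{1..l}. M p p * munit 1 1 i j)"
      using ij by (simp add: sum_subtractf)
    also have "\<dots> = M i j" using tr by (simp add: mtr_def flip: sum_distrib_right)
    finally show "(\<Sum>x\<in>{1..l} \<times> {1..l}. (case x of (p, q) \<Rightarrow> M p q) * f x i j) = M i j" .
  qed
qed

context weyl_alg
begin

definition iota :: "(nat \<Rightarrow> nat \<Rightarrow> complex) \<Rightarrow> weyl_elt" where "iota M = W.Q (pre M)"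

text \<open>Injectivity comes from \<open>mat\<close>, which vanishes on the ideal of relations and
  recovers the entries.\<close>

lemma iota_eq: "iota M = iota M' \<longleftrightarrow> (\<forall>i\<in>{1..l}. \<forall>j\<in>{1..l}. M i j = M' i j)"
proof
  assume "iota M = iota M'"
  then have "pre M - pre M' \<in> W.I" by (simp add: iota_def W.Q_eq)
  then have m: "mat (pre M) i j - mat (pre M') i j = 0" for i j
    using mat_I[of "pre M - pre M'" i j] by (simp only: mat_diff)
  have "M i j = M' i j" if "i \<in> {1..l}" "j \<in> {1..l}" for i j
    using m[of i j] unfolding mat_pre[OF that] by simp
  then show "\<forall>i\<in>{1..l}. \<forall>j\<in>{1..l}. M i j = M' i j" by blast
next
  assume "\<forall>i\<in>{1..l}. \<forall>j\<in>{1..l}. M i j = M' i j"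
  then have "pre M = pre M'" by (intro pre_cong) auto
  then show "iota M = iota M'" by (simp add: iota_def)
qed

lemma iota_cong: "(\<And>i j. i \<in> {1..l} \<Longrightarrow> j \<in> {1..l} \<Longrightarrow> M i j = M' i j) \<Longrightarrow> iota M = iota M'"
  by (simp add: iota_eq)

lemma sl_sel:
  "ring.add (sl l) = ring.add W.A" "ring.zero (sl l) = ring.zero W.A" "smult (sl l) = smult W.A"
  "bracket (sl l) x y = x \<otimes>\<^bsub>W.A\<^esub> y \<ominus>\<^bsub>W.A\<^esub> y \<otimes>\<^bsub>W.A\<^esub> x"
  by (simp_all add: sl_def lie_generated_def commutator_lie_def module.defs lie_algebra.defs weyl_eq)

lemma comm_sel:
  "carrier (commutator_lie (weyl l)) = carrier W.A"
  "ring.add (commutator_lie (weyl l)) = ring.add W.A" "ring.zero (commutator_lie (weyl l)) = ring.zero W.A"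
  "smult (commutator_lie (weyl l)) = smult W.A" "bracket (commutator_lie (weyl l)) = bracket (sl l)"
  by (simp_all add: sl_def lie_generated_def commutator_lie_def module.defs lie_algebra.defs weyl_eq)

lemma iota_ops:
  "iota M \<oplus>\<^bsub>sl l\<^esub> iota M' = iota (\<lambda>i j. M i j + M' i j)"
  "c \<odot>\<^bsub>sl l\<^esub> iota M = iota (\<lambda>i j. c * M i j)"
  "\<zero>\<^bsub>sl l\<^esub> = iota (\<lambda>i j. 0)"
  "bracket (sl l) (iota M) (iota M') = iota (mbr l M M')"
proof -
  show "iota M \<oplus>\<^bsub>sl l\<^esub> iota M' = iota (\<lambda>i j. M i j + M' i j)"
    by (simp add: sl_sel iota_def W.Q_ops pre_add)
  show "c \<odot>\<^bsub>sl l\<^esub> iota M = iota (\<lambda>i j. c * M i j)"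
    by (simp add: sl_sel iota_def pre_scale)
  have "pre (\<lambda>i j. 0) = 0" using pre_scale[of 0 "\<lambda>i j. 0"] by simp
  then show "\<zero>\<^bsub>sl l\<^esub> = iota (\<lambda>i j. 0)" by (simp add: sl_sel iota_def W.Q_ops)
  have "bracket (sl l) (iota M) (iota M') = W.Q (br (pre M) (pre M'))"
    by (simp add: sl_sel iota_def W.Q_ops W.Q_minus)
  also have "\<dots> = iota (mbr l M M')"
    unfolding iota_def by (subst W.Q_cg) (auto intro: br_pre)
  finally show "bracket (sl l) (iota M) (iota M') = iota (mbr l M M')" .
qed

lemma root_vec_iota: "i \<in> {1..l} \<Longrightarrow> j \<in> {1..l} \<Longrightarrow> root_vec l i j = iota (\<lambda>x y. - munit i j x y)"
proof -
  assume ij: "i \<in> {1..l}" "j \<in> {1..l}"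
  have "pre (\<lambda>x y. - munit i j x y) = scal (- 1) * E i j"
    using pre_scale[of "- 1" "munit i j"] pre_unit[OF ij] by simp
  then show ?thesis using ij ab_car
    by (simp add: root_vec_def normal_order_def weyl_a_def weyl_a_star_def weyl_eq W.presented_gen_Q W.Q_ops
        iota_def E_def scal_assoc)
qed

lemma cartan_h_iota: "i \<in> {1..l} \<Longrightarrow> cartan_h l i = iota (munit i i)"
proof -
  assume i: "i \<in> {1..l}"
  then show ?thesis using ab_car
    by (simp add: cartan_h_def normal_order_def weyl_a_def weyl_a_star_def weyl_eq W.presented_gen_Q W.Q_ops
        W.Q_uminus iota_def pre_unit E_def scal_uminus)
qed

lemma iota_carrier_A: "iota M \<in> carrier W.A" by (simp add: iota_def)

text \<open>The traceless matrices contain the generators and are closed under brackets. Conversely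
  the generators are the off-diagonal units up to sign, and brackets of opposite ones produce the
  diagonal differences.\<close>

lemma sl_carrier: "carrier (sl l) = {iota M | M. mtr l M = 0}"
proof
  let ?X = "{root_vec l i j | i j. i \<in> {1..l} \<and> j \<in> {1..l} \<and> i \<noteq> j}"
  have car: "carrier (sl l) = \<Inter>{H. lie_subalgebra H (commutator_lie (weyl l)) \<and> ?X \<subseteq> H}"
    by (simp add: sl_def lie_generated_def)
  have sub: "lie_subalgebra H (commutator_lie (weyl l)) \<longleftrightarrow> H \<subseteq> carrier W.A \<and> \<zero>\<^bsub>sl l\<^esub> \<in> H \<and>
     (\<forall>x\<in>H. \<forall>y\<in>H. x \<oplus>\<^bsub>sl l\<^esub> y \<in> H) \<and> (\<forall>c. \<forall>x\<in>H. c \<odot>\<^bsub>sl l\<^esub> x \<in> H) \<and> (\<forall>x\<in>H. \<forall>y\<in>H. bracket (sl l) x y \<in> H)" for H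
    by (simp add: lie_subalgebra_def linear_subspace_def comm_sel sl_sel(1-3))
  show "carrier (sl l) \<subseteq> {iota M | M. mtr l M = 0}"
  proof -
    let ?H = "{iota M | M. mtr l M = 0}"
    have "lie_subalgebra ?H (commutator_lie (weyl l))"
      unfolding sub
    proof (intro conjI ballI allI)
      show "?H \<subseteq> carrier W.A" using iota_carrier_A by blast
      show "\<zero>\<^bsub>sl l\<^esub> \<in> ?H" unfolding iota_ops using mtr_simps(5) by blast
      show "x \<oplus>\<^bsub>sl l\<^esub> y \<in> ?H" if xy: "x \<in> ?H" "y \<in> ?H" for x y
      proof -
        obtain M M' where "x = iota M" "y = iota M'" "mtr l M = 0" "mtr l M' = 0" using xy by blast
        then show ?thesis using mtr_simps(1)[of l M M'] by (auto simp: iota_ops)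
      qed
      show "c \<odot>\<^bsub>sl l\<^esub> x \<in> ?H" if xy: "x \<in> ?H" for c x
      proof -
        obtain M where "x = iota M" "mtr l M = 0" using xy by blast
        then show ?thesis using mtr_simps(3)[of l c M] by (auto simp: iota_ops)
      qed
      show "bracket (sl l) x y \<in> ?H" if xy: "x \<in> ?H" "y \<in> ?H" for x y
      proof -
        obtain M M' where "x = iota M" "y = iota M'" using xy by blast
        then show ?thesis using mtr_mbr[of l M M'] by (auto simp: iota_ops)
      qed
    qed
    moreover have "?X \<subseteq> ?H"
    proof
      fix x assume "x \<in> ?X"
      then obtain i j where "x = root_vec l i j" "i \<in> {1..l}" "j \<in> {1..l}" "i \<noteq> j" by blast
      then show "x \<in> ?H" using mtr_simps(4)[of l "munit i j"] by (auto simp: root_vec_iota mtr_munit)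
    qed
    ultimately show ?thesis unfolding car by blast
  qed
  show "{iota M | M. mtr l M = 0} \<subseteq> carrier (sl l)"
    unfolding car
  proof clarify
    fix M H assume tr: "mtr l M = 0" and H: "lie_subalgebra H (commutator_lie (weyl l))" "?X \<subseteq> H"
    have u: "iota (munit p q) \<in> H" if "p \<in> {1..l}" "q \<in> {1..l}" "p \<noteq> q" for p q
    proof -
      have "root_vec l p q \<in> H" using H(2) that by blast
      then have "- 1 \<odot>\<^bsub>sl l\<^esub> root_vec l p q \<in> H" using H(1) unfolding sub by blast
      then show ?thesis using that by (simp add: root_vec_iota iota_ops)
    qed
    from tr show "iota M \<in> H"
    proof (induction rule: traceless_induct)
      case (cong M M')
      then show ?case using iota_cong[of M M'] by simp
    next
      case zero
      then show ?case using H(1) unfolding sub iota_ops by blast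
    next
      case (add M M')
      then show ?case using H(1) unfolding sub by (metis iota_ops(1))
    next
      case (scale c M)
      then show ?case using H(1) unfolding sub by (metis iota_ops(2))
    next
      case (unit p q)
      then show ?case by (rule u)
    next
      case (diag p q)
      then have "bracket (sl l) (iota (munit p q)) (iota (munit q p)) \<in> H"
        using u[of p q] u[of q p] H(1) unfolding sub by simp
      moreover have "mbr l (munit p q) (munit q p) = hdiff p q"
        using diag by (intro ext) (simp add: mbr_munit hdiff_def)
      ultimately show ?case by (simp add: iota_ops)
    qed
  qed
qed

lemma iota_sl [simp]: "mtr l M = 0 \<Longrightarrow> iota M \<in> carrier (sl l)"
  unfolding sl_carrier by blast

lemma sl_abelian_monoid: "abelian_monoid (sl l)"
proof (rule abelian_monoidI)
  interpret ring W.A by (rule W.ring_A)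
  fix x y z assume "x \<in> carrier (sl l)" "y \<in> carrier (sl l)" "z \<in> carrier (sl l)"
  then obtain M M' M'' where M: "x = iota M" "y = iota M'" "z = iota M''" "mtr l M = 0" "mtr l M' = 0"
    unfolding sl_carrier by blast
  show "x \<oplus>\<^bsub>sl l\<^esub> y \<in> carrier (sl l)" using M mtr_simps(1)[of l M M'] by (simp add: iota_ops)
  show "x \<oplus>\<^bsub>sl l\<^esub> y \<oplus>\<^bsub>sl l\<^esub> z = x \<oplus>\<^bsub>sl l\<^esub> (y \<oplus>\<^bsub>sl l\<^esub> z)" unfolding M iota_ops by (simp add: add.assoc)
  show "\<zero>\<^bsub>sl l\<^esub> \<oplus>\<^bsub>sl l\<^esub> x = x" unfolding M iota_ops by simp
  show "x \<oplus>\<^bsub>sl l\<^esub> y = y \<oplus>\<^bsub>sl l\<^esub> x" unfolding M iota_ops by (simp add: add.commute)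
next
  show "\<zero>\<^bsub>sl l\<^esub> \<in> carrier (sl l)" unfolding iota_ops by (simp add: mtr_simps)
qed

lemma sl_finsum: "finite B \<Longrightarrow> (\<And>x. x \<in> B \<Longrightarrow> mtr l (M x) = 0) \<Longrightarrow>
   finsum (sl l) (\<lambda>x. iota (M x)) B = iota (\<lambda>i j. \<Sum>x\<in>B. M x i j) \<and> mtr l (\<lambda>i j. \<Sum>x\<in>B. M x i j) = 0"
proof (induction B rule: finite_induct)
  case empty
  interpret abelian_monoid "sl l" by (rule sl_abelian_monoid)
  show ?case by (simp add: iota_ops mtr_simps)
next
  case (insert x B)
  interpret abelian_monoid "sl l" by (rule sl_abelian_monoid)
  show ?case using insert by (simp add: iota_ops Pi_def mtr_simps)
qed

lemma weyl_finsum: "finite B \<Longrightarrow> finsum (weyl l) (\<lambda>x. iota (M x)) B = iota (\<lambda>i j. \<Sum>x\<in>B. M x i j)"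
proof (induction B rule: finite_induct)
  case empty
  interpret ring W.A by (rule W.ring_A)
  show ?case using iota_ops(3) by (simp add: weyl_eq sl_sel)
next
  case (insert x B)
  interpret ring W.A by (rule W.ring_A)
  show ?case using insert iota_ops(1) by (simp add: weyl_eq sl_sel Pi_def iota_carrier_A)
qed

lemma linear_subspace_iota: "linear_subspace H (sl l) \<longleftrightarrow> H \<subseteq> carrier (sl l) \<and> \<zero>\<^bsub>sl l\<^esub> \<in> H \<and>
     (\<forall>x\<in>H. \<forall>y\<in>H. x \<oplus>\<^bsub>sl l\<^esub> y \<in> H) \<and> (\<forall>c. \<forall>x\<in>H. c \<odot>\<^bsub>sl l\<^esub> x \<in> H)"
  by (simp add: linear_subspace_def)

lemma cartan_gen: "i \<in> {1..l} \<Longrightarrow> j \<in> {1..l} \<Longrightarrow> cartan_h l i \<ominus>\<^bsub>weyl l\<^esub> cartan_h l j = iota (hdiff i j)"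
  unfolding hdiff_def[abs_def] by (simp add: cartan_h_iota weyl_eq iota_def W.Q_minus pre_diff)

lemma cartan_eq: "cartan l = {iota (mdiag d) | d. (\<Sum>i\<in>{1..l}. d i) = 0}"
proof
  let ?H = "{iota (mdiag d) | d. (\<Sum>i\<in>{1..l}. d i) = 0}"
  let ?X = "{cartan_h l i \<ominus>\<^bsub>weyl l\<^esub> cartan_h l j | i j. i \<in> {1..l} \<and> j \<in> {1..l}}"
  have "linear_subspace ?H (sl l)" unfolding linear_subspace_iota
  proof (intro conjI ballI allI)
    show "?H \<subseteq> carrier (sl l)" by (auto simp: mtr_simps)
    have "(\<lambda>i j. 0) = mdiag (\<lambda>i. 0)" by (intro ext) (simp add: mdiag_def)
    then show "\<zero>\<^bsub>sl l\<^esub> \<in> ?H" unfolding iota_ops by (auto intro!: exI[of _ "\<lambda>i. 0"])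
    fix x assume "x \<in> ?H"
    then obtain d where d: "x = iota (mdiag d)" "(\<Sum>i\<in>{1..l}. d i) = 0" by blast
    show "c \<odot>\<^bsub>sl l\<^esub> x \<in> ?H" for c
    proof -
      have "(\<lambda>i j. c * mdiag d i j) = mdiag (\<lambda>i. c * d i)" by (intro ext) (simp add: mdiag_def)
      then show ?thesis unfolding d iota_ops using d(2) by (auto intro!: exI[of _ "\<lambda>i. c * d i"] simp flip: sum_distrib_left)
    qed
    fix y assume "y \<in> ?H"
    then obtain d' where d': "y = iota (mdiag d')" "(\<Sum>i\<in>{1..l}. d' i) = 0" by blast
    have "(\<lambda>i j. mdiag d i j + mdiag d' i j) = mdiag (\<lambda>i. d i + d' i)" by (intro ext) (simp add: mdiag_def)
    then show "x \<oplus>\<^bsub>sl l\<^esub> y \<in> ?H"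
      unfolding d d' iota_ops using d(2) d'(2) by (auto intro!: exI[of _ "\<lambda>i. d i + d' i"] simp: sum.distrib)
  qed
  moreover have "?X \<subseteq> ?H"
  proof clarify
    fix i j assume ij: "i \<in> {1..l}" "j \<in> {1..l}"
    have "hdiff i j = mdiag (\<lambda>k. (if k = i then 1 else 0) - (if k = j then 1 else 0))"
      by (intro ext) (simp add: hdiff_def munit_def mdiag_def)
    moreover have "(\<Sum>k\<in>{1..l}. (if k = i then 1 else 0) - (if k = j then 1 else (0::complex))) = 0"
      using ij by (simp add: sum_subtractf)
    ultimately show "\<exists>d. cartan_h l i \<ominus>\<^bsub>weyl l\<^esub> cartan_h l j = iota (mdiag d) \<and> (\<Sum>i\<in>{1..l}. d i) = 0"
      using ij cartan_gen by metis
  qed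
  ultimately show "cartan l \<subseteq> ?H" unfolding cartan_def linear_span_def by blast
  show "?H \<subseteq> cartan l" unfolding cartan_def linear_span_def
  proof clarify
    fix d :: "nat \<Rightarrow> complex" and H assume d: "(\<Sum>i\<in>{1..l}. d i) = 0" and H: "linear_subspace H (sl l)" "?X \<subseteq> H"
    have hd: "iota (hdiff i 1) \<in> H" if "i \<in> {1..l}" for i
    proof -
      have "1 \<in> {1..l}" using that by auto
      then have "cartan_h l i \<ominus>\<^bsub>weyl l\<^esub> cartan_h l 1 \<in> ?X" using that by blast
      then show ?thesis using H(2) that \<open>1 \<in> {1..l}\<close> cartan_gen by auto
    qed
    have "iota (\<lambda>i j. \<Sum>x\<in>B. d x * hdiff x 1 i j) \<in> H" if "finite B" "B \<subseteq> {1..l}" for B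
      using that
    proof (induction rule: finite_induct)
      case empty
      then show ?case using H(1) by (simp add: linear_subspace_iota iota_ops)
    next
      case (insert x B)
      then have "d x \<odot>\<^bsub>sl l\<^esub> iota (hdiff x 1) \<oplus>\<^bsub>sl l\<^esub> iota (\<lambda>i j. \<Sum>x\<in>B. d x * hdiff x 1 i j) \<in> H"
        using H(1) hd[of x] unfolding linear_subspace_iota by simp
      then show ?case using insert by (simp add: iota_ops)
    qed
    from this[of "{1..l}"] have "iota (\<lambda>i j. \<Sum>x\<in>{1..l}. d x * hdiff x 1 i j) \<in> H" by simp
    moreover have "iota (\<lambda>i j. \<Sum>x\<in>{1..l}. d x * hdiff x 1 i j) = iota (mdiag d)"
    proof (rule iota_cong)
      fix i j assume ij: "i \<in> {1..l}" "j \<in> {1..l}"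
      have "(\<Sum>x\<in>{1..l}. d x * hdiff x 1 i j) = (\<Sum>x\<in>{1..l}. (if x = i then mdiag d i j else 0) - d x * munit 1 1 i j)"
        by (intro sum.cong refl) (auto simp: hdiff_def munit_def mdiag_def)
      also have "\<dots> = mdiag d i j" using ij d by (simp add: sum_subtractf flip: sum_distrib_right)
      finally show "(\<Sum>x\<in>{1..l}. d x * hdiff x 1 i j) = mdiag d i j" .
    qed
    ultimately show "iota (mdiag d) \<in> H" by simp
  qed
qed

text \<open>The uniqueness of coordinates on which the description in \<open>eps\<close> depends is
  the injectivity of \<open>iota\<close>.\<close>

lemma eps_iota: "i \<in> {1..l} \<Longrightarrow> eps l i (iota (mdiag d)) = d i"
proof -
  assume i: "i \<in> {1..l}"
  have fs: "(\<Oplus>\<^bsub>weyl l\<^esub> j\<in>{1..l}. c j \<odot>\<^bsub>weyl l\<^esub> cartan_h l j) = iota (mdiag c)" for c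
  proof -
    interpret ring W.A by (rule W.ring_A)
    have "(\<Oplus>\<^bsub>weyl l\<^esub> j\<in>{1..l}. c j \<odot>\<^bsub>weyl l\<^esub> cartan_h l j) = (\<Oplus>\<^bsub>weyl l\<^esub> j\<in>{1..l}. iota (\<lambda>x y. c j * munit j j x y))"
      unfolding weyl_eq using iota_ops(2)
      by (intro finsum_cong') (auto simp: cartan_h_iota sl_sel iota_carrier_A)
    also have "\<dots> = iota (\<lambda>x y. \<Sum>j\<in>{1..l}. c j * munit j j x y)" by (rule weyl_finsum) simp
    also have "\<dots> = iota (mdiag c)"
    proof (rule iota_cong)
      fix x y assume "x \<in> {1..l}" "y \<in> {1..l}"
      moreover have "(\<Sum>j\<in>{1..l}. c j * munit j j x y) = (\<Sum>j\<in>{1..l}. if j = x then mdiag c x y else 0)"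
        by (intro sum.cong refl) (auto simp: munit_def mdiag_def)
      ultimately show "(\<Sum>j\<in>{1..l}. c j * munit j j x y) = mdiag c x y" by simp
    qed
    finally show ?thesis .
  qed
  have "c i = d i" if "iota (mdiag d) = iota (mdiag c)" for c
  proof -
    have "mdiag d i i = mdiag c i i" using that i unfolding iota_eq by blast
    then show ?thesis by (simp add: mdiag_def)
  qed
  then show ?thesis unfolding eps_def fs by (intro the_equality) blast+
qed

text \<open>A single Cartan element separates the root: \<open>h_p - h_q\<close> has eigenvalue 2 on
  the unit at \<open>(p, q)\<close> and on no other unit.\<close>

lemma root_space_sub:
  assumes pq: "p \<in> {1..l}" "q \<in> {1..l}" "p \<noteq> q" and x: "x \<in> root_space l (\<lambda>h. eps l p h - eps l q h)"
  shows "\<exists>c. x = c \<odot>\<^bsub>sl l\<^esub> iota (munit p q)"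
proof -
  obtain M where M: "x = iota M" using x by (auto simp: root_space_def sl_carrier)
  let ?d = "\<lambda>k. (if k = p then 1 else 0) - (if k = q then 1 else (0::complex))"
  have "(\<Sum>k\<in>{1..l}. ?d k) = 0" using pq by (simp add: sum_subtractf)
  then have "iota (mdiag ?d) \<in> cartan l" unfolding cartan_eq by blast
  then have "bracket (sl l) (iota (mdiag ?d)) x = (eps l p (iota (mdiag ?d)) - eps l q (iota (mdiag ?d))) \<odot>\<^bsub>sl l\<^esub> x"
    using x by (auto simp: root_space_def)
  then have "iota (mbr l (mdiag ?d) M) = iota (\<lambda>i j. 2 * M i j)"
    using pq unfolding M iota_ops by (simp add: eps_iota)
  then have e: "(?d i - ?d j) * M i j = 2 * M i j" if "i \<in> {1..l}" "j \<in> {1..l}" for i j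
    using that by (auto simp: iota_eq mbr_mdiag)
  have "M i j = M p q * munit p q i j" if "i \<in> {1..l}" "j \<in> {1..l}" for i j
    using e[OF that] pq(3) by (cases "i = p"; cases "j = q"; cases "i = q"; cases "j = p"; simp add: munit_def)
  then have "x = iota (\<lambda>i j. M p q * munit p q i j)" unfolding M by (rule iota_cong)
  then show ?thesis by (auto simp: iota_ops)
qed

text \<open>Reduces the claim that \<open>n_plus\<close> kills a vector to the matrix units above
  the diagonal.\<close>

lemma n_plus_least:
  assumes H: "linear_subspace H (sl l)" and u: "\<And>p q. 1 \<le> p \<Longrightarrow> p < q \<Longrightarrow> q \<le> l \<Longrightarrow> iota (munit p q) \<in> H"
  shows "n_plus l \<subseteq> H"
proof -
  have "root_space l (\<lambda>h. eps l p h - eps l q h) \<subseteq> H" if pq: "1 \<le> p" "p < q" "q \<le> l" for p q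
  proof
    fix x assume "x \<in> root_space l (\<lambda>h. eps l p h - eps l q h)"
    then obtain c where "x = c \<odot>\<^bsub>sl l\<^esub> iota (munit p q)" using root_space_sub[of p q x] pq by auto
    then show "x \<in> H" using u[OF pq] H by (simp add: linear_subspace_iota)
  qed
  then show ?thesis unfolding n_plus_def linear_span_def using H by blast
qed

end

section \<open>The normalized form is the trace form\<close>

definition mform :: "nat \<Rightarrow> (nat \<Rightarrow> nat \<Rightarrow> complex) \<Rightarrow> (nat \<Rightarrow> nat \<Rightarrow> complex) \<Rightarrow> complex" where
  "mform l M M' = (\<Sum>i\<in>{1..l}. \<Sum>j\<in>{1..l}. M i j * M' j i)"

lemma mform_add: "mform l (\<lambda>i j. M i j + N i j) P = mform l M P + mform l N P"
  by (simp add: mform_def distrib_right sum.distrib)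

lemma mform_scale: "mform l (\<lambda>i j. c * M i j) P = c * mform l M P"
  by (simp add: mform_def sum_distrib_left mult.assoc)

lemma mform_diff: "mform l (\<lambda>i j. M i j - N i j) P = mform l M P - mform l N P"
  by (simp add: mform_def left_diff_distrib sum_subtractf)

lemma mform_munit: "p \<in> {1..l} \<Longrightarrow> q \<in> {1..l} \<Longrightarrow> mform l (munit p q) M = M q p"
proof -
  assume pq: "p \<in> {1..l}" "q \<in> {1..l}"
  have "mform l (munit p q) M = (\<Sum>i\<in>{1..l}. \<Sum>j\<in>{1..l}. if j = q then if i = p then M q p else 0 else 0)"
    unfolding mform_def by (intro sum.cong refl) (auto simp: munit_def)
  then show ?thesis using pq by simp
qed

lemma mform_cong: "(\<And>i j. i \<in> {1..l} \<Longrightarrow> j \<in> {1..l} \<Longrightarrow> M i j = M' i j) \<Longrightarrow> mform l M N = mform l M' N"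
  unfolding mform_def by (intro sum.cong refl) simp

lemma mform_sym: "mform l M N = mform l N M"
  unfolding mform_def by (subst sum.swap) (simp add: mult.commute)

definition hd2 :: "nat \<Rightarrow> nat \<Rightarrow> nat \<Rightarrow> complex" where
  "hd2 p q k = (if k = p then 1 else 0) - (if k = q then 1 else 0)"

lemma hdiff_mdiag: "hdiff p q = mdiag (hd2 p q)"
  by (intro ext) (simp add: hdiff_def munit_def mdiag_def hd2_def)

lemma mbr_antisym: "mbr l M N i j = - mbr l N M i j"
  by (simp add: mbr_def flip: sum_negf)

context weyl_alg
begin

lemma mbr_hdiff_munit: "p \<in> {1..l} \<Longrightarrow> q \<in> {1..l} \<Longrightarrow>
   iota (mbr l (mdiag d) (munit p q)) = iota (\<lambda>i j. (d p - d q) * munit p q i j)"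
  by (rule iota_cong) (auto simp: mbr_mdiag munit_def)

lemma mbr_munit_hdiff: "p \<in> {1..l} \<Longrightarrow> q \<in> {1..l} \<Longrightarrow>
   mbr l (munit p q) (munit q p) = hdiff p q"
  by (intro ext) (simp add: mbr_munit hdiff_def)

text \<open>By invariance the Cartan subalgebra is orthogonal to all root vectors, and a root vector
  pairs only with its opposite. Brackets of units show that these pairings have a common value
  \<open>\<gamma>\<close>, so the form is \<open>\<gamma>\<close> times the trace form; the
  normalization forces \<open>\<gamma> = 1\<close>.\<close>

lemma form_trace:
  assumes B: "normalized_form l B" and l: "l \<ge> 2" and M: "mtr l M = 0" "mtr l M' = 0"
  shows "B (iota M) (iota M') = mform l M M'"
proof -
  define \<beta> where "\<beta> M N = B (iota M) (iota N)" for M N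
  have inv: "invariant_form (sl l) B" using B by (simp add: normalized_form_def)
  have add: "\<beta> M (\<lambda>i j. N i j + P i j) = \<beta> M N + \<beta> M P"
    and scale: "\<beta> M (\<lambda>i j. c * N i j) = c * \<beta> M N"
    and sym: "\<beta> M N = \<beta> N M" and inva: "\<beta> (mbr l M N) P = \<beta> M (mbr l N P)"
    if "mtr l M = 0" "mtr l N = 0" "mtr l P = 0" for M N P c
  proof -
    let ?C = "carrier (sl l)"
    have C: "iota M \<in> ?C" "iota N \<in> ?C" "iota P \<in> ?C" using that by simp_all
    have 1: "\<forall>x\<in>?C. \<forall>y\<in>?C. \<forall>z\<in>?C. B x (y \<oplus>\<^bsub>sl l\<^esub> z) = B x y + B x z"
      and 2: "\<forall>x\<in>?C. \<forall>c. \<forall>y\<in>?C. B x (c \<odot>\<^bsub>sl l\<^esub> y) = c * B x y"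
      and 3: "\<forall>x\<in>?C. \<forall>y\<in>?C. B x y = B y x"
      and 4: "\<forall>x\<in>?C. \<forall>y\<in>?C. \<forall>z\<in>?C. B (bracket (sl l) x y) z = B x (bracket (sl l) y z)"
      using inv unfolding invariant_form_def linear_functional_on_def by blast+
    have "B (iota M) (iota N \<oplus>\<^bsub>sl l\<^esub> iota P) = B (iota M) (iota N) + B (iota M) (iota P)"
      using 1 C by blast
    then show "\<beta> M (\<lambda>i j. N i j + P i j) = \<beta> M N + \<beta> M P" by (simp only: \<beta>_def iota_ops)
    have "B (iota M) (c \<odot>\<^bsub>sl l\<^esub> iota N) = c * B (iota M) (iota N)" using 2 C by blast
    then show "\<beta> M (\<lambda>i j. c * N i j) = c * \<beta> M N" by (simp only: \<beta>_def iota_ops)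
    show "\<beta> M N = \<beta> N M" unfolding \<beta>_def using 3 C by blast
    have "B (bracket (sl l) (iota M) (iota N)) (iota P) = B (iota M) (bracket (sl l) (iota N) (iota P))"
      using 4 C by blast
    then show "\<beta> (mbr l M N) P = \<beta> M (mbr l N P)" by (simp only: \<beta>_def iota_ops)
  qed
  have cong: "\<beta> M N = \<beta> M N'" if "iota N = iota N'" for M N N' using that by (simp add: \<beta>_def)
  have cong': "\<beta> N M = \<beta> N' M" if "iota N = iota N'" for M N N' using that by (simp add: \<beta>_def)
  have zero: "\<beta> M (\<lambda>i j. 0) = 0" if "mtr l M = 0" for M
    using scale[of M "\<lambda>i j. 0" "\<lambda>i j. 0" 0] that by (simp add: mtr_simps)
  have tu: "mtr l (munit p q) = 0" if "p \<in> {1..l}" "p \<noteq> q" for p q using that by (simp add: mtr_munit)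
  have th: "mtr l (mdiag (hd2 p q)) = 0" if "p \<in> {1..l}" "q \<in> {1..l}" for p q
    using mtr_hdiff[OF that] by (simp add: hdiff_mdiag)
  \<comment> \<open>The diagonal difference \<open>hd2 p q\<close> commutes with the diagonal matrix
    but has eigenvalue 2 on the unit; invariance compares the two.\<close>
  have c1: "\<beta> (mdiag d) (munit p q) = 0"
    if d: "mtr l (mdiag d) = 0" and pq: "p \<in> {1..l}" "q \<in> {1..l}" "p \<noteq> q" for d p q
  proof -
    have "\<beta> (mbr l (mdiag d) (mdiag (hd2 p q))) (munit p q) = \<beta> (mdiag d) (mbr l (mdiag (hd2 p q)) (munit p q))"
      by (rule inva[OF d th tu]) (use pq in auto)
    also have "\<dots> = \<beta> (mdiag d) (\<lambda>i j. (hd2 p q p - hd2 p q q) * munit p q i j)"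
      by (intro cong mbr_hdiff_munit pq)
    also have "\<dots> = 2 * \<beta> (mdiag d) (munit p q)"
      using scale[OF d tu tu, of p q p q] pq by (simp add: hd2_def)
    finally have "2 * \<beta> (mdiag d) (munit p q) = \<beta> (mbr l (mdiag d) (mdiag (hd2 p q))) (munit p q)" by simp
    also have "\<dots> = \<beta> (\<lambda>i j. 0) (munit p q)"
      by (intro cong' iota_cong) (auto simp: mbr_mdiag mdiag_def)
    also have "\<dots> = 0" using sym[of "\<lambda>i j. 0" "munit p q" "munit p q"] zero[of "munit p q"] tu[of p q] pq by (simp add: mtr_simps)
    finally show ?thesis by simp
  qed
  \<comment> \<open>The weights of two paired root vectors must cancel: \<open>hd2 i j\<close> has
    eigenvalue 2 on the first unit, and eigenvalue -2 only on the unit at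
    \<open>(j, i)\<close>.\<close>
  have c2: "\<beta> (munit i j) (munit p q) = 0"
    if ij: "i \<in> {1..l}" "j \<in> {1..l}" "i \<noteq> j" and pq: "p \<in> {1..l}" "q \<in> {1..l}" "p \<noteq> q" and ne: "\<not> (p = j \<and> q = i)"
    for i j p q
  proof -
    let ?e = "mdiag (hd2 i j)"
    have "\<beta> (mbr l (munit i j) ?e) (munit p q) = \<beta> (munit i j) (mbr l ?e (munit p q))"
      by (rule inva[OF tu th tu]) (use ij pq in auto)
    also have "\<dots> = \<beta> (munit i j) (\<lambda>x y. (hd2 i j p - hd2 i j q) * munit p q x y)"
      by (intro cong mbr_hdiff_munit pq)
    also have "\<dots> = (hd2 i j p - hd2 i j q) * \<beta> (munit i j) (munit p q)"
      by (rule scale[OF tu[OF ij(1,3)] tu[OF pq(1,3)] tu[OF pq(1,3)]])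
    finally have 1: "\<beta> (mbr l (munit i j) ?e) (munit p q) = (hd2 i j p - hd2 i j q) * \<beta> (munit i j) (munit p q)" .
    have "\<beta> (mbr l (munit i j) ?e) (munit p q) = \<beta> (\<lambda>x y. - 2 * munit i j x y) (munit p q)"
    proof (intro cong' iota_cong)
      fix x y assume xy: "x \<in> {1..l}" "y \<in> {1..l}"
      have "mbr l (munit i j) ?e x y = - ((hd2 i j x - hd2 i j y) * munit i j x y)"
        using mbr_antisym[of l "munit i j" ?e x y] mbr_mdiag[OF xy, of "hd2 i j" "munit i j"] by simp
      then show "mbr l (munit i j) ?e x y = - 2 * munit i j x y"
        using ij by (auto simp: munit_def hd2_def)
    qed
    also have "\<dots> = - 2 * \<beta> (munit i j) (munit p q)"
      using sym[of "\<lambda>x y. - 2 * munit i j x y" "munit p q" "munit p q"] sym[of "munit i j" "munit p q" "munit p q"]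
        scale[of "munit p q" "munit i j" "munit i j" "- 2"] tu[of i j] tu[of p q] ij pq by (simp add: mtr_simps)
    finally have "(hd2 i j p - hd2 i j q) * \<beta> (munit i j) (munit p q) = - 2 * \<beta> (munit i j) (munit p q)"
      using 1 by simp
    then have "(hd2 i j p - hd2 i j q + 2) * \<beta> (munit i j) (munit p q) = 0" by (simp add: algebra_simps)
    moreover have "hd2 i j p - hd2 i j q + 2 \<noteq> 0"
      using ij pq ne by (auto simp: hd2_def)
    ultimately show ?thesis by simp
  qed
  define c where "c i j = \<beta> (munit i j) (munit j i)" for i j
  have c3: "\<beta> (mdiag d) (mdiag (hd2 i j)) = (d i - d j) * c i j"
    if d: "mtr l (mdiag d) = 0" and ij: "i \<in> {1..l}" "j \<in> {1..l}" "i \<noteq> j" for d i j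
  proof -
    have "\<beta> (mdiag d) (mdiag (hd2 i j)) = \<beta> (mdiag d) (mbr l (munit i j) (munit j i))"
      using ij by (simp add: mbr_munit_hdiff hdiff_mdiag)
    also have "\<dots> = \<beta> (mbr l (mdiag d) (munit i j)) (munit j i)"
      by (rule inva[symmetric, OF d tu tu]) (use ij in auto)
    also have "\<dots> = \<beta> (\<lambda>x y. (d i - d j) * munit i j x y) (munit j i)"
      by (intro cong' mbr_hdiff_munit ij)
    also have "\<dots> = (d i - d j) * c i j"
      using sym[of "\<lambda>x y. (d i - d j) * munit i j x y" "munit j i" "munit j i"] sym[of "munit i j" "munit j i" "munit j i"]
        scale[of "munit j i" "munit i j" "munit i j" "d i - d j"] tu[of i j] tu[of j i] ij by (simp add: mtr_simps c_def)
    finally show ?thesis .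
  qed
  have csym: "c i j = c j i" if "i \<in> {1..l}" "j \<in> {1..l}" "i \<noteq> j" for i j
    unfolding c_def by (rule sym[OF tu tu tu]) (use that in auto)
  \<comment> \<open>Invariance applied to \<open>E_ij = [E_ik, E_kj]\<close>. Together with
    \<open>csym\<close> this connects all pairs of distinct indices.\<close>
  have ck: "c i j = c i k" if ijk: "i \<in> {1..l}" "j \<in> {1..l}" "k \<in> {1..l}" "i \<noteq> j" "i \<noteq> k" for i j k
  proof (cases "j = k")
    case False
    have "c i j = \<beta> (mbr l (munit i k) (munit k j)) (munit j i)"
    proof -
      have "mbr l (munit i k) (munit k j) = munit i j" using ijk by (intro ext) (simp add: mbr_munit)
      then show ?thesis by (simp add: c_def)
    qed
    also have "\<dots> = \<beta> (munit i k) (mbr l (munit k j) (munit j i))"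
      by (rule inva[OF tu tu tu]) (use ijk False in auto)
    also have "mbr l (munit k j) (munit j i) = munit k i" using ijk by (intro ext) (simp add: mbr_munit)
    finally show ?thesis by (simp add: c_def)
  qed simp
  define \<gamma> where "\<gamma> = c 1 2"
  have cg: "c i j = \<gamma>" if ij: "i \<in> {1..l}" "j \<in> {1..l}" "i \<noteq> j" for i j
  proof -
    have 12: "1 \<in> {1..l}" "2 \<in> {1..l}" "(1::nat) \<noteq> 2" using l by auto
    show ?thesis
    proof (cases "i = 1")
      case True
      then show ?thesis using ck[of 1 j 2] ij 12 by (simp add: \<gamma>_def)
    next
      case False
      then have "c i j = c i 1" using ck[of i j 1] ij 12 by simp
      also have "\<dots> = c 1 i" using csym[of i 1] ij 12 False by simp
      also have "\<dots> = \<gamma>" using ck[of 1 i 2] ij 12 False by (simp add: \<gamma>_def)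
      finally show ?thesis .
    qed
  qed
  \<comment> \<open>Two linear functionals agree on traceless matrices once they agree on the
    spanning ones. Linearity of \<open>F\<close> is asked for on traceless matrices only, since
    nothing is known of \<open>B\<close> elsewhere.\<close>
  have lin: "F N = G N"
    if N: "mtr l N = 0" and FC: "\<And>N N'. iota N = iota N' \<Longrightarrow> F N = F N'"
      and GC: "\<And>N N'. (\<And>i j. i \<in> {1..l} \<Longrightarrow> j \<in> {1..l} \<Longrightarrow> N i j = N' i j) \<Longrightarrow> G N = G N'"
      and Z: "F (\<lambda>i j. 0) = G (\<lambda>i j. 0)"
      and FA: "\<And>N P. mtr l N = 0 \<Longrightarrow> mtr l P = 0 \<Longrightarrow> F (\<lambda>i j. N i j + P i j) = F N + F P"
      and FS: "\<And>c N. mtr l N = 0 \<Longrightarrow> F (\<lambda>i j. c * N i j) = c * F N"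
      and GA: "\<And>N P. G (\<lambda>i j. N i j + P i j) = G N + G P" and GS: "\<And>c N. G (\<lambda>i j. c * N i j) = c * G N"
      and U: "\<And>p q. p \<in> {1..l} \<Longrightarrow> q \<in> {1..l} \<Longrightarrow> p \<noteq> q \<Longrightarrow> F (munit p q) = G (munit p q)"
      and D: "\<And>p q. p \<in> {1..l} \<Longrightarrow> q \<in> {1..l} \<Longrightarrow> p \<noteq> q \<Longrightarrow> F (mdiag (hd2 p q)) = G (mdiag (hd2 p q))"
    for N and F G :: "(nat \<Rightarrow> nat \<Rightarrow> complex) \<Rightarrow> complex"
    using N
  proof (induction rule: traceless_induct)
    case (cong M M')
    then show ?case using FC[of M M'] GC[of M M'] iota_cong[of M M'] by simp
  next
    case (diag p q)
    then show ?case using D[of p q] by (simp add: hdiff_mdiag)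
  next
    case zero
    show ?case by (rule Z)
  next
    case (add M M')
    then show ?case using FA[of M M'] GA[of M M'] by simp
  next
    case (scale c M)
    then show ?case using FS[of M c] GS[of c M] by simp
  next
    case (unit p q)
    then show ?case by (rule U)
  qed
  have fu: "\<beta> (munit i j) N = \<gamma> * N j i" if ij: "i \<in> {1..l}" "j \<in> {1..l}" "i \<noteq> j" and N: "mtr l N = 0" for i j N
    using N
  proof (rule lin)
    have t: "mtr l (munit i j) = 0" using tu ij by simp
    show "\<beta> (munit i j) (\<lambda>i j. 0) = \<gamma> * 0" using zero[OF t] by simp
    show "\<beta> (munit i j) (\<lambda>i j. N i j + P i j) = \<beta> (munit i j) N + \<beta> (munit i j) P"
      if "mtr l N = 0" "mtr l P = 0" for N P by (rule add[OF t that])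
    show "\<beta> (munit i j) (\<lambda>i j. c * N i j) = c * \<beta> (munit i j) N"
      if "mtr l N = 0" for N c by (rule scale[OF t that that])
    show "\<beta> (munit i j) (munit p q) = \<gamma> * munit p q j i" if "p \<in> {1..l}" "q \<in> {1..l}" "p \<noteq> q" for p q
      using c2[OF ij that] cg[OF ij] by (cases "p = j \<and> q = i") (auto simp: c_def munit_def)
    show "\<beta> (munit i j) (mdiag (hd2 p q)) = \<gamma> * mdiag (hd2 p q) j i" if pq: "p \<in> {1..l}" "q \<in> {1..l}" "p \<noteq> q" for p q
      using sym[OF t th[OF pq(1,2)] t] c1[OF th[OF pq(1,2)] ij] ij by (simp add: mdiag_def)
    show "\<beta> (munit i j) N = \<beta> (munit i j) N'" if "iota N = iota N'" for N N' using that by (rule cong)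
    show "\<gamma> * N j i = \<gamma> * N' j i" if "\<And>i j. i \<in> {1..l} \<Longrightarrow> j \<in> {1..l} \<Longrightarrow> N i j = N' i j" for N N'
      using that[OF ij(2,1)] by simp
  qed (simp_all add: algebra_simps)
  have fd: "\<beta> (mdiag d) N = \<gamma> * mform l (mdiag d) N" if d: "mtr l (mdiag d) = 0" and N: "mtr l N = 0" for d N
    using N
  proof (rule lin)
    show "\<beta> (mdiag d) (\<lambda>i j. 0) = \<gamma> * mform l (mdiag d) (\<lambda>i j. 0)" using zero[OF d] by (simp add: mform_def)
    show "\<beta> (mdiag d) (\<lambda>i j. N i j + P i j) = \<beta> (mdiag d) N + \<beta> (mdiag d) P"
      if "mtr l N = 0" "mtr l P = 0" for N P by (rule add[OF d that])
    show "\<beta> (mdiag d) (\<lambda>i j. c * N i j) = c * \<beta> (mdiag d) N"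
      if "mtr l N = 0" for N c by (rule scale[OF d that that])
    show "\<beta> (mdiag d) (munit p q) = \<gamma> * mform l (mdiag d) (munit p q)" if "p \<in> {1..l}" "q \<in> {1..l}" "p \<noteq> q" for p q
      using c1[OF d that] that by (simp add: mform_sym[of l "mdiag d"] mform_munit mdiag_def)
    show "\<beta> (mdiag d) (mdiag (hd2 p q)) = \<gamma> * mform l (mdiag d) (mdiag (hd2 p q))" if pq: "p \<in> {1..l}" "q \<in> {1..l}" "p \<noteq> q" for p q
    proof -
      have "mform l (mdiag d) (mdiag (hd2 p q)) = mform l (\<lambda>i j. munit p p i j - munit q q i j) (mdiag d)"
        unfolding mform_sym[of l "mdiag d"] by (simp add: hdiff_mdiag[symmetric] hdiff_def[abs_def])
      also have "\<dots> = d p - d q" using pq by (simp add: mform_diff mform_munit mdiag_def)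
      finally show ?thesis using c3[OF d pq] cg[OF pq] by simp
    qed
    show "\<gamma> * mform l (mdiag d) N = \<gamma> * mform l (mdiag d) N'" if "\<And>i j. i \<in> {1..l} \<Longrightarrow> j \<in> {1..l} \<Longrightarrow> N i j = N' i j" for N N'
      using mform_cong[of l N N' "mdiag d"] that by (simp add: mform_sym[of l "mdiag d"])
    show "\<beta> (mdiag d) N = \<beta> (mdiag d) N'" if "iota N = iota N'" for N N' using that by (rule cong)
  qed (simp_all add: mform_sym[of l "mdiag d"] mform_add mform_scale algebra_simps)
  have ft: "\<beta> P N = \<gamma> * mform l P N" if P: "mtr l P = 0" and N: "mtr l N = 0" for P N
    using P
  proof (rule lin)
    show "\<beta> (\<lambda>i j. 0) N = \<gamma> * mform l (\<lambda>i j. 0) N"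
      using sym[of "\<lambda>i j. 0" N N] zero[OF N] N by (simp add: mform_def mtr_simps(5))
    show "\<beta> (\<lambda>i j. P i j + P' i j) N = \<beta> P N + \<beta> P' N" if "mtr l P = 0" "mtr l P' = 0" for P P'
      using sym[of "\<lambda>i j. P i j + P' i j" N N] sym[of P N N] sym[of P' N N] add[OF N that] that N
      by (simp add: mtr_simps(1))
    show "\<beta> (\<lambda>i j. c * P i j) N = c * \<beta> P N" if "mtr l P = 0" for P c
      using sym[of "\<lambda>i j. c * P i j" N N] sym[of P N N] scale[OF N that that, of c] that N
      by (simp add: mtr_simps(3))
    show "\<beta> (munit p q) N = \<gamma> * mform l (munit p q) N" if "p \<in> {1..l}" "q \<in> {1..l}" "p \<noteq> q" for p q
      using fu[OF that N] that by (simp add: mform_munit)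
    show "\<beta> (mdiag (hd2 p q)) N = \<gamma> * mform l (mdiag (hd2 p q)) N" if "p \<in> {1..l}" "q \<in> {1..l}" "p \<noteq> q" for p q
      by (rule fd[OF th[OF that(1,2)] N])
    show "\<gamma> * mform l P N = \<gamma> * mform l P' N" if "\<And>i j. i \<in> {1..l} \<Longrightarrow> j \<in> {1..l} \<Longrightarrow> P i j = P' i j" for P P'
      using mform_cong[of l P P' N] that by simp
    show "\<beta> P N = \<beta> P' N" if "iota P = iota P'" for P P' using that by (rule cong')
  qed (simp_all add: mform_add mform_scale algebra_simps)
  obtain t where t: "t \<in> cartan l" "\<forall>h\<in>cartan l. B t h = highest_root l h" "B t t = 2"
    using B by (auto simp: normalized_form_def)
  then obtain d where d: "t = iota (mdiag d)" "(\<Sum>i\<in>{1..l}. d i) = 0" unfolding cartan_eq by blast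
  have ll: "1 \<in> {1..l}" "l \<in> {1..l}" "1 \<noteq> l" using l by auto
  have hr: "highest_root l (iota (mdiag x)) = x 1 - x l" for x
    using eps_iota[OF ll(1), of x] eps_iota[OF ll(2), of x] by (simp add: highest_root_def)
  have "(\<Sum>i\<in>{1..l}. hd2 1 l i) = 0" using th[OF ll(1,2)] by (simp add: mtr_simps)
  then have h: "iota (mdiag (hd2 1 l)) \<in> cartan l" unfolding cartan_eq by blast
  have td: "mtr l (mdiag d) = 0" using d by (simp add: mtr_simps)
  \<comment> \<open>The element \<open>t\<close> represents the highest root. Pairing it with
    \<open>h_1 - h_l\<close> gives the value 2 of the root there, and pairing it with itself gives
    \<open>d 1 - d l\<close>, which is 2 by the normalization.\<close>
  have "(d 1 - d l) * \<gamma> = B t (iota (mdiag (hd2 1 l)))"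
    using c3[OF td ll] cg[OF ll] by (simp add: d \<beta>_def)
  also have "\<dots> = 2" using t(2) h ll by (auto simp: hr hd2_def)
  finally have 1: "(d 1 - d l) * \<gamma> = 2" .
  have "d 1 - d l = B t t" using t(1,2) d(1) hr by auto
  then have "\<gamma> = 1" using 1 t(3) by simp
  then show ?thesis using ft[OF M] by (simp add: \<beta>_def)
qed

end

section \<open>The affine algebra over the realization\<close>

type_synonym cmat = "nat \<Rightarrow> nat \<Rightarrow> complex"

lemma mbr_zero: "mbr l M (\<lambda>i j. 0) = (\<lambda>i j. 0)" "mbr l (\<lambda>i j. 0) M = (\<lambda>i j. 0)"
  by (intro ext, simp add: mbr_def)+

lemma mbr_cong: "(\<And>i j. i \<in> {1..l} \<Longrightarrow> j \<in> {1..l} \<Longrightarrow> M i j = M' i j) \<Longrightarrow>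
   (\<And>i j. i \<in> {1..l} \<Longrightarrow> j \<in> {1..l} \<Longrightarrow> N i j = N' i j) \<Longrightarrow> x \<in> {1..l} \<Longrightarrow> y \<in> {1..l} \<Longrightarrow>
   mbr l M N x y = mbr l M' N' x y"
  unfolding mbr_def by (intro sum.cong refl) simp

lemma mbr_uminus: "mbr l (\<lambda>i j. - M i j) N x y = - mbr l M N x y" "mbr l M (\<lambda>i j. - N i j) x y = - mbr l M N x y"
  by (simp_all add: mbr_def flip: sum_negf)

lemma mtr_sum: "mtr l (\<lambda>i j. \<Sum>x\<in>A. M x i j) = (\<Sum>x\<in>A. mtr l (M x))"
  unfolding mtr_def by (rule sum.swap)

locale affine_sl =
  fixes l :: nat and B :: "weyl_elt \<Rightarrow> weyl_elt \<Rightarrow> complex" and k :: complex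
  assumes l2: "2 \<le> l" and B: "normalized_form l B"
begin

sublocale WA: weyl_alg l .

abbreviation "iota \<equiv> WA.iota"
abbreviation "G \<equiv> affine (sl l) B"

definition el :: "(int \<Rightarrow> cmat) \<Rightarrow> complex \<Rightarrow> complex \<Rightarrow> weyl_elt affine_elt" where
  "el F a b = (\<lambda>n. iota (F n), a, b)"

definition fam :: "(int \<Rightarrow> cmat) \<Rightarrow> bool" where
  "fam F \<longleftrightarrow> (\<forall>n. mtr l (F n) = 0) \<and> finite {n. F n \<noteq> (\<lambda>i j. 0)}"

lemma fam_tr: "fam F \<Longrightarrow> mtr l (F n) = 0" by (simp add: fam_def)

lemma el_cong: "(\<And>n i j. i \<in> {1..l} \<Longrightarrow> j \<in> {1..l} \<Longrightarrow> F n i j = F' n i j) \<Longrightarrow> el F a b = el F' a b"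
proof -
  assume "\<And>n i j. i \<in> {1..l} \<Longrightarrow> j \<in> {1..l} \<Longrightarrow> F n i j = F' n i j"
  then have "iota (F n) = iota (F' n)" for n by (rule WA.iota_cong)
  then show ?thesis by (simp add: el_def)
qed

lemma form: "mtr l M = 0 \<Longrightarrow> mtr l M' = 0 \<Longrightarrow> B (iota M) (iota M') = mform l M M'"
  by (rule WA.form_trace[OF B l2])

text \<open>Zero is sent to the zero matrix, so that a loop of finite support lifts to a family of
  finite support.\<close>

definition matof :: "weyl_elt \<Rightarrow> cmat" where
  "matof x = (if x = \<zero>\<^bsub>sl l\<^esub> then (\<lambda>i j. 0) else (SOME M. x = iota M \<and> mtr l M = 0))"

lemma matof: "x \<in> carrier (sl l) \<Longrightarrow> iota (matof x) = x \<and> mtr l (matof x) = 0"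
proof (cases "x = \<zero>\<^bsub>sl l\<^esub>")
  case True
  then show ?thesis by (simp add: matof_def WA.iota_ops mtr_simps)
next
  case False
  assume "x \<in> carrier (sl l)"
  then have "\<exists>M. x = iota M \<and> mtr l M = 0" by (auto simp: WA.sl_carrier)
  from someI_ex[OF this] show ?thesis using False by (simp add: matof_def)
qed

lemma matof_iota: "mtr l M = 0 \<Longrightarrow> i \<in> {1..l} \<Longrightarrow> j \<in> {1..l} \<Longrightarrow> matof (iota M) i j = M i j"
  using matof[of "iota M"] WA.iota_eq[of "matof (iota M)" M] by simp

lemma loops_fam: "f \<in> loops (sl l) \<Longrightarrow> f = (\<lambda>n. iota (matof (f n))) \<and> fam (\<lambda>n. matof (f n))"
proof -
  assume f: "f \<in> loops (sl l)"
  then have c: "f n \<in> carrier (sl l)" for n by (auto simp: loops_def)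
  have "{n. matof (f n) \<noteq> (\<lambda>i j. 0)} \<subseteq> loop_support (sl l) f"
    by (auto simp: loop_support_def matof_def)
  then show ?thesis using f c matof by (auto simp: fam_def loops_def intro: finite_subset)
qed

lemma fam_loops: "fam F \<Longrightarrow> (\<lambda>n. iota (F n)) \<in> loops (sl l)"
proof -
  assume F: "fam F"
  have "loop_support (sl l) (\<lambda>n. iota (F n)) \<subseteq> {n. F n \<noteq> (\<lambda>i j. 0)}"
    by (auto simp: loop_support_def WA.iota_ops)
  then show ?thesis using F by (auto simp: loops_def fam_def intro: finite_subset)
qed

lemma G_carrier: "carrier G = {el F a b | F a b. fam F}"
proof (intro equalityI subsetI)
  fix x assume "x \<in> carrier G"
  then obtain f a b where x: "x = (f, a, b)" "f \<in> loops (sl l)" by (auto simp: affine_def)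
  then have "x = el (\<lambda>n. matof (f n)) a b \<and> fam (\<lambda>n. matof (f n))"
    using loops_fam[OF x(2)] by (simp add: el_def)
  then show "x \<in> {el F a b | F a b. fam F}" by blast
next
  fix x assume "x \<in> {el F a b | F a b. fam F}"
  then obtain F a b where "x = el F a b" "fam F" by blast
  then show "x \<in> carrier G" using fam_loops[of F] by (simp add: el_def affine_def)
qed

lemma el_G [simp]: "fam F \<Longrightarrow> el F a b \<in> carrier G" unfolding G_carrier by blast

lemma el_ops:
  "el F a b \<oplus>\<^bsub>G\<^esub> el F' a' b' = el (\<lambda>n i j. F n i j + F' n i j) (a + a') (b + b')"
  "c \<odot>\<^bsub>G\<^esub> el F a b = el (\<lambda>n i j. c * F n i j) (c * a) (c * b)"
  by (simp_all add: affine_def el_def WA.iota_ops)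

lemma fam_closed:
  "fam F \<Longrightarrow> fam F' \<Longrightarrow> fam (\<lambda>n i j. F n i j + F' n i j)"
  "fam F \<Longrightarrow> fam (\<lambda>n i j. c n * F n i j)"
proof -
  assume F: "fam F"
  have "{n. (\<lambda>i j. c n * F n i j) \<noteq> (\<lambda>i j. 0)} \<subseteq> {n. F n \<noteq> (\<lambda>i j. 0)}" by auto
  then show "fam (\<lambda>n i j. c n * F n i j)" using F by (auto simp: fam_def mtr_simps intro: finite_subset)
  assume F': "fam F'"
  have "{n. (\<lambda>i j. F n i j + F' n i j) \<noteq> (\<lambda>i j. 0)} \<subseteq> {n. F n \<noteq> (\<lambda>i j. 0)} \<union> {n. F' n \<noteq> (\<lambda>i j. 0)}" by auto
  then show "fam (\<lambda>n i j. F n i j + F' n i j)" using F F' by (auto simp: fam_def mtr_simps intro: finite_subset)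
qed

text \<open>The summation set is a parameter because the support of a loop is tested through
  \<open>iota\<close>, which ignores entries outside the index range; it can be smaller than the
  support of the family of matrices.\<close>

definition conv :: "int set \<Rightarrow> (int \<Rightarrow> cmat) \<Rightarrow> (int \<Rightarrow> cmat) \<Rightarrow> int \<Rightarrow> cmat" where
  "conv S F F' n i j = (\<Sum>s\<in>S. mbr l (F s) (F' (n - s)) i j)"

lemma fam_conv: "fam F' \<Longrightarrow> finite S \<Longrightarrow> fam (conv S F F')"
proof -
  assume F': "fam F'" and S: "finite S"
  let ?T = "\<Union>s\<in>S. (\<lambda>t. t + s) ` {n. F' n \<noteq> (\<lambda>i j. 0)}"
  have "conv S F F' n = (\<lambda>i j. 0)" if "n \<notin> ?T" for n
  proof -
    have "F' (n - s) = (\<lambda>i j. 0)" if "s \<in> S" for s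
    proof (rule ccontr)
      assume "F' (n - s) \<noteq> (\<lambda>i j. 0)"
      then have "n - s + s \<in> (\<lambda>t. t + s) ` {n. F' n \<noteq> (\<lambda>i j. 0)}" by blast
      then show False using \<open>n \<notin> ?T\<close> that by auto
    qed
    then show ?thesis by (intro ext) (simp add: conv_def mbr_zero)
  qed
  then have "{n. conv S F F' n \<noteq> (\<lambda>i j. 0)} \<subseteq> ?T" by blast
  moreover have "finite ?T" using S F' by (auto simp: fam_def)
  moreover have "mtr l (conv S F F' n) = 0" for n
    using mtr_sum[of l "\<lambda>s. mbr l (F s) (F' (n - s))" S] by (simp add: conv_def[abs_def] mtr_mbr)
  ultimately show ?thesis by (auto simp: fam_def intro: finite_subset)
qed

lemma el_bracket:
  assumes F: "fam F" and F': "fam F'" and S: "finite S" "{n. F n \<noteq> (\<lambda>i j. 0)} \<subseteq> S"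
  shows "bracket G (el F a b) (el F' a' b') =
    el (\<lambda>n i j. conv S F F' n i j + (b * of_int n) * F' n i j + (- b' * of_int n) * F n i j)
       (\<Sum>s\<in>S. of_int s * mform l (F s) (F' (- s))) 0"
proof -
  let ?f = "\<lambda>n. iota (F n)"
  let ?U = "loop_support (sl l) ?f"
  have U: "?U \<subseteq> S"
  proof
    fix s assume s: "s \<in> ?U"
    show "s \<in> S"
    proof (rule ccontr)
      assume "s \<notin> S"
      then have "F s = (\<lambda>i j. 0)" using S(2) by blast
      then show False using s by (simp add: loop_support_def WA.iota_ops)
    qed
  qed
  have z: "F s i j = 0" if "s \<notin> ?U" "i \<in> {1..l}" "j \<in> {1..l}" for s i j
  proof -
    have "iota (F s) = iota (\<lambda>i j. 0)" using that(1) by (simp add: loop_support_def WA.iota_ops)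
    then show ?thesis using that(2,3) unfolding WA.iota_eq by blast
  qed
  have fin: "finite ?U" using U S(1) finite_subset by blast
  have 1: "finsum (sl l) (\<lambda>s. bracket (sl l) (?f s) (iota (F' (n - s)))) ?U = iota (conv S F F' n)" for n
  proof -
    have "finsum (sl l) (\<lambda>s. bracket (sl l) (?f s) (iota (F' (n - s)))) ?U
        = finsum (sl l) (\<lambda>s. iota (mbr l (F s) (F' (n - s)))) ?U" by (simp only: WA.iota_ops(4))
    also have "\<dots> = iota (\<lambda>i j. \<Sum>s\<in>?U. mbr l (F s) (F' (n - s)) i j)"
      by (rule conjunct1[OF WA.sl_finsum[OF fin, where M = "\<lambda>s. mbr l (F s) (F' (n - s))"]]) (rule mtr_mbr)
    also have "\<dots> = iota (conv S F F' n)"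
    proof (rule WA.iota_cong)
      fix i j assume ij: "i \<in> {1..l}" "j \<in> {1..l}"
      show "(\<Sum>s\<in>?U. mbr l (F s) (F' (n - s)) i j) = conv S F F' n i j"
        unfolding conv_def
      proof (rule sum.mono_neutral_left[OF S(1) U], rule ballI)
        fix s assume "s \<in> S - ?U"
        then have "mbr l (F s) (F' (n - s)) i j = mbr l (\<lambda>i j. 0) (F' (n - s)) i j"
          using z ij by (intro mbr_cong) auto
        then show "mbr l (F s) (F' (n - s)) i j = 0" by (simp add: mbr_zero)
      qed
    qed
    finally show ?thesis .
  qed
  have 2: "(\<Sum>s\<in>?U. of_int s * B (?f s) (iota (F' (- s)))) = (\<Sum>s\<in>S. of_int s * mform l (F s) (F' (- s)))"
  proof -
    have "(\<Sum>s\<in>?U. of_int s * B (?f s) (iota (F' (- s)))) = (\<Sum>s\<in>?U. of_int s * mform l (F s) (F' (- s)))"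
      using fam_tr[OF F] fam_tr[OF F'] by (simp add: form)
    also have "\<dots> = (\<Sum>s\<in>S. of_int s * mform l (F s) (F' (- s)))"
    proof (rule sum.mono_neutral_left[OF S(1) U], rule ballI)
      fix s assume "s \<in> S - ?U"
      then have "mform l (F s) (F' (- s)) = mform l (\<lambda>i j. 0) (F' (- s))" using z by (intro mform_cong) auto
      then show "of_int s * mform l (F s) (F' (- s)) = 0" by (simp add: mform_def)
    qed
    finally show ?thesis .
  qed
  have "bracket G = affine_bracket (sl l) B" by (simp add: affine_def)
  then have "bracket G (el F a b) (el F' a' b') = affine_bracket (sl l) B (?f, a, b) (\<lambda>n. iota (F' n), a', b')"
    by (simp only: el_def)
  also have "\<dots> = (\<lambda>n. iota (conv S F F' n) \<oplus>\<^bsub>sl l\<^esub> (b * of_int n) \<odot>\<^bsub>sl l\<^esub> iota (F' n)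
      \<oplus>\<^bsub>sl l\<^esub> (- b' * of_int n) \<odot>\<^bsub>sl l\<^esub> iota (F n), \<Sum>s\<in>S. of_int s * mform l (F s) (F' (- s)), 0)"
    unfolding affine_bracket.simps 1 2 ..
  finally show ?thesis unfolding el_def WA.iota_ops(1,2) .
qed

lemma el_bracket_fam: "fam F \<Longrightarrow> fam F' \<Longrightarrow> finite S \<Longrightarrow>
   fam (\<lambda>n i j. conv S F F' n i j + (b * of_int n) * F' n i j + (- b' * of_int n) * F n i j)"
  by (rule fam_closed(1)[OF fam_closed(1)[OF fam_conv fam_closed(2)] fam_closed(2)])

abbreviation "CP \<equiv> {f \<in> loops (sl l). \<forall>n<0. f n = \<zero>\<^bsub>sl l\<^esub>} \<times> (UNIV :: (complex \<times> complex) set)"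

lemma CP_el: "CP = {el F a b | F a b. fam F \<and> (\<forall>n<0. F n = (\<lambda>i j. 0))}"
proof (intro equalityI subsetI)
  fix x assume "x \<in> CP"
  then obtain f a b where x: "x = (f, a, b)" "f \<in> loops (sl l)" "\<forall>n<0. f n = \<zero>\<^bsub>sl l\<^esub>" by auto
  then have "x = el (\<lambda>n. matof (f n)) a b \<and> fam (\<lambda>n. matof (f n)) \<and> (\<forall>n<0. matof (f n) = (\<lambda>i j. 0))"
    using loops_fam[OF x(2)] by (simp add: el_def matof_def)
  then show "x \<in> {el F a b | F a b. fam F \<and> (\<forall>n<0. F n = (\<lambda>i j. 0))}" by blast
next
  fix x assume "x \<in> {el F a b | F a b. fam F \<and> (\<forall>n<0. F n = (\<lambda>i j. 0))}"
  then obtain F a b where "x = el F a b" "fam F" "\<forall>n<0. F n = (\<lambda>i j. 0)" by blast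
  then show "x \<in> CP" using fam_loops[of F] by (simp add: el_def WA.iota_ops)
qed

lemma CP_I: "fam F \<Longrightarrow> (\<And>n. n < 0 \<Longrightarrow> F n = (\<lambda>i j. 0)) \<Longrightarrow> el F a b \<in> CP"
  unfolding CP_el by blast

lemma G_cases:
  assumes "x \<in> carrier G" obtains F a b where "x = el F a b" "fam F"
  using assms unfolding G_carrier by blast

lemma fam_support: "fam F \<Longrightarrow> finite {n. F n \<noteq> (\<lambda>i j. 0)}" by (simp add: fam_def)

sublocale V: induced G CP "level_char k"
proof
  fix x y c assume x: "x \<in> carrier G"
  obtain F a b where F: "x = el F a b" "fam F" using x by (rule G_cases)
  show "c \<odot>\<^bsub>G\<^esub> x \<in> carrier G" unfolding F el_ops using fam_closed(2)[OF F(2), of "\<lambda>_. c"] by simp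
  assume y: "y \<in> carrier G"
  obtain F' a' b' where F': "y = el F' a' b'" "fam F'" using y by (rule G_cases)
  show "x \<oplus>\<^bsub>G\<^esub> y \<in> carrier G" unfolding F F' el_ops using fam_closed(1)[OF F(2) F'(2)] by simp
  show "bracket G x y \<in> carrier G"
    unfolding F F' el_bracket[OF F(2) F'(2) fam_support[OF F(2)] subset_refl]
    by (intro el_G el_bracket_fam F F' fam_support)
next
  show "CP \<subseteq> carrier G" unfolding CP_el G_carrier by blast
next
  fix x y c assume x: "x \<in> CP"
  obtain F a b where F: "x = el F a b" "fam F" "\<forall>n<0. F n = (\<lambda>i j. 0)" using x unfolding CP_el by blast
  show "c \<odot>\<^bsub>G\<^esub> x \<in> CP" unfolding F el_ops CP_el using fam_closed(2)[OF F(2), of "\<lambda>_. c"] F(3) by fastforce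
  show "level_char k (c \<odot>\<^bsub>G\<^esub> x) = c * level_char k x" unfolding F el_ops by (simp add: el_def)
  assume y: "y \<in> CP"
  obtain F' a' b' where F': "y = el F' a' b'" "fam F'" "\<forall>n<0. F' n = (\<lambda>i j. 0)" using y unfolding CP_el by blast
  show "x \<oplus>\<^bsub>G\<^esub> y \<in> CP" unfolding F F' el_ops CP_el using fam_closed(1)[OF F(2) F'(2)] F(3) F'(3) by fastforce
  show "level_char k (x \<oplus>\<^bsub>G\<^esub> y) = level_char k x + level_char k y"
    unfolding F F' el_ops by (simp add: el_def distrib_left)
  let ?S = "{n. F n \<noteq> (\<lambda>i j. 0)}"
  have S: "s \<ge> 0" if "s \<in> ?S" for s
  proof (rule ccontr)
    assume "\<not> s \<ge> 0"
    then have "F s = (\<lambda>i j. 0)" using F(3) by simp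
    then show False using that by simp
  qed
  have br: "bracket G x y = el (\<lambda>n i j. conv ?S F F' n i j + (b * of_int n) * F' n i j + (- b' * of_int n) * F n i j)
       (\<Sum>s\<in>?S. of_int s * mform l (F s) (F' (- s))) 0"
    unfolding F F' by (rule el_bracket[OF F(2) F'(2) fam_support[OF F(2)] subset_refl])
  have "conv ?S F F' n = (\<lambda>i j. 0)" if "n < 0" for n
  proof (intro ext, unfold conv_def, rule sum.neutral, rule ballI)
    fix i j s assume "s \<in> ?S"
    then have "F' (n - s) = (\<lambda>i j. 0)" using F'(3) S[of s] that by simp
    then show "mbr l (F s) (F' (n - s)) i j = 0" by (simp add: mbr_zero)
  qed
  then show "bracket G x y \<in> CP"
    unfolding br using F(3) F'(3) by (intro CP_I el_bracket_fam F F' fam_support) simp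
  \<comment> \<open>For loops without negative powers the cocycle can only see degree 0, where its
    factor vanishes. Hence the level is a character of the parabolic subalgebra.\<close>
  have "of_int s * mform l (F s) (F' (- s)) = 0" if "s \<in> ?S" for s
    using S[OF that] F'(3) by (cases "s = 0") (auto simp: mform_def)
  then have "(\<Sum>s\<in>?S. of_int s * mform l (F s) (F' (- s))) = 0" by (intro sum.neutral ballI)
  then show "level_char k (bracket G x y) = 0"
    unfolding br el_def by (simp only: level_char.simps mult_zero_right)
qed

lemma verma_eq: "verma (sl l) B k = V.N" "vacuum (sl l) B k = V.vec 1"
proof -
  have P: "affine_P (sl l) B = V.H" by (simp add: affine_P_def)
  have r: "env_P_right_action (sl l) B = V.ra" by (intro ext) (simp add: env_P_right_action_def)
  have la: "env_P_left_action k = V.la" by (intro ext) (simp add: env_P_left_action_def)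
  show "verma (sl l) B k = V.N" unfolding verma_def P r la ..
  show "vacuum (sl l) B k = V.vec 1" unfolding vacuum_def P r la by (rule V.pure_tensor_one)
qed

abbreviation "PJ \<equiv> {u. proj (carrier G) u \<in> V.J}"

sublocale VM: module_ideal V.PI PJ
  by unfold_locales (auto simp: proj_add proj_mult V.J_add V.J_mult V.I_J)

section \<open>Commutation relations and vacuum relations on words\<close>

definition single :: "cmat \<Rightarrow> int \<Rightarrow> int \<Rightarrow> cmat" where
  "single M n = (\<lambda>p. if p = n then M else (\<lambda>i j. 0))"

lemma fam_single [simp]: "mtr l M = 0 \<Longrightarrow> fam (single M n)"
proof -
  assume M: "mtr l M = 0"
  have "{p. single M n p \<noteq> (\<lambda>i j. 0)} \<subseteq> {n}" by (auto simp: single_def)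
  then show ?thesis using M by (auto simp: fam_def single_def mtr_simps intro: finite_subset)
qed

lemma fam_zero [simp]: "fam (\<lambda>n i j. 0)" by (simp add: fam_def mtr_simps)

lemma at_power_el: "at_power (sl l) (iota M) n = el (single M n) 0 0"
  unfolding at_power_def el_def single_def WA.iota_ops by (simp add: if_distrib[of iota] fun_eq_iff)

abbreviation LL :: "cmat \<Rightarrow> int \<Rightarrow> weyl_elt affine_elt word \<Rightarrow>\<^sub>0 complex" where
  "LL M n \<equiv> letter (at_power (sl l) (iota M) n)"

abbreviation "Kc a \<equiv> letter (el (\<lambda>n i j. 0) a 0)"
abbreviation "Dl b \<equiv> letter (el (\<lambda>n i j. 0) 0 b)"

lemma letter_add: "x \<in> carrier G \<Longrightarrow> y \<in> carrier G \<Longrightarrow> V.cg (letter (x \<oplus>\<^bsub>G\<^esub> y)) (letter x + letter y)"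
proof (rule V.rel_cg)
  assume xy: "x \<in> carrier G" "y \<in> carrier G"
  have "letter (x \<oplus>\<^bsub>G\<^esub> y) - letter x - letter y \<in> env_rels G"
    unfolding env_rels_def by (intro UnI1 CollectI exI[of _ x] exI[of _ y] conjI refl xy)
  then show "letter (x \<oplus>\<^bsub>G\<^esub> y) - (letter x + letter y) \<in> env_rels G" by (simp only: diff_diff_eq)
qed

lemma letter_scale: "x \<in> carrier G \<Longrightarrow> V.cg (letter (c \<odot>\<^bsub>G\<^esub> x)) (scal c * letter x)"
  by (intro V.rel_cg, unfold env_rels_def, rule UnI1, rule UnI2, intro CollectI exI[of _ c] exI[of _ x] conjI refl)

lemma letter_br: "x \<in> carrier G \<Longrightarrow> y \<in> carrier G \<Longrightarrow> V.cg (br (letter x) (letter y)) (letter (bracket G x y))"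
  by (intro V.rel_cg, unfold env_rels_def, rule UnI2, intro CollectI exI[of _ x] exI[of _ y] conjI refl)

lemma el_split: "fam F \<Longrightarrow> V.cg (letter (el F a b)) (letter (el F 0 0) + Kc a + Dl b)"
proof -
  assume F: "fam F"
  have "V.cg (letter (el F a 0 \<oplus>\<^bsub>G\<^esub> el (\<lambda>n i j. 0) 0 b)) (letter (el F a 0) + Dl b)"
    using F by (intro letter_add) auto
  also have "V.cg (letter (el F a 0) + Dl b) (letter (el F 0 0) + Kc a + Dl b)"
    using letter_add[of "el F 0 0" "el (\<lambda>n i j. 0) a 0"] F by (intro V.cg_add V.cg_refl) (simp add: el_ops)
  finally show ?thesis by (simp add: el_ops)
qed

lemma LL_add: "mtr l M = 0 \<Longrightarrow> mtr l M' = 0 \<Longrightarrow> V.cg (LL (\<lambda>i j. M i j + M' i j) n) (LL M n + LL M' n)"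
proof -
  assume M: "mtr l M = 0" "mtr l M' = 0"
  have "el (single (\<lambda>i j. M i j + M' i j) n) 0 0 = el (single M n) 0 0 \<oplus>\<^bsub>G\<^esub> el (single M' n) 0 0"
    unfolding el_ops by (rule trans[OF el_cong]) (auto simp: single_def)
  then show ?thesis unfolding at_power_el
    using letter_add[OF el_G[OF fam_single[OF M(1)]] el_G[OF fam_single[OF M(2)]]] by simp
qed

lemma LL_scale: "mtr l M = 0 \<Longrightarrow> V.cg (LL (\<lambda>i j. c * M i j) n) (scal c * LL M n)"
proof -
  assume M: "mtr l M = 0"
  have "el (single (\<lambda>i j. c * M i j) n) 0 0 = c \<odot>\<^bsub>G\<^esub> el (single M n) 0 0"
    unfolding el_ops by (rule trans[OF el_cong]) (auto simp: single_def)
  then show ?thesis unfolding at_power_el using letter_scale[OF el_G[OF fam_single[OF M]]] by simp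
qed

lemma LL_cong: "(\<And>i j. i \<in> {1..l} \<Longrightarrow> j \<in> {1..l} \<Longrightarrow> M i j = M' i j) \<Longrightarrow> LL M n = LL M' n"
  using WA.iota_cong[of M M'] by simp

lemma Kc_scale: "V.cg (Kc a) (scal a * Kc 1)"
  using letter_scale[of "el (\<lambda>n i j. 0) 1 0" a] by (simp add: el_ops)

lemma Kc_zero: "V.cg (Kc 0) 0"
  using Kc_scale[of 0] by simp

lemma LL_zero: "V.cg (LL (\<lambda>i j. 0) n) 0"
  using LL_scale[of "\<lambda>i j. 0" 0 n] by (simp add: mtr_simps)

lemma LL_br:
  assumes M: "mtr l M = 0" "mtr l M' = 0"
  shows "V.cg (br (LL M n) (LL M' p)) (LL (mbr l M M') (n + p) + Kc (if n + p = 0 then of_int n * mform l M M' else 0))"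
proof -
  have "V.cg (br (LL M n) (LL M' p)) (letter (bracket G (el (single M n) 0 0) (el (single M' p) 0 0)))"
    unfolding at_power_el by (rule letter_br) (use M in auto)
  also have "bracket G (el (single M n) 0 0) (el (single M' p) 0 0) =
     el (single (mbr l M M') (n + p)) (if n + p = 0 then of_int n * mform l M M' else 0) 0"
  proof -
    have "bracket G (el (single M n) 0 0) (el (single M' p) 0 0) =
      el (\<lambda>q i j. conv {n} (single M n) (single M' p) q i j + (0 * of_int q) * single M' p q i j + (- 0 * of_int q) * single M n q i j)
       (\<Sum>s\<in>{n}. of_int s * mform l (single M n s) (single M' p (- s))) 0"
      by (rule el_bracket[OF fam_single[OF M(1)] fam_single[OF M(2)]]) (auto simp: single_def)
    also have "(\<Sum>s\<in>{n}. of_int s * mform l (single M n s) (single M' p (- s))) = (if n + p = 0 then of_int n * mform l M M' else 0)"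
      by (auto simp: single_def mform_def)
    also have "(\<lambda>q i j. conv {n} (single M n) (single M' p) q i j + (0 * of_int q) * single M' p q i j + (- 0 * of_int q) * single M n q i j)
       = single (mbr l M M') (n + p)"
      by (intro ext) (auto simp: conv_def single_def mbr_zero)
    finally show ?thesis .
  qed
  also have "V.cg (letter \<dots>) (letter (el (single (mbr l M M') (n + p)) 0 0) +
      Kc (if n + p = 0 then of_int n * mform l M M' else 0) + Dl 0)"
    by (rule el_split) (simp add: mtr_mbr)
  also have "V.cg \<dots> (LL (mbr l M M') (n + p) + Kc (if n + p = 0 then of_int n * mform l M M' else 0) + 0)"
    unfolding at_power_el using Kc_zero by (intro V.cg_add V.cg_refl)
  finally show ?thesis by simp
qed

lemma Kc_br: "fam F \<Longrightarrow> V.cg (br (Kc a) (letter (el F c b))) 0"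
proof -
  assume F: "fam F"
  have "V.cg (br (Kc a) (letter (el F c b))) (letter (bracket G (el (\<lambda>n i j. 0) a 0) (el F c b)))"
    by (rule letter_br) (use F in auto)
  also have "bracket G (el (\<lambda>n i j. 0) a 0) (el F c b) = el (\<lambda>n i j. 0) 0 0"
    using el_bracket[OF fam_zero F, of "{}" a 0 c b] by (simp add: conv_def)
  also have "V.cg (letter \<dots>) 0" by (rule Kc_zero)
  finally show ?thesis .
qed

lemma Dl_br: "mtr l M = 0 \<Longrightarrow> V.cg (br (Dl b) (LL M n)) (scal (b * of_int n) * LL M n)"
proof -
  assume M: "mtr l M = 0"
  have "V.cg (br (Dl b) (LL M n)) (letter (bracket G (el (\<lambda>n i j. 0) 0 b) (el (single M n) 0 0)))"
    unfolding at_power_el by (rule letter_br) (use M in auto)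
  also have "bracket G (el (\<lambda>n i j. 0) 0 b) (el (single M n) 0 0) = el (single (\<lambda>i j. (b * of_int n) * M i j) n) 0 0"
  proof -
    have "(\<lambda>q i j. b * of_int q * single M n q i j) = single (\<lambda>i j. b * of_int n * M i j) n"
      by (intro ext) (simp add: single_def)
    then show ?thesis
      using el_bracket[OF fam_zero fam_single[OF M, of n], of "{}" 0 b 0 0] by (simp add: conv_def)
  qed
  also have "V.cg (letter \<dots>) (scal (b * of_int n) * LL M n)"
    using LL_scale[OF M] by (simp add: at_power_el)
  finally show ?thesis .
qed

text \<open>The case \<open>u = 1\<close> of \<open>J_char\<close>, in the form in which it enters
  the congruences.\<close>

lemma P_vac: "x \<in> CP \<Longrightarrow> VM.cj (letter x) (scal (level_char k x))"
proof -
  assume x: "x \<in> CP"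
  have "1 * (letter x - scal (word_char (level_char k) (letter x))) \<in> V.J"
    by (rule V.J_char[OF fcar_closed(2) fcar_closed(4)[OF x]])
  moreover have "letter x \<in> fcar (carrier G)" by (rule fcar_closed(4)[OF subsetD[OF V.CP_sub x]])
  ultimately show ?thesis
    unfolding VM.cj_def by (simp only: mem_Collect_eq proj_diff proj_id fcar_closed(3) word_char_simps mult_1_left)
qed

lemma LL_vac: "mtr l M = 0 \<Longrightarrow> n \<ge> 0 \<Longrightarrow> VM.cj (LL M n) 0"
proof -
  assume M: "mtr l M = 0" and n: "n \<ge> 0"
  have "el (single M n) 0 0 \<in> CP" using M n by (intro CP_I fam_single) (auto simp: single_def)
  from P_vac[OF this] show ?thesis by (simp add: at_power_el el_def)
qed

lemma Kc_vac: "VM.cj (Kc a) (scal (k * a))"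
proof -
  have "el (\<lambda>n i j. 0) a 0 \<in> CP" by (intro CP_I) auto
  from P_vac[OF this] show ?thesis by (simp add: el_def)
qed

lemma Dl_vac: "VM.cj (Dl b) 0"
proof -
  have "el (\<lambda>n i j. 0) 0 b \<in> CP" by (intro CP_I) auto
  from P_vac[OF this] show ?thesis by (simp add: el_def)
qed

end

section \<open>The singular vector\<close>

text \<open>The matrix of a root vector: in this realization root vectors are the negatives of
  matrix units.\<close>

definition mneg :: "nat \<Rightarrow> nat \<Rightarrow> cmat" where "mneg i j x y = - munit i j x y"

lemma mtr_mneg: "i \<in> {1..l} \<Longrightarrow> i \<noteq> j \<Longrightarrow> mtr l (mneg i j) = 0"
  unfolding mneg_def[abs_def] by (simp add: mtr_simps mtr_munit)

lemma pdet_row_uminus: "q \<in> {1..m} \<Longrightarrow> pdet m (y(q := \<lambda>j. - z j)) = - pdet m (y(q := z))"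
proof -
  assume q: "q \<in> {1..m}"
  have *: "prod_list (map (\<lambda>i. (y(q := \<lambda>j. - z j)) i (\<sigma> i)) xs) = - prod_list (map (\<lambda>i. (y(q := z)) i (\<sigma> i)) xs)"
    if "distinct xs" "q \<in> set xs" for \<sigma> xs
    using that
  proof (induction xs)
    case (Cons a xs)
    show ?case
    proof (cases "a = q")
      case True
      then have "map (\<lambda>i. (y(q := \<lambda>j. - z j)) i (\<sigma> i)) xs = map (\<lambda>i. (y(q := z)) i (\<sigma> i)) xs"
        using Cons.prems by auto
      then show ?thesis by (simp only: list.map prod_list.Cons True fun_upd_same mult_minus_left)
    next
      case False
      then show ?thesis using Cons by simp
    qed
  qed simp
  have "q \<in> set [1..<Suc m]" using q by auto
  then show ?thesis unfolding pdet_def by (simp only: * distinct_upt mult_minus_right sum_negf)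
qed

locale affine_det = affine_sl +
  fixes m n :: nat
  assumes m1: "1 \<le> m" and ml: "2 * m \<le> l" and n1: "1 \<le> n" and k: "k = of_nat n - of_nat m"
begin

definition e :: "nat \<Rightarrow> nat \<Rightarrow> weyl_elt affine_elt word \<Rightarrow>\<^sub>0 complex" where
  "e i j = letter (at_power (sl l) (root_vec l i (l - j + 1)) (- 1))"

definition D where "D = pdet m e"

lemma range: "i \<in> {1..m} \<Longrightarrow> i \<in> {1..l}" "j \<in> {1..m} \<Longrightarrow> l - j + 1 \<in> {1..l}"
  "i \<in> {1..m} \<Longrightarrow> j \<in> {1..m} \<Longrightarrow> i \<noteq> l - j + 1"
  using ml by auto

lemma e_LL: "i \<in> {1..m} \<Longrightarrow> j \<in> {1..m} \<Longrightarrow> e i j = LL (mneg i (l - j + 1)) (- 1)"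
  unfolding e_def mneg_def[abs_def] by (simp only: WA.root_vec_iota range)

lemma LL_fcar [simp]: "mtr l M = 0 \<Longrightarrow> LL M r \<in> fcar (carrier G)"
  unfolding at_power_el by (intro fcar_closed(4) el_G fam_single)

lemma e_fcar: "i \<in> {1..m} \<Longrightarrow> j \<in> {1..m} \<Longrightarrow> e i j \<in> fcar (carrier G)"
  unfolding e_LL by (intro LL_fcar mtr_mneg range)

lemma prod_fcar: "\<sigma> permutes {1..m} \<Longrightarrow> prod_list (map (\<lambda>i. e i (\<sigma> i)) [1..<Suc m]) \<in> fcar (carrier G)"
proof (rule fcar_prod_list)
  fix i assume s: "\<sigma> permutes {1..m}" and "i \<in> set [1..<Suc m]"
  then have "i \<in> {1..m}" unfolding set_upt1 by simp
  then show "e i (\<sigma> i) \<in> fcar (carrier G)" using permutes_in_image[OF s] by (intro e_fcar) blast+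
qed

lemma D_fcar: "D \<in> fcar (carrier G)"
  unfolding D_def pdet_def
proof (rule fcar_sum)
  fix \<sigma> assume "\<sigma> \<in> {\<sigma>. \<sigma> permutes {1..m}}"
  then have "\<sigma> permutes {1..m}" by simp
  then show "of_int (sign \<sigma>) * prod_list (map (\<lambda>i. e i (\<sigma> i)) [1..<Suc m]) \<in> fcar (carrier G)"
    using fcar_closed(3)[of "of_int (sign \<sigma>)" "carrier G"] unfolding scal_of_int
    by (intro fcar_closed(6) prod_fcar)
qed

text \<open>Passes from the determinant in the enveloping algebra to \<open>pdet\<close> on words,
  where the congruence calculus is available.\<close>

lemma Delta_eq: "Delta l B m = V.Q D"
proof -
  interpret ring V.A by (rule V.ring_A)
  let ?S = "{\<sigma>. \<sigma> permutes {1..m}}"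
  have 1: "of_int (sign \<sigma>) \<odot>\<^bsub>V.A\<^esub> foldr (\<lambda>i y. V.Q (e i (\<sigma> i)) \<otimes>\<^bsub>V.A\<^esub> y) [1..<Suc m] \<one>\<^bsub>V.A\<^esub>
      = V.Q (of_int (sign \<sigma>) * prod_list (map (\<lambda>i. e i (\<sigma> i)) [1..<Suc m]))" if s: "\<sigma> permutes {1..m}" for \<sigma>
  proof -
    have "foldr (\<lambda>i y. V.Q (e i (\<sigma> i)) \<otimes>\<^bsub>V.A\<^esub> y) [1..<Suc m] \<one>\<^bsub>V.A\<^esub> = V.Q (prod_list (map (\<lambda>i. e i (\<sigma> i)) [1..<Suc m]))"
    proof (rule V.Q_foldr)
      fix i assume "i \<in> set [1..<Suc m]"
      then have "i \<in> {1..m}" unfolding set_upt1 by simp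
      then show "e i (\<sigma> i) \<in> fcar (carrier G)" using permutes_in_image[OF s] by (intro e_fcar) blast+
    qed
    then show ?thesis using V.Q_smult[OF prod_fcar[OF s], of "of_int (sign \<sigma>)"] by (simp only: scal_of_int)
  qed
  have c: "of_int (sign \<sigma>) * prod_list (map (\<lambda>i. e i (\<sigma> i)) [1..<Suc m]) \<in> fcar (carrier G)" if "\<sigma> permutes {1..m}" for \<sigma>
    using fcar_closed(3)[of "of_int (sign \<sigma>)" "carrier G"] that unfolding scal_of_int
    by (intro fcar_closed(6) prod_fcar)
  have "Delta l B m = (\<Oplus>\<^bsub>V.A\<^esub> \<sigma>\<in>?S. of_int (sign \<sigma>) \<odot>\<^bsub>V.A\<^esub> foldr (\<lambda>i y. V.Q (e i (\<sigma> i)) \<otimes>\<^bsub>V.A\<^esub> y) [1..<Suc m] \<one>\<^bsub>V.A\<^esub>)"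
    unfolding Delta_def alg_det_def V.env_eq V.env_gen_eq e_def ..
  also have "\<dots> = (\<Oplus>\<^bsub>V.A\<^esub> \<sigma>\<in>?S. V.Q (of_int (sign \<sigma>) * prod_list (map (\<lambda>i. e i (\<sigma> i)) [1..<Suc m])))"
    by (rule finsum_cong'[OF refl]) (use 1 c in \<open>simp_all del: upt_Suc add: Pi_def\<close>)
  also have "\<dots> = V.Q D" unfolding D_def pdet_def
    by (rule V.Q_finsum) (use c finite_permutations[of "{1..m}"] in \<open>simp_all del: upt_Suc\<close>)
  finally show ?thesis .
qed

lemma LL_uminus: "mtr l M = 0 \<Longrightarrow> V.cg (LL (\<lambda>i j. - M i j) r) (- LL M r)"
  using LL_scale[of M "- 1" r] by (simp add: scal_uminus)

lemma br_mneg: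
  assumes "i \<in> {1..l}" "j \<in> {1..l}" "i \<noteq> j" "p \<in> {1..l}" "q \<in> {1..l}" "p \<noteq> q"
  shows "V.cg (br (LL (mneg i j) r) (LL (mneg p q) s))
    (LL (\<lambda>x y. (if j = p then munit i q x y else 0) - (if q = i then munit p j x y else 0)) (r + s)
      + Kc (if r + s = 0 then of_int r * (if j = p \<and> i = q then 1 else 0) else 0))"
proof -
  have "mbr l (mneg i j) (mneg p q) = (\<lambda>x y. (if j = p then munit i q x y else 0) - (if q = i then munit p j x y else 0))"
    unfolding mneg_def[abs_def] by (intro ext) (simp only: mbr_uminus mbr_munit[OF assms(2,1)] minus_minus)
  moreover have "mform l (mneg i j) (mneg p q) = (if j = p \<and> i = q then 1 else 0)"
  proof -
    have "mform l (mneg i j) (mneg p q) = mform l (munit i j) (munit p q)" by (simp add: mform_def mneg_def)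
    then show ?thesis using assms by (simp add: mform_munit munit_def)
  qed
  ultimately show ?thesis
    using LL_br[OF mtr_mneg[OF assms(1,3)] mtr_mneg[OF assms(4,6)], of r s] by (simp only:)
qed

lemma cg_plus_Kc0: "V.cg (x + Kc 0) x"
  using V.cg_add[OF V.cg_refl[of x] Kc_zero] by simp

text \<open>As \<open>2 * m \<le> l\<close>, the labels \<open>l - j + 1\<close> of the columns
  exceed \<open>m\<close>, whereas those of the rows do not. So the matrix units multiply to zero in
  either order, and there is no central term because both degrees are -1.\<close>

lemma comm_e:
  assumes "i \<in> {1..m}" "j \<in> {1..m}" "p \<in> {1..m}" "s \<in> {1..m}"
  shows "V.cg (br (e i j) (e p s)) 0"
proof -
  have ne: "l - j + 1 \<noteq> p" "l - s + 1 \<noteq> i" using assms ml by auto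
  have "V.cg (br (e i j) (e p s)) (LL (\<lambda>x y. 0) (- 2) + Kc 0)"
    using br_mneg[OF range(1)[OF assms(1)] range(2)[OF assms(2)] range(3)[OF assms(1,2)]
      range(1)[OF assms(3)] range(2)[OF assms(4)] range(3)[OF assms(3,4)], of "- 1" "- 1"] assms ne
    by (simp add: e_LL)
  also have "V.cg (LL (\<lambda>x y. 0) (- 2) + Kc 0) (0 + 0)" by (intro V.cg_add LL_zero Kc_zero)
  finally show ?thesis by simp
qed

lemma diag_e:
  assumes d: "mtr l (mdiag d) = 0" and ps: "p \<in> {1..m}" "s \<in> {1..m}"
  shows "V.cg (br (LL (mdiag d) 0) (e p s)) (scal (d p - d (l - s + 1)) * e p s)"
proof -
  have t: "mtr l (mneg p (l - s + 1)) = 0" by (intro mtr_mneg range ps)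
  have "V.cg (br (LL (mdiag d) 0) (e p s)) (LL (mbr l (mdiag d) (mneg p (l - s + 1))) (- 1) + Kc 0)"
    using LL_br[OF d t, of 0 "- 1"] ps by (simp add: e_LL)
  also have "V.cg \<dots> (LL (mbr l (mdiag d) (mneg p (l - s + 1))) (- 1))" by (rule cg_plus_Kc0)
  also have "LL (mbr l (mdiag d) (mneg p (l - s + 1))) (- 1) = LL (\<lambda>x y. (d p - d (l - s + 1)) * mneg p (l - s + 1) x y) (- 1)"
    by (rule LL_cong) (auto simp: mbr_mdiag mneg_def munit_def)
  also have "V.cg \<dots> (scal (d p - d (l - s + 1)) * e p s)"
    unfolding e_LL[OF ps] by (rule LL_scale[OF t])
  finally show ?thesis .
qed

lemma Kc_e: "p \<in> {1..m} \<Longrightarrow> s \<in> {1..m} \<Longrightarrow> V.cg (br (Kc a) (e p s)) 0"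
  unfolding e_LL at_power_el by (intro Kc_br fam_single mtr_mneg range)

section \<open>The lowering operator of degree 1\<close>

definition "f0 = LL (mneg l 1) 1"
text \<open>The central summand is the cocycle in degrees 1 and -1: the trace form of the two
  opposite root vectors equals 1.\<close>

definition "H0 = LL (hdiff l 1) 0 + Kc 1"
definition "X0 i = LL (mneg i 1) 0"
definition "Y0 j = LL (mneg l (l - j + 1)) 0"

lemma ends: "1 \<in> {1..l}" "l \<in> {1..l}" "l \<noteq> 1" using l2 by auto

text \<open>The parameter \<open>\<kappa>\<close> is the level: the diagonal part of
  \<open>H0\<close> kills the vacuum, and its central part acts by \<open>k = n - m\<close>.\<close>

lemma lower: "lowering V.PI PJ m e f0 H0 X0 Y0 (int n - int m)"
proof
  show "1 \<le> m" by (rule m1)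
  fix i j p s assume ij: "i \<in> {1..m}" "j \<in> {1..m}"
  note r = range(1)[OF ij(1)] range(2)[OF ij(2)] range(3)[OF ij]
  show "ring_ideal.cg V.PI (br f0 (e i j)) (if i = 1 \<and> j = 1 then H0 else if i = 1 then - Y0 j else if j = 1 then X0 i else 0)"
  proof -
    have jl: "l - j + 1 = l \<longleftrightarrow> j = 1" using ij ml by auto
    have 1: "V.cg (br f0 (e i j)) (LL (\<lambda>x y. (if 1 = i then munit l (l - j + 1) x y else 0) - (if l - j + 1 = l then munit i 1 x y else 0)) 0
      + Kc (if 1 = i \<and> l = l - j + 1 then 1 else 0))"
      using br_mneg[OF ends(2,1,3) r, of 1 "- 1"] unfolding f0_def e_LL[OF ij] by simp
    consider "i = 1" "j = 1" | "i = 1" "j \<noteq> 1" | "i \<noteq> 1" "j = 1" | "i \<noteq> 1" "j \<noteq> 1" by blast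
    then show ?thesis
    proof cases
      case 1
      then have "(\<lambda>x y. (if 1 = i then munit l (l - j + 1) x y else 0) - (if l - j + 1 = l then munit i 1 x y else 0)) = hdiff l 1"
        using jl by (intro ext) (simp add: hdiff_def)
      then show ?thesis using \<open>V.cg (br f0 (e i j)) _\<close> 1 jl by (simp add: H0_def)
    next
      case 2
      then have "(\<lambda>x y. (if 1 = i then munit l (l - j + 1) x y else 0) - (if l - j + 1 = l then munit i 1 x y else 0)) = (\<lambda>x y. - mneg l (l - j + 1) x y)"
        using jl by (intro ext) (simp add: mneg_def)
      then have "V.cg (br f0 (e i j)) (LL (\<lambda>x y. - mneg l (l - j + 1) x y) 0 + Kc 0)"
        using \<open>V.cg (br f0 (e i j)) _\<close> 2 jl by auto
      also have "V.cg \<dots> (LL (\<lambda>x y. - mneg l (l - j + 1) x y) 0)" by (rule cg_plus_Kc0)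
      also have "V.cg \<dots> (- Y0 j)" unfolding Y0_def
        by (rule LL_uminus[OF mtr_mneg[OF ends(2)]]) (use 2 jl in auto)
      finally show ?thesis using 2 by simp
    next
      case 3
      then have "(\<lambda>x y. (if 1 = i then munit l (l - j + 1) x y else 0) - (if l - j + 1 = l then munit i 1 x y else 0)) = mneg i 1"
        using jl by (intro ext) (simp add: mneg_def)
      then have "V.cg (br f0 (e i j)) (LL (mneg i 1) 0 + Kc 0)"
        using \<open>V.cg (br f0 (e i j)) _\<close> 3 by auto
      also have "V.cg \<dots> (X0 i)" unfolding X0_def by (rule cg_plus_Kc0)
      finally show ?thesis using 3 by simp
    next
      case 4
      then have "(\<lambda>x y. (if 1 = i then munit l (l - j + 1) x y else 0) - (if l - j + 1 = l then munit i 1 x y else 0)) = (\<lambda>x y. 0)"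
        using jl by (intro ext) simp
      then have "V.cg (br f0 (e i j)) (LL (\<lambda>x y. 0) 0 + Kc 0)"
        using \<open>V.cg (br f0 (e i j)) _\<close> 4 by auto
      also have "V.cg \<dots> (LL (\<lambda>x y. 0) 0)" by (rule cg_plus_Kc0)
      also have "V.cg \<dots> 0" by (rule LL_zero)
      finally show ?thesis using 4 by simp
    qed
  qed
  show "ring_ideal.cg V.PI (br H0 (e i j)) (((if i = 1 then - 1 else 0) + (if j = 1 then - 1 else 0)) * e i j)"
  proof -
    have "br H0 (e i j) = br (LL (hdiff l 1) 0) (e i j) + br (Kc 1) (e i j)"
      by (simp add: H0_def algebra_simps)
    also have "V.cg \<dots> (scal (hd2 l 1 i - hd2 l 1 (l - j + 1)) * e i j + 0)"
      unfolding hdiff_mdiag by (intro V.cg_add diag_e Kc_e ij) (use mtr_hdiff[OF ends(2,1)] in \<open>simp add: hdiff_mdiag\<close>)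
    also have "hd2 l 1 i - hd2 l 1 (l - j + 1) = (if i = 1 then - 1 else 0) + (if j = 1 then - 1 else 0)"
      using ij ml by (auto simp: hd2_def)
    also have "scal ((if i = 1 then - 1 else 0) + (if j = 1 then - 1 else 0)) * e i j + 0
       = ((if i = 1 then - 1 else 0) + (if j = 1 then - 1 else 0)) * e i j"
      by (simp add: scal_uminus single_add)
    finally show ?thesis .
  qed
  show "ring_ideal.cg V.PI (br (Y0 p) (e i j)) (if j = 1 then e i p else 0)" if p: "p \<in> {2..m}"
  proof -
    have p': "p \<in> {1..m}" "l - p + 1 \<noteq> l" using p ml by auto
    have jl: "l - j + 1 = l \<longleftrightarrow> j = 1" using ij ml by auto
    have pi: "l - p + 1 \<noteq> i" using p ij ml by auto
    have 1: "V.cg (br (Y0 p) (e i j)) (LL (\<lambda>x y. (if l - p + 1 = i then munit l (l - j + 1) x y else 0) - (if l - j + 1 = l then munit i (l - p + 1) x y else 0)) (- 1)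
      + Kc 0)"
      using br_mneg[OF ends(2) range(2)[OF p'(1)] p'(2)[symmetric] r, of 0 "- 1"] unfolding Y0_def e_LL[OF ij] by simp
    also have "(\<lambda>x y. (if l - p + 1 = i then munit l (l - j + 1) x y else 0) - (if l - j + 1 = l then munit i (l - p + 1) x y else 0))
       = (if j = 1 then mneg i (l - p + 1) else (\<lambda>x y. 0))"
      using jl pi by (intro ext) (simp add: mneg_def)
    also have "V.cg (LL \<dots> (- 1) + Kc 0) (LL (if j = 1 then mneg i (l - p + 1) else (\<lambda>x y. 0)) (- 1))" by (rule cg_plus_Kc0)
    also have "V.cg \<dots> (if j = 1 then e i p else 0)"
      using LL_zero by (simp add: e_LL[OF ij(1) p'(1)])
    finally show ?thesis .
  qed
  show "ring_ideal.cg V.PI (br (X0 p) (e i j)) (if i = 1 then - e p j else 0)" if p: "p \<in> {2..m}"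
  proof -
    have p': "p \<in> {1..m}" "p \<noteq> 1" using p by auto
    have pj: "l - j + 1 \<noteq> p" using p ij ml by auto
    have 1: "V.cg (br (X0 p) (e i j)) (LL (\<lambda>x y. (if 1 = i then munit p (l - j + 1) x y else 0) - (if l - j + 1 = p then munit i 1 x y else 0)) (- 1)
      + Kc 0)"
      using br_mneg[OF range(1)[OF p'(1)] ends(1) p'(2) r, of 0 "- 1"] unfolding X0_def e_LL[OF ij] by simp
    also have "(\<lambda>x y. (if 1 = i then munit p (l - j + 1) x y else 0) - (if l - j + 1 = p then munit i 1 x y else 0))
       = (if i = 1 then (\<lambda>x y. - mneg p (l - j + 1) x y) else (\<lambda>x y. 0))"
      using pj by (intro ext) (auto simp: mneg_def)
    also have "V.cg (LL \<dots> (- 1) + Kc 0) (LL (if i = 1 then (\<lambda>x y. - mneg p (l - j + 1) x y) else (\<lambda>x y. 0)) (- 1))" by (rule cg_plus_Kc0)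
    also have "V.cg \<dots> (if i = 1 then - e p j else 0)"
      using LL_zero LL_uminus[OF mtr_mneg[OF range(1)[OF p'(1)] pj[symmetric]]] by (simp add: e_LL[OF p'(1) ij(2)])
    finally show ?thesis .
  qed
  show "ring_ideal.cg V.PI (e i j * e p s) (e p s * e i j)" if "p \<in> {1..m}" "s \<in> {1..m}"
    using comm_e[OF ij that] by (rule V.br_zeroD)
next
  show "f0 \<in> PJ" unfolding f0_def VM.cj_zero_iff[symmetric] by (intro LL_vac mtr_mneg ends) simp
  show "X0 i \<in> PJ" if "i \<in> {2..m}" for i
    unfolding X0_def VM.cj_zero_iff[symmetric] by (intro LL_vac mtr_mneg) (use that ml in auto)
  show "Y0 j \<in> PJ" if "j \<in> {2..m}" for j
    unfolding Y0_def VM.cj_zero_iff[symmetric] by (intro LL_vac mtr_mneg) (use that ml in auto)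
  have "VM.cj H0 (0 + scal (k * 1))" unfolding H0_def
    by (intro VM.cj_add LL_vac Kc_vac mtr_hdiff ends) simp
  moreover have "0 + scal (k * 1) = (of_int (int n - int m) :: weyl_elt affine_elt word \<Rightarrow>\<^sub>0 complex)"
    unfolding k by (simp add: single_diff)
  ultimately show "module_ideal.cj PJ H0 (of_int (int n - int m))" by (simp only:)
qed

text \<open>\<open>Z r M\<close> says that \<open>M\<close> in degree \<open>r\<close> annihilates
  the candidate vector. In nonnegative degrees such elements are closed under brackets, without a
  central contribution, so that a few generators decide.\<close>

definition Z :: "int \<Rightarrow> cmat \<Rightarrow> bool" where "Z r M \<longleftrightarrow> VM.cj (LL M r * D ^ n) 0"

lemma cj_right: "V.cg x y \<Longrightarrow> VM.cj (x * u) (y * u)"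
  by (intro VM.cg_cj V.cg_mult V.cg_refl)

lemma Z_cong: "Z r M \<Longrightarrow> (\<And>i j. i \<in> {1..l} \<Longrightarrow> j \<in> {1..l} \<Longrightarrow> M i j = M' i j) \<Longrightarrow> Z r M'"
  unfolding Z_def using LL_cong[of M M' r] by simp

lemma Z_add: "Z r M \<Longrightarrow> Z r M' \<Longrightarrow> mtr l M = 0 \<Longrightarrow> mtr l M' = 0 \<Longrightarrow> Z r (\<lambda>i j. M i j + M' i j)"
proof -
  assume Z: "Z r M" "Z r M'" and t: "mtr l M = 0" "mtr l M' = 0"
  have "VM.cj (LL (\<lambda>i j. M i j + M' i j) r * D ^ n) ((LL M r + LL M' r) * D ^ n)"
    by (rule cj_right[OF LL_add[OF t]])
  also have "(LL M r + LL M' r) * D ^ n = LL M r * D ^ n + LL M' r * D ^ n" by (rule distrib_right)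
  also have "VM.cj \<dots> (0 + 0)" using Z unfolding Z_def by (rule VM.cj_add)
  finally show ?thesis by (simp add: Z_def)
qed

lemma Z_scale: "Z r M \<Longrightarrow> mtr l M = 0 \<Longrightarrow> Z r (\<lambda>i j. c * M i j)"
proof -
  assume Z: "Z r M" and t: "mtr l M = 0"
  have "VM.cj (LL (\<lambda>i j. c * M i j) r * D ^ n) ((scal c * LL M r) * D ^ n)"
    by (rule cj_right[OF LL_scale[OF t]])
  also have "(scal c * LL M r) * D ^ n = scal c * (LL M r * D ^ n)" by (rule mult.assoc)
  also have "VM.cj \<dots> (scal c * 0)" using Z unfolding Z_def by (rule VM.cj_left)
  finally show ?thesis by (simp add: Z_def)
qed

lemma Z_zero: "Z r (\<lambda>i j. 0)"
  using cj_right[OF LL_zero, of r "D ^ n"] by (simp add: Z_def)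

lemma Z_bracket:
  assumes Z: "Z r M" "Z s M'" and t: "mtr l M = 0" "mtr l M' = 0" and rs: "0 \<le> r" "0 \<le> s"
  shows "Z (r + s) (mbr l M M')"
proof -
  have k0: "(if r + s = 0 then of_int r * mform l M M' else 0) = 0" using rs by auto
  have "V.cg (br (LL M r) (LL M' s)) (LL (mbr l M M') (r + s) + Kc 0)"
    using LL_br[OF t, of r s] unfolding k0 .
  also have "V.cg \<dots> (LL (mbr l M M') (r + s))" by (rule cg_plus_Kc0)
  finally have "V.cg (br (LL M r) (LL M' s)) (LL (mbr l M M') (r + s))" .
  then have "VM.cj (LL (mbr l M M') (r + s) * D ^ n) (br (LL M r) (LL M' s) * D ^ n)"
    by (rule cj_right[OF V.cg_sym])
  also have "br (LL M r) (LL M' s) * D ^ n = LL M r * (LL M' s * D ^ n) - LL M' s * (LL M r * D ^ n)"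
    by (simp only: left_diff_distrib mult.assoc)
  also have "VM.cj \<dots> (LL M r * 0 - LL M' s * 0)"
    using Z unfolding Z_def by (intro VM.cj_diff VM.cj_left)
  finally show ?thesis by (simp add: Z_def)
qed

lemma Z_ann:
  assumes "V.cg (br (LL M r) D) 0" "mtr l M = 0" "0 \<le> r"
  shows "Z r M"
proof -
  have "VM.cj (LL M r * D ^ n) ((0 + of_nat n * 0) * D ^ n)"
    by (rule VM.cj_power_weight) (use assms LL_vac in simp_all)
  then show ?thesis by (simp add: Z_def)
qed

lemma Z_minus: "Z r (mneg p q) \<Longrightarrow> p \<in> {1..l} \<Longrightarrow> p \<noteq> q \<Longrightarrow> Z r (munit p q)"
  using Z_scale[of r "mneg p q" "- 1"] mtr_mneg[of p l q] by (simp add: mneg_def)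

text \<open>The bracket with the entry in row \<open>i\<close> and column \<open>j\<close> is
  nonzero only if \<open>q = i\<close> or \<open>p = l - j + 1\<close>. For \<open>q \<le> m\<close>
  the unit acts as a row operation, for \<open>p \<ge> l - m + 1\<close> as a column operation, and
  otherwise it commutes with every entry. As \<open>p < q\<close>, the first two cases exclude each
  other.\<close>

lemma Z0_pos:
  assumes pq: "1 \<le> p" "p < q" "q \<le> l"
  shows "Z 0 (munit p q)"
proof (rule Z_minus)
  have r: "p \<in> {1..l}" "q \<in> {1..l}" "p \<noteq> q" using pq by auto
  have t: "mtr l (mneg p q) = 0" by (rule mtr_mneg[OF r(1,3)])
  have b: "V.cg (br (LL (mneg p q) 0) (e i j)) (LL (\<lambda>x y. (if q = i then munit p (l - j + 1) x y else 0) - (if l - j + 1 = p then munit i q x y else 0)) (- 1))"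
    if ij: "i \<in> {1..m}" "j \<in> {1..m}" for i j
  proof -
    have "V.cg (br (LL (mneg p q) 0) (e i j)) (LL (\<lambda>x y. (if q = i then munit p (l - j + 1) x y else 0) - (if l - j + 1 = p then munit i q x y else 0)) (- 1) + Kc 0)"
      using br_mneg[OF r range(1)[OF ij(1)] range(2)[OF ij(2)] range(3)[OF ij], of 0 "- 1"] unfolding e_LL[OF ij] by simp
    also have "V.cg \<dots> (LL (\<lambda>x y. (if q = i then munit p (l - j + 1) x y else 0) - (if l - j + 1 = p then munit i q x y else 0)) (- 1))"
      by (rule cg_plus_Kc0)
    finally show ?thesis .
  qed
  show "Z 0 (mneg p q)"
  proof (rule Z_ann[OF _ t])
    show "V.cg (br (LL (mneg p q) 0) D) 0"
    proof (cases "q \<le> m")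
      case True
      then have pm: "p \<in> {1..m}" "q \<in> {1..m}" using pq by auto
      have "V.cg (br (LL (mneg p q) 0) (e i j)) (if i = q then - e p j else 0)" if ij: "i \<in> {1..m}" "j \<in> {1..m}" for i j
      proof -
        have "(\<lambda>x y. (if q = i then munit p (l - j + 1) x y else 0) - (if l - j + 1 = p then munit i q x y else 0))
           = (if i = q then (\<lambda>x y. - mneg p (l - j + 1) x y) else (\<lambda>x y. 0))"
          using pm ij ml by (intro ext) (auto simp: mneg_def)
        then have "V.cg (br (LL (mneg p q) 0) (e i j)) (LL (if i = q then (\<lambda>x y. - mneg p (l - j + 1) x y) else (\<lambda>x y. 0)) (- 1))"
          using b[OF ij] by simp
        also have "V.cg \<dots> (if i = q then - e p j else 0)"
          using LL_zero LL_uminus[OF mtr_mneg[OF range(1)[OF pm(1)] range(3)[OF pm(1) ij(2)]]] by (simp add: e_LL[OF pm(1) ij(2)])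
        finally show ?thesis .
      qed
      then have "V.cg (br (LL (mneg p q) 0) D) (pdet m (e(q := \<lambda>j. - e p j)))"
        unfolding D_def by (intro V.br_pdet_row pm)
      also have "V.cg \<dots> 0"
      proof -
        have "pdet m (e(q := \<lambda>j. - e p j)) = - pdet m (e(q := e p))" by (rule pdet_row_uminus) (rule pm)
        also have "V.cg \<dots> (- 0)"
        proof (intro V.cg_uminus V.pdet_equal_rows[of p _ q] pm)
          fix a b c d assume abcd: "a \<in> {1..m}" "b \<in> {1..m}" "c \<in> {1..m}" "d \<in> {1..m}"
          have cc: "V.cg (e a b * e c d) (e c d * e a b)" if "a \<in> {1..m}" "c \<in> {1..m}" for a c
            by (rule V.br_zeroD(1)[OF comm_e]) (use that abcd in auto)
          have x: "(e(q := e p)) a = e (if a = q then p else a)" for a by simp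
          show "V.cg ((e(q := e p)) a b * (e(q := e p)) c d) ((e(q := e p)) c d * (e(q := e p)) a b)"
            unfolding x by (rule cc) (use abcd pm in auto)
        qed (use r in auto)
        finally show ?thesis by simp
      qed
      finally show ?thesis .
    next
      case False
      show ?thesis
      proof (cases "p \<ge> l - m + 1")
        case True
        let ?p = "l - p + 1" and ?q = "l - q + 1"
        have pm: "?p \<in> {1..m}" "?q \<in> {1..m}" "?p \<noteq> ?q" using True pq ml by auto
        have "V.cg (br (LL (mneg p q) 0) (e i j)) (if j = ?p then e i ?q else 0)" if ij: "i \<in> {1..m}" "j \<in> {1..m}" for i j
        proof -
          have j: "l - j + 1 = p \<longleftrightarrow> j = ?p" and qi: "q \<noteq> i" and qq: "l - ?q + 1 = q" using ij pq ml False by auto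
          have "(\<lambda>x y. (if q = i then munit p (l - j + 1) x y else 0) - (if l - j + 1 = p then munit i q x y else 0))
             = (if j = ?p then mneg i q else (\<lambda>x y. 0))"
            using qi j by (intro ext) (auto simp: mneg_def)
          then have "V.cg (br (LL (mneg p q) 0) (e i j)) (LL (if j = ?p then mneg i q else (\<lambda>x y. 0)) (- 1))"
            using b[OF ij] by simp
          also have "V.cg \<dots> (if j = ?p then e i ?q else 0)"
          proof -
            have "e i ?q = LL (mneg i q) (- 1)" using e_LL[OF ij(1) pm(2)] by (simp only: qq)
            then show ?thesis using LL_zero by (cases "j = ?p") (simp_all only: if_True if_False simp_thms V.cg_refl)
          qed
          finally show ?thesis .
        qed
        then have "V.cg (br (LL (mneg p q) 0) D) (pdet m (\<lambda>i j. if j = ?p then e i ?q else e i j))"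
          unfolding D_def by (intro V.br_pdet_col pm)
        also have "V.cg \<dots> 0" by (rule V.pdet_equal_cols[of ?p _ ?q]) (use pm in auto)
        finally show ?thesis .
      next
        case np: False
        have "V.cg (br (LL (mneg p q) 0) (e i j)) ((0 + 0) * e i j)" if ij: "i \<in> {1..m}" "j \<in> {1..m}" for i j
        proof -
          have "q \<noteq> i" "l - j + 1 \<noteq> p" using ij np False ml by auto
          then show ?thesis using V.cg_trans[OF b[OF ij]] LL_zero by simp
        qed
        then have "V.cg (br (LL (mneg p q) 0) D) ((sum (\<lambda>_. 0) {1..m} + sum (\<lambda>_. 0) {1..m}) * D)"
          unfolding D_def by (intro V.br_pdet_diag) simp_all
        then show ?thesis by simp
      qed
    qed
  qed simp
qed (use pq in auto)

lemma Z1_low: "Z 1 (munit l 1)"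
proof (rule Z_minus)
  interpret lw: lowering V.PI PJ m e f0 H0 X0 Y0 "int n - int m" by (rule lower)
  have "f0 * lw.D ^ n \<in> PJ" by (rule lw.f_power_zero[OF refl n1])
  moreover have "lw.D = D" unfolding lw.D_def D_def ..
  ultimately show "Z 1 (mneg l 1)" unfolding Z_def VM.cj_zero_iff f0_def by simp
qed (rule ends)+

lemma Z_traceless:
  assumes "mtr l M = 0" "\<And>p q. p \<in> {1..l} \<Longrightarrow> q \<in> {1..l} \<Longrightarrow> p \<noteq> q \<Longrightarrow> Z r (munit p q)"
    "\<And>p q. p \<in> {1..l} \<Longrightarrow> q \<in> {1..l} \<Longrightarrow> p \<noteq> q \<Longrightarrow> Z r (hdiff p q)"
  shows "Z r M"
  using assms(1)
proof (induction rule: traceless_induct)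
  case (cong M M')
  show ?case by (rule Z_cong[OF cong])
qed (use assms Z_zero Z_add Z_scale in auto)

text \<open>Brackets of the lowest unit in degree 1 with positive units in degree 0 give the first
  column, then the differences with the first diagonal unit, the first row, the other units and
  finally the other diagonal differences.\<close>

lemma Z1: assumes "mtr l M = 0" shows "Z 1 M"
proof -
  have up: "Z 1 (mbr l (munit p q) N)" if "1 \<le> p" "p < q" "q \<le> l" "Z 1 N" "mtr l N = 0" for p q N
    using Z_bracket[OF Z0_pos[OF that(1-3)] that(4)] that by (simp add: mtr_munit)
  have tu: "mtr l (munit p q) = 0" if "p \<in> {1..l}" "p \<noteq> q" for p q using that by (simp add: mtr_munit)
  have mb: "mbr l (munit i j) (munit p q) = (\<lambda>x y. (if j = p then munit i q x y else 0) - (if q = i then munit p j x y else 0))"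
    if "i \<in> {1..l}" "j \<in> {1..l}" for i j p q
    using that by (intro ext) (rule mbr_munit)
  have p1: "Z 1 (munit p 1)" if p: "1 < p" "p \<le> l" for p
  proof (cases "p = l")
    case False
    have "Z 1 (mbr l (munit p l) (munit l 1))" by (rule up) (use p False Z1_low tu ends in auto)
    then show ?thesis using p mb[of p l l 1] ends by simp
  qed (use Z1_low in simp)
  have h1: "Z 1 (hdiff 1 p)" if p: "1 < p" "p \<le> l" for p
  proof -
    have "Z 1 (mbr l (munit 1 p) (munit p 1))" by (rule up) (use p p1 tu in auto)
    moreover have "mbr l (munit 1 p) (munit p 1) = hdiff 1 p" using p by (intro WA.mbr_munit_hdiff) auto
    ultimately show ?thesis by simp
  qed
  have th: "mtr l (hdiff p q) = 0" if "p \<in> {1..l}" "q \<in> {1..l}" for p q using that by (rule mtr_hdiff)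
  have u: "Z 1 (munit p q)" if pq: "p \<in> {1..l}" "q \<in> {1..l}" "p \<noteq> q" for p q
  proof -
    consider "q = 1" | "p = 1" | "p \<noteq> 1" "q \<noteq> 1" by blast
    then show ?thesis
    proof cases
      case 1
      then show ?thesis using p1[of p] pq by auto
    next
      case 2
      then have q: "1 < q" "q \<le> l" using pq by auto
      \<comment> \<open>The bracket is -2 times the unit at \<open>(1, q)\<close>, which explains
        the factor used next.\<close>
      have "Z 1 (mbr l (munit 1 q) (hdiff 1 q))" by (rule up) (use q h1 th in auto)
      then have "Z 1 (\<lambda>x y. - (1 / 2) * mbr l (munit 1 q) (hdiff 1 q) x y)" by (rule Z_scale) (rule mtr_mbr)
      then show ?thesis
      proof (rule Z_cong)
        fix x y assume xy: "x \<in> {1..l}" "y \<in> {1..l}"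
        have "mbr l (munit 1 q) (hdiff 1 q) x y = - ((hd2 1 q x - hd2 1 q y) * munit 1 q x y)"
          unfolding hdiff_mdiag using mbr_antisym[of l "munit 1 q" "mdiag (hd2 1 q)" x y] mbr_mdiag[OF xy] by simp
        then show "- (1 / 2) * mbr l (munit 1 q) (hdiff 1 q) x y = munit p q x y"
          using 2 q by (auto simp: munit_def hd2_def)
      qed
    next
      case 3
      then have pq': "1 < p" "p \<le> l" "1 < q" "q \<le> l" using pq by auto
      have "Z 1 (mbr l (munit 1 q) (munit p 1))" by (rule up) (use pq' p1 tu in auto)
      then have "Z 1 (\<lambda>x y. - 1 * mbr l (munit 1 q) (munit p 1) x y)" by (rule Z_scale) (rule mtr_mbr)
      then show ?thesis
        by (rule Z_cong) (use pq pq' mb[of 1 q p 1] in simp)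
    qed
  qed
  show ?thesis
  proof (rule Z_traceless[OF assms u])
    fix p q assume pq: "p \<in> {1..l}" "q \<in> {1..l}" "p \<noteq> q"
    have "Z 1 (mbr l (munit p q) (munit q p))" if "p < q"
      by (rule up) (use pq that u tu in auto)
    then have 1: "Z 1 (hdiff p q)" if "p < q" using that pq WA.mbr_munit_hdiff[of p q] by simp
    have "Z 1 (mbr l (munit q p) (munit p q))" if "q < p"
      by (rule up) (use pq that u tu in auto)
    then have 2: "Z 1 (hdiff q p)" if "q < p" using that pq WA.mbr_munit_hdiff[of q p] by simp
    show "Z 1 (hdiff p q)"
    proof (cases "p < q")
      case False
      then have "Z 1 (\<lambda>x y. - 1 * hdiff q p x y)" using pq 2 th by (intro Z_scale) auto
      then show ?thesis by (rule Z_cong) (simp add: hdiff_def)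
    qed (rule 1)
  qed
qed

text \<open>Each further degree is reached by bracketing with degree 1, because the traceless
  matrices are spanned by brackets of traceless matrices.\<close>

lemma Z_pos: "mtr l M = 0 \<Longrightarrow> Z (int (Suc r)) M"
proof (induction r arbitrary: M)
  case 0
  then show ?case using Z1 by simp
next
  case (Suc r)
  have br: "Z (int (Suc (Suc r))) (mbr l N P)" if "mtr l N = 0" "mtr l P = 0" for N P
  proof -
    have "Z (1 + int (Suc r)) (mbr l N P)" using that by (intro Z_bracket Z1 Suc.IH) auto
    then show ?thesis by (simp add: add.commute)
  qed
  show ?case
  proof (rule Z_traceless[OF Suc.prems])
    fix p q assume pq: "p \<in> {1..l}" "q \<in> {1..l}" "p \<noteq> q"
    have "Z (int (Suc (Suc r))) (mbr l (munit p q) (munit q p))" using pq by (intro br) (auto simp: mtr_munit)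
    then show "Z (int (Suc (Suc r))) (hdiff p q)" using WA.mbr_munit_hdiff[OF pq(1,2)] by simp
    have "Z (int (Suc (Suc r))) (mbr l (hdiff p q) (munit p q))" using pq by (intro br mtr_hdiff) (auto simp: mtr_munit)
    then have "Z (int (Suc (Suc r))) (\<lambda>x y. (1 / 2) * mbr l (hdiff p q) (munit p q) x y)" by (rule Z_scale) (rule mtr_mbr)
    then show "Z (int (Suc (Suc r))) (munit p q)"
    proof (rule Z_cong)
      fix x y assume xy: "x \<in> {1..l}" "y \<in> {1..l}"
      show "(1 / 2) * mbr l (hdiff p q) (munit p q) x y = munit p q x y"
        unfolding hdiff_mdiag mbr_mdiag[OF xy] using pq by (auto simp: munit_def hd2_def)
    qed
  qed
qed


section \<open>The vector in the induced module, its annihilators and its weight\<close>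

definition v where "v = V.vec (D ^ n)"

lemma Dn_fcar: "D ^ n \<in> fcar (carrier G)"
  by (intro fcar_power D_fcar)

lemma v_eq: "(Delta l B m [^]\<^bsub>env G\<^esub> n) \<odot>\<^bsub>verma (sl l) B k\<^esub> vacuum (sl l) B k = v"
  unfolding verma_eq Delta_eq V.env_eq V.Q_pow[OF D_fcar] v_def
  using V.smult_vec[OF Dn_fcar fcar_closed(2)] unfolding V.env_eq by simp

lemma gen_v: "x \<in> carrier G \<Longrightarrow> env_gen G x \<odot>\<^bsub>verma (sl l) B k\<^esub> v = V.vec (letter x * D ^ n)"
proof -
  assume x: "x \<in> carrier G"
  have "env_gen G x = V.Q (letter x)" by (simp only: V.env_gen_eq)
  then show ?thesis unfolding verma_eq v_def using V.smult_vec[OF fcar_closed(4)[OF x] Dn_fcar] by (simp only:)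
qed

lemma gen_v_zero: "x \<in> carrier G \<Longrightarrow> VM.cj (letter x * D ^ n) 0 \<Longrightarrow>
    env_gen G x \<odot>\<^bsub>verma (sl l) B k\<^esub> v = \<zero>\<^bsub>verma (sl l) B k\<^esub>"
proof -
  assume x: "x \<in> carrier G" and c: "VM.cj (letter x * D ^ n) 0"
  have f: "letter x * D ^ n \<in> fcar (carrier G)" by (intro fcar_closed(6) fcar_closed(4) x Dn_fcar)
  have "letter x * D ^ n \<in> V.J" using c f unfolding VM.cj_zero_iff by simp
  then show ?thesis unfolding gen_v[OF x] unfolding verma_eq V.vec_zero_iff[OF f] .
qed

lemma n_plus_kills: "x \<in> n_plus l \<Longrightarrow> env_gen G (at_power (sl l) x 0) \<odot>\<^bsub>verma (sl l) B k\<^esub> v = \<zero>\<^bsub>verma (sl l) B k\<^esub>"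
proof -
  assume x: "x \<in> n_plus l"
  let ?H = "{iota M | M. mtr l M = 0 \<and> Z 0 M}"
  have "n_plus l \<subseteq> ?H"
  proof (rule WA.n_plus_least)
    show "linear_subspace ?H (sl l)" unfolding WA.linear_subspace_iota
    proof (intro conjI ballI allI)
      show "?H \<subseteq> carrier (sl l)" by auto
      show "\<zero>\<^bsub>sl l\<^esub> \<in> ?H" unfolding WA.iota_ops using Z_zero mtr_simps(5) by blast
      fix y assume "y \<in> ?H"
      then obtain M where M: "y = iota M" "mtr l M = 0" "Z 0 M" by blast
      show "c \<odot>\<^bsub>sl l\<^esub> y \<in> ?H" for c
      proof -
        have "mtr l (\<lambda>i j. c * M i j) = 0" "Z 0 (\<lambda>i j. c * M i j)"
          using M by (simp add: mtr_simps, intro Z_scale)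
        then show ?thesis unfolding M(1) WA.iota_ops by blast
      qed
      fix z assume "z \<in> ?H"
      then obtain M' where M': "z = iota M'" "mtr l M' = 0" "Z 0 M'" by blast
      have "mtr l (\<lambda>i j. M i j + M' i j) = 0" "Z 0 (\<lambda>i j. M i j + M' i j)"
        using M M' by (simp add: mtr_simps, intro Z_add)
      then show "y \<oplus>\<^bsub>sl l\<^esub> z \<in> ?H" unfolding M(1) M'(1) WA.iota_ops by blast
    qed
    show "iota (munit p q) \<in> ?H" if "1 \<le> p" "p < q" "q \<le> l" for p q
      using Z0_pos[OF that] that mtr_munit[of p l q] by auto
  qed
  then obtain M where M: "x = iota M" "mtr l M = 0" "Z 0 M" using x by blast
  show ?thesis unfolding M(1)
  proof (rule gen_v_zero)
    show "at_power (sl l) (iota M) 0 \<in> carrier G" unfolding at_power_el using M by simp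
    show "VM.cj (LL M 0 * D ^ n) 0" using M(3) by (simp add: Z_def)
  qed
qed

text \<open>Decomposes a loop into homogeneous components. A letter depends additively on its
  element only modulo the relations, hence the congruence and the induction.\<close>

lemma letter_sum: "finite S \<Longrightarrow> fam F \<Longrightarrow>
   V.cg (letter (el (\<lambda>r. if r \<in> S then F r else (\<lambda>i j. 0)) 0 0)) (\<Sum>r\<in>S. LL (F r) r)"
proof (induction S rule: finite_induct)
  case empty
  then show ?case using Kc_zero by simp
next
  case (insert r S)
  let ?F = "\<lambda>S r. if r \<in> S then F r else (\<lambda>i j. 0)"
  have fS: "fam (?F S)" for S
  proof -
    have "{n. ?F S n \<noteq> (\<lambda>i j. 0)} \<subseteq> {n. F n \<noteq> (\<lambda>i j. 0)}" by auto
    then show ?thesis using insert.prems by (auto simp: fam_def mtr_simps intro: finite_subset)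
  qed
  have t: "mtr l (F r) = 0" using insert.prems by (rule fam_tr)
  have "el (?F (insert r S)) 0 0 = el (single (F r) r) 0 0 \<oplus>\<^bsub>G\<^esub> el (?F S) 0 0"
    unfolding el_ops using insert.hyps by (intro trans[OF el_cong[of "?F (insert r S)" "\<lambda>n i j. single (F r) r n i j + ?F S n i j"]]) (auto simp: single_def)
  then have "V.cg (letter (el (?F (insert r S)) 0 0)) (letter (el (single (F r) r) 0 0) + letter (el (?F S) 0 0))"
    using letter_add[OF el_G[OF fam_single[OF t]] el_G[OF fS]] by simp
  also have "V.cg \<dots> (LL (F r) r + (\<Sum>r\<in>S. LL (F r) r))"
    unfolding at_power_el[symmetric] using insert by (intro V.cg_add V.cg_refl) simp
  finally show ?case using insert.hyps by simp
qed

lemma positive_kills: "x \<in> positive_loops (sl l) \<Longrightarrow> env_gen G x \<odot>\<^bsub>verma (sl l) B k\<^esub> v = \<zero>\<^bsub>verma (sl l) B k\<^esub>"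
proof -
  assume x: "x \<in> positive_loops (sl l)"
  then obtain f where f: "x = (f, 0, 0)" "f \<in> loops (sl l)" "\<forall>r\<le>0. f r = \<zero>\<^bsub>sl l\<^esub>"
    by (auto simp: positive_loops_def)
  define F where "F = (\<lambda>r. matof (f r))"
  have F: "fam F" "x = el F 0 0" using loops_fam[OF f(2)] f(1) by (simp_all add: F_def el_def)
  have F0: "F r = (\<lambda>i j. 0)" if "r \<le> 0" for r using f(3) that by (simp add: F_def matof_def)
  let ?S = "{r. F r \<noteq> (\<lambda>i j. 0)}"
  have fin: "finite ?S" by (rule fam_support[OF F(1)])
  have FS: "(\<lambda>r. if r \<in> ?S then F r else (\<lambda>i j. 0)) = F" by auto
  have "VM.cj (letter x * D ^ n) ((\<Sum>r\<in>?S. LL (F r) r) * D ^ n)"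
    using cj_right[OF letter_sum[OF fin F(1)]] unfolding FS F(2) .
  also have "(\<Sum>r\<in>?S. LL (F r) r) * D ^ n = (\<Sum>r\<in>?S. LL (F r) r * D ^ n)" by (rule sum_distrib_right)
  also have "VM.cj \<dots> (\<Sum>r\<in>?S. 0)"
  proof (rule VM.cj_sum)
    fix r assume "r \<in> ?S"
    then have "\<not> r \<le> 0" using F0 by blast
    then have "r = int (Suc (nat (r - 1)))" by simp
    then show "VM.cj (LL (F r) r * D ^ n) 0"
      using Z_pos[OF fam_tr[OF F(1)], of "nat (r - 1)" r] unfolding Z_def by simp
  qed
  finally have "VM.cj (letter x * D ^ n) 0" by simp
  then show ?thesis using F by (intro gen_v_zero) simp
qed

text \<open>\<open>k * a\<close> is the weight of the vacuum. Each of the \<open>n\<close> factors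
  \<open>D\<close> adds the weights of its row and column labels; the degree -1 of its
  \<open>m\<close> entries appears as the summand \<open>- b\<close> in the sum over rows.\<close>

definition wt :: "weyl_elt affine_elt \<Rightarrow> complex" where
  "wt = (\<lambda>(f, a, b). k * a + of_nat n *
     ((\<Sum>i\<in>{1..m}. eps l i (f 0) - b) + (\<Sum>j\<in>{1..m}. - eps l (l - j + 1) (f 0))))"

lemma affine_cartan_el: "h \<in> affine_cartan l \<longleftrightarrow> (\<exists>d a b. h = el (single (mdiag d) 0) a b \<and> (\<Sum>i\<in>{1..l}. d i) = 0)"
proof -
  have "fst (at_power (sl l) (iota (mdiag d)) 0) = fst (el (single (mdiag d) 0) 0 0)" for d
    by (simp only: at_power_el)
  then have "(fst (at_power (sl l) (iota (mdiag d)) 0), a, b) = el (single (mdiag d) 0) a b" for d a b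
    by (simp add: el_def)
  then show ?thesis unfolding affine_cartan_def WA.cartan_eq by auto metis+
qed

lemma wt_el: "wt (el (single (mdiag d) 0) a b) = k * a + of_nat n * ((\<Sum>i\<in>{1..m}. d i - b) + (\<Sum>j\<in>{1..m}. - d (l - j + 1)))"
proof -
  have "(\<Sum>i\<in>{1..m}. eps l i (iota (mdiag d)) - b) = (\<Sum>i\<in>{1..m}. d i - b)"
    by (intro sum.cong refl) (simp only: WA.eps_iota range)
  moreover have "(\<Sum>j\<in>{1..m}. - eps l (l - j + 1) (iota (mdiag d))) = (\<Sum>j\<in>{1..m}. - d (l - j + 1))"
    by (intro sum.cong refl) (simp only: WA.eps_iota range)
  ultimately show ?thesis unfolding wt_def el_def by (simp add: single_def)
qed

lemma wt_linear: "linear_functional_on (affine_cartan l) G wt"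
  unfolding linear_functional_on_def
proof (intro conjI ballI allI)
  fix x c assume "x \<in> affine_cartan l"
  then obtain d a b where x: "x = el (single (mdiag d) 0) a b" "(\<Sum>i\<in>{1..l}. d i) = 0" unfolding affine_cartan_el by blast
  have "el (\<lambda>n i j. c * single (mdiag d) 0 n i j) (c * a) (c * b) = el (single (mdiag (\<lambda>i. c * d i)) 0) (c * a) (c * b)"
    by (rule el_cong) (simp add: single_def mdiag_def)
  then show "wt (c \<odot>\<^bsub>G\<^esub> x) = c * wt x"
    unfolding x el_ops by (simp add: wt_el sum_distrib_left algebra_simps sum_negf sum_subtractf sum.distrib)
  fix y assume "y \<in> affine_cartan l"
  then obtain d' a' b' where y: "y = el (single (mdiag d') 0) a' b'" "(\<Sum>i\<in>{1..l}. d' i) = 0" unfolding affine_cartan_el by blast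
  have "el (\<lambda>n i j. single (mdiag d) 0 n i j + single (mdiag d') 0 n i j) (a + a') (b + b')
     = el (single (mdiag (\<lambda>i. d i + d' i)) 0) (a + a') (b + b')"
    by (rule el_cong) (simp add: single_def mdiag_def)
  then show "wt (x \<oplus>\<^bsub>G\<^esub> y) = wt x + wt y"
    unfolding x y el_ops by (simp add: wt_el sum_negf sum_subtractf sum.distrib algebra_simps)
qed

lemma weight: "weight_vector l B (verma (sl l) B k) v"
  unfolding weight_vector_def
proof (intro exI[of _ wt] conjI ballI wt_linear)
  fix h assume "h \<in> affine_cartan l"
  then obtain d a b where h: "h = el (single (mdiag d) 0) a b" "(\<Sum>i\<in>{1..l}. d i) = 0" unfolding affine_cartan_el by blast
  have t: "mtr l (mdiag d) = 0" using h(2) by (simp add: mtr_simps)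
  have hG: "h \<in> carrier G" unfolding h by (intro el_G fam_single t)
  let ?s = "(\<Sum>i\<in>{1..m}. scal (d i - b)) + (\<Sum>j\<in>{1..m}. scal (- d (l - j + 1))) ::
      weyl_elt affine_elt word \<Rightarrow>\<^sub>0 complex"
  have sp: "V.cg (letter h) (LL (mdiag d) 0 + Kc a + Dl b)"
    unfolding h at_power_el by (rule el_split[OF fam_single[OF t]])
  have "V.cg (br (letter h) D) (?s * D)"
    unfolding D_def
  proof (rule V.br_pdet_diag)
    fix i j assume ij: "i \<in> {1..m}" "j \<in> {1..m}"
    have tm: "mtr l (mneg i (l - j + 1)) = 0" by (intro mtr_mneg range ij)
    have "V.cg (br (letter h) (e i j)) (br (LL (mdiag d) 0 + Kc a + Dl b) (e i j))"
      by (intro V.br_cg sp V.cg_refl)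
    also have "br (LL (mdiag d) 0 + Kc a + Dl b) (e i j) = br (LL (mdiag d) 0) (e i j) + br (Kc a) (e i j) + br (Dl b) (e i j)"
      by (simp add: algebra_simps)
    also have "V.cg \<dots> (scal (d i - d (l - j + 1)) * e i j + 0 + scal (b * of_int (- 1)) * e i j)"
      using Dl_br[OF tm, of b "- 1"] unfolding e_LL[OF ij, symmetric]
      by (intro V.cg_add diag_e[OF t ij] Kc_e[OF ij])
    also have "\<dots> = (scal (d i - d (l - j + 1)) + scal (b * of_int (- 1))) * e i j" by (simp add: distrib_right)
    also have "scal (d i - d (l - j + 1)) + scal (b * of_int (- 1)) = scal (d i - b) + scal (- d (l - j + 1))"
      unfolding scal_add by (rule arg_cong[of _ _ scal]) simp
    finally show "V.cg (br (letter h) (e i j)) ((scal (d i - b) + scal (- d (l - j + 1))) * e i j)" .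
  qed (rule scal_commute[symmetric])+
  moreover have "?s = scal ((\<Sum>i\<in>{1..m}. d i - b) + (\<Sum>j\<in>{1..m}. - d (l - j + 1)))"
    by (simp only: scal_sum[symmetric] scal_add)
  ultimately have b: "V.cg (br (letter h) D) (scal ((\<Sum>i\<in>{1..m}. d i - b) + (\<Sum>j\<in>{1..m}. - d (l - j + 1))) * D)"
    by (simp only:)
  have vac: "VM.cj (letter h) (scal (k * a))"
  proof -
    have "VM.cj (letter h) (LL (mdiag d) 0 + Kc a + Dl b)" by (rule VM.cg_cj[OF sp])
    also have "VM.cj \<dots> (0 + scal (k * a) + 0)" by (intro VM.cj_add LL_vac t Kc_vac Dl_vac) simp
    finally show ?thesis by simp
  qed
  have "VM.cj (letter h * D ^ n) ((scal (k * a) + of_nat n * scal ((\<Sum>i\<in>{1..m}. d i - b) + (\<Sum>j\<in>{1..m}. - d (l - j + 1)))) * D ^ n)"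
    by (rule VM.cj_power_weight[OF b _ _ vac]) (rule scal_commute[symmetric])+
  also have "scal (k * a) + of_nat n * scal ((\<Sum>i\<in>{1..m}. d i - b) + (\<Sum>j\<in>{1..m}. - d (l - j + 1))) = scal (wt h)"
    unfolding h wt_el by (simp only: scal_of_nat[symmetric] scal_mult scal_add)
  finally have c: "VM.cj (letter h * D ^ n) (scal (wt h) * D ^ n)" .
  have f: "letter h * D ^ n \<in> fcar (carrier G)" "scal (wt h) * D ^ n \<in> fcar (carrier G)"
    by (intro fcar_closed(6) fcar_closed(4) fcar_closed(3) hG Dn_fcar)+
  have "letter h * D ^ n - scal (wt h) * D ^ n \<in> V.J"
    using c f unfolding VM.cj_def by (simp add: proj_diff)
  then have "V.vec (letter h * D ^ n) = V.vec (scal (wt h) * D ^ n)" by (simp only: V.vec_eq_iff[OF f])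
  moreover have "wt h \<odot>\<^bsub>env G\<^esub> \<one>\<^bsub>env G\<^esub> = V.Q (scal (wt h))"
    unfolding V.env_eq V.Q_ops using V.Q_smult[OF fcar_closed(2), of "wt h"] by simp
  moreover have "V.Q (scal (wt h)) \<odot>\<^bsub>verma (sl l) B k\<^esub> v = V.vec (scal (wt h) * D ^ n)"
    unfolding verma_eq v_def by (rule V.smult_vec[OF fcar_closed(3) Dn_fcar])
  ultimately show "env_gen G h \<odot>\<^bsub>verma (sl l) B k\<^esub> v = (wt h \<odot>\<^bsub>env G\<^esub> \<one>\<^bsub>env G\<^esub>) \<odot>\<^bsub>verma (sl l) B k\<^esub> v"
    using gen_v[OF hG] by simp
qed

lemma singular: "D ^ n \<notin> V.J \<Longrightarrow> singular_vector l B (verma (sl l) B k) v"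
  unfolding singular_vector_def
  using weight n_plus_kills positive_kills V.vec_carrier[OF Dn_fcar] V.vec_zero_iff[OF Dn_fcar]
  by (auto simp: v_def verma_eq)

end

section \<open>Row-finite matrices\<close>

text \<open>Finite rows make all products finite sums and the matrices a ring. Loops, the degree
  operator, the projections and the points of the big cell all live in it.\<close>

typedef 'k rfm = "UNIV :: ('k \<Rightarrow> 'k \<Rightarrow>\<^sub>0 complex) set" by simp

definition ent :: "'k rfm \<Rightarrow> 'k \<Rightarrow> 'k \<Rightarrow> complex" where
  "ent A r s = Poly_Mapping.lookup (Rep_rfm A r) s"

definition mk :: "('k \<Rightarrow> 'k \<Rightarrow> complex) \<Rightarrow> 'k rfm" where
  "mk f = Abs_rfm (\<lambda>r. Abs_poly_mapping (f r))"

lemma ent_mk: "(\<And>r. finite {s. f r s \<noteq> 0}) \<Longrightarrow> ent (mk f) r s = f r s"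
  by (simp add: ent_def mk_def Abs_rfm_inverse)

lemma ent_finite [simp]: "finite {s. ent A r s \<noteq> 0}"
  by (simp add: ent_def)

lemma rfm_eqI: "(\<And>r s. ent A r s = ent B r s) \<Longrightarrow> A = B"
  by (metis (no_types, lifting) Rep_rfm_inject ent_def ext poly_mapping_eqI)

instantiation rfm :: (type) ring_1
begin
definition "0 = (mk (\<lambda>r s. 0) :: 'a rfm)"
definition "1 = (mk (\<lambda>r s. if r = s then 1 else 0) :: 'a rfm)"
definition "A + B = (mk (\<lambda>r s. ent A r s + ent B r s) :: 'a rfm)"
definition "A - B = (mk (\<lambda>r s. ent A r s - ent B r s) :: 'a rfm)"
definition "- A = (mk (\<lambda>r s. - ent A r s) :: 'a rfm)"
definition "A * B = (mk (\<lambda>r s. \<Sum>u\<in>{u. ent A r u \<noteq> 0}. ent A r u * ent B u s) :: 'a rfm)"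

lemma ent_simps [simp]:
  "ent 0 r s = 0" "ent 1 r s = (if r = s then 1 else 0)" "ent (A + B) r s = ent A r s + ent B r s"
  "ent (A - B) r s = ent A r s - ent B r s" "ent (- A) r s = - ent A r s"
proof -
  have "finite {s. ent A r s + ent B r s \<noteq> 0}" "finite {s. ent A r s - ent B r s \<noteq> 0}" for r
    by (rule finite_subset[of _ "{s. ent A r s \<noteq> 0} \<union> {s. ent B r s \<noteq> 0}"]; auto)+
  then show "ent (A + B) r s = ent A r s + ent B r s" "ent (A - B) r s = ent A r s - ent B r s"
    by (simp_all add: plus_rfm_def minus_rfm_def ent_mk)
qed (simp_all add: zero_rfm_def one_rfm_def uminus_rfm_def ent_mk)

lemma ent_mult: "ent (A * B) r s = (\<Sum>u\<in>{u. ent A r u \<noteq> 0}. ent A r u * ent B u s)"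
proof -
  have "{s. (\<Sum>u\<in>{u. ent A r u \<noteq> 0}. ent A r u * ent B u s) \<noteq> 0} \<subseteq> (\<Union>u\<in>{u. ent A r u \<noteq> 0}. {s. ent B u s \<noteq> 0})" for r
    by (auto elim!: sum.not_neutral_contains_not_neutral)
  then have "finite {s. (\<Sum>u\<in>{u. ent A r u \<noteq> 0}. ent A r u * ent B u s) \<noteq> 0}" for r
    by (rule finite_subset) simp
  then show ?thesis unfolding times_rfm_def by (rule ent_mk)
qed

text \<open>The summation set only has to contain the indices where both factors are nonzero. This
  allows finiteness to be taken from a column of the right factor instead of a row of the left
  one.\<close>

lemma ent_mult_row: "finite S \<Longrightarrow> (\<And>u. ent A r u \<noteq> 0 \<Longrightarrow> ent B u s \<noteq> 0 \<Longrightarrow> u \<in> S) \<Longrightarrow>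
   ent (A * B) r s = (\<Sum>u\<in>S. ent A r u * ent B u s)"
  unfolding ent_mult
proof -
  assume S: "finite S" "\<And>u. ent A r u \<noteq> 0 \<Longrightarrow> ent B u s \<noteq> 0 \<Longrightarrow> u \<in> S"
  have "(\<Sum>u\<in>{u. ent A r u \<noteq> 0}. ent A r u * ent B u s) = (\<Sum>u\<in>{u. ent A r u \<noteq> 0} \<union> S. ent A r u * ent B u s)"
    by (rule sum.mono_neutral_left) (use S in auto)
  also have "\<dots> = (\<Sum>u\<in>S. ent A r u * ent B u s)"
    by (rule sum.mono_neutral_right) (use S in auto)
  finally show "(\<Sum>u\<in>{u. ent A r u \<noteq> 0}. ent A r u * ent B u s) = (\<Sum>u\<in>S. ent A r u * ent B u s)" .
qed

instance
proof
  fix A B C :: "'a rfm"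
  show "A * B * C = A * (B * C)"
  proof (rule rfm_eqI)
    fix r s
    let ?A = "{u. ent A r u \<noteq> 0}"
    let ?S = "\<Union>v\<in>?A. {u. ent B v u \<noteq> 0}"
    have S: "finite ?S" by simp
    have "ent (A * B * C) r s = (\<Sum>u\<in>?S. ent (A * B) r u * ent C u s)"
      by (rule ent_mult_row[OF S]) (auto simp: ent_mult elim!: sum.not_neutral_contains_not_neutral)
    also have "\<dots> = (\<Sum>u\<in>?S. \<Sum>v\<in>?A. ent A r v * (ent B v u * ent C u s))"
      by (simp add: ent_mult sum_distrib_right mult.assoc)
    also have "\<dots> = (\<Sum>v\<in>?A. \<Sum>u\<in>?S. ent A r v * (ent B v u * ent C u s))" by (rule sum.swap)
    also have "\<dots> = (\<Sum>v\<in>?A. ent A r v * ent (B * C) v s)"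
    proof (rule sum.cong[OF refl])
      fix v assume "v \<in> ?A"
      then have "ent (B * C) v s = (\<Sum>u\<in>?S. ent B v u * ent C u s)"
        by (intro ent_mult_row[OF S]) blast
      then show "(\<Sum>u\<in>?S. ent A r v * (ent B v u * ent C u s)) = ent A r v * ent (B * C) v s"
        by (simp add: sum_distrib_left)
    qed
    also have "\<dots> = ent (A * (B * C)) r s" by (simp add: ent_mult)
    finally show "ent (A * B * C) r s = ent (A * (B * C)) r s" .
  qed
  show "(A + B) * C = A * C + B * C"
  proof (rule rfm_eqI)
    fix r s
    let ?S = "{u. ent A r u \<noteq> 0} \<union> {u. ent B r u \<noteq> 0}"
    have "ent ((A + B) * C) r s = (\<Sum>u\<in>?S. ent (A + B) r u * ent C u s)"
      "ent (A * C) r s = (\<Sum>u\<in>?S. ent A r u * ent C u s)" "ent (B * C) r s = (\<Sum>u\<in>?S. ent B r u * ent C u s)"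
      by (rule ent_mult_row; auto)+
    then show "ent ((A + B) * C) r s = ent (A * C + B * C) r s"
      by (simp add: distrib_right sum.distrib)
  qed
  show "A * (B + C) = A * B + A * C"
    by (rule rfm_eqI) (simp add: ent_mult distrib_left sum.distrib)
  show "1 * A = A"
  proof (rule rfm_eqI)
    fix r s show "ent (1 * A) r s = ent A r s" by (subst ent_mult_row[of "{r}"]) (auto split: if_splits)
  qed
  show "A * 1 = A"
  proof (rule rfm_eqI)
    fix r s show "ent (A * 1) r s = ent A r s" by (subst ent_mult_row[of "{s}"]) (auto split: if_splits)
  qed
  show "(0 :: 'a rfm) \<noteq> 1"
  proof
    assume "(0 :: 'a rfm) = 1"
    then have "ent (0 :: 'a rfm) r r = ent 1 r r" for r by simp
    then show False by simp
  qed
qed (auto intro!: rfm_eqI)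

end

definition sc :: "complex \<Rightarrow> 'k rfm" where "sc c = mk (\<lambda>r s. if r = s then c else 0)"

lemma ent_sc [simp]: "ent (sc c) r s = (if r = s then c else 0)"
  unfolding sc_def by (rule ent_mk) simp

lemma ent_sc_mult [simp]: "ent (sc c * A) r s = c * ent A r s" "ent (A * sc c) r s = ent A r s * c"
  by (subst ent_mult_row[of "{r}"], auto split: if_splits, subst ent_mult_row[of "{s}"], auto split: if_splits)

lemma sc_zero [simp]: "sc 0 = 0"
  by (rule rfm_eqI) simp

lemma sc_commute: "sc c * A = A * sc c"
  by (rule rfm_eqI) simp

section \<open>Finite support, finite columns and the trace\<close>

definition fsup :: "'k rfm \<Rightarrow> bool" where
  "fsup A \<longleftrightarrow> (\<exists>W. finite W \<and> (\<forall>r s. ent A r s \<noteq> 0 \<longrightarrow> r \<in> W \<and> s \<in> W))"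

definition colfin :: "'k rfm \<Rightarrow> bool" where
  "colfin A \<longleftrightarrow> (\<forall>s. finite {r. ent A r s \<noteq> 0})"

lemma fsup_add: "fsup A \<Longrightarrow> fsup B \<Longrightarrow> fsup (A + B)"
proof -
  assume "fsup A" "fsup B"
  then obtain W W' where W: "finite W" "\<And>r s. ent A r s \<noteq> 0 \<Longrightarrow> r \<in> W \<and> s \<in> W"
    "finite W'" "\<And>r s. ent B r s \<noteq> 0 \<Longrightarrow> r \<in> W' \<and> s \<in> W'" unfolding fsup_def by blast
  have "r \<in> W \<union> W' \<and> s \<in> W \<union> W'" if "ent (A + B) r s \<noteq> 0" for r s
    using W(2)[of r s] W(4)[of r s] that by (cases "ent A r s = 0") auto
  then show ?thesis unfolding fsup_def using W by (intro exI[of _ "W \<union> W'"]) auto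
qed

lemma fsup_uminus: "fsup A \<Longrightarrow> fsup (- A)" by (simp add: fsup_def)

lemma fsup_diff: "fsup A \<Longrightarrow> fsup B \<Longrightarrow> fsup (A - B)"
  using fsup_add[OF _ fsup_uminus, of A B] by simp

lemma ent_mult_nonzero: "ent (A * B) r s \<noteq> 0 \<Longrightarrow> \<exists>u. ent A r u \<noteq> 0 \<and> ent B u s \<noteq> 0"
  unfolding ent_mult by (auto elim!: sum.not_neutral_contains_not_neutral)

lemma fsup_mult_left: "fsup A \<Longrightarrow> fsup (A * B)"
proof -
  assume "fsup A"
  then obtain W where W: "finite W" "\<And>r s. ent A r s \<noteq> 0 \<Longrightarrow> r \<in> W \<and> s \<in> W" unfolding fsup_def by blast
  let ?W = "W \<union> (\<Union>u\<in>W. {s. ent B u s \<noteq> 0})"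
  have "r \<in> ?W \<and> s \<in> ?W" if "ent (A * B) r s \<noteq> 0" for r s
    using ent_mult_nonzero[OF that] W(2) by blast
  then show ?thesis unfolding fsup_def using W(1) by (intro exI[of _ ?W]) auto
qed

lemma fsup_mult_right: "fsup A \<Longrightarrow> colfin B \<Longrightarrow> fsup (B * A)"
proof -
  assume "fsup A" and B: "colfin B"
  then obtain W where W: "finite W" "\<And>r s. ent A r s \<noteq> 0 \<Longrightarrow> r \<in> W \<and> s \<in> W" unfolding fsup_def by blast
  let ?W = "W \<union> (\<Union>u\<in>W. {s. ent B s u \<noteq> 0})"
  have "r \<in> ?W \<and> s \<in> ?W" if "ent (B * A) r s \<noteq> 0" for r s
    using ent_mult_nonzero[OF that] W(2) by blast
  then show ?thesis unfolding fsup_def using W(1) B by (intro exI[of _ ?W]) (auto simp: colfin_def)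
qed

lemma colfin_add: "colfin A \<Longrightarrow> colfin B \<Longrightarrow> colfin (A + B)"
  unfolding colfin_def
proof
  fix s assume A: "\<forall>s. finite {r. ent A r s \<noteq> 0}" and B: "\<forall>s. finite {r. ent B r s \<noteq> 0}"
  have "{r. ent (A + B) r s \<noteq> 0} \<subseteq> {r. ent A r s \<noteq> 0} \<union> {r. ent B r s \<noteq> 0}" by auto
  then show "finite {r. ent (A + B) r s \<noteq> 0}" by (rule finite_subset) (use A B in auto)
qed

lemma colfin_sc: "colfin A \<Longrightarrow> colfin (sc c * A)"
  unfolding colfin_def by (auto intro: finite_subset[rotated])

text \<open>Meaningful when only finitely many diagonal entries are nonzero; otherwise the sum takes
  the default value 0. The rules below therefore ask for \<open>fsup\<close> where additivity or
  cyclicity is concerned.\<close>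

definition tr :: "'k rfm \<Rightarrow> complex" where
  "tr A = (\<Sum>r\<in>{r. ent A r r \<noteq> 0}. ent A r r)"

lemma tr_eq: "finite W \<Longrightarrow> (\<And>r. ent A r r \<noteq> 0 \<Longrightarrow> r \<in> W) \<Longrightarrow> tr A = (\<Sum>r\<in>W. ent A r r)"
  unfolding tr_def by (rule sum.mono_neutral_left) auto

lemma tr_add: "fsup A \<Longrightarrow> fsup B \<Longrightarrow> tr (A + B) = tr A + tr B"
proof -
  assume "fsup A" "fsup B"
  then obtain W W' where W: "finite W" "\<And>r s. ent A r s \<noteq> 0 \<Longrightarrow> r \<in> W \<and> s \<in> W"
    "finite W'" "\<And>r s. ent B r s \<noteq> 0 \<Longrightarrow> r \<in> W' \<and> s \<in> W'" unfolding fsup_def by blast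
  have "tr A = (\<Sum>r\<in>W \<union> W'. ent A r r)" "tr B = (\<Sum>r\<in>W \<union> W'. ent B r r)"
    by (rule tr_eq; use W in blast)+
  moreover have "tr (A + B) = (\<Sum>r\<in>W \<union> W'. ent (A + B) r r)"
  proof (rule tr_eq)
    fix r assume "ent (A + B) r r \<noteq> 0"
    then show "r \<in> W \<union> W'" using W(2)[of r r] W(4)[of r r] by (cases "ent A r r = 0") auto
  qed (use W in auto)
  ultimately show ?thesis by (simp add: sum.distrib)
qed

lemma tr_uminus: "tr (- A) = - tr A"
  by (simp add: tr_def sum_negf)

lemma tr_diff: "fsup A \<Longrightarrow> fsup B \<Longrightarrow> tr (A - B) = tr A - tr B"
  using tr_add[OF _ fsup_uminus, of A B] by (simp add: tr_uminus)

lemma tr_sc: "tr (sc c * A) = c * tr A"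
  by (cases "c = 0") (simp_all add: tr_def sum_distrib_left)

text \<open>Finite support of one factor already turns both traces into double sums over the same
  finite square.\<close>

lemma tr_commute: "fsup A \<Longrightarrow> tr (A * B) = tr (B * A)"
proof -
  assume "fsup A"
  then obtain W where W: "finite W" "\<And>r s. ent A r s \<noteq> 0 \<Longrightarrow> r \<in> W \<and> s \<in> W" unfolding fsup_def by blast
  have "tr (A * B) = (\<Sum>r\<in>W. ent (A * B) r r)" "tr (B * A) = (\<Sum>r\<in>W. ent (B * A) r r)"
  proof -
    have "r \<in> W" if "ent (A * B) r r \<noteq> 0" for r using ent_mult_nonzero[OF that] W(2) by blast
    then show "tr (A * B) = (\<Sum>r\<in>W. ent (A * B) r r)" by (rule tr_eq[OF W(1)])
    have "r \<in> W" if "ent (B * A) r r \<noteq> 0" for r using ent_mult_nonzero[OF that] W(2) by blast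
    then show "tr (B * A) = (\<Sum>r\<in>W. ent (B * A) r r)" by (rule tr_eq[OF W(1)])
  qed
  moreover have "ent (A * B) r r = (\<Sum>u\<in>W. ent A r u * ent B u r)" for r
    by (rule ent_mult_row) (use W in auto)
  moreover have "ent (B * A) r r = (\<Sum>u\<in>W. ent B r u * ent A u r)" for r
    by (rule ent_mult_row) (use W in auto)
  ultimately show ?thesis
    by (simp only:) (subst sum.swap, simp add: mult.commute)
qed

section \<open>The Riccati vector fields on the big cell\<close>

text \<open>The index \<open>(a, i)\<close> stands for the basis vector $e_i\otimes t^a$ of
  $\mathbb C^\ell\otimes\mathbb C[t,t^{-1}]$, and \<open>p\<close>, \<open>q\<close> (\<open>pp\<close>, \<open>qq\<close> below) project to \<open>a \<ge> 0\<close> and \<open>a < 0\<close>.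
  A matrix \<open>Z\<close> with \<open>Z = q Z p\<close> is the operator whose graph is a point of the big cell of the
  Grassmannian, and an operator \<open>X\<close> acts there by the
  vector field \<open>(q - Z) X (p + Z)\<close>, and on the powers of the determinant line bundle with the
  multiplier \<open>tr (p X Z)\<close>. Since vector fields form an anti-representation, brackets
  appear with the opposite sign. Any matrix \<open>Z\<close> is allowed as a point; only its block \<open>zc Z\<close> matters.\<close>

type_synonym ix = "int \<times> nat"

definition pp :: "ix rfm" where "pp = mk (\<lambda>r s. if r = s \<and> 0 \<le> fst r then 1 else 0)"
definition qq :: "ix rfm" where "qq = 1 - pp"

lemma ent_pp: "ent pp r s = (if r = s \<and> 0 \<le> fst r then 1 else 0)"
  unfolding pp_def by (rule ent_mk) (rule finite_subset[of _ "{_}"], auto)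

lemma ent_qq: "ent qq r s = (if r = s \<and> fst r < 0 then 1 else 0)"
  by (simp add: qq_def ent_pp)

lemma ent_pp_mult: "ent (pp * A) r s = (if 0 \<le> fst r then ent A r s else 0)"
    "ent (A * pp) r s = (if 0 \<le> fst s then ent A r s else 0)"
proof -
  have "ent (pp * A) r s = (\<Sum>u\<in>{r}. ent pp r u * ent A u s)"
    by (rule ent_mult_row) (auto simp: ent_pp split: if_splits)
  then show "ent (pp * A) r s = (if 0 \<le> fst r then ent A r s else 0)" by (simp add: ent_pp)
  have "ent (A * pp) r s = (\<Sum>u\<in>{s}. ent A r u * ent pp u s)"
    by (rule ent_mult_row) (auto simp: ent_pp split: if_splits)
  then show "ent (A * pp) r s = (if 0 \<le> fst s then ent A r s else 0)" by (simp add: ent_pp)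
qed

lemma ent_qq_mult: "ent (qq * A) r s = (if fst r < 0 then ent A r s else 0)"
  "ent (A * qq) r s = (if fst s < 0 then ent A r s else 0)"
  by (simp_all add: qq_def left_diff_distrib right_diff_distrib ent_pp_mult)

lemma pq [simp]: "pp * pp = pp" "qq * qq = qq" "pp * qq = 0" "qq * pp = 0"
  "pp * (pp * A) = pp * A" "qq * (qq * A) = qq * A" "pp * (qq * A) = 0" "qq * (pp * A) = 0"
  by (rule rfm_eqI; auto simp: ent_pp_mult ent_qq_mult ent_pp ent_qq)+

lemma pq_one: "pp + qq = 1" by (simp add: qq_def)

definition zc :: "ix rfm \<Rightarrow> ix rfm" where "zc Z = qq * Z * pp"

lemma ent_zc: "ent (zc Z) r s = (if fst r < 0 \<and> 0 \<le> fst s then ent Z r s else 0)"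
  by (simp add: zc_def ent_pp_mult ent_qq_mult)

lemma zc_simps [simp]: "qq * zc Z = zc Z" "zc Z * pp = zc Z" "pp * zc Z = 0" "zc Z * qq = 0"
  "qq * (zc Z * A) = zc Z * A" "zc Z * (pp * A) = zc Z * A" "pp * (zc Z * A) = 0" "zc Z * (qq * A) = 0"
  by (simp_all add: zc_def mult.assoc)

definition Ric :: "ix rfm \<Rightarrow> ix rfm \<Rightarrow> ix rfm" where
  "Ric X Z = (qq - zc Z) * X * (pp + zc Z)"

definition mlt :: "ix rfm \<Rightarrow> ix rfm \<Rightarrow> complex" where
  "mlt X Z = tr (pp * X * zc Z)"

text \<open>The finite block with rows in \<open>pp\<close> and columns in \<open>qq\<close> makes
  the quadratic term of the vector field polynomial and the trace in the multiplier finite. Finite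
  columns do the same for the term in which \<open>X\<close> stands to the right of
  \<open>Z\<close>.\<close>

definition good :: "ix rfm \<Rightarrow> bool" where
  "good X \<longleftrightarrow> colfin X \<and> fsup (pp * X * qq)"

lemma Ric_expand: "Ric X Z = qq * X * pp + qq * X * zc Z - zc Z * X * pp - zc Z * X * zc Z"
  by (simp add: Ric_def algebra_simps)

lemma zc_Ric: "zc (Ric X Z) = Ric X Z"
  unfolding zc_def[of "Ric X Z"] unfolding Ric_expand by (simp add: algebra_simps)

lemma mlt_eq: "mlt X Z = tr (pp * X * qq * zc Z)"
  by (simp add: mlt_def mult.assoc)

interpretation ps: poly_space "\<lambda>v Z. ent (Z :: ix rfm) (fst v) (snd v)" "\<lambda>Z \<epsilon> U. Z + sc \<epsilon> * U"
  by unfold_locales simp_all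

lemma ent_poly: "(\<lambda>Z. ent (Z :: ix rfm) r s) \<in> ps.polyfun"
  using ps.coord[of "(r, s)"] by simp

lemma zc_poly: "(\<lambda>Z. ent (zc Z) r s) \<in> ps.polyfun"
proof (cases "fst r < 0 \<and> 0 \<le> fst s")
  case True
  then have "(\<lambda>Z. ent (zc Z) r s) = (\<lambda>Z. ent Z r s)" by (intro ext) (simp add: ent_zc)
  then show ?thesis by (simp only: ent_poly)
next
  case False
  then have "(\<lambda>Z. ent (zc Z) r s) = (\<lambda>Z. 0)" by (intro ext) (auto simp: ent_zc)
  then show ?thesis by (simp only: ps.const)
qed

lemma good_finite: "good X \<Longrightarrow> \<exists>W. finite W \<and> (\<forall>r s. ent (pp * X * qq) r s \<noteq> 0 \<longrightarrow> r \<in> W \<and> s \<in> W)"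
  unfolding good_def fsup_def by blast

lemma xz_poly:
  "(\<lambda>Z. ent (A * zc Z) r s) \<in> ps.polyfun"
  "colfin A \<Longrightarrow> (\<lambda>Z. ent (zc Z * A) r s) \<in> ps.polyfun"
proof -
  have "(\<lambda>Z. \<Sum>u\<in>{u. ent A r u \<noteq> 0}. ent A r u * ent (zc Z) u s) \<in> ps.polyfun"
    by (intro ps.polyfun_sum ps.polyfun_scale zc_poly)
  then show "(\<lambda>Z. ent (A * zc Z) r s) \<in> ps.polyfun" by (simp add: ent_mult)
  assume A: "colfin A"
  have fin: "finite {u. ent A u s \<noteq> 0}" using A unfolding colfin_def by blast
  have "ent (zc Z * A) r s = (\<Sum>u\<in>{u. ent A u s \<noteq> 0}. ent (zc Z) r u * ent A u s)" for Z
    by (rule ent_mult_row[OF fin]) simp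
  moreover have "(\<lambda>Z. \<Sum>u\<in>{u. ent A u s \<noteq> 0}. ent (zc Z) r u * ent A u s) \<in> ps.polyfun"
    by (intro ps.polyfun_sum ps.mult zc_poly ps.const)
  ultimately show "(\<lambda>Z. ent (zc Z * A) r s) \<in> ps.polyfun" by simp
qed

lemma zxz: "zc Z * X * zc Z = zc Z * ((pp * X * qq) * zc Z)"
  by (simp add: mult.assoc)

lemma Ric_poly: "good X \<Longrightarrow> ps.poly_field (Ric X)"
  unfolding ps.poly_field_def
proof
  fix v :: "ix \<times> ix"
  assume X: "good X"
  obtain r s where v: "v = (r, s)" by (cases v)
  obtain W where W: "finite W" "\<And>r s. ent (pp * X * qq) r s \<noteq> 0 \<Longrightarrow> r \<in> W \<and> s \<in> W" using good_finite[OF X] by blast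
  have 1: "(\<lambda>Z. ent (qq * X * zc Z) r s) \<in> ps.polyfun" by (rule xz_poly)
  have cf: "colfin (X * pp)"
  proof -
    have "{r. ent (X * pp) r s \<noteq> 0} \<subseteq> {r. ent X r s \<noteq> 0}" for s by (auto simp: ent_pp_mult)
    then show ?thesis using X unfolding good_def colfin_def by (meson finite_subset)
  qed
  have 2: "(\<lambda>Z. ent (zc Z * X * pp) r s) \<in> ps.polyfun" using xz_poly(2)[OF cf] by (simp add: mult.assoc)
  have "ent (zc Z * X * zc Z) r s = (\<Sum>u\<in>W. ent (zc Z) r u * ent ((pp * X * qq) * zc Z) u s)" for Z
    unfolding zxz
  proof (rule ent_mult_row[OF W(1)])
    fix u assume "ent ((pp * X * qq) * zc Z) u s \<noteq> 0"
    from ent_mult_nonzero[OF this] show "u \<in> W" using W(2) by blast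
  qed
  moreover have "(\<lambda>Z. \<Sum>u\<in>W. ent (zc Z) r u * ent ((pp * X * qq) * zc Z) u s) \<in> ps.polyfun"
    by (intro ps.polyfun_sum ps.mult zc_poly xz_poly)
  ultimately have 3: "(\<lambda>Z. ent (zc Z * X * zc Z) r s) \<in> ps.polyfun" by simp
  have "(\<lambda>Z. ent (qq * X * pp) r s + ent (qq * X * zc Z) r s - ent (zc Z * X * pp) r s - ent (zc Z * X * zc Z) r s) \<in> ps.polyfun"
    by (intro ps.polyfun_diff ps.add 1 2 3 ps.const)
  then show "(\<lambda>Z. ent (Ric X Z) (fst v) (snd v)) \<in> ps.polyfun"
    unfolding v Ric_expand ent_simps fst_conv snd_conv .
qed

text \<open>The set \<open>W\<close> is chosen before \<open>A\<close>: the trace is a fixed finite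
  linear form in the entries of \<open>A\<close> and can be differentiated term by term.\<close>

lemma mlt_sum:
  assumes X: "good X"
  shows "\<exists>W. finite W \<and> (\<forall>A. tr (pp * X * qq * A) = (\<Sum>r\<in>W. \<Sum>u\<in>W. ent (pp * X * qq) r u * ent A u r))"
proof -
  obtain W where W: "finite W" "\<And>r s. ent (pp * X * qq) r s \<noteq> 0 \<Longrightarrow> r \<in> W \<and> s \<in> W" using good_finite[OF X] by blast
  have "tr (pp * X * qq * A) = (\<Sum>r\<in>W. \<Sum>u\<in>W. ent (pp * X * qq) r u * ent A u r)" for A
  proof -
    have "tr (pp * X * qq * A) = (\<Sum>r\<in>W. ent (pp * X * qq * A) r r)"
    proof (rule tr_eq[OF W(1)])
      fix r assume "ent (pp * X * qq * A) r r \<noteq> 0"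
      from ent_mult_nonzero[OF this] show "r \<in> W" using W(2) by blast
    qed
    also have "\<dots> = (\<Sum>r\<in>W. \<Sum>u\<in>W. ent (pp * X * qq) r u * ent A u r)"
      by (intro sum.cong refl ent_mult_row W(1)) (use W(2) in blast)
    finally show ?thesis .
  qed
  then show ?thesis using W(1) by blast
qed

lemma mlt_poly: "good X \<Longrightarrow> mlt X \<in> ps.polyfun"
proof -
  assume "good X"
  then obtain W where W: "\<And>A. tr (pp * X * qq * A) = (\<Sum>r\<in>W. \<Sum>u\<in>W. ent (pp * X * qq) r u * ent A u r)"
    using mlt_sum by blast
  have "mlt X = (\<lambda>Z. \<Sum>r\<in>W. \<Sum>u\<in>W. ent (pp * X * qq) r u * ent (zc Z) u r)"
    by (rule ext) (simp only: mlt_eq W)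
  also have "\<dots> \<in> ps.polyfun" by (intro ps.polyfun_sum ps.polyfun_scale zc_poly)
  finally show ?thesis .
qed

lemma Der_zc: "ps.Der V (\<lambda>Z. ent (zc Z) r s) Z = ent (zc (V Z)) r s"
proof (cases "fst r < 0 \<and> 0 \<le> fst s")
  case True
  then show ?thesis using ps.Der_coord[of V "(r, s)" Z] by (simp add: ent_zc)
qed (auto simp: ent_zc)

lemma Der_mlt: "good Y \<Longrightarrow> ps.Der (Ric X) (mlt Y) Z = tr (pp * Y * qq * Ric X Z)"
proof -
  assume "good Y"
  then obtain W where W: "\<And>A. tr (pp * Y * qq * A) = (\<Sum>r\<in>W. \<Sum>u\<in>W. ent (pp * Y * qq) r u * ent A u r)"
    using mlt_sum by blast
  have "mlt Y = (\<lambda>Z. \<Sum>r\<in>W. \<Sum>u\<in>W. ent (pp * Y * qq) r u * ent (zc Z) u r)"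
    by (rule ext) (simp only: mlt_eq W)
  then have "ps.Der (Ric X) (mlt Y) Z = (\<Sum>r\<in>W. \<Sum>u\<in>W. ent (pp * Y * qq) r u * ent (zc (Ric X Z)) u r)"
    by (simp only: ps.Der_sum ps.polyfun_sum ps.polyfun_scale zc_poly ps.Der_scale Der_zc)
  then show ?thesis by (simp only: W zc_Ric)
qed

lemma product_expand:
  fixes N P U Y e :: "'a::ring_1"
  assumes e: "\<And>A. A * e = e * A"
  shows "(N - e * U) * Y * (P + e * U) = N * Y * P + e * (N * Y * U - U * Y * P) - e * (e * (U * Y * U))"
proof -
  have c: "A * (e * C) = e * (A * C)" for A C by (simp only: mult.assoc[symmetric] e)
  have "(N - e * U) * Y * (P + e * U) = (N * Y * P - e * U * Y * P) + (N * Y * (e * U) - e * U * Y * (e * U))"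
    by (simp only: left_diff_distrib distrib_left)
  also have "N * Y * (e * U) = e * (N * Y * U)" by (rule c)
  also have "e * U * Y * (e * U) = e * (e * (U * Y * U))" unfolding c[of "e * U * Y"] by (simp only: mult.assoc)
  finally show ?thesis by (simp add: right_diff_distrib mult.assoc)
qed

text \<open>Along a line the Riccati field is a quadratic polynomial in the parameter; the
  derivative is its linear coefficient.\<close>

lemma Ric_derivative: "ps.Der V (\<lambda>Z. ent (Ric Y Z) r s) Z =
    ent ((qq - zc Z) * Y * zc (V Z) - zc (V Z) * Y * (pp + zc Z)) r s"
proof (rule ps.Der_eqI)
  let ?U = "zc (V Z)"
  have sz: "zc (Z + sc \<epsilon> * V Z) = zc Z + sc \<epsilon> * ?U" for \<epsilon>
    by (rule rfm_eqI) (simp add: ent_zc)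
  have "ent (Ric Y (Z + sc \<epsilon> * V Z)) r s = ent (Ric Y Z) r s
      + \<epsilon> * ent ((qq - zc Z) * Y * ?U - ?U * Y * (pp + zc Z)) r s - \<epsilon> * \<epsilon> * ent (?U * Y * ?U) r s" for \<epsilon>
  proof -
    have "Ric Y (Z + sc \<epsilon> * V Z) = Ric Y Z + sc \<epsilon> * ((qq - zc Z) * Y * ?U - ?U * Y * (pp + zc Z)) - sc \<epsilon> * (sc \<epsilon> * (?U * Y * ?U))"
      unfolding Ric_def sz diff_diff_add[symmetric] add.assoc[symmetric] by (rule product_expand) (rule sc_commute[symmetric])
    then show ?thesis by simp
  qed
  then show "((\<lambda>\<epsilon>. ent (Ric Y (Z + sc \<epsilon> * V Z)) r s) has_field_derivative
     ent ((qq - zc Z) * Y * ?U - ?U * Y * (pp + zc Z)) r s) (at 0)"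
    by (simp only:) (auto intro!: derivative_eq_intros)
qed

text \<open>It is used for \<open>N = qq - zc Z\<close> and \<open>P = pp + zc Z\<close>, where
  \<open>P + N = 1\<close>. The right side then becomes \<open>N (Y X - X Y) P\<close>, which is
  again a Riccati field.\<close>

lemma commutator_insert:
  fixes N P X Y :: "'a::ring_1"
  shows "(N * Y * (N * X * P) - (N * X * P) * Y * P) - (N * X * (N * Y * P) - (N * Y * P) * X * P)
     = N * Y * (P + N) * X * P - N * X * (P + N) * Y * P"
proof -
  have e: "(a - b) - (c - d) = (d + a) - (b + c)" for a b c d :: 'a by (simp add: algebra_simps)
  show ?thesis by (simp only: e distrib_left distrib_right mult.assoc)
qed

lemma Ric_bracket:
  assumes "good X" "good Y" "f \<in> ps.polyfun"
  shows "ps.Der (Ric X) (ps.Der (Ric Y) f) Z - ps.Der (Ric Y) (ps.Der (Ric X) f) Z = ps.Der (Ric (Y * X - X * Y)) f Z"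
proof (rule ps.Der_bracket[OF Ric_poly[OF assms(1)] Ric_poly[OF assms(2)] _ assms(3)])
  fix v Z
  let ?P = "pp + zc Z" and ?N = "qq - zc Z"
  have PN: "?P + ?N = 1" by (simp add: pq_one)
  have "(?N * Y * zc (Ric X Z) - zc (Ric X Z) * Y * ?P) - (?N * X * zc (Ric Y Z) - zc (Ric Y Z) * X * ?P)
     = ?N * Y * (?P + ?N) * X * ?P - ?N * X * (?P + ?N) * Y * ?P"
    unfolding zc_Ric unfolding Ric_def by (rule commutator_insert)
  also have "\<dots> = Ric (Y * X - X * Y) Z"
    unfolding PN Ric_def by (simp only: mult_1_right left_diff_distrib right_diff_distrib mult.assoc)
  finally show "ps.Der (Ric X) (\<lambda>Z. ent (Ric Y Z) (fst v) (snd v)) Z - ps.Der (Ric Y) (\<lambda>Z. ent (Ric X Z) (fst v) (snd v)) Z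
     = ent (Ric (Y * X - X * Y) Z) (fst v) (snd v)"
    unfolding Ric_derivative by (metis ent_simps(4))
qed

text \<open>The terms quadratic in \<open>Z\<close> cancel by cyclicity of the trace, and the linear
  ones form the multiplier of the commutator. The constant that remains is the Japanese cocycle of
  the splitting by \<open>pp\<close> and \<open>qq\<close>, the source of the central
  charge.\<close>

lemma mlt_bracket:
  assumes X: "good X" and Y: "good Y"
  shows "ps.Der (Ric X) (mlt Y) Z - ps.Der (Ric Y) (mlt X) Z = mlt (Y * X - X * Y) Z
     + (tr (pp * Y * qq * X * pp) - tr (pp * X * qq * Y * pp))"
proof -
  let ?z = "zc Z"
  define x where "x = pp * X * qq"
  define y where "y = pp * Y * qq"
  have fx: "fsup x" "fsup y" using X Y by (simp_all add: good_def x_def y_def)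
  have zz: "?z * A * ?z = ?z * (pp * A * qq) * ?z" for A by (simp add: mult.assoc)
  have cp: "colfin (pp * A * pp)" if "good A" for A
  proof -
    have "{r. ent (pp * A * pp) r s \<noteq> 0} \<subseteq> {r. ent A r s \<noteq> 0}" for s by (auto simp: ent_pp_mult)
    then show ?thesis using that unfolding good_def colfin_def by (meson finite_subset)
  qed
  \<comment> \<open>\<open>y'\<close> is the finite block of one operator and \<open>x'\<close> that
    of the other. The finite support of \<open>y'\<close> justifies splitting the trace into four
    and rotating its factors.\<close>
  have exp: "tr (y' * Ric X' Z) = tr (y' * X' * pp) + tr (y' * X' * ?z) - tr (pp * X' * pp * y' * ?z) - tr (y' * ?z * x' * ?z)"
    if y': "fsup y'" "y' * qq = y'" "pp * y' = y'" and X': "good X'" and x': "x' = pp * X' * qq" for y' X' x'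
  proof -
    have "y' * Ric X' Z = y' * qq * X' * pp + y' * qq * X' * ?z - y' * ?z * X' * pp - y' * ?z * X' * ?z"
      unfolding Ric_expand by (simp only: distrib_left right_diff_distrib mult.assoc)
    also have "\<dots> = y' * X' * pp + y' * X' * ?z - y' * (?z * X' * pp) - y' * (?z * x' * ?z)"
      unfolding y'(2) x' by (simp add: mult.assoc)
    finally have "tr (y' * Ric X' Z) = tr (y' * X' * pp) + tr (y' * X' * ?z) - tr (y' * (?z * X' * pp)) - tr (y' * (?z * x' * ?z))"
      using y'(1) by (simp add: tr_diff tr_add fsup_mult_left fsup_add fsup_diff mult.assoc)
    also have "tr (y' * (?z * X' * pp)) = tr (pp * X' * pp * y' * ?z)"
    proof -
      have "tr (y' * (?z * X' * pp)) = tr ((?z * X' * pp) * y')" by (rule tr_commute[OF y'(1)])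
      also have "(?z * X' * pp) * y' = ?z * (pp * X' * pp * y')" by (simp add: mult.assoc)
      also have "tr \<dots> = tr ((pp * X' * pp * y') * ?z)"
        by (rule tr_commute[symmetric]) (intro fsup_mult_right y' cp X')
      finally show ?thesis .
    qed
    finally show ?thesis by (simp only: mult.assoc)
  qed
  have ex: "ps.Der (Ric X) (mlt Y) Z = tr (y * X * pp) + tr (y * X * ?z) - tr (pp * X * pp * y * ?z) - tr (y * ?z * x * ?z)"
    unfolding Der_mlt[OF Y] y_def[symmetric] by (rule exp[OF fx(2) _ _ X x_def]) (simp_all add: y_def mult.assoc)
  have ey: "ps.Der (Ric Y) (mlt X) Z = tr (x * Y * pp) + tr (x * Y * ?z) - tr (pp * Y * pp * x * ?z) - tr (x * ?z * y * ?z)"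
    unfolding Der_mlt[OF X] x_def[symmetric] by (rule exp[OF fx(1) _ _ Y y_def]) (simp_all add: x_def mult.assoc)
  have sym: "tr (y * ?z * x * ?z) = tr (x * ?z * y * ?z)"
  proof -
    have "tr (y * (?z * x * ?z)) = tr ((?z * x * ?z) * y)" by (rule tr_commute[OF fx(2)])
    also have "(?z * x * ?z) * y = ?z * (x * ?z * y)" by (simp only: mult.assoc)
    also have "tr \<dots> = tr ((x * ?z * y) * ?z)"
      by (rule tr_commute[symmetric]) (simp only: mult.assoc fsup_mult_left fx)
    finally show ?thesis by (simp only: mult.assoc)
  qed
  have fs: "fsup (y * X * ?z)" "fsup (x * Y * ?z)" "fsup (pp * X * pp * y * ?z)" "fsup (pp * Y * pp * x * ?z)"
    by (rule fsup_mult_left[OF fsup_mult_left[OF fx(2)]], rule fsup_mult_left[OF fsup_mult_left[OF fx(1)]],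
      rule fsup_mult_left[OF fsup_mult_right[OF fx(2) cp[OF X]]], rule fsup_mult_left[OF fsup_mult_right[OF fx(1) cp[OF Y]]])
  have "mlt (Y * X - X * Y) Z = tr (y * X * ?z + pp * Y * pp * x * ?z - (x * Y * ?z + pp * X * pp * y * ?z))"
  proof -
    have ins: "pp * (A * B) * ?z = pp * A * qq * B * ?z + pp * A * pp * (pp * B * qq) * ?z" for A B
    proof -
      have "pp * (A * B) * ?z = pp * A * (pp + qq) * B * ?z" by (simp only: pq_one mult_1_right mult.assoc)
      also have "\<dots> = pp * A * qq * B * ?z + pp * A * pp * B * ?z"
        by (simp only: distrib_left distrib_right add.commute)
      also have "pp * A * pp * B * ?z = pp * A * pp * (pp * B * qq) * ?z" by (simp add: mult.assoc)
      finally show ?thesis .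
    qed
    have "pp * (Y * X - X * Y) * ?z = pp * (Y * X) * ?z - pp * (X * Y) * ?z"
      by (simp only: left_diff_distrib right_diff_distrib)
    then show ?thesis unfolding mlt_def ins x_def y_def by simp
  qed
  also have "\<dots> = tr (y * X * ?z) + tr (pp * Y * pp * x * ?z) - (tr (x * Y * ?z) + tr (pp * X * pp * y * ?z))"
    by (simp only: tr_diff tr_add fs fsup_add)
  finally show ?thesis unfolding ex ey sym unfolding x_def y_def by simp
qed

lemma Ric_linear: "Ric (X + Y) Z = Ric X Z + Ric Y Z" "Ric (sc c * X) Z = sc c * Ric X Z"
proof -
  show "Ric (X + Y) Z = Ric X Z + Ric Y Z" by (simp add: Ric_def distrib_left distrib_right)
  show "Ric (sc c * X) Z = sc c * Ric X Z"
    unfolding Ric_def by (metis mult.assoc sc_commute)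
qed

lemma mlt_linear: "good X \<Longrightarrow> good Y \<Longrightarrow> mlt (X + Y) Z = mlt X Z + mlt Y Z" "mlt (sc c * X) Z = c * mlt X Z"
proof -
  assume "good X" "good Y"
  then show "mlt (X + Y) Z = mlt X Z + mlt Y Z"
    unfolding mlt_eq good_def by (simp add: distrib_left distrib_right tr_add fsup_mult_left)
next
  show "mlt (sc c * X) Z = c * mlt X Z"
    unfolding mlt_def tr_sc[symmetric] by (metis mult.assoc sc_commute)
qed

section \<open>The representation on polynomial functions\<close>

context affine_sl
begin

text \<open>Multiplication by the loop \<open>F\<close> on \<open>C^l[t, t^-1]\<close>, a block
  Toeplitz matrix.\<close>

definition T0 :: "(int \<Rightarrow> cmat) \<Rightarrow> ix rfm" where
  "T0 F = mk (\<lambda>r s. if snd r \<in> {1..l} \<and> snd s \<in> {1..l} then F (fst r - fst s) (snd r) (snd s) else 0)"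

text \<open>The operator \<open>t d/dt\<close>, through which \<open>d\<close> acts on
  \<open>C^l[t, t^-1]\<close>.\<close>

definition Dg :: "ix rfm" where "Dg = mk (\<lambda>r s. if r = s then of_int (fst r) else 0)"

lemma ent_Dg: "ent Dg r s = (if r = s then of_int (fst r) else 0)"
  unfolding Dg_def by (rule ent_mk) (rule finite_subset[of _ "{_}"], auto)

lemma ent_Dg_mult: "ent (Dg * A) r s = of_int (fst r) * ent A r s" "ent (A * Dg) r s = ent A r s * of_int (fst s)"
proof -
  have "ent (Dg * A) r s = (\<Sum>u\<in>{r}. ent Dg r u * ent A u s)"
    by (rule ent_mult_row) (auto simp: ent_Dg split: if_splits)
  then show "ent (Dg * A) r s = of_int (fst r) * ent A r s" by (simp add: ent_Dg)
  have "ent (A * Dg) r s = (\<Sum>u\<in>{s}. ent A r u * ent Dg u s)"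
    by (rule ent_mult_row) (auto simp: ent_Dg split: if_splits)
  then show "ent (A * Dg) r s = ent A r s * of_int (fst s)" by (simp add: ent_Dg)
qed

lemma ent_T0:
  assumes F: "fam F"
  shows "ent (T0 F) r s = (if snd r \<in> {1..l} \<and> snd s \<in> {1..l} then F (fst r - fst s) (snd r) (snd s) else 0)"
  unfolding T0_def
proof (rule ent_mk)
  fix r :: ix
  let ?S = "{n. F n \<noteq> (\<lambda>i j. 0)}"
  have "{s. (if snd r \<in> {1..l} \<and> snd s \<in> {1..l} then F (fst r - fst s) (snd r) (snd s) else 0) \<noteq> 0}
      \<subseteq> (\<lambda>(p, j). (fst r - p, j)) ` (?S \<times> {1..l})"
  proof
    fix s assume "s \<in> {s. (if snd r \<in> {1..l} \<and> snd s \<in> {1..l} then F (fst r - fst s) (snd r) (snd s) else 0) \<noteq> 0}"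
    then have "fst r - fst s \<in> ?S" "snd s \<in> {1..l}" by (auto split: if_splits)
    then show "s \<in> (\<lambda>(p, j). (fst r - p, j)) ` (?S \<times> {1..l})"
      by (intro image_eqI[of _ _ "(fst r - fst s, snd s)"]) auto
  qed
  then show "finite {s. (if snd r \<in> {1..l} \<and> snd s \<in> {1..l} then F (fst r - fst s) (snd r) (snd s) else 0) \<noteq> 0}"
    by (rule finite_subset) (use fam_support[OF F] in simp)
qed

lemma T0_nonzero: "fam F \<Longrightarrow> ent (T0 F) r s \<noteq> 0 \<Longrightarrow>
   snd r \<in> {1..l} \<and> snd s \<in> {1..l} \<and> F (fst r - fst s) \<noteq> (\<lambda>i j. 0)"
  by (auto simp: ent_T0 split: if_splits)

lemma T0_add: "fam F \<Longrightarrow> fam F' \<Longrightarrow> T0 (\<lambda>n i j. F n i j + F' n i j) = T0 F + T0 F'"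
  by (rule rfm_eqI) (simp add: ent_T0 fam_closed)

lemma T0_scale: "fam F \<Longrightarrow> T0 (\<lambda>n i j. c * F n i j) = sc c * T0 F"
  using fam_closed(2)[of F "\<lambda>_. c"] by (intro rfm_eqI) (simp add: ent_T0)

lemma colfin_T0: "fam F \<Longrightarrow> colfin (T0 F)"
  unfolding colfin_def
proof
  fix s assume F: "fam F"
  let ?S = "{n. F n \<noteq> (\<lambda>i j. 0)}"
  have "{r. ent (T0 F) r s \<noteq> 0} \<subseteq> (\<lambda>(p, j). (fst s + p, j)) ` (?S \<times> {1..l})"
  proof
    fix r assume "r \<in> {r. ent (T0 F) r s \<noteq> 0}"
    then show "r \<in> (\<lambda>(p, j). (fst s + p, j)) ` (?S \<times> {1..l})"
      using T0_nonzero[OF F, of r s] by (intro image_eqI[of _ _ "(fst r - fst s, snd r)"]) auto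
  qed
  then show "finite {r. ent (T0 F) r s \<noteq> 0}" by (rule finite_subset) (use fam_support[OF F] in simp)
qed

lemma fsup_T0: "fam F \<Longrightarrow> fsup (pp * T0 F * qq)"
  unfolding fsup_def
proof (intro exI conjI allI impI)
  assume F: "fam F"
  let ?W = "(\<Union>p\<in>{n. F n \<noteq> (\<lambda>i j. 0)}. {-p..<p}) \<times> {1..l}"
  show "finite ?W" using fam_support[OF F] by simp
  fix r s assume "ent (pp * T0 F * qq) r s \<noteq> 0"
  then have rs: "0 \<le> fst r" "fst s < 0" "ent (T0 F) r s \<noteq> 0"
    by (auto simp: ent_pp_mult ent_qq_mult mult.assoc split: if_splits)
  then have "fst r - fst s \<in> {n. F n \<noteq> (\<lambda>i j. 0)}" "snd r \<in> {1..l}" "snd s \<in> {1..l}"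
    "fst r \<in> {-(fst r - fst s)..<fst r - fst s}" "fst s \<in> {-(fst r - fst s)..<fst r - fst s}"
    using T0_nonzero[OF F rs(3)] by auto
  then show "r \<in> ?W" "s \<in> ?W" by (auto simp: mem_Times_iff simp del: atLeastLessThan_iff atLeastAtMost_iff)
qed

lemma ent_mult_T0:
  assumes F: "fam F" and S: "finite S" "{n. F n \<noteq> (\<lambda>i j. 0)} \<subseteq> S"
  shows "ent (T0 F * A) r s = (if snd r \<in> {1..l} then \<Sum>p\<in>S. \<Sum>y\<in>{1..l}. F p (snd r) y * ent A (fst r - p, y) s else 0)"
    "ent (A * T0 F) r s = (if snd s \<in> {1..l} then \<Sum>p\<in>S. \<Sum>y\<in>{1..l}. ent A r (fst s + p, y) * F p y (snd s) else 0)"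
proof -
  let ?f = "\<lambda>(p, y). (fst r - p, y :: nat)" and ?g = "\<lambda>(p, y). (fst s + p, y :: nat)"
  have "ent (T0 F * A) r s = (\<Sum>u\<in>?f ` (S \<times> {1..l}). ent (T0 F) r u * ent A u s)"
  proof (rule ent_mult_row)
    fix u assume "ent (T0 F) r u \<noteq> 0"
    from T0_nonzero[OF F this] show "u \<in> ?f ` (S \<times> {1..l})"
      using S(2) by (intro image_eqI[of _ _ "(fst r - fst u, snd u)"]) auto
  qed (use S in simp)
  also have "\<dots> = (\<Sum>x\<in>S \<times> {1..l}. ent (T0 F) r (?f x) * ent A (?f x) s)"
    by (rule sum.reindex[unfolded o_def]) (auto simp: inj_on_def)
  also have "\<dots> = (\<Sum>p\<in>S. \<Sum>y\<in>{1..l}. ent (T0 F) r (fst r - p, y) * ent A (fst r - p, y) s)"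
    by (simp only: sum.cartesian_product case_prod_unfold)
  also have "\<dots> = (if snd r \<in> {1..l} then \<Sum>p\<in>S. \<Sum>y\<in>{1..l}. F p (snd r) y * ent A (fst r - p, y) s else 0)"
    by (cases "snd r \<in> {1..l}") (simp_all only: ent_T0[OF F] fst_conv snd_conv if_True if_False simp_thms cong: sum.cong, simp_all)
  finally show "ent (T0 F * A) r s = (if snd r \<in> {1..l} then \<Sum>p\<in>S. \<Sum>y\<in>{1..l}. F p (snd r) y * ent A (fst r - p, y) s else 0)" .
  have "ent (A * T0 F) r s = (\<Sum>u\<in>?g ` (S \<times> {1..l}). ent A r u * ent (T0 F) u s)"
  proof (rule ent_mult_row)
    fix u assume "ent (T0 F) u s \<noteq> 0"
    from T0_nonzero[OF F this] show "u \<in> ?g ` (S \<times> {1..l})"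
      using S(2) by (intro image_eqI[of _ _ "(fst u - fst s, snd u)"]) auto
  qed (use S in simp)
  also have "\<dots> = (\<Sum>x\<in>S \<times> {1..l}. ent A r (?g x) * ent (T0 F) (?g x) s)"
    by (rule sum.reindex[unfolded o_def]) (auto simp: inj_on_def)
  also have "\<dots> = (\<Sum>p\<in>S. \<Sum>y\<in>{1..l}. ent A r (fst s + p, y) * ent (T0 F) (fst s + p, y) s)"
    by (simp only: sum.cartesian_product case_prod_unfold)
  also have "\<dots> = (if snd s \<in> {1..l} then \<Sum>p\<in>S. \<Sum>y\<in>{1..l}. ent A r (fst s + p, y) * F p y (snd s) else 0)"
    by (cases "snd s \<in> {1..l}") (simp_all only: ent_T0[OF F] fst_conv snd_conv if_True if_False simp_thms cong: sum.cong, simp_all)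
  finally show "ent (A * T0 F) r s = (if snd s \<in> {1..l} then \<Sum>p\<in>S. \<Sum>y\<in>{1..l}. ent A r (fst s + p, y) * F p y (snd s) else 0)" .
qed

lemma T0_conv:
  assumes F: "fam F" and F': "fam F'" and S: "finite S" "{n. F n \<noteq> (\<lambda>i j. 0)} \<subseteq> S"
  shows "T0 (conv S F F') = T0 F * T0 F' - T0 F' * T0 F"
proof (rule rfm_eqI)
  fix r s
  show "ent (T0 (conv S F F')) r s = ent (T0 F * T0 F' - T0 F' * T0 F) r s"
  proof (cases "snd r \<in> {1..l} \<and> snd s \<in> {1..l}")
    case True
    have "ent (T0 (conv S F F')) r s = (\<Sum>p\<in>S. mbr l (F p) (F' (fst r - fst s - p)) (snd r) (snd s))"
      unfolding ent_T0[OF fam_conv[OF F' S(1)]] using True by (simp add: conv_def)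
    also have "\<dots> = (\<Sum>p\<in>S. \<Sum>y\<in>{1..l}. F p (snd r) y * F' (fst r - p - fst s) y (snd s))
        - (\<Sum>p\<in>S. \<Sum>y\<in>{1..l}. F' (fst r - (fst s + p)) (snd r) y * F p y (snd s))"
      by (simp add: mbr_def sum_subtractf algebra_simps)
    also have "\<dots> = ent (T0 F * T0 F' - T0 F' * T0 F) r s"
      unfolding ent_simps ent_mult_T0[OF F S] using True by (simp add: ent_T0[OF F'])
    finally show ?thesis .
  next
    case False
    then show ?thesis
      unfolding ent_simps ent_mult_T0[OF F S] ent_T0[OF fam_conv[OF F' S(1)]] by (auto simp: ent_T0[OF F'])
  qed
qed

lemma Dg_T0: "fam F \<Longrightarrow> Dg * T0 F - T0 F * Dg = T0 (\<lambda>n i j. of_int n * F n i j)"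
proof (rule rfm_eqI)
  fix r s assume F: "fam F"
  show "ent (Dg * T0 F - T0 F * Dg) r s = ent (T0 (\<lambda>n i j. of_int n * F n i j)) r s"
    unfolding ent_simps ent_Dg_mult ent_T0[OF F] ent_T0[OF fam_closed(2)[OF F]] by (simp add: algebra_simps)
qed

text \<open>A diagonal entry in degree \<open>a\<close> records a passage from
  \<open>a \<ge> 0\<close> to the negative degree \<open>a - p\<close> and back. It exists for
  \<open>0 \<le> a < p\<close>, that is for \<open>nat p\<close> values of \<open>a\<close>.\<close>

lemma tr_T0:
  assumes F: "fam F" and F': "fam F'" and S: "finite S" "{n. F n \<noteq> (\<lambda>i j. 0)} \<subseteq> S"
  shows "tr (pp * T0 F * qq * T0 F' * pp) = (\<Sum>p\<in>S. of_nat (nat p) * mform l (F p) (F' (- p)))"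
proof -
  let ?A = "\<Union>p\<in>S. {0..<p}"
  let ?c = "\<lambda>a i p. \<Sum>y\<in>{1..l}. if a < p then F p i y * F' (- p) y i else 0"
  have e: "ent (pp * T0 F * qq * T0 F' * pp) r r =
      (if 0 \<le> fst r \<and> snd r \<in> {1..l} then \<Sum>p\<in>S. ?c (fst r) (snd r) p else 0)" for r
  proof -
    have "ent (pp * T0 F * qq * T0 F' * pp) r r = (if 0 \<le> fst r then ent (T0 F * (qq * (T0 F' * pp))) r r else 0)"
      by (simp add: mult.assoc ent_pp_mult)
    also have "ent (T0 F * (qq * (T0 F' * pp))) r r = (if snd r \<in> {1..l} then \<Sum>p\<in>S. \<Sum>y\<in>{1..l}. F p (snd r) y *
        ent (qq * (T0 F' * pp)) (fst r - p, y) r else 0)" by (rule ent_mult_T0(1)[OF F S])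
    finally show ?thesis
      by (auto simp: ent_qq_mult ent_pp_mult ent_T0[OF F'] intro!: sum.cong)
  qed
  have A: "finite ?A" using S by simp
  have "tr (pp * T0 F * qq * T0 F' * pp) = (\<Sum>r\<in>?A \<times> {1..l}. ent (pp * T0 F * qq * T0 F' * pp) r r)"
  proof (rule tr_eq)
    fix r assume "ent (pp * T0 F * qq * T0 F' * pp) r r \<noteq> 0"
    then have r: "0 \<le> fst r" "snd r \<in> {1..l}" "(\<Sum>p\<in>S. ?c (fst r) (snd r) p) \<noteq> 0" unfolding e by (auto split: if_splits)
    from r(3) obtain p where p: "p \<in> S" "?c (fst r) (snd r) p \<noteq> 0" by (rule sum.not_neutral_contains_not_neutral)
    have "fst r < p" using p(2) by (cases "fst r < p") auto
    then show "r \<in> ?A \<times> {1..l}" using r p(1) by (auto simp: mem_Times_iff)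
  qed (use A in simp)
  also have "\<dots> = (\<Sum>r\<in>?A \<times> {1..l}. \<Sum>p\<in>S. ?c (fst r) (snd r) p)"
    unfolding e by (intro sum.cong refl) auto
  also have "\<dots> = (\<Sum>p\<in>S. \<Sum>r\<in>?A \<times> {1..l}. ?c (fst r) (snd r) p)" by (rule sum.swap)
  also have "\<dots> = (\<Sum>p\<in>S. of_nat (nat p) * mform l (F p) (F' (- p)))"
  proof (rule sum.cong[OF refl])
    fix p assume p: "p \<in> S"
    have "(\<Sum>r\<in>?A \<times> {1..l}. ?c (fst r) (snd r) p) = (\<Sum>a\<in>?A. \<Sum>i\<in>{1..l}. ?c a i p)"
      using sum.cartesian_product[where g = "\<lambda>a i. ?c a i p" and A = ?A and B = "{1..l}"] by (simp only: case_prod_unfold)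
    also have "\<dots> = (\<Sum>a\<in>?A. if a < p then mform l (F p) (F' (- p)) else 0)"
      by (intro sum.cong refl) (simp add: mform_def)
    also have "\<dots> = (\<Sum>a\<in>{0..<p}. mform l (F p) (F' (- p)))"
      by (rule sum.mono_neutral_cong_right[OF A]) (use p in auto)
    also have "\<dots> = of_nat (nat p) * mform l (F p) (F' (- p))" by simp
    finally show "(\<Sum>r\<in>?A \<times> {1..l}. ?c (fst r) (snd r) p) = of_nat (nat p) * mform l (F p) (F' (- p))" .
  qed
  finally show ?thesis .
qed

text \<open>The two counts differ by \<open>p\<close> itself, whatever its sign. So the cocycle of
  the splitting restricts on loops to the affine cocycle of the trace form.\<close>

lemma tr_T0_diff:
  assumes F: "fam F" and F': "fam F'" and S: "finite S" "{n. F n \<noteq> (\<lambda>i j. 0)} \<subseteq> S" "uminus ` {n. F' n \<noteq> (\<lambda>i j. 0)} \<subseteq> S"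
  shows "tr (pp * T0 F * qq * T0 F' * pp) - tr (pp * T0 F' * qq * T0 F * pp) = (\<Sum>p\<in>S. of_int p * mform l (F p) (F' (- p)))"
proof -
  have S': "finite (uminus ` S)" "{n. F' n \<noteq> (\<lambda>i j. 0)} \<subseteq> uminus ` S"
  proof -
    have "uminus ` uminus ` {n. F' n \<noteq> (\<lambda>i j. 0)} \<subseteq> uminus ` S" using S(3) by (rule image_mono)
    then show "{n. F' n \<noteq> (\<lambda>i j. 0)} \<subseteq> uminus ` S" by (simp add: image_image)
  qed (use S in simp)
  have "tr (pp * T0 F' * qq * T0 F * pp) = (\<Sum>p\<in>S. of_nat (nat (- p)) * mform l (F' (- p)) (F p))"
    unfolding tr_T0[OF F' F S'] by (subst sum.reindex) (auto simp: inj_on_def)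
  also have "\<dots> = (\<Sum>p\<in>S. of_nat (nat (- p)) * mform l (F p) (F' (- p)))"
    by (intro sum.cong refl arg_cong2[where f = "(*)"] mform_sym)
  finally have t: "tr (pp * T0 F * qq * T0 F' * pp) - tr (pp * T0 F' * qq * T0 F * pp)
     = (\<Sum>p\<in>S. (of_nat (nat p) - of_nat (nat (- p))) * mform l (F p) (F' (- p)))"
    unfolding tr_T0[OF F F' S(1,2)] by (simp only: sum_subtractf left_diff_distrib)
  have "of_nat (nat p) - of_nat (nat (- p)) = (of_int p :: complex)" for p
    by (cases "0 \<le> p") (simp_all add: of_nat_nat)
  then show ?thesis unfolding t by simp
qed

text \<open>The central coordinate acts as zero on \<open>C^l[t, t^-1]\<close>; it comes back in the
  multiplier of \<open>opr\<close>.\<close>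

definition TT :: "weyl_elt affine_elt \<Rightarrow> ix rfm" where
  "TT x = T0 (\<lambda>n. matof (fst x n)) + sc (snd (snd x)) * Dg"

lemma TT_el: "fam F \<Longrightarrow> TT (el F a b) = T0 F + sc b * Dg"
proof -
  assume F: "fam F"
  have F': "fam (\<lambda>n. matof (iota (F n)))" using loops_fam[OF fam_loops[OF F]] by simp
  have "T0 (\<lambda>n. matof (iota (F n))) = T0 F"
    by (rule rfm_eqI) (auto simp: ent_T0[OF F] ent_T0[OF F'] matof_iota[OF fam_tr[OF F]] simp del: atLeastAtMost_iff)
  then show ?thesis by (simp add: TT_def el_def)
qed

lemma pq_TT: "fam F \<Longrightarrow> pp * TT (el F a b) * qq = pp * T0 F * qq" "fam F \<Longrightarrow> qq * TT (el F a b) * pp = qq * T0 F * pp"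
proof -
  assume F: "fam F"
  have "pp * (sc b * Dg) * qq = 0" "qq * (sc b * Dg) * pp = 0"
    by (rule rfm_eqI; simp add: ent_pp_mult ent_qq_mult ent_Dg)+
  then show "pp * TT (el F a b) * qq = pp * T0 F * qq" "qq * TT (el F a b) * pp = qq * T0 F * pp"
    unfolding TT_el[OF F] by (simp_all add: distrib_left distrib_right)
qed

lemma good_TT: "x \<in> carrier G \<Longrightarrow> good (TT x)"
proof -
  assume "x \<in> carrier G"
  then obtain F a b where x: "x = el F a b" "fam F" by (rule G_cases)
  have "colfin Dg" unfolding colfin_def
  proof
    fix s
    have "{r. ent Dg r s \<noteq> 0} \<subseteq> {s}" by (auto simp: ent_Dg split: if_splits)
    then show "finite {r. ent Dg r s \<noteq> 0}" by (rule finite_subset) simp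
  qed
  then show ?thesis unfolding good_def x(1) pq_TT[OF x(2)]
    unfolding TT_el[OF x(2)] by (intro conjI colfin_add colfin_sc colfin_T0 fsup_T0 x(2))
qed

lemma TT_add: "x \<in> carrier G \<Longrightarrow> y \<in> carrier G \<Longrightarrow> TT (x \<oplus>\<^bsub>G\<^esub> y) = TT x + TT y"
proof -
  assume "x \<in> carrier G" "y \<in> carrier G"
  then obtain F a b F' a' b' where x: "x = el F a b" "fam F" "y = el F' a' b'" "fam F'" by (metis G_cases)
  have "sc (b + b') * Dg = sc b * Dg + sc b' * Dg" by (rule rfm_eqI) (simp add: algebra_simps)
  then show ?thesis unfolding x el_ops by (simp add: TT_el x fam_closed T0_add)
qed

lemma TT_scale: "x \<in> carrier G \<Longrightarrow> TT (c \<odot>\<^bsub>G\<^esub> x) = sc c * TT x"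
proof -
  assume "x \<in> carrier G"
  then obtain F a b where x: "x = el F a b" "fam F" by (rule G_cases)
  have "sc (c * b) * Dg = sc c * (sc b * Dg)" by (rule rfm_eqI) simp
  then show ?thesis unfolding x el_ops
    using fam_closed(2)[OF x(2), of "\<lambda>_. c"] by (simp add: TT_el x T0_scale distrib_left)
qed

lemma TT_bracket:
  assumes x: "x \<in> carrier G" and y: "y \<in> carrier G"
  shows "TT (bracket G x y) = TT x * TT y - TT y * TT x"
    "fst (snd (bracket G x y)) = tr (pp * TT x * qq * TT y * pp) - tr (pp * TT y * qq * TT x * pp)"
proof -
  obtain F a b where F: "x = el F a b" "fam F" using x by (rule G_cases)
  obtain F' a' b' where F': "y = el F' a' b'" "fam F'" using y by (rule G_cases)
  define S where "S = {n. F n \<noteq> (\<lambda>i j. 0)} \<union> uminus ` {n. F' n \<noteq> (\<lambda>i j. 0)}"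
  have S: "finite S" "{n. F n \<noteq> (\<lambda>i j. 0)} \<subseteq> S" "uminus ` {n. F' n \<noteq> (\<lambda>i j. 0)} \<subseteq> S"
    unfolding S_def using fam_support[OF F(2)] fam_support[OF F'(2)] by auto
  have b: "bracket G x y = el (\<lambda>n i j. conv S F F' n i j + (b * of_int n) * F' n i j + (- b' * of_int n) * F n i j)
       (\<Sum>s\<in>S. of_int s * mform l (F s) (F' (- s))) 0"
    unfolding F F' by (rule el_bracket[OF F(2) F'(2) S(1,2)])
  have f: "fam (\<lambda>n i j. of_int n * F n i j)" "fam (\<lambda>n i j. of_int n * F' n i j)"
    by (rule fam_closed(2)[OF F(2)], rule fam_closed(2)[OF F'(2)])
  have "T0 (\<lambda>n i j. conv S F F' n i j + (b * of_int n) * F' n i j + (- b' * of_int n) * F n i j)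
     = T0 (conv S F F') + sc b * T0 (\<lambda>n i j. of_int n * F' n i j) + sc (- b') * T0 (\<lambda>n i j. of_int n * F n i j)"
    unfolding T0_scale[OF f(1), symmetric] T0_scale[OF f(2), symmetric] mult.assoc
    by (subst T0_add, (intro fam_closed fam_conv F F' S(1) f)+, subst T0_add, (intro fam_closed fam_conv F F' S(1) f)+) simp
  also have "\<dots> = (T0 F * T0 F' - T0 F' * T0 F) + sc b * (Dg * T0 F' - T0 F' * Dg) + sc (- b') * (Dg * T0 F - T0 F * Dg)"
    unfolding T0_conv[OF F(2) F'(2) S(1,2)] Dg_T0[OF F(2)] Dg_T0[OF F'(2)] ..
  also have "\<dots> = (T0 F + sc b * Dg) * (T0 F' + sc b' * Dg) - (T0 F' + sc b' * Dg) * (T0 F + sc b * Dg)"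
  proof (rule rfm_eqI)
    fix r s
    have e: "(T0 F + sc b * Dg) * (T0 F' + sc b' * Dg) = T0 F * T0 F' + sc b * (Dg * T0 F') + sc b' * (T0 F * Dg) + sc b * (sc b' * (Dg * Dg))"
      for F F' and b b' :: complex
    proof -
      have c: "A * (sc b' * Dg) = sc b' * (A * Dg)" for A :: "ix rfm"
        by (metis mult.assoc sc_commute)
      show ?thesis by (simp only: distrib_left distrib_right c[of "T0 F"] c[of Dg] mult.assoc add.assoc add.left_commute add.commute)
    qed
    show "ent ((T0 F * T0 F' - T0 F' * T0 F) + sc b * (Dg * T0 F' - T0 F' * Dg) + sc (- b') * (Dg * T0 F - T0 F * Dg)) r s
       = ent ((T0 F + sc b * Dg) * (T0 F' + sc b' * Dg) - (T0 F' + sc b' * Dg) * (T0 F + sc b * Dg)) r s"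
      unfolding e by (simp add: algebra_simps)
  qed
  finally show "TT (bracket G x y) = TT x * TT y - TT y * TT x"
    unfolding b TT_el[OF el_bracket_fam[OF F(2) F'(2) S(1)]] unfolding F F' TT_el[OF F(2)] TT_el[OF F'(2)] by simp
  have e: "pp * TT (el F a b) * qq * TT (el F' a' b') * pp = pp * T0 F * qq * T0 F' * pp"
    if "fam F" "fam F'" for F F' a b a' b'
  proof -
    have "pp * TT (el F a b) * qq * TT (el F' a' b') * pp = (pp * TT (el F a b) * qq) * (qq * TT (el F' a' b') * pp)"
      by (simp add: mult.assoc)
    also have "\<dots> = pp * T0 F * qq * T0 F' * pp" unfolding pq_TT[OF that(1)] pq_TT[OF that(2)] by (simp add: mult.assoc)
    finally show ?thesis .
  qed
  have "fst (snd (bracket G x y)) = (\<Sum>s\<in>S. of_int s * mform l (F s) (F' (- s)))" unfolding b el_def by simp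
  then show "fst (snd (bracket G x y)) = tr (pp * TT x * qq * TT y * pp) - tr (pp * TT y * qq * TT x * pp)"
    unfolding F F' e[OF F(2) F'(2)] e[OF F'(2) F(2)] tr_T0_diff[OF F(2) F'(2) S] by simp
qed

text \<open>The same factor \<open>k\<close> scales the multiplier and the central coordinate, which
  matches the cocycle of the multiplier with the centre at every complex level.\<close>

definition opr :: "weyl_elt affine_elt \<Rightarrow> (ix rfm \<Rightarrow> complex) \<Rightarrow> ix rfm \<Rightarrow> complex" where
  "opr x f Z = ps.Der (Ric (TT x)) f Z + (k * mlt (TT x) Z + k * fst (snd x)) * f Z"

end

context affine_sl
begin

text \<open>Composing in the order of the letters turns the anti-representation by vector fields
  into a right module, as \<open>act\<close> requires. The constant defect of the multipliers is the
  central component of the bracket by \<open>TT_bracket\<close>.\<close>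

lemma opr_bracket:
  assumes x: "x \<in> carrier G" and y: "y \<in> carrier G" and f: "f \<in> ps.polyfun"
  shows "opr y (opr x f) Z - opr x (opr y f) Z = opr (bracket G x y) f Z"
proof -
  let ?X = "TT x" and ?Y = "TT y"
  have gX: "good ?X" and gY: "good ?Y" by (rule good_TT[OF x], rule good_TT[OF y])
  define a where "a = fst (snd x)"
  define b where "b = fst (snd y)"
  have p: "ps.Der (Ric ?X) f \<in> ps.polyfun" "ps.Der (Ric ?Y) f \<in> ps.polyfun" "mlt ?X \<in> ps.polyfun" "mlt ?Y \<in> ps.polyfun"
    by (intro ps.Der_polyfun f Ric_poly mlt_poly gX gY)+
  have D: "ps.Der V (\<lambda>Z. ps.Der W f Z + (k * mlt A Z + k * c) * f Z) Z =
      ps.Der V (ps.Der W f) Z + (k * mlt A Z + k * c) * ps.Der V f Z + k * ps.Der V (mlt A) Z * f Z"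
    if "ps.Der W f \<in> ps.polyfun" "mlt A \<in> ps.polyfun" for V W A c
  proof -
    have q: "(\<lambda>Z. k * mlt A Z + k * c) \<in> ps.polyfun" by (intro ps.add ps.polyfun_scale ps.const that)
    have r: "(\<lambda>Z. k * mlt A Z) \<in> ps.polyfun" by (intro ps.polyfun_scale that)
    show ?thesis
      by (simp only: ps.Der_add[OF that(1) ps.mult[OF q f]] ps.Der_mult[OF q f] ps.Der_add[OF r ps.const] ps.Der_scale[OF that(2)] ps.Der_const add_0_right add.assoc)
  qed
  have oX: "opr x f = (\<lambda>Z. ps.Der (Ric ?X) f Z + (k * mlt ?X Z + k * a) * f Z)"
    and oY: "opr y f = (\<lambda>Z. ps.Der (Ric ?Y) f Z + (k * mlt ?Y Z + k * b) * f Z)"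
    by (rule ext, simp add: opr_def a_def b_def)+
  have 1: "ps.Der (Ric ?Y) (ps.Der (Ric ?X) f) Z - ps.Der (Ric ?X) (ps.Der (Ric ?Y) f) Z = ps.Der (Ric (?X * ?Y - ?Y * ?X)) f Z"
    by (rule Ric_bracket[OF gY gX f])
  have 2: "ps.Der (Ric ?Y) (mlt ?X) Z - ps.Der (Ric ?X) (mlt ?Y) Z = mlt (?X * ?Y - ?Y * ?X) Z + fst (snd (bracket G x y))"
    unfolding TT_bracket(2)[OF x y] by (rule mlt_bracket[OF gY gX])
  have "opr y (opr x f) Z = ps.Der (Ric ?Y) (opr x f) Z + (k * mlt ?Y Z + k * b) * opr x f Z"
    and "opr x (opr y f) Z = ps.Der (Ric ?X) (opr y f) Z + (k * mlt ?X Z + k * a) * opr y f Z"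
    by (simp_all add: opr_def a_def b_def)
  then have "opr y (opr x f) Z - opr x (opr y f) Z
     = (ps.Der (Ric ?Y) (ps.Der (Ric ?X) f) Z - ps.Der (Ric ?X) (ps.Der (Ric ?Y) f) Z)
       + k * (ps.Der (Ric ?Y) (mlt ?X) Z - ps.Der (Ric ?X) (mlt ?Y) Z) * f Z"
    unfolding oX oY D[OF p(1,3)] D[OF p(2,4)] by (simp add: algebra_simps)
  also have "\<dots> = opr (bracket G x y) f Z"
    unfolding 1 2 opr_def TT_bracket(1)[OF x y] by (simp add: algebra_simps)
  finally show ?thesis .
qed

lemma opr_polyfun: "x \<in> carrier G \<Longrightarrow> f \<in> ps.polyfun \<Longrightarrow> opr x f \<in> ps.polyfun"
proof -
  assume x: "x \<in> carrier G" and f: "f \<in> ps.polyfun"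
  have "opr x f = (\<lambda>Z. ps.Der (Ric (TT x)) f Z + (k * mlt (TT x) Z + k * fst (snd x)) * f Z)"
    by (rule ext) (simp add: opr_def)
  also have "\<dots> \<in> ps.polyfun"
    by (intro ps.add ps.mult ps.Der_polyfun f Ric_poly good_TT x ps.polyfun_scale ps.const mlt_poly)
  finally show ?thesis .
qed

lemma opr_add_left: "x \<in> carrier G \<Longrightarrow> y \<in> carrier G \<Longrightarrow> f \<in> ps.polyfun \<Longrightarrow> opr (x \<oplus>\<^bsub>G\<^esub> y) f Z = opr x f Z + opr y f Z"
proof -
  assume x: "x \<in> carrier G" and y: "y \<in> carrier G" and f: "f \<in> ps.polyfun"
  have "fst (snd (x \<oplus>\<^bsub>G\<^esub> y)) = fst (snd x) + fst (snd y)" by (simp add: affine_def case_prod_unfold)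
  moreover have "ps.Der (Ric (TT x + TT y)) f Z = 1 * ps.Der (Ric (TT x)) f Z + 1 * ps.Der (Ric (TT y)) f Z"
    by (rule ps.Der_linear) (simp_all add: Ric_linear f)
  ultimately show ?thesis
    unfolding opr_def TT_add[OF x y] mlt_linear(1)[OF good_TT[OF x] good_TT[OF y]] by (simp add: algebra_simps)
qed

lemma opr_scale_left: "x \<in> carrier G \<Longrightarrow> f \<in> ps.polyfun \<Longrightarrow> opr (c \<odot>\<^bsub>G\<^esub> x) f Z = c * opr x f Z"
proof -
  assume x: "x \<in> carrier G" and f: "f \<in> ps.polyfun"
  have "fst (snd (c \<odot>\<^bsub>G\<^esub> x)) = c * fst (snd x)" by (simp add: affine_def case_prod_unfold)
  moreover have "ps.Der (Ric (sc c * TT x)) f Z = c * ps.Der (Ric (TT x)) f Z + 0 * ps.Der (Ric (TT x)) f Z"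
    by (rule ps.Der_linear) (simp_all add: Ric_linear f)
  ultimately show ?thesis unfolding opr_def TT_scale[OF x] mlt_linear(2) by (simp add: algebra_simps)
qed

sublocale WO: word_action "carrier G" opr ps.polyfun
proof
  show "(\<lambda>Z. 0) \<in> ps.polyfun" by (rule ps.const)
  show "(\<lambda>Z. f Z + g Z) \<in> ps.polyfun" if "f \<in> ps.polyfun" "g \<in> ps.polyfun" for f g using that by (rule ps.add)
  show "(\<lambda>Z. c * f Z) \<in> ps.polyfun" if "f \<in> ps.polyfun" for f c using that by (rule ps.polyfun_scale)
  show "opr x f \<in> ps.polyfun" if "x \<in> carrier G" "f \<in> ps.polyfun" for x f using that by (rule opr_polyfun)
  show "opr x (\<lambda>Z. f Z + g Z) = (\<lambda>Z. opr x f Z + opr x g Z)" if "f \<in> ps.polyfun" "g \<in> ps.polyfun" for x f g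
    by (rule ext) (simp add: opr_def ps.Der_add[OF that] algebra_simps)
  show "opr x (\<lambda>Z. c * f Z) = (\<lambda>Z. c * opr x f Z)" if "f \<in> ps.polyfun" for x f c
    by (rule ext) (simp add: opr_def ps.Der_scale[OF that] algebra_simps)
qed

sublocale RA: presentation_action "carrier G" "env_rels G" opr ps.polyfun
proof
  fix r f assume r: "r \<in> env_rels G" and f: "f \<in> ps.polyfun"
  from r consider
    (add) x y where "x \<in> carrier G" "y \<in> carrier G" "r = letter (x \<oplus>\<^bsub>G\<^esub> y) - letter x - letter y" |
    (scale) c x where "x \<in> carrier G" "r = letter (c \<odot>\<^bsub>G\<^esub> x) - scal c * letter x" |
    (bracket) x y where "x \<in> carrier G" "y \<in> carrier G" "r = letter x * letter y - letter y * letter x - letter (bracket G x y)"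
    unfolding env_rels_def by blast
  then show "act opr r f = (\<lambda>Z. 0)"
  proof cases
    case add
    show ?thesis unfolding add WO.act_diff_left WO.act_letter using opr_add_left[OF add(1,2) f] by simp
  next
    case scale
    show ?thesis unfolding scale WO.act_diff_left WO.act_scal WO.act_letter using opr_scale_left[OF scale(1) f] by simp
  next
    case bracket
    have m: "act opr (letter x * letter y) f = opr y (opr x f)" if "x \<in> carrier G" "y \<in> carrier G" for x y
      using WO.act_mult[OF fcar_closed(4)[OF that(1)] fcar_closed(4)[OF that(2)] f] by simp
    show ?thesis unfolding bracket WO.act_diff_left m[OF bracket(1,2)] m[OF bracket(2,1)] WO.act_letter
      using opr_bracket[OF bracket(1,2) f] by simp
  qed
qed

text \<open>At the base point the vector field equals \<open>qq * X * pp\<close>, which is zero for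
  loops without negative powers, and the multiplier is zero as well. Only the central coordinate is
  left.\<close>

lemma opr_base: "x \<in> CP \<Longrightarrow> opr x f 0 = level_char k x * f 0"
proof -
  assume "x \<in> CP"
  then obtain F a b where x: "x = el F a b" "fam F" "\<forall>n<0. F n = (\<lambda>i j. 0)" unfolding CP_el by blast
  have z: "zc 0 = 0" by (rule rfm_eqI) (simp add: ent_zc)
  have "qq * T0 F * pp = 0"
    by (rule rfm_eqI) (auto simp: mult.assoc ent_qq_mult ent_pp_mult ent_T0[OF x(2)] x(3))
  then have "Ric (TT x) 0 = 0" unfolding Ric_expand z x(1) using pq_TT(2)[OF x(2)] by simp
  then have "ps.Der (Ric (TT x)) f 0 = 0" by (intro ps.Der_eqI) simp
  moreover have "mlt (TT x) 0 = 0" by (simp add: mlt_def z tr_def)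
  ultimately show ?thesis by (simp add: opr_def x(1) el_def)
qed

lemma act_base: "p \<in> fcar CP \<Longrightarrow> act opr p f 0 = word_char (level_char k) p * f 0"
proof -
  have w: "fold opr xs f 0 = prod_list (map (level_char k) xs) * f 0" if "set xs \<subseteq> CP" for xs f
    using that by (induction xs arbitrary: f) (auto simp: opr_base)
  assume p: "p \<in> fcar CP"
  have "wsum (\<lambda>w. fold opr (letters w) f 0) p = wsum (\<lambda>w. prod_list (map (level_char k) (letters w))) p * f 0"
    unfolding wsum_def sum_distrib_right mult.assoc
    by (intro sum.cong refl arg_cong2[where f = "(*)"] w) (use p in \<open>auto simp: fcar_iff\<close>)
  then show ?thesis by (simp add: act_def word_char_def)
qed

text \<open>In a right module the factor \<open>p\<close> of \<open>u * p\<close> acts last, so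
  evaluation at the base point turns it into the scalar given by its character. This is the
  eigenvector property that \<open>J_functional\<close> asks for.\<close>

lemma act_J: "u \<in> V.J \<Longrightarrow> f \<in> ps.polyfun \<Longrightarrow> act opr u f 0 = 0"
proof (rule V.J_functional[where \<phi> = "\<lambda>u. act opr u f 0"])
  assume f: "f \<in> ps.polyfun"
  show "act opr (p + q) f 0 = act opr p f 0 + act opr q f 0" for p q by (simp add: WO.act_add_left)
  show "act opr p f 0 = 0" if "p \<in> V.I" for p using RA.act_I[OF that f] by simp
  fix u p assume u: "u \<in> fcar (carrier G)" and p: "p \<in> fcar CP"
  show "act opr (u * p) f 0 = act opr u f 0 * word_char (level_char k) p"
    unfolding WO.act_mult[OF u V.CP_fcar[OF p] f] act_base[OF p] by simp
qed

end

section \<open>Nonvanishing of the vector\<close>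

context affine_det
begin

text \<open>The coordinates dual to the diagonal entries of the matrix: the row is
  \<open>e_i\<close> in degree -1 and the column is the basis vector with index
  \<open>l - i + 1\<close> in degree 0.\<close>

definition zz :: "nat \<Rightarrow> ix rfm \<Rightarrow> complex" where "zz i pt = ent pt (- 1, i) (0, l - i + 1)"

definition gg :: "(nat \<Rightarrow> nat) \<Rightarrow> ix rfm \<Rightarrow> complex" where "gg N pt = (\<Prod>i\<in>{1..m}. zz i pt ^ N i)"

lemma gg_polyfun: "gg N \<in> ps.polyfun"
proof -
  have "(\<lambda>pt. zz i pt ^ p) \<in> ps.polyfun" for i p
  proof (induction p)
    case (Suc p)
    have "(\<lambda>pt. zz i pt * zz i pt ^ p) \<in> ps.polyfun"
      using Suc by (intro ps.mult) (simp_all add: zz_def[abs_def] ent_poly)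
    then show ?case by simp
  qed (simp add: ps.const)
  then show ?thesis unfolding gg_def[abs_def] by (rule ps.polyfun_prod)
qed

lemma gg_cong: "(\<And>i. i \<in> {1..m} \<Longrightarrow> N i = N' i) \<Longrightarrow> gg N = gg N'"
  unfolding gg_def by (intro ext prod.cong refl) simp

text \<open>An entry of the matrix changes the degree by one. Between a row of degree -1 and a
  column of degree 0 only the constant term of the Riccati field contributes: the terms with
  \<open>Z\<close> would need a row of degree 0 or a column of degree -1 in its block.\<close>

lemma Ric_e:
  assumes ij: "i \<in> {1..m}" "j \<in> {1..m}" and a: "a \<in> {1..m}"
  shows "zz a (Ric (TT (el (single (mneg i (l - j + 1)) (- 1)) 0 0)) pt) = (if a = i \<and> a = j then - 1 else 0)"
    "mlt (TT (el (single (mneg i (l - j + 1)) (- 1)) 0 0)) pt = 0"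
proof -
  let ?F = "single (mneg i (l - j + 1)) (- 1)" and ?z = "zc pt"
  have F: "fam ?F" using ij by (intro fam_single mtr_mneg range)
  have X: "TT (el ?F 0 0) = T0 ?F" using TT_el[OF F] by simp
  have nz: "fst r - fst s = - 1" if "ent (T0 ?F) r s \<noteq> 0" for r s
    using T0_nonzero[OF F that] by (auto simp: single_def split: if_splits)
  have 0: "pp * T0 ?F * qq = 0"
  proof (rule rfm_eqI)
    fix r s show "ent (pp * T0 ?F * qq) r s = ent 0 r s"
      using nz[of r s] by (cases "ent (T0 ?F) r s = 0") (simp_all add: mult.assoc ent_pp_mult ent_qq_mult)
  qed
  then show "mlt (TT (el ?F 0 0)) pt = 0" unfolding mlt_eq X by (simp add: tr_def)
  have 3: "?z * T0 ?F * ?z = 0" unfolding zxz 0 by simp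
  let ?r = "(- 1 :: int, a)" and ?s = "(0 :: int, l - a + 1)"
  have 1: "ent (qq * T0 ?F * ?z) ?r ?s = 0"
  proof (rule ccontr)
    assume "\<not> ?thesis"
    from ent_mult_nonzero[OF this] obtain u where u: "ent (qq * T0 ?F) ?r u \<noteq> 0" "ent ?z u ?s \<noteq> 0" by blast
    from u(1) have "ent (T0 ?F) ?r u \<noteq> 0" by (simp add: ent_qq_mult)
    from nz[OF this] have "fst u = 0" by simp
    then show False using u(2) by (simp add: ent_zc)
  qed
  have 2: "ent (?z * T0 ?F * pp) ?r ?s = 0"
  proof (rule ccontr)
    assume "\<not> ?thesis"
    from ent_mult_nonzero[OF this] obtain u where u: "ent (?z * T0 ?F) ?r u \<noteq> 0" "ent pp u ?s \<noteq> 0" by blast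
    from u(2) have us: "u = ?s" by (auto simp: ent_pp split: if_splits)
    from ent_mult_nonzero[OF u(1)] obtain w where w: "ent ?z ?r w \<noteq> 0" "ent (T0 ?F) w u \<noteq> 0" by blast
    from nz[OF w(2)] us have "fst w = - 1" by simp
    then show False using w(1) by (simp add: ent_zc)
  qed
  have "zz a (Ric (TT (el ?F 0 0)) pt) = ent (qq * T0 ?F * pp) ?r ?s"
    unfolding zz_def X Ric_expand ent_simps 1 2 3 by simp
  also have "\<dots> = mneg i (l - j + 1) a (l - a + 1)"
  proof -
    have "ent (T0 ?F) ?r ?s = mneg i (l - j + 1) a (l - a + 1)"
      using range(1)[OF a] range(2)[OF a] unfolding ent_T0[OF F] by (simp add: single_def)
    then show ?thesis by (simp add: mult.assoc ent_qq_mult ent_pp_mult)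
  qed
  also have "\<dots> = (if a = i \<and> a = j then - 1 else 0)"
    using ij a ml by (auto simp: mneg_def munit_def)
  finally show "zz a (Ric (TT (el ?F 0 0)) pt) = (if a = i \<and> a = j then - 1 else 0)" .
qed

lemma opr_gg:
  assumes ij: "i \<in> {1..m}" "j \<in> {1..m}"
  shows "opr (el (single (mneg i (l - j + 1)) (- 1)) 0 0) (gg N) =
    (\<lambda>pt. if i = j then - of_nat (N i) * gg (N(i := N i - 1)) pt else 0)"
proof
  fix pt
  let ?x = "el (single (mneg i (l - j + 1)) (- 1)) 0 0"
  let ?V = "Ric (TT ?x)"
  have sh: "gg N (pt + sc \<epsilon> * ?V pt) = (\<Prod>a\<in>{1..m}. (zz a pt + \<epsilon> * (if a = i \<and> a = j then - 1 else 0)) ^ N a)" for \<epsilon>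
  proof -
    have "zz a (pt + sc \<epsilon> * ?V pt) = zz a pt + \<epsilon> * (if a = i \<and> a = j then - 1 else 0)" if "a \<in> {1..m}" for a
      unfolding Ric_e(1)[OF ij that, of pt, symmetric] by (simp add: zz_def)
    then show ?thesis unfolding gg_def by (intro prod.cong refl) simp
  qed
  have "ps.Der ?V (gg N) pt = (if i = j then - of_nat (N i) * gg (N(i := N i - 1)) pt else 0)"
  proof (rule ps.Der_eqI, cases "i = j")
    case True
    let ?c = "\<Prod>a\<in>{1..m} - {i}. zz a pt ^ N a"
    have "gg N (pt + sc \<epsilon> * ?V pt) = (zz i pt - \<epsilon>) ^ N i * ?c" for \<epsilon>
      unfolding sh by (subst prod.remove[OF _ ij(1)]) (use True in \<open>auto intro!: prod.cong\<close>)
    moreover have "gg (N(i := N i - 1)) pt = zz i pt ^ (N i - 1) * ?c"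
      unfolding gg_def by (subst prod.remove[OF _ ij(1)]) (auto intro!: prod.cong)
    ultimately show "((\<lambda>\<epsilon>. gg N (pt + sc \<epsilon> * ?V pt)) has_field_derivative
        (if i = j then - of_nat (N i) * gg (N(i := N i - 1)) pt else 0)) (at 0)"
      using True by (auto intro!: derivative_eq_intros)
  next
    case False
    then have "gg N (pt + sc \<epsilon> * ?V pt) = gg N pt" for \<epsilon>
      unfolding sh by (auto simp: gg_def intro!: prod.cong)
    then show "((\<lambda>\<epsilon>. gg N (pt + sc \<epsilon> * ?V pt)) has_field_derivative
        (if i = j then - of_nat (N i) * gg (N(i := N i - 1)) pt else 0)) (at 0)"
      using False by simp
  qed
  moreover have "fst (snd ?x) = 0" by (simp add: el_def)
  ultimately show "opr ?x (gg N) pt = (if i = j then - of_nat (N i) * gg (N(i := N i - 1)) pt else 0)"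
    unfolding opr_def Ric_e(2)[OF ij ij(1)] by (simp only: mult_zero_right mult_zero_left add_0_right)
qed

lemma act_e: "i \<in> {1..m} \<Longrightarrow> j \<in> {1..m} \<Longrightarrow>
    act opr (e i j) (gg N) = (\<lambda>pt. if i = j then - of_nat (N i) * gg (N(i := N i - 1)) pt else 0)"
  unfolding e_LL at_power_el WO.act_letter by (rule opr_gg)

text \<open>An off-diagonal entry kills a monomial in the diagonal coordinates, and a diagonal entry
  lowers one exponent by one. In the sum over permutations only the identity can contribute.\<close>

lemma act_prod:
  assumes "distinct xs" "set xs \<subseteq> {1..m}" "\<sigma> permutes {1..m}" "\<And>i. i \<in> set xs \<Longrightarrow> N i = t"
  shows "act opr (prod_list (map (\<lambda>i. e i (\<sigma> i)) xs)) (gg N) =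
    (\<lambda>pt. if \<forall>i\<in>set xs. \<sigma> i = i then (- of_nat t) ^ length xs * gg (\<lambda>a. if a \<in> set xs then t - 1 else N a) pt else 0)"
  using assms
proof (induction xs arbitrary: N)
  case (Cons i xs)
  have i: "i \<in> {1..m}" "\<sigma> i \<in> {1..m}" using Cons.prems permutes_in_image[OF Cons.prems(3), of i] by auto
  have f: "prod_list (map (\<lambda>i. e i (\<sigma> i)) xs) \<in> fcar (carrier G)"
  proof (rule fcar_prod_list)
    fix a assume "a \<in> set xs"
    then have "a \<in> {1..m}" using Cons.prems(2) by auto
    then show "e a (\<sigma> a) \<in> fcar (carrier G)" using permutes_in_image[OF Cons.prems(3), of a] by (intro e_fcar) blast+
  qed
  let ?N = "N(i := t - 1)"
  have "act opr (prod_list (map (\<lambda>i. e i (\<sigma> i)) (i # xs))) (gg N) =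
      act opr (prod_list (map (\<lambda>i. e i (\<sigma> i)) xs)) (act opr (e i (\<sigma> i)) (gg N))"
    unfolding list.map prod_list.Cons by (rule WO.act_mult[OF e_fcar[OF i] f gg_polyfun])
  also have "act opr (e i (\<sigma> i)) (gg N) = (\<lambda>pt. (if i = \<sigma> i then - of_nat t else 0) * gg ?N pt)"
    unfolding act_e[OF i] using Cons.prems(4)[of i] by (intro ext) simp
  also have "act opr (prod_list (map (\<lambda>i. e i (\<sigma> i)) xs)) \<dots> = (\<lambda>pt. (if i = \<sigma> i then - of_nat t else 0) *
      act opr (prod_list (map (\<lambda>i. e i (\<sigma> i)) xs)) (gg ?N) pt)"
    by (rule WO.act_scale[OF f gg_polyfun])
  also have "act opr (prod_list (map (\<lambda>i. e i (\<sigma> i)) xs)) (gg ?N) =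
    (\<lambda>pt. if \<forall>i\<in>set xs. \<sigma> i = i then (- of_nat t) ^ length xs * gg (\<lambda>a. if a \<in> set xs then t - 1 else ?N a) pt else 0)"
    using Cons.prems by (intro Cons.IH) auto
  also have "(\<lambda>a. if a \<in> set xs then t - 1 else ?N a) = (\<lambda>a. if a \<in> set (i # xs) then t - 1 else N a)" by auto
  finally show ?case by auto
qed simp

lemma act_D: "act opr D (gg (\<lambda>_. t)) = (\<lambda>pt. (- of_nat t) ^ m * gg (\<lambda>_. t - 1) pt)"
proof
  fix pt
  let ?p = "\<lambda>\<sigma>. prod_list (map (\<lambda>i. e i (\<sigma> i)) [1..<Suc m])"
  have s: "act opr (?p \<sigma>) (gg (\<lambda>_. t)) pt = (if \<sigma> = id then (- of_nat t) ^ m * gg (\<lambda>_. t - 1) pt else 0)"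
    if p: "\<sigma> permutes {1..m}" for \<sigma>
  proof -
    have st: "set [1..<Suc m] = {1..m}" by auto
    have "(\<forall>i\<in>{1..m}. \<sigma> i = i) \<longleftrightarrow> \<sigma> = id" using p by (auto simp: permutes_def fun_eq_iff)
    moreover have "gg (\<lambda>a. if a \<in> {1..m} then t - 1 else t) = gg (\<lambda>_. t - 1)" by (rule gg_cong) simp
    moreover have "act opr (?p \<sigma>) (gg (\<lambda>_. t)) = (\<lambda>pt. if \<forall>i\<in>{1..m}. \<sigma> i = i
        then (- of_nat t) ^ length [1..<Suc m] * gg (\<lambda>a. if a \<in> {1..m} then t - 1 else t) pt else 0)"
      using act_prod[OF distinct_upt _ p, of 1 "Suc m" "\<lambda>_. t" t] unfolding st by blast
    ultimately show ?thesis by (simp only: length_upt diff_Suc_1)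
  qed
  have "act opr D (gg (\<lambda>_. t)) pt =
      (\<Sum>\<sigma>\<in>{\<sigma>. \<sigma> permutes {1..m}}. of_int (sign \<sigma>) * act opr (?p \<sigma>) (gg (\<lambda>_. t)) pt)"
    unfolding D_def pdet_def scal_of_int[symmetric] act_def wsum_sum wsum_scal ..
  also have "\<dots> = (\<Sum>\<sigma>\<in>{\<sigma>. \<sigma> permutes {1..m}}. if \<sigma> = id then (- of_nat t) ^ m * gg (\<lambda>_. t - 1) pt else 0)"
  proof (rule sum.cong[OF refl])
    fix \<sigma> assume "\<sigma> \<in> {\<sigma>. \<sigma> permutes {1..m}}"
    then have "\<sigma> permutes {1..m}" by blast
    from s[OF this] show "of_int (sign \<sigma>) * act opr (?p \<sigma>) (gg (\<lambda>_. t)) pt =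
       (if \<sigma> = id then (- of_nat t) ^ m * gg (\<lambda>_. t - 1) pt else 0)"
      by (cases "\<sigma> = id") (simp_all only: if_True if_False refl sign_id of_int_1 mult_1_left mult_zero_right)
  qed
  finally have "act opr D (gg (\<lambda>_. t)) pt = (\<Sum>\<sigma>\<in>{\<sigma>. \<sigma> permutes {1..m}}.
      if \<sigma> = id then (- of_nat t) ^ m * gg (\<lambda>_. t - 1) pt else 0)" .
  then show "act opr D (gg (\<lambda>_. t)) pt = (- of_nat t) ^ m * gg (\<lambda>_. t - 1) pt"
    by (simp add: permutes_id finite_permutations)
qed

text \<open>Up to sign the constant is the \<open>m\<close>-th power of the factorial of
  \<open>t\<close>: lowering all \<open>m\<close> exponents from \<open>s\<close> to
  \<open>s - 1\<close> gives the factor \<open>(- s) ^ m\<close>.\<close>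

lemma act_Dn: "\<exists>c. c \<noteq> 0 \<and> act opr (D ^ t) (gg (\<lambda>_. t)) = (\<lambda>pt. c)"
proof (induction t)
  case 0
  show ?case by (intro exI[of _ 1]) (simp add: gg_def[abs_def])
next
  case (Suc t)
  then obtain c where c: "c \<noteq> 0" "act opr (D ^ t) (gg (\<lambda>_. t)) = (\<lambda>pt. c)" by blast
  have p: "D ^ t \<in> fcar (carrier G)" by (intro fcar_power D_fcar)
  have "act opr (D ^ Suc t) (gg (\<lambda>_. Suc t)) = (\<lambda>pt. (- of_nat (Suc t)) ^ m * act opr (D ^ t) (gg (\<lambda>_. t)) pt)"
    unfolding power_Suc WO.act_mult[OF D_fcar p gg_polyfun] act_D WO.act_scale[OF p gg_polyfun] by simp
  then show ?case using c by (intro exI[of _ "(- of_nat (Suc t)) ^ m * c"]) (simp del: of_nat_Suc)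
qed

lemma Dn_not_J: "D ^ n \<notin> V.J"
  using act_Dn[of n] act_J[OF _ gg_polyfun, of "D ^ n" "\<lambda>_. n"] by auto

end

theorem theorem5p1:
  fixes l m n :: nat and B :: "weyl_elt \<Rightarrow> weyl_elt \<Rightarrow> complex"
    and k :: complex
  assumes "l \<ge> 2" and "m \<ge> 1" and "n \<ge> 1" and "2 * m \<le> l"
    and "normalized_form l B"
    and "k = of_nat n - of_nat m"
  shows "singular_vector l B (verma (sl l) B k)
    ((Delta l B m [^]\<^bsub>env (affine (sl l) B)\<^esub> n) \<odot>\<^bsub>verma (sl l) B k\<^esub> vacuum (sl l) B k)"
proof -
  interpret affine_det l B k m n using assms by unfold_locales auto
  show ?thesis unfolding v_eq by (rule singular[OF Dn_not_J])
qed

end
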